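(* On the category $\mathsf{C}_1^*\mathsf{cat}$ of small (unital) $\mathrm{C}^*$-categories and $*$-functors, let $\mathrm{Weq}$ be the class of unitary equivalences, $\mathrm{Cof}$ the class of $*$-functors $F\colon A\to B$ such that $\mathrm{ob} F\colon\mathrm{ob} A\to\mathrm{ob} B$ is injective, and $\mathrm{Fib}$ the class of $*$-functors $F\colon A\to B$ such that for all $x\in\mathrm{ob} A$, $y\in \mathrm{ob} B$ and every unitary $v\colon Fx\to y$ in $B$ there exists a unitary $u\colon x\to x'$ in $A$ with $Fu=v$ (so $Fx'=y$). Then $(\mathsf{C}_1^*\mathsf{cat},\mathrm{Weq},\mathrm{Fib},\mathrm{Cof})$ is a model structure, with weak equivalences $\mathrm{Weq}$, fibrations $\mathrm{Fib}$ and cofibrations $\mathrm{Cof}$ (the unitary model structure).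
   Context: Let $\mathbb F$ be $\mathbb R$ or $\mathbb C$. All categories have identities and all functors preserve them. An $\mathbb F$-category is a category enriched over $\mathbb F$-vector spaces. A $*$-category is an $\mathbb F$-category with an involution: maps $A(x,y)\to A(y,x)$, $a\mapsto a^*$, which are antilinear, with $(ba)^*=a^*b^*$ and $(a^* )^*=a$. A $*$-functor is an $\mathbb F$-linear functor with $F(a^* )=F(a)^*$. A $\mathrm{C}^*$-category is a $*$-category whose Hom spaces are Banach spaces, with $\|ba\|\le\|b\|\|a\|$, $\|a^*a\|=\|a\|^2$, and such that for each $a\in A(x,y)$ the element $a^*a$ of $A(x,x)$ is positive (its spectrum $\{z\in\mathbb F\mid a^*a-z1_x \text{ not invertible}\}$ lies in $[0,\infty)$). $\mathsf{C}_1^*\mathsf{cat}$ is the category of small $\mathrm{C}^*$-categories and $*$-functors. An arrow $a\in A(x,y)$ is unitary if $a^*a=1_x$ and $aa^*=1_y$. A $*$-functor $F\colon A\to B$ is a unitary equivalence if there exist a $*$-functor $G\colon B\to A$ and natural isomorphisms $GF\simeq\mathrm{id}_A$ and $FG\simeq\mathrm{id}_B$ all of whose components are unitary. Model categories are understood as in Hovey's book "Model Categories": small limits and colimits exist, weak equivalences satisfy 2-out-of-3, the three classes are closed under retracts, the two lifting axioms hold, and the two factorizations exist functorially. *)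

theory Defs
  imports Complex_Main "HOL-Library.Nonpos_Ints" "HOL-Algebra.Module"
begin

unbundle cardinal_syntax

section \<open>Categories, limits and colimits\<close>

text \<open>In \<open>Cmp C g f\<close> the arrow \<open>f\<close> comes first: it is \<open>g \<circ> f\<close>.\<close>

record ('o, 'm) cat =
  Obj :: "'o set"
  Arr :: "'m set"
  Dom :: "'m \<Rightarrow> 'o"
  Cod :: "'m \<Rightarrow> 'o"
  Ide :: "'o \<Rightarrow> 'm"
  Cmp :: "'m \<Rightarrow> 'm \<Rightarrow> 'm"

definition in_hom :: "('o, 'm) cat \<Rightarrow> 'm \<Rightarrow> 'o \<Rightarrow> 'o \<Rightarrow> bool" where
  "in_hom C f x y \<longleftrightarrow> f \<in> Arr C \<and> Dom C f = x \<and> Cod C f = y"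

locale category =
  fixes C :: "('o, 'm) cat"
  assumes dom_obj: "f \<in> Arr C \<Longrightarrow> Dom C f \<in> Obj C"
    and cod_obj: "f \<in> Arr C \<Longrightarrow> Cod C f \<in> Obj C"
    and ide_in_hom: "x \<in> Obj C \<Longrightarrow> in_hom C (Ide C x) x x"
    and cmp_in_hom: "in_hom C f x y \<Longrightarrow> in_hom C g y z \<Longrightarrow> in_hom C (Cmp C g f) x z"
    and cmp_assoc: "in_hom C f w x \<Longrightarrow> in_hom C g x y \<Longrightarrow> in_hom C h y z \<Longrightarrow>
      Cmp C h (Cmp C g f) = Cmp C (Cmp C h g) f"
    and cmp_ide_right: "in_hom C f x y \<Longrightarrow> Cmp C f (Ide C x) = f"
    and cmp_ide_left: "in_hom C f x y \<Longrightarrow> Cmp C (Ide C y) f = f"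

definition diagram ::
    "('i, 'j) cat \<Rightarrow> ('o, 'm) cat \<Rightarrow> ('i \<Rightarrow> 'o) \<Rightarrow> ('j \<Rightarrow> 'm) \<Rightarrow> bool" where
  "diagram J C D \<Delta> \<longleftrightarrow>
     (\<forall>i\<in>Obj J. D i \<in> Obj C) \<and>
     (\<forall>t i j. in_hom J t i j \<longrightarrow> in_hom C (\<Delta> t) (D i) (D j)) \<and>
     (\<forall>i\<in>Obj J. \<Delta> (Ide J i) = Ide C (D i)) \<and>
     (\<forall>s t i j k. in_hom J s i j \<longrightarrow> in_hom J t j k \<longrightarrow> \<Delta> (Cmp J t s) = Cmp C (\<Delta> t) (\<Delta> s))"

definition cone ::
    "('i, 'j) cat \<Rightarrow> ('o, 'm) cat \<Rightarrow> ('i \<Rightarrow> 'o) \<Rightarrow> ('j \<Rightarrow> 'm) \<Rightarrow> 'o \<Rightarrow> ('i \<Rightarrow> 'm) \<Rightarrow> bool" where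
  "cone J C D \<Delta> l \<pi> \<longleftrightarrow> l \<in> Obj C \<and>
     (\<forall>i\<in>Obj J. in_hom C (\<pi> i) l (D i)) \<and>
     (\<forall>t i j. in_hom J t i j \<longrightarrow> Cmp C (\<Delta> t) (\<pi> i) = \<pi> j)"

definition cocone ::
    "('i, 'j) cat \<Rightarrow> ('o, 'm) cat \<Rightarrow> ('i \<Rightarrow> 'o) \<Rightarrow> ('j \<Rightarrow> 'm) \<Rightarrow> 'o \<Rightarrow> ('i \<Rightarrow> 'm) \<Rightarrow> bool" where
  "cocone J C D \<Delta> l \<iota> \<longleftrightarrow> l \<in> Obj C \<and>
     (\<forall>i\<in>Obj J. in_hom C (\<iota> i) (D i) l) \<and>
     (\<forall>t i j. in_hom J t i j \<longrightarrow> Cmp C (\<iota> j) (\<Delta> t) = \<iota> i)"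

definition is_limit ::
    "('i, 'j) cat \<Rightarrow> ('o, 'm) cat \<Rightarrow> ('i \<Rightarrow> 'o) \<Rightarrow> ('j \<Rightarrow> 'm) \<Rightarrow> 'o \<Rightarrow> ('i \<Rightarrow> 'm) \<Rightarrow> bool" where
  "is_limit J C D \<Delta> l \<pi> \<longleftrightarrow> cone J C D \<Delta> l \<pi> \<and>
     (\<forall>k \<rho>. cone J C D \<Delta> k \<rho> \<longrightarrow>
        (\<exists>!h. in_hom C h k l \<and> (\<forall>i\<in>Obj J. Cmp C (\<pi> i) h = \<rho> i)))"

definition is_colimit ::
    "('i, 'j) cat \<Rightarrow> ('o, 'm) cat \<Rightarrow> ('i \<Rightarrow> 'o) \<Rightarrow> ('j \<Rightarrow> 'm) \<Rightarrow> 'o \<Rightarrow> ('i \<Rightarrow> 'm) \<Rightarrow> bool" where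
  "is_colimit J C D \<Delta> l \<iota> \<longleftrightarrow> cocone J C D \<Delta> l \<iota> \<and>
     (\<forall>k \<rho>. cocone J C D \<Delta> k \<rho> \<longrightarrow>
        (\<exists>!h. in_hom C h l k \<and> (\<forall>i\<in>Obj J. Cmp C h (\<iota> i) = \<rho> i)))"

text \<open>
  Since \<open>\<mu>\<close> is a cardinal on the type \<open>'j\<close>, every category with fewer than \<open>\<mu>\<close> objects and arrows
  has an isomorphic copy with objects and arrows in \<open>'j\<close>; it suffices to let \<open>J\<close> range over these.
\<close>

definition small_limits :: "'j rel \<Rightarrow> ('o, 'm) cat \<Rightarrow> bool" where
  "small_limits \<mu> C \<longleftrightarrow>
     (\<forall>(J :: ('j, 'j) cat) D \<Delta>. category J \<and> |Obj J| <o \<mu> \<and> |Arr J| <o \<mu> \<and> diagram J C D \<Delta> \<longrightarrow>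
        (\<exists>l \<pi>. is_limit J C D \<Delta> l \<pi>))"

definition small_colimits :: "'j rel \<Rightarrow> ('o, 'm) cat \<Rightarrow> bool" where
  "small_colimits \<mu> C \<longleftrightarrow>
     (\<forall>(J :: ('j, 'j) cat) D \<Delta>. category J \<and> |Obj J| <o \<mu> \<and> |Arr J| <o \<mu> \<and> diagram J C D \<Delta> \<longrightarrow>
        (\<exists>l \<iota>. is_colimit J C D \<Delta> l \<iota>))"

section \<open>Model structures\<close>

definition wide_subcategory :: "('o, 'm) cat \<Rightarrow> 'm set \<Rightarrow> bool" where
  "wide_subcategory C S \<longleftrightarrow> S \<subseteq> Arr C \<and> (\<forall>x\<in>Obj C. Ide C x \<in> S) \<and>
     (\<forall>f\<in>S. \<forall>g\<in>S. Cod C f = Dom C g \<longrightarrow> Cmp C g f \<in> S)"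

definition two_out_of_three :: "('o, 'm) cat \<Rightarrow> 'm set \<Rightarrow> bool" where
  "two_out_of_three C W \<longleftrightarrow>
     (\<forall>f\<in>Arr C. \<forall>g\<in>Arr C. Cod C f = Dom C g \<longrightarrow>
        (f \<in> W \<and> g \<in> W \<longrightarrow> Cmp C g f \<in> W) \<and>
        (f \<in> W \<and> Cmp C g f \<in> W \<longrightarrow> g \<in> W) \<and>
        (g \<in> W \<and> Cmp C g f \<in> W \<longrightarrow> f \<in> W))"

definition retract_of :: "('o, 'm) cat \<Rightarrow> 'm \<Rightarrow> 'm \<Rightarrow> bool" where
  "retract_of C f g \<longleftrightarrow> f \<in> Arr C \<and> g \<in> Arr C \<and>
     (\<exists>i r i' r'.
        in_hom C i (Dom C f) (Dom C g) \<and> in_hom C r (Dom C g) (Dom C f) \<and>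
        in_hom C i' (Cod C f) (Cod C g) \<and> in_hom C r' (Cod C g) (Cod C f) \<and>
        Cmp C r i = Ide C (Dom C f) \<and> Cmp C r' i' = Ide C (Cod C f) \<and>
        Cmp C g i = Cmp C i' f \<and> Cmp C f r = Cmp C r' g)"

definition closed_under_retracts :: "('o, 'm) cat \<Rightarrow> 'm set \<Rightarrow> bool" where
  "closed_under_retracts C S \<longleftrightarrow> (\<forall>f g. retract_of C f g \<and> g \<in> S \<longrightarrow> f \<in> S)"

text \<open>\<open>square C f g u v\<close>: the pair \<open>(u, v)\<close> is an arrow from \<open>f\<close> to \<open>g\<close> in the category of arrows
  of \<open>C\<close>, that is, \<open>g \<circ> u = v \<circ> f\<close>.\<close>

definition square :: "('o, 'm) cat \<Rightarrow> 'm \<Rightarrow> 'm \<Rightarrow> 'm \<Rightarrow> 'm \<Rightarrow> bool" where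
  "square C f g u v \<longleftrightarrow> f \<in> Arr C \<and> g \<in> Arr C \<and>
     in_hom C u (Dom C f) (Dom C g) \<and> in_hom C v (Cod C f) (Cod C g) \<and>
     Cmp C g u = Cmp C v f"

definition has_lifting :: "('o, 'm) cat \<Rightarrow> 'm \<Rightarrow> 'm \<Rightarrow> bool" where
  "has_lifting C i p \<longleftrightarrow>
     (\<forall>u v. square C i p u v \<longrightarrow>
        (\<exists>h. in_hom C h (Cod C i) (Dom C p) \<and> Cmp C h i = u \<and> Cmp C p h = v))"

text \<open>
  A functorial factorization \<open>f = R f \<circ> L f\<close>. The middle object of \<open>f\<close> is \<open>Cod C (L f)\<close>, and
  \<open>M f g u v\<close> is the arrow between middle objects induced by the square \<open>(u, v)\<close> from \<open>f\<close> to \<open>g\<close>.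
  The last two clauses say that the middle object is a functor on the category of arrows.
\<close>

definition functorial_factorization ::
    "('o, 'm) cat \<Rightarrow> ('m \<Rightarrow> 'm) \<Rightarrow> ('m \<Rightarrow> 'm) \<Rightarrow> ('m \<Rightarrow> 'm \<Rightarrow> 'm \<Rightarrow> 'm \<Rightarrow> 'm) \<Rightarrow> bool" where
  "functorial_factorization C L R M \<longleftrightarrow>
     (\<forall>f\<in>Arr C. in_hom C (L f) (Dom C f) (Cod C (L f)) \<and>
        in_hom C (R f) (Cod C (L f)) (Cod C f) \<and> Cmp C (R f) (L f) = f) \<and>
     (\<forall>f g u v. square C f g u v \<longrightarrow>
        in_hom C (M f g u v) (Cod C (L f)) (Cod C (L g)) \<and>
        Cmp C (M f g u v) (L f) = Cmp C (L g) u \<and>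
        Cmp C (R g) (M f g u v) = Cmp C v (R f)) \<and>
     (\<forall>f\<in>Arr C. M f f (Ide C (Dom C f)) (Ide C (Cod C f)) = Ide C (Cod C (L f))) \<and>
     (\<forall>f g h u v u' v'. square C f g u v \<and> square C g h u' v' \<longrightarrow>
        M f h (Cmp C u' u) (Cmp C v' v) = Cmp C (M g h u' v') (M f g u v))"

definition functorially_factors :: "('o, 'm) cat \<Rightarrow> 'm set \<Rightarrow> 'm set \<Rightarrow> bool" where
  "functorially_factors C S T \<longleftrightarrow>
     (\<exists>L R M. functorial_factorization C L R M \<and> (\<forall>f\<in>Arr C. L f \<in> S \<and> R f \<in> T))"

definition model_category ::
    "'j rel \<Rightarrow> ('o, 'm) cat \<Rightarrow> 'm set \<Rightarrow> 'm set \<Rightarrow> 'm set \<Rightarrow> bool" where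
  "model_category \<mu> C W Fib Cof \<longleftrightarrow>
     category C \<and> small_limits \<mu> C \<and> small_colimits \<mu> C \<and>
     wide_subcategory C W \<and> wide_subcategory C Fib \<and> wide_subcategory C Cof \<and>
     two_out_of_three C W \<and>
     closed_under_retracts C W \<and> closed_under_retracts C Fib \<and> closed_under_retracts C Cof \<and>
     (\<forall>i\<in>Cof. \<forall>p\<in>W \<inter> Fib. has_lifting C i p) \<and>
     (\<forall>i\<in>W \<inter> Cof. \<forall>p\<in>Fib. has_lifting C i p) \<and>
     functorially_factors C Cof (W \<inter> Fib) \<and>
     functorially_factors C (W \<inter> Cof) Fib"

section \<open>C*-categories\<close>

text \<open>
  The hom sets need not be disjoint, so all operations take the objects as arguments.
  For \<open>a\<close> from \<open>x\<close> to \<open>y\<close> and \<open>b\<close> from \<open>y\<close> to \<open>z\<close>, the composite \<open>ba\<close> is \<open>Comp A x y z b a\<close>,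
  and \<open>Star A x y a\<close> goes from \<open>y\<close> to \<open>x\<close>. The values of the operations outside the hom sets of
  \<open>A\<close> are irrelevant.
\<close>

record ('o, 'a) normed_star_cat =
  Ob :: "'o set"
  Hom :: "'o \<Rightarrow> 'o \<Rightarrow> 'a set"
  Unit :: "'o \<Rightarrow> 'a"
  Comp :: "'o \<Rightarrow> 'o \<Rightarrow> 'o \<Rightarrow> 'a \<Rightarrow> 'a \<Rightarrow> 'a"
  Zero :: "'o \<Rightarrow> 'o \<Rightarrow> 'a"
  Add :: "'o \<Rightarrow> 'o \<Rightarrow> 'a \<Rightarrow> 'a \<Rightarrow> 'a"
  Scale :: "'o \<Rightarrow> 'o \<Rightarrow> complex \<Rightarrow> 'a \<Rightarrow> 'a"
  Star :: "'o \<Rightarrow> 'o \<Rightarrow> 'a \<Rightarrow> 'a"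
  Norm :: "'o \<Rightarrow> 'o \<Rightarrow> 'a \<Rightarrow> real"

text \<open>The scalar field is a subfield \<open>F\<close> of the complex numbers: \<open>\<real>\<close> or \<open>UNIV\<close>.\<close>

definition scalar_ring :: "complex set \<Rightarrow> complex ring" where
  "scalar_ring F = \<lparr>carrier = F, mult = (*), one = 1, zero = 0, add = (+)\<rparr>"

text \<open>The multiplicative slots of a record of type \<open>module\<close> play no role in the locale \<open>module\<close>.\<close>

definition hom_space :: "('o, 'a) normed_star_cat \<Rightarrow> 'o \<Rightarrow> 'o \<Rightarrow> (complex, 'a) module" where
  "hom_space A x y = \<lparr>carrier = Hom A x y, mult = undefined, one = undefined,
     zero = Zero A x y, add = Add A x y, smult = Scale A x y\<rparr>"

abbreviation Diff :: "('o, 'a) normed_star_cat \<Rightarrow> 'o \<Rightarrow> 'o \<Rightarrow> 'a \<Rightarrow> 'a \<Rightarrow> 'a" where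
  "Diff A x y a b \<equiv> a \<ominus>\<^bsub>hom_space A x y\<^esub> b"

locale F_category =
  fixes F :: "complex set" and A :: "('o, 'a) normed_star_cat"
  assumes hom_vector_space:
      "x \<in> Ob A \<Longrightarrow> y \<in> Ob A \<Longrightarrow> module (scalar_ring F) (hom_space A x y)"
    and unit_closed: "x \<in> Ob A \<Longrightarrow> Unit A x \<in> Hom A x x"
    and comp_closed:
      "\<lbrakk>x \<in> Ob A; y \<in> Ob A; z \<in> Ob A; a \<in> Hom A x y; b \<in> Hom A y z\<rbrakk> \<Longrightarrow>
       Comp A x y z b a \<in> Hom A x z"
    and comp_assoc:
      "\<lbrakk>w \<in> Ob A; x \<in> Ob A; y \<in> Ob A; z \<in> Ob A;
        a \<in> Hom A w x; b \<in> Hom A x y; c \<in> Hom A y z\<rbrakk> \<Longrightarrow>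
       Comp A w x z (Comp A x y z c b) a = Comp A w y z c (Comp A w x y b a)"
    and comp_unit_right:
      "\<lbrakk>x \<in> Ob A; y \<in> Ob A; a \<in> Hom A x y\<rbrakk> \<Longrightarrow> Comp A x x y a (Unit A x) = a"
    and comp_unit_left:
      "\<lbrakk>x \<in> Ob A; y \<in> Ob A; a \<in> Hom A x y\<rbrakk> \<Longrightarrow> Comp A x y y (Unit A y) a = a"
    and comp_add_right:
      "\<lbrakk>x \<in> Ob A; y \<in> Ob A; z \<in> Ob A; a \<in> Hom A x y; a' \<in> Hom A x y; b \<in> Hom A y z\<rbrakk> \<Longrightarrow>
       Comp A x y z b (Add A x y a a') = Add A x z (Comp A x y z b a) (Comp A x y z b a')"
    and comp_add_left:
      "\<lbrakk>x \<in> Ob A; y \<in> Ob A; z \<in> Ob A; a \<in> Hom A x y; b \<in> Hom A y z; b' \<in> Hom A y z\<rbrakk> \<Longrightarrow>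
       Comp A x y z (Add A y z b b') a = Add A x z (Comp A x y z b a) (Comp A x y z b' a)"
    and comp_scale_right:
      "\<lbrakk>x \<in> Ob A; y \<in> Ob A; z \<in> Ob A; a \<in> Hom A x y; b \<in> Hom A y z; t \<in> F\<rbrakk> \<Longrightarrow>
       Comp A x y z b (Scale A x y t a) = Scale A x z t (Comp A x y z b a)"
    and comp_scale_left:
      "\<lbrakk>x \<in> Ob A; y \<in> Ob A; z \<in> Ob A; a \<in> Hom A x y; b \<in> Hom A y z; t \<in> F\<rbrakk> \<Longrightarrow>
       Comp A x y z (Scale A y z t b) a = Scale A x z t (Comp A x y z b a)"

locale star_category = F_category F A
  for F :: "complex set" and A :: "('o, 'a) normed_star_cat" +
  assumes star_closed:
      "\<lbrakk>x \<in> Ob A; y \<in> Ob A; a \<in> Hom A x y\<rbrakk> \<Longrightarrow> Star A x y a \<in> Hom A y x"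
    and star_add:
      "\<lbrakk>x \<in> Ob A; y \<in> Ob A; a \<in> Hom A x y; b \<in> Hom A x y\<rbrakk> \<Longrightarrow>
       Star A x y (Add A x y a b) = Add A y x (Star A x y a) (Star A x y b)"
    and star_scale:
      "\<lbrakk>x \<in> Ob A; y \<in> Ob A; a \<in> Hom A x y; t \<in> F\<rbrakk> \<Longrightarrow>
       Star A x y (Scale A x y t a) = Scale A y x (cnj t) (Star A x y a)"
    and star_comp:
      "\<lbrakk>x \<in> Ob A; y \<in> Ob A; z \<in> Ob A; a \<in> Hom A x y; b \<in> Hom A y z\<rbrakk> \<Longrightarrow>
       Star A x z (Comp A x y z b a) = Comp A z y x (Star A x y a) (Star A y z b)"
    and star_star:
      "\<lbrakk>x \<in> Ob A; y \<in> Ob A; a \<in> Hom A x y\<rbrakk> \<Longrightarrow> Star A y x (Star A x y a) = a"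

definition invertible_endo :: "('o, 'a) normed_star_cat \<Rightarrow> 'o \<Rightarrow> 'a \<Rightarrow> bool" where
  "invertible_endo A x b \<longleftrightarrow>
     (\<exists>c\<in>Hom A x x. Comp A x x x c b = Unit A x \<and> Comp A x x x b c = Unit A x)"

definition spectrum_in ::
    "complex set \<Rightarrow> ('o, 'a) normed_star_cat \<Rightarrow> 'o \<Rightarrow> 'a \<Rightarrow> complex set" where
  "spectrum_in F A x b =
     {z \<in> F. \<not> invertible_endo A x (Diff A x x b (Scale A x x z (Unit A x)))}"

definition norm_complete :: "('o, 'a) normed_star_cat \<Rightarrow> 'o \<Rightarrow> 'o \<Rightarrow> bool" where
  "norm_complete A x y \<longleftrightarrow>
     (\<forall>s :: nat \<Rightarrow> 'a. range s \<subseteq> Hom A x y \<and>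
        (\<forall>e>0. \<exists>N. \<forall>m\<ge>N. \<forall>n\<ge>N. Norm A x y (Diff A x y (s m) (s n)) < e) \<longrightarrow>
        (\<exists>l\<in>Hom A x y. (\<lambda>n. Norm A x y (Diff A x y (s n) l)) \<longlonglongrightarrow> 0))"

locale Cstar_category = star_category F A
  for F :: "complex set" and A :: "('o, 'a) normed_star_cat" +
  assumes norm_nonneg:
      "\<lbrakk>x \<in> Ob A; y \<in> Ob A; a \<in> Hom A x y\<rbrakk> \<Longrightarrow> 0 \<le> Norm A x y a"
    and norm_eq_zero:
      "\<lbrakk>x \<in> Ob A; y \<in> Ob A; a \<in> Hom A x y\<rbrakk> \<Longrightarrow> Norm A x y a = 0 \<longleftrightarrow> a = Zero A x y"
    and norm_triangle:
      "\<lbrakk>x \<in> Ob A; y \<in> Ob A; a \<in> Hom A x y; b \<in> Hom A x y\<rbrakk> \<Longrightarrow>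
       Norm A x y (Add A x y a b) \<le> Norm A x y a + Norm A x y b"
    and norm_scale:
      "\<lbrakk>x \<in> Ob A; y \<in> Ob A; a \<in> Hom A x y; t \<in> F\<rbrakk> \<Longrightarrow>
       Norm A x y (Scale A x y t a) = cmod t * Norm A x y a"
    and complete: "\<lbrakk>x \<in> Ob A; y \<in> Ob A\<rbrakk> \<Longrightarrow> norm_complete A x y"
    and norm_comp:
      "\<lbrakk>x \<in> Ob A; y \<in> Ob A; z \<in> Ob A; a \<in> Hom A x y; b \<in> Hom A y z\<rbrakk> \<Longrightarrow>
       Norm A x z (Comp A x y z b a) \<le> Norm A y z b * Norm A x y a"
    and cstar_identity:
      "\<lbrakk>x \<in> Ob A; y \<in> Ob A; a \<in> Hom A x y\<rbrakk> \<Longrightarrow>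
       Norm A x x (Comp A x y x (Star A x y a) a) = (Norm A x y a)\<^sup>2"
    and positive:
      "\<lbrakk>x \<in> Ob A; y \<in> Ob A; a \<in> Hom A x y\<rbrakk> \<Longrightarrow>
       spectrum_in F A x (Comp A x y x (Star A x y a) a) \<subseteq> \<real>\<^sub>\<ge>\<^sub>0"

text \<open>Nothing is required of the norms: \<open>*\<close>-functors are purely algebraic.\<close>

locale star_functor =
  fixes F :: "complex set"
    and A :: "('o, 'a) normed_star_cat" and B :: "('p, 'b) normed_star_cat"
    and f :: "'o \<Rightarrow> 'p" and \<phi> :: "'o \<Rightarrow> 'o \<Rightarrow> 'a \<Rightarrow> 'b"
  assumes ob_closed: "x \<in> Ob A \<Longrightarrow> f x \<in> Ob B"
    and hom_closed: "\<lbrakk>x \<in> Ob A; y \<in> Ob A; a \<in> Hom A x y\<rbrakk> \<Longrightarrow> \<phi> x y a \<in> Hom B (f x) (f y)"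
    and map_unit: "x \<in> Ob A \<Longrightarrow> \<phi> x x (Unit A x) = Unit B (f x)"
    and map_comp:
      "\<lbrakk>x \<in> Ob A; y \<in> Ob A; z \<in> Ob A; a \<in> Hom A x y; b \<in> Hom A y z\<rbrakk> \<Longrightarrow>
       \<phi> x z (Comp A x y z b a) = Comp B (f x) (f y) (f z) (\<phi> y z b) (\<phi> x y a)"
    and map_add:
      "\<lbrakk>x \<in> Ob A; y \<in> Ob A; a \<in> Hom A x y; b \<in> Hom A x y\<rbrakk> \<Longrightarrow>
       \<phi> x y (Add A x y a b) = Add B (f x) (f y) (\<phi> x y a) (\<phi> x y b)"
    and map_scale:
      "\<lbrakk>x \<in> Ob A; y \<in> Ob A; a \<in> Hom A x y; t \<in> F\<rbrakk> \<Longrightarrow>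
       \<phi> x y (Scale A x y t a) = Scale B (f x) (f y) t (\<phi> x y a)"
    and map_star:
      "\<lbrakk>x \<in> Ob A; y \<in> Ob A; a \<in> Hom A x y\<rbrakk> \<Longrightarrow>
       \<phi> y x (Star A x y a) = Star B (f x) (f y) (\<phi> x y a)"

definition unitary :: "('o, 'a) normed_star_cat \<Rightarrow> 'o \<Rightarrow> 'o \<Rightarrow> 'a \<Rightarrow> bool" where
  "unitary A x y a \<longleftrightarrow> a \<in> Hom A x y \<and>
     Comp A x y x (Star A x y a) a = Unit A x \<and> Comp A y x y a (Star A x y a) = Unit A y"

text \<open>Natural isomorphisms \<open>\<eta>\<close>, with unitary components, from the functor \<open>(f, \<phi>)\<close> to the functor
  \<open>(g, \<psi>)\<close>, both from \<open>A\<close> to \<open>B\<close>.\<close>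

definition unitary_nat_iso ::
    "('o, 'a) normed_star_cat \<Rightarrow> ('p, 'b) normed_star_cat \<Rightarrow>
     ('o \<Rightarrow> 'p) \<Rightarrow> ('o \<Rightarrow> 'o \<Rightarrow> 'a \<Rightarrow> 'b) \<Rightarrow> ('o \<Rightarrow> 'p) \<Rightarrow> ('o \<Rightarrow> 'o \<Rightarrow> 'a \<Rightarrow> 'b) \<Rightarrow>
     ('o \<Rightarrow> 'b) \<Rightarrow> bool" where
  "unitary_nat_iso A B f \<phi> g \<psi> \<eta> \<longleftrightarrow>
     (\<forall>x\<in>Ob A. unitary B (f x) (g x) (\<eta> x)) \<and>
     (\<forall>x\<in>Ob A. \<forall>y\<in>Ob A. \<forall>a\<in>Hom A x y.
        Comp B (f x) (f y) (g y) (\<eta> y) (\<phi> x y a) = Comp B (f x) (g x) (g y) (\<psi> x y a) (\<eta> x))"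

definition unitary_equivalence ::
    "complex set \<Rightarrow> ('o, 'a) normed_star_cat \<Rightarrow> ('p, 'b) normed_star_cat \<Rightarrow>
     ('o \<Rightarrow> 'p) \<Rightarrow> ('o \<Rightarrow> 'o \<Rightarrow> 'a \<Rightarrow> 'b) \<Rightarrow> bool" where
  "unitary_equivalence F A B f \<phi> \<longleftrightarrow> star_functor F A B f \<phi> \<and>
     (\<exists>g \<psi>. star_functor F B A g \<psi> \<and>
        (\<exists>\<eta>. unitary_nat_iso A A (g \<circ> f) (\<lambda>x y. \<psi> (f x) (f y) \<circ> \<phi> x y) id (\<lambda>x y. id) \<eta>) \<and>
        (\<exists>\<epsilon>. unitary_nat_iso B B (f \<circ> g) (\<lambda>x y. \<phi> (g x) (g y) \<circ> \<psi> x y) id (\<lambda>x y. id) \<epsilon>))"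

section \<open>The category of small C*-categories\<close>

record ('o, 'a) fun_arrow =
  Src :: "('o, 'a) normed_star_cat"
  Tgt :: "('o, 'a) normed_star_cat"
  obmap :: "'o \<Rightarrow> 'o"
  hommap :: "'o \<Rightarrow> 'o \<Rightarrow> 'a \<Rightarrow> 'a"

text \<open>Maps are set to \<open>undefined\<close> outside their domain, so that two arrows are equal iff they are
  equal as functors.\<close>

definition mk_arrow ::
    "('o, 'a) normed_star_cat \<Rightarrow> ('o, 'a) normed_star_cat \<Rightarrow>
     ('o \<Rightarrow> 'o) \<Rightarrow> ('o \<Rightarrow> 'o \<Rightarrow> 'a \<Rightarrow> 'a) \<Rightarrow> ('o, 'a) fun_arrow" where
  "mk_arrow A B f \<phi> = \<lparr>Src = A, Tgt = B,
     obmap = (\<lambda>x. if x \<in> Ob A then f x else undefined),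
     hommap = (\<lambda>x y a. if x \<in> Ob A \<and> y \<in> Ob A \<and> a \<in> Hom A x y then \<phi> x y a else undefined)\<rparr>"

definition small_Cstar_categories ::
    "complex set \<Rightarrow> 'u rel \<Rightarrow> ('u, 'u) normed_star_cat set" where
  "small_Cstar_categories F \<kappa> =
     {A. Cstar_category F A \<and> |Ob A| <o \<kappa> \<and> (\<forall>x\<in>Ob A. \<forall>y\<in>Ob A. |Hom A x y| <o \<kappa>)}"

definition C1star_cat ::
    "complex set \<Rightarrow> 'u rel \<Rightarrow> (('u, 'u) normed_star_cat, ('u, 'u) fun_arrow) cat" where
  "C1star_cat F \<kappa> = \<lparr>
     Obj = small_Cstar_categories F \<kappa>,
     Arr = {mk_arrow A B f \<phi> | A B f \<phi>.
       A \<in> small_Cstar_categories F \<kappa> \<and> B \<in> small_Cstar_categories F \<kappa> \<and> star_functor F A B f \<phi>},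
     Dom = Src,
     Cod = Tgt,
     Ide = (\<lambda>A. mk_arrow A A id (\<lambda>x y. id)),
     Cmp = (\<lambda>\<Psi> \<Phi>. mk_arrow (Src \<Phi>) (Tgt \<Psi>) (obmap \<Psi> \<circ> obmap \<Phi>)
       (\<lambda>x y. hommap \<Psi> (obmap \<Phi> x) (obmap \<Phi> y) \<circ> hommap \<Phi> x y))\<rparr>"

definition Weq :: "complex set \<Rightarrow> 'u rel \<Rightarrow> ('u, 'u) fun_arrow set" where
  "Weq F \<kappa> = {\<Phi> \<in> Arr (C1star_cat F \<kappa>).
     unitary_equivalence F (Src \<Phi>) (Tgt \<Phi>) (obmap \<Phi>) (hommap \<Phi>)}"

definition Cof :: "complex set \<Rightarrow> 'u rel \<Rightarrow> ('u, 'u) fun_arrow set" where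
  "Cof F \<kappa> = {\<Phi> \<in> Arr (C1star_cat F \<kappa>). inj_on (obmap \<Phi>) (Ob (Src \<Phi>))}"

definition Fib :: "complex set \<Rightarrow> 'u rel \<Rightarrow> ('u, 'u) fun_arrow set" where
  "Fib F \<kappa> = {\<Phi> \<in> Arr (C1star_cat F \<kappa>).
     \<forall>x\<in>Ob (Src \<Phi>). \<forall>y\<in>Ob (Tgt \<Phi>). \<forall>v. unitary (Tgt \<Phi>) (obmap \<Phi> x) y v \<longrightarrow>
       (\<exists>x'\<in>Ob (Src \<Phi>). \<exists>u. unitary (Src \<Phi>) x x' u \<and> obmap \<Phi> x' = y \<and> hommap \<Phi> x x' u = v)}"

section \<open>Size\<close>

text \<open>
  "Small" is relative to cardinals: the objects of the category are the C*-categories whose sets of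
  objects and of arrows have fewer than \<open>\<kappa>\<close> elements, and (co)limits are indexed by categories with
  fewer than \<open>\<mu>\<close> objects and arrows. For \<open>\<mu> = \<kappa>\<close> the conditions below say that \<open>\<kappa>\<close> is an
  uncountable inaccessible cardinal, which is the usual reading: small means element of a fixed
  Grothendieck universe (\<open>size_bounds_inaccessible\<close>). HOL does not prove that such a cardinal
  exists; keeping \<open>\<mu>\<close> apart from \<open>\<kappa>\<close> makes the conditions satisfiable in HOL as well
  (\<open>size_bounds_satisfiable\<close>).
\<close>

definition size_bounds :: "'j rel \<Rightarrow> 'u rel \<Rightarrow> bool" where
  "size_bounds \<mu> \<kappa> \<longleftrightarrow>
     Card_order \<mu> \<and> Card_order \<kappa> \<and> natLeq <o \<mu> \<and> \<mu> \<le>o \<kappa> \<and> regularCard \<kappa> \<and>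
     (\<forall>(X :: 'u set) (I :: 'j set). |X| <o \<kappa> \<and> |I| <o \<mu> \<longrightarrow> |X| ^c |I| <o \<kappa>)"

lemma card_of_less_cardSuc:
  "Card_order r \<Longrightarrow> |X| <o cardSuc r \<longleftrightarrow> |X| \<le>o r"
  by (simp add: cardSuc_ordLeq_ordLess card_of_Card_order)

lemma power_less_imp_Pow_less:
  assumes "Card_order \<kappa>" "natLeq <o \<kappa>" "|X :: 'u set| <o (\<kappa> :: 'u rel)"
    and exp: "\<And>(X :: 'u set) (I :: 'u set). |X| <o \<kappa> \<Longrightarrow> |I| <o \<kappa> \<Longrightarrow> |X| ^c |I| <o \<kappa>"
  shows "|Pow X| <o \<kappa>"
proof -
  have inf: "infinite (Field \<kappa>)"
    using cinfinite_mono[OF ordLess_imp_ordLeq[OF assms(2)] natLeq_cinfinite]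
    by (simp add: cinfinite_def)
  obtain a b :: 'u where ab: "a \<noteq> b"
    using inf by (metis finite.simps infinite_imp_nonempty rev_finite_subset singleton_iff subset_eq)
  have "bij_betw (\<lambda>x. x = a) {a, b} (UNIV :: bool set)"
    using ab by (auto simp: bij_betw_def inj_on_def UNIV_bool)
  then have 1: "|{a, b}| =o ctwo"
    unfolding ctwo_def by (rule card_of_ordIsoI)
  also have "ctwo <o \<kappa>"
    using ctwo_ordLess_natLeq assms(2) ordLess_transitive by blast
  finally have 2: "|{a, b}| ^c |X| <o \<kappa>"
    using assms(3) by (rule exp)
  have "|Pow X| =o ctwo ^c |X|"
    unfolding cexp_def ctwo_def Field_card_of by (rule card_of_Pow_Func)
  also have "ctwo ^c |X| =o |{a, b}| ^c |X|"
    by (rule cexp_cong1) (auto intro: 1 ordIso_symmetric card_of_Card_order)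
  finally show ?thesis
    using 2 by (rule ordIso_ordLess_trans)
qed

lemma Pow_less_imp_power_less:
  assumes "Card_order \<kappa>" "natLeq <o \<kappa>" "regularCard \<kappa>" "|X :: 'u set| <o (\<kappa> :: 'u rel)" "|I :: 'u set| <o \<kappa>"
    and pow: "\<And>X. |X :: 'u set| <o \<kappa> \<Longrightarrow> |Pow X| <o \<kappa>"
  shows "|X| ^c |I| <o \<kappa>"
proof -
  have inf: "infinite (Field \<kappa>)"
    using cinfinite_mono[OF ordLess_imp_ordLeq[OF assms(2)] natLeq_cinfinite]
    by (simp add: cinfinite_def)
  have lt: "|I \<times> X| <o \<kappa>"
    using stable_elim[OF regularCard_stable[OF assms(1) inf assms(3)] assms(5), of "\<lambda>_. X"] assms(4)
    by simp
  obtain Z where Z: "|I \<times> X| =o |Z :: 'u set|"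
    using internalize_card_of_ordLeq[of "I \<times> X" \<kappa>] ordLess_imp_ordLeq[OF lt] by blast
  have "|Pow (I \<times> X)| =o |Pow Z|"
    using Z bij_betw_Pow unfolding card_of_ordIso[symmetric] by blast
  moreover have "|Pow Z| <o \<kappa>"
    using pow[OF ordIso_ordLess_trans[OF ordIso_symmetric[OF Z] lt]] .
  moreover have "|X| ^c |I| \<le>o |Pow (I \<times> X)|"
    unfolding cexp_def Field_card_of
  proof (rule card_of_ordLeqI[where f = "\<lambda>g. {(i, g i) | i. i \<in> I}"])
    show "inj_on (\<lambda>g. {(i, g i) | i. i \<in> I}) (Func I X)"
    proof (rule inj_onI)
      fix g h assume "g \<in> Func I X" "h \<in> Func I X" and eq: "{(i, g i) | i. i \<in> I} = {(i, h i) | i. i \<in> I}"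
      moreover have "g i = h i" if "i \<in> I" for i
        using eq that by blast
      ultimately show "g = h" by (fastforce simp: Func_def)
    qed
  qed (auto simp: Func_def)
  ultimately show ?thesis
    using ordIso_ordLess_trans ordLeq_ordLess_trans by blast
qed

lemma size_bounds_inaccessible:
  fixes \<kappa> :: "'a rel"
  shows "size_bounds \<kappa> \<kappa> \<longleftrightarrow>
     Card_order \<kappa> \<and> natLeq <o \<kappa> \<and> regularCard \<kappa> \<and> (\<forall>X :: 'a set. |X| <o \<kappa> \<longrightarrow> |Pow X| <o \<kappa>)"
proof
  assume "size_bounds \<kappa> \<kappa>"
  then have "Card_order \<kappa>" "natLeq <o \<kappa>" "regularCard \<kappa>"
    and exp: "\<And>X I. |X :: 'a set| <o \<kappa> \<Longrightarrow> |I :: 'a set| <o \<kappa> \<Longrightarrow> |X| ^c |I| <o \<kappa>"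
    unfolding size_bounds_def by simp_all
  with power_less_imp_Pow_less[OF _ _ _ exp] show "Card_order \<kappa> \<and> natLeq <o \<kappa> \<and> regularCard \<kappa> \<and> (\<forall>X :: 'a set. |X| <o \<kappa> \<longrightarrow> |Pow X| <o \<kappa>)"
    by blast
next
  assume "Card_order \<kappa> \<and> natLeq <o \<kappa> \<and> regularCard \<kappa> \<and> (\<forall>X :: 'a set. |X| <o \<kappa> \<longrightarrow> |Pow X| <o \<kappa>)"
  then have *: "Card_order \<kappa>" "natLeq <o \<kappa>" "regularCard \<kappa>"
    and pow: "\<And>X. |X :: 'a set| <o \<kappa> \<Longrightarrow> |Pow X| <o \<kappa>"
    by simp_all
  show "size_bounds \<kappa> \<kappa>"
    unfolding size_bounds_def
    using * ordLeq_refl[OF *(1)] Pow_less_imp_power_less[OF * _ _ pow] by simp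
qed

lemma size_bounds_satisfiable:
  "size_bounds (cardSuc natLeq) (cardSuc |UNIV :: nat set set| )"
proof -
  let ?c = "|UNIV :: nat set set|"
  have c: "?c =o ctwo ^c natLeq"
    using card_of_Pow_Func[of "UNIV::nat set"] by (simp add: cexp_def ctwo_def Field_natLeq Field_card_of)
  have "|UNIV :: nat set| \<le>o ?c"
    by (rule card_of_ordLeqI[where f = "\<lambda>n. {n}"]) auto
  then have nat_le: "natLeq \<le>o ?c"
    using card_of_nat ordIso_ordLeq_trans ordIso_symmetric by blast
  then have C: "Cinfinite ?c"
    using cinfinite_mono natLeq_cinfinite card_of_Card_order by blast
  have "|X| ^c |I| <o cardSuc ?c"
    if "|X| <o cardSuc ?c" "|I| <o cardSuc natLeq" for X :: "nat set set set" and I :: "nat set set"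
  proof -
    have X: "|X| \<le>o ?c" and I: "|I| \<le>o natLeq"
      using that by (simp_all add: card_of_less_cardSuc natLeq_Card_order card_of_Card_order)
    have "|X| ^c |I| \<le>o ?c ^c |I|"
      using X card_of_Card_order by (rule cexp_mono1)
    also have "?c ^c |I| \<le>o ?c ^c natLeq"
    proof (cases "I = {}")
      case True
      show ?thesis
        unfolding cexp_def Field_card_of Field_natLeq True
        by (rule card_of_ordLeqI[where f = "\<lambda>_ _. {}"]) (auto simp: Func_def inj_on_def fun_eq_iff)
    next
      case False
      then show ?thesis
        using cexp_mono2_Cnotzero[OF I card_of_Card_order]
        by (simp add: card_of_Card_order card_of_ordIso_czero_iff_empty)
    qed
    also have "?c ^c natLeq =o (ctwo ^c natLeq) ^c natLeq"
      using c by (rule cexp_cong1) (rule natLeq_Card_order)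
    also have "(ctwo ^c natLeq) ^c natLeq =o ctwo ^c natLeq"
      by (rule cexp_cprod_ordLeq[OF Card_order_ctwo natLeq_Cinfinite Cinfinite_Cnotzero[OF natLeq_Cinfinite]
            ordLeq_refl[OF natLeq_Card_order]])
    also have "ctwo ^c natLeq =o ?c"
      using c by (rule ordIso_symmetric)
    finally show ?thesis
      by (simp add: cexp_def card_of_less_cardSuc card_of_Card_order)
  qed
  moreover have "cardSuc natLeq \<le>o cardSuc ?c"
    using nat_le by (simp add: cardSuc_mono_ordLeq natLeq_Card_order card_of_Card_order)
  ultimately show ?thesis
    unfolding size_bounds_def
    using C by (simp add: cardSuc_Card_order cardSuc_greater natLeq_Card_order card_of_Card_order regularCard_cardSuc)
qed
end

theory Submission
  imports Defs
begin

text \<open>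
  In a C*-category the spectral radius of a selfadjoint endomorphism is its norm. This is obtained from
  Rickart's doubling argument for resolvents, which is algebraic and works over both scalar fields.
  Consequently positivity of \<open>a\<^sup>* a\<close> can be read off from norms, a *-functor is contractive (isometric when
  faithful), and norm-closed *-subcategories as well as bounded products of C*-categories are C*-categories.
  Limits are then equalizers inside bounded products. For colimits one takes the bounded product of all
  cocones; it need not be small, but the closed *-subcategory generated by the image of the diagram is, and
  it is universal.

  A *-functor is a unitary equivalence iff it is fully faithful and every object of the target is unitarily
  isomorphic to one in the image. As in the canonical model structure on categories, a lift is then
  defined on objects by choices and on arrows by full faithfulness and conjugation with unitaries;
  the factorizations come from the mapping cylinder, whose objects are the disjoint union of the objects of
  source and target, and from the path object, whose objects are unitaries \<open>Fx \<rightarrow> y\<close>.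
\<close>

section \<open>Commutative real Banach algebras\<close>

text \<open>Positivity is the axiom that resists constructions: componentwise inverses of
  \<open>a^* a - z\<close> need not be bounded in a product, and an inverse need not a priori lie in
  a subcategory. As a condition on all arrows it is equivalent to the inequality
  \<open>norm(norm(a)^2 - a^* a) \<le> norm(a)^2\<close>, which mentions norms only and so passes to
  suprema and to isometric subcategories. The equivalence rests on the spectral radius. Over the
  reals the axiom speaks of real spectral values only, so points of the complex unit circle are
  represented by the real quadratics \<open>1 - 2 c x + x^2\<close> with \<open>c\<close> in [-1,1];
  commutativity is gained by working in a bicommutant. Contractivity makes bounded products
  categorical: the images of one arrow under a family of *-functors are bounded by its norm.
  Smallness of limits comes from powers with exponent below \<mu>, smallness of colimits from
  countable powers, which bound closures under sequences. Lifts must commute on the nose, so the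
  chosen unitaries are identities over the image of a cofibration.\<close>

locale real_banach_cring = cring R for R (structure) +
  fixes s :: "real \<Rightarrow> 'a" and n :: "'a \<Rightarrow> real"
  assumes s_closed [simp, intro]: "s t \<in> carrier R"
    and s_add: "s (t + u) = s t \<oplus> s u"
    and s_mult: "s (t * u) = s t \<otimes> s u"
    and s_one: "s 1 = \<one>"
    and n_nonneg: "a \<in> carrier R \<Longrightarrow> 0 \<le> n a"
    and n_eq_0: "a \<in> carrier R \<Longrightarrow> n a = 0 \<longleftrightarrow> a = \<zero>"
    and n_add: "a \<in> carrier R \<Longrightarrow> b \<in> carrier R \<Longrightarrow> n (a \<oplus> b) \<le> n a + n b"
    and n_scale: "a \<in> carrier R \<Longrightarrow> n (s t \<otimes> a) = \<bar>t\<bar> * n a"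
    and n_mult: "a \<in> carrier R \<Longrightarrow> b \<in> carrier R \<Longrightarrow> n (a \<otimes> b) \<le> n a * n b"
    and n_one: "n \<one> \<le> 1"
    and n_complete: "\<lbrakk>range f \<subseteq> carrier R; \<forall>e>0. \<exists>N. \<forall>i\<ge>N. \<forall>j\<ge>N. n (f i \<ominus> f j) < e\<rbrakk> \<Longrightarrow>
      \<exists>l\<in>carrier R. (\<lambda>i::nat. n (f i \<ominus> l)) \<longlonglongrightarrow> 0"
begin

lemma s_zero: "s 0 = \<zero>"
proof -
  have "s 0 \<oplus> s 0 = s 0"
    using s_add[of 0 0] by simp
  then show ?thesis
    by (metis add.l_cancel_one s_closed)
qed

lemma s_minus: "s (- t) = \<ominus> s t"
proof -
  have "s (- t) \<oplus> s t = \<zero>"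
    using s_add[of "- t" t] s_zero by simp
  then show ?thesis
    by (simp add: minus_equality)
qed

lemma s_diff: "s (t - u) = s t \<ominus> s u"
  using s_add[of t "- u"] by (simp add: s_minus a_minus_def)

lemma n_minus: "a \<in> carrier R \<Longrightarrow> n (\<ominus> a) = n a"
  using n_scale[of a "- 1"] by (simp add: s_minus s_one l_minus)

lemma n_zero: "n \<zero> = 0"
  by (simp add: n_eq_0)

lemma n_diff: "a \<in> carrier R \<Longrightarrow> b \<in> carrier R \<Longrightarrow> n (a \<ominus> b) \<le> n a + n b"
  using n_add[of a "\<ominus> b"] by (simp add: n_minus a_minus_def)

lemma n_diff_triangle:
  assumes "a \<in> carrier R" "b \<in> carrier R" "c \<in> carrier R"
  shows "n (a \<ominus> c) \<le> n (a \<ominus> b) + n (b \<ominus> c)"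
proof -
  have "a \<ominus> c = (a \<ominus> b) \<oplus> (b \<ominus> c)"
    using assms by algebra
  then show ?thesis
    using n_add[of "a \<ominus> b" "b \<ominus> c"] assms by simp
qed

text \<open>Geometric series. The bound on \<open>n b\<close> is read off from the fixed point
  equation \<open>b = \<one> \<oplus> a \<otimes> b\<close>, without a limit of norms.\<close>

lemma neumann:
  assumes a: "a \<in> carrier R" and lt: "n a < 1"
  shows "\<exists>b\<in>carrier R. (\<one> \<ominus> a) \<otimes> b = \<one> \<and> n b \<le> 1 / (1 - n a)"
proof -
  \<comment> \<open>Horner form of the partial sums \<open>1 + a + ... + a^(m-1)\<close>; each
    difference of consecutive sums is \<open>a\<close> times the previous one.\<close>
  define S where "S m = rec_nat \<zero> (\<lambda>_ b. \<one> \<oplus> a \<otimes> b) m" for m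
  have S0: "S 0 = \<zero>" and SS: "S (Suc m) = \<one> \<oplus> a \<otimes> S m" for m
    by (simp_all add: S_def)
  have Sc [simp]: "S m \<in> carrier R" for m
    by (induction m) (simp_all add: S0 SS a)
  have step: "n (S (Suc m) \<ominus> S m) \<le> n a ^ m" for m
  proof (induction m)
    case 0
    then show ?case
      using n_one by (simp add: S0 SS a minus_eq)
  next
    case (Suc m)
    have "S (Suc (Suc m)) \<ominus> S (Suc m) = (\<one> \<oplus> a \<otimes> S (Suc m)) \<ominus> (\<one> \<oplus> a \<otimes> S m)"
      by (simp only: SS)
    also have "\<dots> = a \<otimes> (S (Suc m) \<ominus> S m)"
      using a Sc[of m] Sc[of "Suc m"] by algebra
    finally have "n (S (Suc (Suc m)) \<ominus> S (Suc m)) \<le> n a * n (S (Suc m) \<ominus> S m)"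
      using n_mult[OF a, of "S (Suc m) \<ominus> S m"] by simp
    also have "\<dots> \<le> n a * n a ^ m"
      using Suc n_nonneg[OF a] by (rule mult_left_mono)
    finally show ?case by simp
  qed
  have far: "n (S (m + p) \<ominus> S m) \<le> (\<Sum>k<p. n a ^ (m + k))" for m p
  proof (induction p)
    case 0
    then show ?case by (simp add: minus_eq r_neg n_zero)
  next
    case (Suc p)
    have "n (S (m + Suc p) \<ominus> S m) \<le> n (S (Suc (m + p)) \<ominus> S (m + p)) + n (S (m + p) \<ominus> S m)"
      using n_diff_triangle[of "S (m + Suc p)" "S (m + p)" "S m"] by simp
    then show ?case
      using Suc step[of "m + p"] by simp
  qed
  have na: "0 \<le> n a" using n_nonneg[OF a] .
  have geo: "(\<Sum>k<p. n a ^ (m + k)) \<le> n a ^ m / (1 - n a)" for m p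
  proof -
    have "(\<Sum>k<p. n a ^ (m + k)) = n a ^ m * (\<Sum>k<p. n a ^ k)"
      by (simp add: power_add sum_distrib_left)
    also have "(\<Sum>k<p. n a ^ k) = (1 - n a ^ p) / (1 - n a)"
      using lt by (simp add: sum_gp_strict)
    also have "\<dots> \<le> 1 / (1 - n a)"
      using lt na by (simp add: divide_right_mono)
    finally show ?thesis
      using na by (simp add: mult_left_mono)
  qed
  have "\<exists>N. \<forall>i\<ge>N. \<forall>j\<ge>N. n (S i \<ominus> S j) < e" if "e > 0" for e
  proof -
    have "(\<lambda>m. n a ^ m / (1 - n a)) \<longlonglongrightarrow> 0"
      using LIMSEQ_realpow_zero[OF na lt] tendsto_divide_zero by blast
    from order_tendstoD(2)[OF this, of "e / 2"] that
    obtain N where N: "n a ^ N / (1 - n a) < e / 2"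
      by (auto simp: eventually_sequentially)
    have close: "n (S i \<ominus> S N) < e / 2" if "i \<ge> N" for i
      using order_trans[OF far geo, of N "i - N"] N unfolding le_add_diff_inverse[OF that] by linarith
    have "n (S i \<ominus> S j) < e" if "i \<ge> N" "j \<ge> N" for i j
    proof -
      have "S N \<ominus> S j = \<ominus> (S j \<ominus> S N)"
        using Sc[of N] Sc[of j] by algebra
      then have "n (S N \<ominus> S j) = n (S j \<ominus> S N)"
        by (simp add: n_minus)
      then show ?thesis
        using n_diff_triangle[of "S i" "S N" "S j"] close[OF that(1)] close[OF that(2)] by simp
    qed
    then show ?thesis by blast
  qed
  then obtain b where b: "b \<in> carrier R" and lim: "(\<lambda>i. n (S i \<ominus> b)) \<longlonglongrightarrow> 0"
    using n_complete[of S] by (metis Sc image_subsetI)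
  \<comment> \<open>The defect of the limit \<open>b\<close>. The recursion
    \<open>S (Suc i) = \<one> \<oplus> a \<otimes> S i\<close> bounds it by quantities that tend to
    0, so it vanishes.\<close>
  define d where "d = (\<one> \<ominus> a) \<otimes> b \<ominus> \<one>"
  have d: "d \<in> carrier R" using a b by (simp add: d_def)
  have "n d \<le> n (S (Suc i) \<ominus> b) + n a * n (S i \<ominus> b)" for i
  proof -
    have "\<ominus> ((\<one> \<oplus> a \<otimes> S i) \<ominus> b) \<oplus> a \<otimes> (S i \<ominus> b) = d"
      unfolding d_def using a b Sc[of i] by algebra
    then have "d = \<ominus> (S (Suc i) \<ominus> b) \<oplus> a \<otimes> (S i \<ominus> b)"
      by (simp add: SS)
    then have "n d \<le> n (S (Suc i) \<ominus> b) + n (a \<otimes> (S i \<ominus> b))"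
      using n_add[of "\<ominus> (S (Suc i) \<ominus> b)" "a \<otimes> (S i \<ominus> b)"] a b n_minus[of "S (Suc i) \<ominus> b"] by simp
    then show ?thesis
      using n_mult[OF a, of "S i \<ominus> b"] b by simp
  qed
  moreover have "(\<lambda>i. n (S (Suc i) \<ominus> b) + n a * n (S i \<ominus> b)) \<longlonglongrightarrow> 0 + n a * 0"
    by (intro tendsto_intros lim LIMSEQ_Suc[OF lim])
  ultimately have "n d \<le> 0"
    by (intro LIMSEQ_le_const[of _ 0 "n d"]) auto
  then have "d = \<zero>"
    using n_nonneg[OF d] n_eq_0[OF d] by simp
  moreover have "(\<one> \<ominus> a) \<otimes> b = d \<oplus> \<one>"
    unfolding d_def using a b by algebra
  ultimately have inv: "(\<one> \<ominus> a) \<otimes> b = \<one>"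
    by simp
  have "b = \<one> \<oplus> a \<otimes> b"
  proof -
    have "b = (\<one> \<ominus> a) \<otimes> b \<oplus> a \<otimes> b" using a b by algebra
    then show ?thesis by (simp add: inv)
  qed
  then have "n b \<le> n \<one> + n (a \<otimes> b)"
    using n_add[of \<one> "a \<otimes> b"] a b by simp
  also have "\<dots> \<le> 1 + n a * n b"
    using n_one n_mult[OF a b] by simp
  finally have "n b * (1 - n a) \<le> 1"
    by (simp add: algebra_simps)
  then show ?thesis
    using b inv lt by (auto simp: pos_le_divide_eq)
qed

section \<open>Stability of inverses\<close>

lemma inverse_unique:
  assumes "d \<in> carrier R" "p \<in> carrier R" "q \<in> carrier R" "d \<otimes> p = \<one>" "d \<otimes> q = \<one>"
  shows "p = q"
proof -
  have "p = (d \<otimes> q) \<otimes> p" using assms by simp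
  also have "\<dots> = (d \<otimes> p) \<otimes> q" using assms(1-3) by algebra
  also have "\<dots> = q" using assms by simp
  finally show ?thesis .
qed

text \<open>Factor \<open>d + e = d (1 + p e)\<close> and invert the second factor by the Neumann
  series; the bound 1/2 produces the factor 2. The last estimate is the resolvent identity
  \<open>p - q = e p q\<close>.\<close>

lemma perturb:
  assumes d: "d \<in> carrier R" and p: "p \<in> carrier R" and e: "e \<in> carrier R"
    and inv: "d \<otimes> p = \<one>" and small: "n e * n p \<le> 1 / 2"
  shows "\<exists>q\<in>carrier R. (d \<oplus> e) \<otimes> q = \<one> \<and> n q \<le> 2 * n p \<and> n (p \<ominus> q) \<le> 2 * n e * (n p)\<^sup>2"
proof -
  have ep: "n (e \<otimes> p) \<le> 1 / 2"
    using n_mult[OF e p] small by simp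
  obtain r where r: "r \<in> carrier R" "(\<one> \<ominus> (\<ominus> (e \<otimes> p))) \<otimes> r = \<one>" "n r \<le> 1 / (1 - n (\<ominus> (e \<otimes> p)))"
    using neumann[of "\<ominus> (e \<otimes> p)"] ep e p n_minus[of "e \<otimes> p"] by auto
  have "1 / (1 - n (\<ominus> (e \<otimes> p))) \<le> 2"
    using ep e p by (simp add: n_minus field_simps)
  with r(3) have nr: "n r \<le> 2" by simp
  define q where "q = p \<otimes> r"
  have q: "q \<in> carrier R" by (simp add: q_def p r)
  have "(d \<oplus> e) \<otimes> q = ((d \<otimes> p) \<ominus> (\<ominus> (e \<otimes> p))) \<otimes> r"
    unfolding q_def using d e p r(1) by algebra
  then have qinv: "(d \<oplus> e) \<otimes> q = \<one>"
    using inv r(2) by simp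
  have nq: "n q \<le> 2 * n p"
    using n_mult[OF p r(1)] mult_left_mono[OF nr n_nonneg[OF p]] by (simp add: q_def)
  have "p \<ominus> q = p \<otimes> ((d \<oplus> e) \<otimes> q) \<ominus> (d \<otimes> p) \<otimes> q"
    using inv qinv p q by simp
  also have "\<dots> = e \<otimes> (p \<otimes> q)"
    using d e p q by algebra
  finally have "n (p \<ominus> q) \<le> n e * n (p \<otimes> q)"
    using n_mult[OF e, of "p \<otimes> q"] p q by simp
  also have "\<dots> \<le> n e * (n p * (2 * n p))"
    using n_mult[OF p q] mult_left_mono[OF nq n_nonneg[OF p]] n_nonneg[OF e]
    by (intro mult_left_mono) auto
  finally show ?thesis
    using q qinv nq by (auto simp: power2_eq_square algebra_simps)
qed

text \<open>For \<open>\<omega>\<close> on the unit circle with real part \<open>c\<close> this is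
  \<open>(1 - \<omega> x) (1 - cnj \<omega> x)\<close>. Its invertibility for all \<open>c\<close>
  in [-1,1] replaces that of \<open>1 - \<omega> x\<close> for all such \<open>\<omega>\<close>,
  with real coefficients only.\<close>

definition quad :: "real \<Rightarrow> 'a \<Rightarrow> 'a" where
  "quad c x = \<one> \<ominus> s (2 * c) \<otimes> x \<oplus> x \<otimes> x"

lemma quad_closed [simp]: "x \<in> carrier R \<Longrightarrow> quad c x \<in> carrier R"
  by (simp add: quad_def)

text \<open>Real form of \<open>(1 - \<omega> x) (1 + \<omega> x) = 1 - \<omega>^2 x^2\<close>: if
  \<open>c\<close> is the cosine of the angle of \<open>\<omega>\<close>, then
  \<open>2 c^2 - 1\<close> is the cosine of twice the angle, and \<open>-c\<close> belongs to
  \<open>-\<omega>\<close>.\<close>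

lemma quad_double:
  assumes "x \<in> carrier R"
  shows "quad (2 * c\<^sup>2 - 1) (x \<otimes> x) = quad c x \<otimes> quad (- c) x"
proof -
  have 1: "s (2 * (2 * c\<^sup>2 - 1)) = s (2 * c) \<otimes> s (2 * c) \<ominus> \<one> \<ominus> \<one>"
    unfolding s_mult[symmetric] s_one[symmetric] s_diff[symmetric]
    by (simp add: power2_eq_square algebra_simps)
  have 2: "s (2 * - c) = \<ominus> s (2 * c)"
    by (simp add: s_minus)
  show ?thesis
    unfolding quad_def 1 2 using assms s_closed[of "2 * c"] by algebra
qed

text \<open>Real part of the partial fraction decomposition \<open>2 / (1 - \<omega>^2 x^2) = 1 / (1
  - \<omega> x) + 1 / (1 + \<omega> x)\<close>. Here \<open>p\<close> and \<open>q\<close> are the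
  inverses of the two quadratics, and their product is the inverse of the doubled one.\<close>

lemma resolvent_double:
  assumes x: "x \<in> carrier R" and p: "p \<in> carrier R" and q: "q \<in> carrier R"
    and "quad c x \<otimes> p = \<one>" "quad (- c) x \<otimes> q = \<one>"
  shows "s 2 \<otimes> ((\<one> \<ominus> s (2 * c\<^sup>2 - 1) \<otimes> (x \<otimes> x)) \<otimes> (p \<otimes> q)) =
    (\<one> \<ominus> s c \<otimes> x) \<otimes> p \<oplus> (\<one> \<oplus> s c \<otimes> x) \<otimes> q"
proof -
  have two: "s (2::real) = \<one> \<oplus> \<one>"
    using s_add[of 1 1] s_one by simp
  have c2: "s (2 * c) = s c \<oplus> s c" "s (2 * - c) = \<ominus> (s c \<oplus> s c)"
    using s_add[of c c] s_minus[of "2 * c"] by simp_all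
  have cc: "s (2 * c\<^sup>2 - 1) = (\<one> \<oplus> \<one>) \<otimes> s c \<otimes> s c \<ominus> \<one>"
    unfolding s_one[symmetric] s_add[symmetric] s_mult[symmetric] s_diff[symmetric]
    by (simp add: power2_eq_square mult.assoc)
  have num: "(\<one> \<ominus> s c \<otimes> x) \<otimes> quad (- c) x \<oplus> (\<one> \<oplus> s c \<otimes> x) \<otimes> quad c x =
      s 2 \<otimes> (\<one> \<ominus> s (2 * c\<^sup>2 - 1) \<otimes> (x \<otimes> x))"
  proof -
    \<comment> \<open>In terms of \<open>y\<close>, \<open>z\<close> and \<open>K\<close> the middle
      identity below is a polynomial one in independent letters, small enough for
      \<open>algebra\<close>.\<close>
    define y z K where "y = s c \<otimes> x" and "z = y \<oplus> y" and "K = \<one> \<oplus> x \<otimes> x"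
    have c: "y \<in> carrier R" "z \<in> carrier R" "K \<in> carrier R"
      using x by (simp_all add: y_def z_def K_def)
    have "quad c x = K \<ominus> z" "quad (- c) x = K \<oplus> z"
      unfolding quad_def K_def z_def y_def c2 using x s_closed[of c] by algebra+
    moreover have "(\<one> \<ominus> y) \<otimes> (K \<oplus> z) \<oplus> (\<one> \<oplus> y) \<otimes> (K \<ominus> z) = (\<one> \<oplus> \<one>) \<otimes> (K \<ominus> y \<otimes> z)"
      using c by algebra
    moreover have "K \<ominus> y \<otimes> z = \<one> \<ominus> s (2 * c\<^sup>2 - 1) \<otimes> (x \<otimes> x)"
      unfolding K_def z_def y_def cc using x s_closed[of c] by algebra
    ultimately show ?thesis
      unfolding two y_def by simp
  qed
  have split: "a \<otimes> p \<otimes> (b \<otimes> q) \<oplus> a' \<otimes> q \<otimes> (b' \<otimes> p) = (a \<otimes> b \<oplus> a' \<otimes> b') \<otimes> (p \<otimes> q)"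
    if "a \<in> carrier R" "b \<in> carrier R" "a' \<in> carrier R" "b' \<in> carrier R" for a b a' b'
    using that p q by algebra
  have "(\<one> \<ominus> s c \<otimes> x) \<otimes> p \<oplus> (\<one> \<oplus> s c \<otimes> x) \<otimes> q =
    (\<one> \<ominus> s c \<otimes> x) \<otimes> p \<otimes> (quad (- c) x \<otimes> q) \<oplus> (\<one> \<oplus> s c \<otimes> x) \<otimes> q \<otimes> (quad c x \<otimes> p)"
    using assms by simp
  also have "\<dots> = s 2 \<otimes> ((\<one> \<ominus> s (2 * c\<^sup>2 - 1) \<otimes> (x \<otimes> x)) \<otimes> (p \<otimes> q))"
    using x p q by (subst split) (simp_all add: num m_assoc)
  finally show ?thesis ..
qed

text \<open>The existential \<open>p\<close> and \<open>q\<close> include the assertion that the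
  quadratics are invertible at \<open>x\<close> and at \<open>t x\<close>. Any tolerance survives
  the averaging in the doubling step; 1/4 is small enough for the final contradiction, where 1/8 is
  added to it and the sum has to stay below 1/2.\<close>

definition resolvents_close :: "'a \<Rightarrow> real \<Rightarrow> bool" where
  "resolvents_close x t \<longleftrightarrow> (\<forall>c\<in>{-1..1}. \<exists>p\<in>carrier R. \<exists>q\<in>carrier R.
     quad c x \<otimes> p = \<one> \<and> quad c (s t \<otimes> x) \<otimes> q = \<one> \<and>
     n ((\<one> \<ominus> s c \<otimes> x) \<otimes> p \<ominus> (\<one> \<ominus> s c \<otimes> (s t \<otimes> x)) \<otimes> q) \<le> 1 / 4)"

text \<open>For \<open>d = 2 c^2 - 1\<close> the difference at the squares is the mean of the
  differences at \<open>c\<close> and at \<open>-c\<close>, so the tolerance does not grow and the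
  step can be iterated indefinitely.\<close>

lemma resolvents_close_square:
  assumes x: "x \<in> carrier R" and close: "resolvents_close x t"
  shows "resolvents_close (x \<otimes> x) (t\<^sup>2)"
  unfolding resolvents_close_def
proof
  fix d :: real assume d: "d \<in> {-1..1}"
  \<comment> \<open>Half-angle formula: \<open>d\<close> in [-1,1] makes the root real and puts
    \<open>c\<close> into [-1,1].\<close>
  define c where "c = sqrt ((1 + d) / 2)"
  have c2: "2 * c\<^sup>2 - 1 = d" and c: "c \<in> {-1..1}"
    using d by (auto simp: c_def field_simps intro: order_trans[of _ 0])
  then have mc: "- c \<in> {-1..1}" by simp
  define y where "y = s t \<otimes> x"
  have y: "y \<in> carrier R" using x by (simp add: y_def)
  have yy: "s (t\<^sup>2) \<otimes> (x \<otimes> x) = y \<otimes> y"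
    unfolding y_def power2_eq_square s_mult using x s_closed[of t] by algebra
  obtain p q where p: "p \<in> carrier R" "quad c x \<otimes> p = \<one>" and q: "q \<in> carrier R" "quad c y \<otimes> q = \<one>"
    and pq: "n ((\<one> \<ominus> s c \<otimes> x) \<otimes> p \<ominus> (\<one> \<ominus> s c \<otimes> y) \<otimes> q) \<le> 1 / 4"
    using close c unfolding resolvents_close_def y_def by blast
  obtain p' q' where p': "p' \<in> carrier R" "quad (- c) x \<otimes> p' = \<one>"
    and q': "q' \<in> carrier R" "quad (- c) y \<otimes> q' = \<one>"
    and pq': "n ((\<one> \<ominus> s (- c) \<otimes> x) \<otimes> p' \<ominus> (\<one> \<ominus> s (- c) \<otimes> y) \<otimes> q') \<le> 1 / 4"
    using close mc unfolding resolvents_close_def y_def by blast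
  have inv: "quad d (z \<otimes> z) \<otimes> (r \<otimes> r') = \<one>"
    if "z \<in> carrier R" "r \<in> carrier R" "r' \<in> carrier R" "quad c z \<otimes> r = \<one>" "quad (- c) z \<otimes> r' = \<one>" for z r r'
  proof -
    have "quad d (z \<otimes> z) \<otimes> (r \<otimes> r') = (quad c z \<otimes> r) \<otimes> (quad (- c) z \<otimes> r')"
      using quad_double[OF that(1), of c] quad_closed[OF that(1)] that(2,3) c2
      by (simp add: m_ac)
    then show ?thesis using that by simp
  qed
  define u v where "u = (\<one> \<ominus> s d \<otimes> (x \<otimes> x)) \<otimes> (p \<otimes> p')" and "v = (\<one> \<ominus> s d \<otimes> (y \<otimes> y)) \<otimes> (q \<otimes> q')"
  have uv: "u \<in> carrier R" "v \<in> carrier R"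
    using x y p(1) p'(1) q(1) q'(1) by (simp_all add: u_def v_def)
  have 1: "s 2 \<otimes> u = (\<one> \<ominus> s c \<otimes> x) \<otimes> p \<oplus> (\<one> \<oplus> s c \<otimes> x) \<otimes> p'"
    using resolvent_double[OF x p(1) p'(1) p(2) p'(2)] c2 by (simp add: u_def)
  have 2: "s 2 \<otimes> v = (\<one> \<ominus> s c \<otimes> y) \<otimes> q \<oplus> (\<one> \<oplus> s c \<otimes> y) \<otimes> q'"
    using resolvent_double[OF y q(1) q'(1) q(2) q'(2)] c2 by (simp add: v_def)
  have swap: "(a \<oplus> b) \<ominus> (a' \<oplus> b') = (a \<ominus> a') \<oplus> (b \<ominus> b')"
    if "a \<in> carrier R" "b \<in> carrier R" "a' \<in> carrier R" "b' \<in> carrier R" for a b a' b'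
    using that by algebra
  have neg: "\<one> \<ominus> s (- c) \<otimes> z = \<one> \<oplus> s c \<otimes> z" if "z \<in> carrier R" for z
    using that by (simp add: s_minus l_minus minus_eq)
  have "s 2 \<otimes> (u \<ominus> v) = s 2 \<otimes> u \<ominus> s 2 \<otimes> v"
    using uv s_closed[of 2] by algebra
  also have "\<dots> = ((\<one> \<ominus> s c \<otimes> x) \<otimes> p \<ominus> (\<one> \<ominus> s c \<otimes> y) \<otimes> q) \<oplus>
      ((\<one> \<ominus> s (- c) \<otimes> x) \<otimes> p' \<ominus> (\<one> \<ominus> s (- c) \<otimes> y) \<otimes> q')"
    unfolding 1 2 neg[OF x] neg[OF y] using x y p(1) p'(1) q(1) q'(1) by (simp add: swap)
  finally have "n (s 2 \<otimes> (u \<ominus> v)) \<le> 1 / 4 + 1 / 4"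
    using n_add[of "(\<one> \<ominus> s c \<otimes> x) \<otimes> p \<ominus> (\<one> \<ominus> s c \<otimes> y) \<otimes> q"
        "(\<one> \<ominus> s (- c) \<otimes> x) \<otimes> p' \<ominus> (\<one> \<ominus> s (- c) \<otimes> y) \<otimes> q'"] pq pq' x y p(1) p'(1) q(1) q'(1)
    by simp
  then have "n (u \<ominus> v) \<le> 1 / 4"
    using n_scale[of "u \<ominus> v" 2] uv by simp
  then show "\<exists>p\<in>carrier R. \<exists>q\<in>carrier R. quad d (x \<otimes> x) \<otimes> p = \<one> \<and>
      quad d (s (t\<^sup>2) \<otimes> (x \<otimes> x)) \<otimes> q = \<one> \<and>
      n ((\<one> \<ominus> s d \<otimes> (x \<otimes> x)) \<otimes> p \<ominus> (\<one> \<ominus> s d \<otimes> (s (t\<^sup>2) \<otimes> (x \<otimes> x))) \<otimes> q) \<le> 1 / 4"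
    unfolding yy u_def v_def
    using inv[OF x p(1) p'(1) p(2) p'(2)] inv[OF y q(1) q'(1) q(2) q'(2)] p(1) p'(1) q(1) q'(1)
    by (intro bexI[of _ "p \<otimes> p'"] bexI[of _ "q \<otimes> q'"]) auto
qed

text \<open>Near each point the inverses stay bounded by \<open>perturb\<close>; the bisection
  principle \<open>Bolzano\<close> supplies the compactness of [-1,1].\<close>

lemma quad_inverses_bounded:
  assumes x: "x \<in> carrier R" and inv: "\<forall>c\<in>{-1..1}. \<exists>p\<in>carrier R. quad c x \<otimes> p = \<one>"
  shows "\<exists>M>0. \<forall>c\<in>{-1..1}. \<exists>p\<in>carrier R. quad c x \<otimes> p = \<one> \<and> n p \<le> M"
proof -
  define P where "P a b \<longleftrightarrow>
    (\<exists>M. \<forall>c\<in>{a..b} \<inter> {-1..1}. \<exists>p\<in>carrier R. quad c x \<otimes> p = \<one> \<and> n p \<le> M)" for a b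
  have "P (- 1) 1"
  proof (rule Bolzano)
    fix a b c assume "P a b" "P b c" and ab: "a \<le> b" "b \<le> c"
    then obtain M N where
      M: "\<And>c. c \<in> {a..b} \<inter> {-1..1} \<Longrightarrow> \<exists>p\<in>carrier R. quad c x \<otimes> p = \<one> \<and> n p \<le> M" and
      N: "\<And>d. d \<in> {b..c} \<inter> {-1..1} \<Longrightarrow> \<exists>p\<in>carrier R. quad d x \<otimes> p = \<one> \<and> n p \<le> N"
      unfolding P_def by blast
    have "\<exists>p\<in>carrier R. quad d x \<otimes> p = \<one> \<and> n p \<le> max M N" if "d \<in> {a..c} \<inter> {-1..1}" for d
      using M[of d] N[of d] that by (cases "d \<le> b") (auto simp: le_max_iff_disj)
    then show "P a c" unfolding P_def by blast
  next
    fix d :: real assume d: "- 1 \<le> d" "d \<le> 1"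
    then obtain p where p: "p \<in> carrier R" "quad d x \<otimes> p = \<one>"
      using inv by (metis atLeastAtMost_iff)
    \<comment> \<open>The quadratics at \<open>c\<close> and \<open>d\<close> differ by
      \<open>-2 (c - d) x\<close>, whose norm times \<open>n p\<close> is at most
      \<open>|c - d| K\<close>; the radius \<open>1 / (2 K)\<close> keeps this below 1/2. The
      summand 1 makes \<open>K\<close> positive.\<close>
    define K where "K = 2 * n x * n p + 1"
    have K: "K > 0" "2 * n x * n p \<le> K" using n_nonneg[OF x] n_nonneg[OF p(1)] by (simp_all add: K_def add_nonneg_pos)
    have "\<exists>q\<in>carrier R. quad c x \<otimes> q = \<one> \<and> n q \<le> 2 * n p" if c: "\<bar>c - d\<bar> < 1 / (2 * K)" for c
    proof -
      define e where "e = s (- (2 * (c - d))) \<otimes> x"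
      have e: "e \<in> carrier R" using x by (simp add: e_def)
      have "s (2 * d) \<ominus> s (2 * c) = s (- (2 * (c - d)))"
        unfolding s_diff[symmetric] by (simp add: algebra_simps)
      then have e': "e = (s (2 * d) \<ominus> s (2 * c)) \<otimes> x" by (simp add: e_def)
      have eq: "quad c x = quad d x \<oplus> e"
        unfolding quad_def e' using x s_closed[of "2 * c"] s_closed[of "2 * d"] by algebra
      have "n e = \<bar>2 * (c - d)\<bar> * n x"
        using n_scale[OF x, of "- (2 * (c - d))"] by (simp only: e_def abs_minus_cancel)
      then have "n e * n p = \<bar>c - d\<bar> * (2 * n x * n p)" unfolding abs_mult by simp
      also have "\<dots> \<le> \<bar>c - d\<bar> * K" using K by (intro mult_left_mono) auto
      also have "\<dots> \<le> 1 / 2" using c K(1) by (simp add: field_simps)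
      finally show ?thesis
        using perturb[OF quad_closed[OF x] p(1) e p(2)] eq by auto
    qed
    then have "P a b" if "a \<le> d \<and> d \<le> b \<and> b - a < 1 / (2 * K)" for a b
      unfolding P_def using that by (intro exI[of _ "2 * n p"]) auto
    then show "\<exists>e>0. \<forall>a b. a \<le> d \<and> d \<le> b \<and> b - a < e \<longrightarrow> P a b"
      using K(1) by (intro exI[of _ "1 / (2 * K)"]) auto
  qed simp
  then obtain M where "\<forall>c\<in>{-1..1}. \<exists>p\<in>carrier R. quad c x \<otimes> p = \<one> \<and> n p \<le> M"
    unfolding P_def by auto
  then show ?thesis
    by (intro exI[of _ "max M 1"]) (fastforce simp: le_max_iff_disj)
qed

text \<open>A common bound \<open>M\<close> for the inverses makes the passage from \<open>x\<close>
  to \<open>t x\<close> uniformly small as \<open>t\<close> tends to 1: every error term is a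
  multiple of \<open>1 - t\<close>.\<close>

lemma resolvents_close_start:
  assumes x: "x \<in> carrier R" and nx: "n x = 1"
    and inv: "\<forall>c\<in>{-1..1}. \<exists>p\<in>carrier R. quad c x \<otimes> p = \<one>"
  shows "\<exists>t. 0 \<le> t \<and> t < 1 \<and> resolvents_close x t"
proof -
  obtain M where M: "M > 0" "\<And>c. c \<in> {-1..1} \<Longrightarrow> \<exists>p\<in>carrier R. quad c x \<otimes> p = \<one> \<and> n p \<le> M"
    using quad_inverses_bounded[OF x inv] by blast
  \<comment> \<open>Arranged so that \<open>(1 - t) (4 M^2 + M) \<le> 1/16\<close>. The final error
    is at most four times this quantity, that is 1/4, and the smallness condition of
    \<open>perturb\<close> follows from the same bound.\<close>
  define K where "K = 16 * (4 * M\<^sup>2 + M) + 1"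
  have K: "K > 1" using M(1) by (simp add: K_def add_pos_pos)
  define t where "t = 1 - 1 / K"
  have t: "0 < t" "t < 1" using K by (auto simp: t_def)
  have Mt: "(1 - t) * (4 * M\<^sup>2 + M) \<le> 1 / 16"
    using K by (simp add: t_def) (simp add: K_def field_simps)
  have "resolvents_close x t"
    unfolding resolvents_close_def
  proof
    fix c :: real assume c: "c \<in> {-1..1}"
    then have c1: "\<bar>c\<bar> \<le> 1" by auto
    obtain p where p: "p \<in> carrier R" "quad c x \<otimes> p = \<one>" "n p \<le> M"
      using M(2) c by blast
    define y where "y = s t \<otimes> x"
    have y: "y \<in> carrier R" using x by (simp add: y_def)
    \<comment> \<open>The difference of the quadratics at \<open>t x\<close> and at
      \<open>x\<close>; its norm is at most \<open>4 (1 - t)\<close>.\<close>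
    define e where "e = s (2 * c * (1 - t)) \<otimes> x \<oplus> s (t\<^sup>2 - 1) \<otimes> (x \<otimes> x)"
    have e: "e \<in> carrier R" using x by (simp add: e_def)
    have s1: "s (2 * c * (1 - t)) = s (2 * c) \<ominus> s (2 * c) \<otimes> s t"
      by (simp add: right_diff_distrib s_diff s_mult)
    have s2: "s (t\<^sup>2 - 1) = s t \<otimes> s t \<ominus> \<one>"
      by (simp add: power2_eq_square s_diff s_mult s_one)
    have eq: "quad c y = quad c x \<oplus> e"
      unfolding quad_def y_def e_def s1 s2 using x s_closed[of "2 * c"] s_closed[of t] by algebra
    have "n e \<le> n (s (2 * c * (1 - t)) \<otimes> x) + n (s (t\<^sup>2 - 1) \<otimes> (x \<otimes> x))"
      unfolding e_def using x by (intro n_add) auto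
    also have "\<dots> = 2 * \<bar>c\<bar> * (1 - t) + (1 - t\<^sup>2) * n (x \<otimes> x)"
      using x nx t by (simp add: n_scale abs_mult power_le_one)
    also have "\<dots> \<le> 2 * 1 * (1 - t) + (1 - t\<^sup>2) * 1"
      using n_mult[OF x x] nx t c1
      by (intro add_mono mult_left_mono mult_right_mono) (auto simp: power_le_one)
    also have "1 - t\<^sup>2 \<le> 2 * (1 - t)"
      using zero_le_square[of "1 - t"] by (simp add: power2_eq_square algebra_simps)
    finally have ne: "n e \<le> 4 * (1 - t)" by simp
    have np: "0 \<le> n p" using n_nonneg[OF p(1)] .
    have "(1 - t) * M \<le> 1 / 16"
      using order_trans[OF mult_left_mono Mt, of M] t(2) by simp
    moreover have "n e * n p \<le> 4 * (1 - t) * M"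
      using ne p(3) np t by (intro mult_mono) auto
    ultimately have "n e * n p \<le> 1 / 2" unfolding mult.assoc by linarith
    from perturb[OF quad_closed[OF x] p(1) e p(2) this]
    obtain q where q: "q \<in> carrier R" "quad c y \<otimes> q = \<one>" "n q \<le> 2 * n p" "n (p \<ominus> q) \<le> 2 * n e * (n p)\<^sup>2"
      by (auto simp: eq)
    have "2 * n e * (n p)\<^sup>2 \<le> 2 * (4 * (1 - t)) * M\<^sup>2"
      using ne p(3) np t n_nonneg[OF e] by (intro mult_mono power_mono) auto
    then have pq: "n (p \<ominus> q) \<le> 8 * (1 - t) * M\<^sup>2" using q(4) by simp
    have nq: "n q \<le> 2 * M" using q(3) p(3) by simp
    have 1: "n (\<one> \<ominus> s c \<otimes> x) \<le> 2"
      using n_diff[of \<one> "s c \<otimes> x"] n_one x nx c1 by (simp add: n_scale)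
    have st: "s (c * (1 - t)) = s c \<ominus> s c \<otimes> s t"
      by (simp add: right_diff_distrib s_diff s_mult)
    \<comment> \<open>Separates the change of the inverse, from \<open>p\<close> to
      \<open>q\<close>, from the change of the numerator.\<close>
    have split: "a \<otimes> p \<ominus> (a \<oplus> b) \<otimes> q = a \<otimes> (p \<ominus> q) \<ominus> b \<otimes> q"
      if "a \<in> carrier R" "b \<in> carrier R" for a b
      using that p(1) q(1) by algebra
    have cy: "\<one> \<ominus> s c \<otimes> y = (\<one> \<ominus> s c \<otimes> x) \<oplus> s (c * (1 - t)) \<otimes> x"
      unfolding st y_def using x s_closed[of c] s_closed[of t] by algebra
    have "(\<one> \<ominus> s c \<otimes> x) \<otimes> p \<ominus> (\<one> \<ominus> s c \<otimes> y) \<otimes> q =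
      (\<one> \<ominus> s c \<otimes> x) \<otimes> (p \<ominus> q) \<ominus> s (c * (1 - t)) \<otimes> (x \<otimes> q)"
      unfolding cy using x q(1) by (simp add: split m_assoc)
    then have "n ((\<one> \<ominus> s c \<otimes> x) \<otimes> p \<ominus> (\<one> \<ominus> s c \<otimes> y) \<otimes> q) \<le>
        n ((\<one> \<ominus> s c \<otimes> x) \<otimes> (p \<ominus> q)) + n (s (c * (1 - t)) \<otimes> (x \<otimes> q))"
      using n_diff[of "(\<one> \<ominus> s c \<otimes> x) \<otimes> (p \<ominus> q)" "s (c * (1 - t)) \<otimes> (x \<otimes> q)"] x p(1) q(1) by simp
    also have "\<dots> \<le> 2 * (8 * (1 - t) * M\<^sup>2) + 1 * (1 - t) * (2 * M)"
    proof (rule add_mono)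
      have "n ((\<one> \<ominus> s c \<otimes> x) \<otimes> (p \<ominus> q)) \<le> n (\<one> \<ominus> s c \<otimes> x) * n (p \<ominus> q)"
        using x p(1) q(1) by (intro n_mult) auto
      also have "\<dots> \<le> 2 * (8 * (1 - t) * M\<^sup>2)"
        using 1 pq p(1) q(1) x by (intro mult_mono n_nonneg) auto
      finally show "n ((\<one> \<ominus> s c \<otimes> x) \<otimes> (p \<ominus> q)) \<le> 2 * (8 * (1 - t) * M\<^sup>2)" .
      have "n (s (c * (1 - t)) \<otimes> (x \<otimes> q)) = \<bar>c\<bar> * (1 - t) * n (x \<otimes> q)"
        using x q(1) t by (simp add: n_scale abs_mult)
      also have "\<dots> \<le> 1 * (1 - t) * (2 * M)"
        using n_mult[OF x q(1)] nx nq c1 t x q(1) by (intro mult_mono n_nonneg) auto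
      finally show "n (s (c * (1 - t)) \<otimes> (x \<otimes> q)) \<le> 1 * (1 - t) * (2 * M)" .
    qed
    also have "\<dots> \<le> 4 * ((1 - t) * (4 * M\<^sup>2 + M))"
      using t M(1) by (simp add: algebra_simps)
    also have "\<dots> \<le> 1 / 4" using Mt by simp
    finally show "\<exists>p\<in>carrier R. \<exists>q\<in>carrier R. quad c x \<otimes> p = \<one> \<and> quad c (s t \<otimes> x) \<otimes> q = \<one> \<and>
        n ((\<one> \<ominus> s c \<otimes> x) \<otimes> p \<ominus> (\<one> \<ominus> s c \<otimes> (s t \<otimes> x)) \<otimes> q) \<le> 1 / 4"
      using p(1,2) q(1,2) by (auto simp: y_def)
  qed
  then show ?thesis using t by (intro exI[of _ t]) auto
qed

text \<open>
  Rickart's proof of the spectral radius formula, in a form that avoids complex scalars: the real part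
  \<open>(1 - c x) / (1 - 2 c x + x\<^sup>2)\<close> of \<open>(1 - \<omega> x)\<^sup>-\<^sup>1\<close>, for \<open>\<omega>\<close> on the unit circle with real part \<open>c\<close>, is uniformly
  close to the one of \<open>t x\<close>, and this property passes from \<open>x, t\<close> to \<open>x\<^sup>2, t\<^sup>2\<close> by doubling the angle.
\<close>

lemma norm_one_imp_not_invertible:
  assumes S: "S \<subseteq> carrier R" "\<And>y. y \<in> S \<Longrightarrow> y \<otimes> y \<in> S \<and> n (y \<otimes> y) = (n y)\<^sup>2"
    and x: "x \<in> S" and nx: "n x = 1"
  shows "\<exists>c\<in>{-1..1}. \<forall>p\<in>carrier R. quad c x \<otimes> p \<noteq> \<one>"
proof (rule ccontr)
  assume "\<not> ?thesis"
  then have inv: "\<forall>c\<in>{-1..1}. \<exists>p\<in>carrier R. quad c x \<otimes> p = \<one>" by blast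
  obtain t where t: "0 \<le> t" "t < 1" "resolvents_close x t"
    using resolvents_close_start[OF _ nx inv] x S(1) by blast
  have iter: "\<exists>y\<in>S. n y = 1 \<and> resolvents_close y (t ^ (2 ^ m))" for m :: nat
  proof (induction m)
    case 0
    then show ?case using x nx t by auto
  next
    case (Suc m)
    then obtain y where y: "y \<in> S" "n y = 1" "resolvents_close y (t ^ (2 ^ m))" by blast
    then show ?case
      using resolvents_close_square[of y "t ^ (2 ^ m)"] S
      by (intro bexI[of _ "y \<otimes> y"]) (auto simp: power_mult[symmetric] mult.commute)
  qed
  have "(\<lambda>k. t ^ k) \<longlonglongrightarrow> 0" using t by (intro LIMSEQ_realpow_zero)
  from order_tendstoD(2)[OF this, of "1 / 4"]
  obtain m where m: "\<And>k. k \<ge> m \<Longrightarrow> t ^ k < 1 / 4"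
    by (auto simp: eventually_sequentially)
  define u where "u = t ^ (2 ^ m)"
  have "u < 1 / 4" unfolding u_def by (rule m) (simp add: less_imp_le)
  moreover have u0: "0 \<le> u" using t by (simp add: u_def)
  ultimately have u2: "u\<^sup>2 \<le> 1 / 16"
    using power_mono[of u "1 / 4" 2] by (simp add: power2_eq_square)
  obtain y where y: "y \<in> S" "n y = 1" "resolvents_close y u"
    using iter[of m] unfolding u_def by blast
  have yc: "y \<in> carrier R" using y S by blast
  have nyy: "n (y \<otimes> y) = 1" using S y by auto
  define z where "z = s u \<otimes> y"
  have z: "z \<in> carrier R" by (simp add: z_def yc)
  \<comment> \<open>At \<open>c = 0\<close> the numerators are 1, so closeness compares the inverses
    of \<open>1 + y^2\<close> and \<open>1 + z^2\<close> themselves.\<close>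
  have quad0: "quad 0 w = \<one> \<oplus> w \<otimes> w" if "w \<in> carrier R" for w
    using that by (simp add: quad_def s_zero minus_eq)
  obtain p q where p: "p \<in> carrier R" "(\<one> \<oplus> y \<otimes> y) \<otimes> p = \<one>"
    and q: "q \<in> carrier R" "(\<one> \<oplus> z \<otimes> z) \<otimes> q = \<one>" and pq: "n (p \<ominus> q) \<le> 1 / 4"
    using y(3) yc z unfolding resolvents_close_def
    by (auto simp: z_def[symmetric] quad0 s_zero minus_eq dest!: bspec[of _ _ 0])
  have "z \<otimes> z = s (u\<^sup>2) \<otimes> (y \<otimes> y)"
    unfolding z_def power2_eq_square s_mult using yc s_closed[of u] by algebra
  then have nzz: "n (z \<otimes> z) = u\<^sup>2"
    using yc nyy by (simp add: n_scale)
  have "n (z \<otimes> z) * n \<one> \<le> 1 / 16 * 1"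
    using nzz u2 n_one n_nonneg[of \<one>] by (intro mult_mono) auto
  then obtain q' where q': "q' \<in> carrier R" "(\<one> \<oplus> z \<otimes> z) \<otimes> q' = \<one>" "n (\<one> \<ominus> q') \<le> 2 * n (z \<otimes> z) * (n \<one>)\<^sup>2"
    using perturb[of \<one> \<one> "z \<otimes> z"] z by auto
  \<comment> \<open>Since \<open>z^2\<close> has norm at most 1/16, the inverse \<open>q\<close> of
    \<open>1 + z^2\<close> is within 1/8 of 1; hence \<open>p\<close> is within 1/8 + 1/4 = 3/8 of
    1.\<close>
  have "q' = q"
    using inverse_unique[OF _ q'(1) q(1) q'(2) q(2)] z by simp
  moreover have "2 * n (z \<otimes> z) * (n \<one>)\<^sup>2 \<le> 2 * (1 / 16) * 1"
    using nzz u2 n_one n_nonneg[of \<one>] by (intro mult_mono power_le_one) auto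
  ultimately have q1: "n (\<one> \<ominus> q) \<le> 1 / 8" using q'(3) by simp
  have "n (q \<ominus> p) = n (\<ominus> (p \<ominus> q))"
    using p(1) q(1) by (intro arg_cong[of _ _ n]) algebra
  then have p1: "n (\<one> \<ominus> p) \<le> 3 / 8"
    using n_diff_triangle[of \<one> q p] p(1) q(1) q1 pq by (simp add: n_minus)
  \<comment> \<open>With \<open>p\<close> this close to 1, the element
    \<open>y^2 = (1 + y^2) (1 - p)\<close> has norm at most 3/8 + 3/8, whereas squaring has kept its
    norm equal to 1.\<close>
  have "y \<otimes> y = (\<one> \<oplus> y \<otimes> y) \<ominus> (\<one> \<oplus> y \<otimes> y) \<otimes> p"
    unfolding p(2) using yc by algebra
  also have "\<dots> = (\<one> \<ominus> p) \<oplus> (y \<otimes> y) \<otimes> (\<one> \<ominus> p)"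
    using yc p(1) by algebra
  finally have "1 \<le> n (\<one> \<ominus> p) + n (y \<otimes> y) * n (\<one> \<ominus> p)"
    using n_add[of "\<one> \<ominus> p" "(y \<otimes> y) \<otimes> (\<one> \<ominus> p)"] n_mult[of "y \<otimes> y" "\<one> \<ominus> p"] yc p(1) nyy by auto
  then show False using p1 nyy by simp
qed

section \<open>Norm bounds from invertibility\<close>

lemma shift_invertible:
  assumes h: "h \<in> carrier R" and lt: "n h < t"
  shows "\<exists>b\<in>carrier R. (s t \<ominus> h) \<otimes> b = \<one>"
proof -
  have t: "t > 0" using n_nonneg[OF h] lt by simp
  have inv: "s t \<otimes> s (1 / t) = \<one>"
    using t by (simp add: s_mult[symmetric] s_one)
  have "n (s (1 / t) \<otimes> h) < 1"
    using t lt h by (simp add: n_scale field_simps)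
  then obtain b where b: "b \<in> carrier R" "(\<one> \<ominus> s (1 / t) \<otimes> h) \<otimes> b = \<one>"
    using neumann[of "s (1 / t) \<otimes> h"] h by auto
  have "(s t \<ominus> h) \<otimes> (s (1 / t) \<otimes> b) = (s t \<otimes> s (1 / t) \<ominus> s (1 / t) \<otimes> h) \<otimes> b"
    using b(1) h s_closed[of t] s_closed[of "1 / t"] by algebra
  also have "\<dots> = \<one>" using inv b(2) by simp
  finally show ?thesis
    using b(1) by (intro bexI[of _ "s (1 / t) \<otimes> b"]) auto
qed

text \<open>\<open>S\<close> stands for the selfadjoint elements. If \<open>h\<close>, scaled to
  \<open>k\<close> of norm 1, violated the bound, some quadratic with \<open>c\<close> in [-1,1]
  would fail to be invertible. For \<open>c = 1\<close> and \<open>c = -1\<close> it is the square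
  of \<open>1 - k\<close> or \<open>1 + k\<close>, excluded by the hypotheses on \<open>h\<close>;
  for \<open>|c| < 1\<close> it is \<open>(k - c)^2 + (1 - c^2)\<close>, excluded by positivity of
  selfadjoint squares.\<close>

lemma norm_le_of_invertible:
  assumes S: "S \<subseteq> carrier R" "\<And>y. y \<in> S \<Longrightarrow> y \<otimes> y \<in> S \<and> n (y \<otimes> y) = (n y)\<^sup>2"
      "\<And>t y. y \<in> S \<Longrightarrow> s t \<otimes> y \<in> S" "\<And>t y. y \<in> S \<Longrightarrow> y \<oplus> s t \<in> S"
    and pos: "\<And>t y. y \<in> S \<Longrightarrow> t > 0 \<Longrightarrow> \<exists>b\<in>carrier R. (y \<otimes> y \<oplus> s t) \<otimes> b = \<one>"
    and h: "h \<in> S" and r: "0 \<le> r"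
    and inv: "\<And>t. t > r \<Longrightarrow> \<exists>b\<in>carrier R. (s t \<ominus> h) \<otimes> b = \<one>"
      "\<And>t. t > r \<Longrightarrow> \<exists>b\<in>carrier R. (s t \<oplus> h) \<otimes> b = \<one>"
  shows "n h \<le> r"
proof (rule ccontr)
  assume "\<not> n h \<le> r"
  define t where "t = n h"
  have t: "t > r" "t > 0" using \<open>\<not> n h \<le> r\<close> r by (simp_all add: t_def)
  have hc: "h \<in> carrier R" using h S(1) by blast
  define k where "k = s (1 / t) \<otimes> h"
  have kS: "k \<in> S" using S(3)[OF h] by (simp add: k_def)
  then have k: "k \<in> carrier R" using S(1) by blast
  have nk: "n k = 1" using t(2) hc by (simp add: k_def n_scale) (simp add: t_def)
  have st: "s t \<otimes> s (1 / t) = \<one>" using t by (simp add: s_mult[symmetric] s_one)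
  have htk: "h = s t \<otimes> k"
    using hc st m_assoc[of "s t" "s (1 / t)" h] by (simp add: k_def)
  obtain c where c: "c \<in> {-1..1}" "\<forall>p\<in>carrier R. quad c k \<otimes> p \<noteq> \<one>"
    using norm_one_imp_not_invertible[OF S(1) S(2) kS nk] by blast
  have s2: "s (2 * d) = s d \<oplus> s d" for d
    using s_add[of d d] by simp
  consider "c = 1" | "c = - 1" | "c\<^sup>2 < 1"
    using c(1) unfolding abs_square_less_1 by fastforce
  then show False
  proof cases
    case 1
    obtain b where b: "b \<in> carrier R" "(s t \<ominus> h) \<otimes> b = \<one>" using inv(1)[OF t(1)] by blast
    \<comment> \<open>\<open>quad 1 k\<close> is the square of \<open>1 - k\<close>, and
      \<open>s t \<ominus> h\<close> is \<open>t (1 - k)\<close>, so the square of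
      \<open>t b\<close> inverts it.\<close>
    have "quad c k \<otimes> ((s t \<otimes> b) \<otimes> (s t \<otimes> b)) = ((s t \<ominus> s t \<otimes> k) \<otimes> b) \<otimes> ((s t \<ominus> s t \<otimes> k) \<otimes> b)"
      unfolding quad_def 1 s2 s_one using k b(1) s_closed[of t] by algebra
    then show False using b htk c(2) by (auto dest!: bspec[of _ _ "(s t \<otimes> b) \<otimes> (s t \<otimes> b)"])
  next
    case 2
    obtain b where b: "b \<in> carrier R" "(s t \<oplus> h) \<otimes> b = \<one>" using inv(2)[OF t(1)] by blast
    have "quad c k \<otimes> ((s t \<otimes> b) \<otimes> (s t \<otimes> b)) = ((s t \<oplus> s t \<otimes> k) \<otimes> b) \<otimes> ((s t \<oplus> s t \<otimes> k) \<otimes> b)"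
      unfolding quad_def 2 s2 s_minus s_one using k b(1) s_closed[of t] by algebra
    then show False using b htk c(2) by (auto dest!: bspec[of _ _ "(s t \<otimes> b) \<otimes> (s t \<otimes> b)"])
  next
    case 3
    define y where "y = k \<oplus> s (- c)"
    have "y \<in> S" using S(4)[OF kS] by (simp add: y_def)
    then obtain b where b: "b \<in> carrier R" "(y \<otimes> y \<oplus> s (1 - c\<^sup>2)) \<otimes> b = \<one>"
      using pos[of y "1 - c\<^sup>2"] 3 by auto
    have cc: "s (1 - c\<^sup>2) = \<one> \<ominus> s c \<otimes> s c"
      by (simp add: s_diff s_one power2_eq_square s_mult)
    have "quad c k = y \<otimes> y \<oplus> s (1 - c\<^sup>2)"
      unfolding quad_def y_def s2 s_minus cc using k s_closed[of c] by algebra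
    then show False using b c(2) by simp
  qed
qed

end

section \<open>Positivity and contractivity\<close>

lemma hom_space_simps [simp]:
  "carrier (hom_space A x y) = Hom A x y" "zero (hom_space A x y) = Zero A x y"
  "add (hom_space A x y) = Add A x y" "smult (hom_space A x y) = Scale A x y"
  by (simp_all add: hom_space_def)

lemma scalar_ring_simps [simp]:
  "carrier (scalar_ring F) = F" "mult (scalar_ring F) = (*)" "one (scalar_ring F) = 1"
  "zero (scalar_ring F) = 0" "add (scalar_ring F) = (+)"
  by (simp_all add: scalar_ring_def)

lemma scalar_ring_cring:
  assumes "F = \<real> \<or> F = UNIV"
  shows "cring (scalar_ring F)"
proof (intro cringI abelian_groupI comm_monoidI)
  fix z assume "z \<in> carrier (scalar_ring F)"
  then show "\<exists>w\<in>carrier (scalar_ring F). w \<oplus>\<^bsub>scalar_ring F\<^esub> z = \<zero>\<^bsub>scalar_ring F\<^esub>"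
    using assms by (intro bexI[of _ "- z"]) auto
qed (use assms in \<open>auto simp: algebra_simps\<close>)

lemma hom_spaceI:
  assumes F: "F = \<real> \<or> F = UNIV"
    and zero: "Zero A x y \<in> Hom A x y"
    and add: "\<And>a b. a \<in> Hom A x y \<Longrightarrow> b \<in> Hom A x y \<Longrightarrow> Add A x y a b \<in> Hom A x y"
    and scale: "\<And>t a. t \<in> F \<Longrightarrow> a \<in> Hom A x y \<Longrightarrow> Scale A x y t a \<in> Hom A x y"
    and "\<And>a b c. \<lbrakk>a \<in> Hom A x y; b \<in> Hom A x y; c \<in> Hom A x y\<rbrakk> \<Longrightarrow>
      Add A x y (Add A x y a b) c = Add A x y a (Add A x y b c)"
    and "\<And>a b. \<lbrakk>a \<in> Hom A x y; b \<in> Hom A x y\<rbrakk> \<Longrightarrow> Add A x y a b = Add A x y b a"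
    and "\<And>a. a \<in> Hom A x y \<Longrightarrow> Add A x y (Zero A x y) a = a"
    and neg: "\<And>a. a \<in> Hom A x y \<Longrightarrow> Add A x y (Scale A x y (-1) a) a = Zero A x y"
    and "\<And>t u a. \<lbrakk>t \<in> F; u \<in> F; a \<in> Hom A x y\<rbrakk> \<Longrightarrow>
      Scale A x y (t + u) a = Add A x y (Scale A x y t a) (Scale A x y u a)"
    and "\<And>t a b. \<lbrakk>t \<in> F; a \<in> Hom A x y; b \<in> Hom A x y\<rbrakk> \<Longrightarrow>
      Scale A x y t (Add A x y a b) = Add A x y (Scale A x y t a) (Scale A x y t b)"
    and "\<And>t u a. \<lbrakk>t \<in> F; u \<in> F; a \<in> Hom A x y\<rbrakk> \<Longrightarrow> Scale A x y (t * u) a = Scale A x y t (Scale A x y u a)"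
    and "\<And>a. a \<in> Hom A x y \<Longrightarrow> Scale A x y 1 a = a"
  shows "module (scalar_ring F) (hom_space A x y)"
proof (rule moduleI)
  show "abelian_group (hom_space A x y)"
  proof (rule abelian_groupI)
    fix a assume "a \<in> carrier (hom_space A x y)"
    moreover have "- 1 \<in> F" using F by auto
    ultimately show "\<exists>b\<in>carrier (hom_space A x y).
        b \<oplus>\<^bsub>hom_space A x y\<^esub> a = \<zero>\<^bsub>hom_space A x y\<^esub>"
      using neg scale by auto
  qed (use assms in auto)
qed (use assms scalar_ring_cring in auto)

context F_category
begin

lemma
  assumes "x \<in> Ob A" "y \<in> Ob A"
  shows zero_closed: "Zero A x y \<in> Hom A x y"
    and add_closed: "a \<in> Hom A x y \<Longrightarrow> b \<in> Hom A x y \<Longrightarrow> Add A x y a b \<in> Hom A x y"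
    and scale_closed: "t \<in> F \<Longrightarrow> a \<in> Hom A x y \<Longrightarrow> Scale A x y t a \<in> Hom A x y"
    and add_assoc: "\<lbrakk>a \<in> Hom A x y; b \<in> Hom A x y; c \<in> Hom A x y\<rbrakk> \<Longrightarrow>
      Add A x y (Add A x y a b) c = Add A x y a (Add A x y b c)"
    and add_commute: "\<lbrakk>a \<in> Hom A x y; b \<in> Hom A x y\<rbrakk> \<Longrightarrow> Add A x y a b = Add A x y b a"
    and add_zero_left: "a \<in> Hom A x y \<Longrightarrow> Add A x y (Zero A x y) a = a"
    and scale_add_left: "\<lbrakk>t \<in> F; u \<in> F; a \<in> Hom A x y\<rbrakk> \<Longrightarrow>
      Scale A x y (t + u) a = Add A x y (Scale A x y t a) (Scale A x y u a)"
    and scale_add_right: "\<lbrakk>t \<in> F; a \<in> Hom A x y; b \<in> Hom A x y\<rbrakk> \<Longrightarrow>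
      Scale A x y t (Add A x y a b) = Add A x y (Scale A x y t a) (Scale A x y t b)"
    and scale_scale: "\<lbrakk>t \<in> F; u \<in> F; a \<in> Hom A x y\<rbrakk> \<Longrightarrow>
      Scale A x y t (Scale A x y u a) = Scale A x y (t * u) a"
    and scale_one: "a \<in> Hom A x y \<Longrightarrow> Scale A x y 1 a = a"
    and scale_zero_left: "a \<in> Hom A x y \<Longrightarrow> Scale A x y 0 a = Zero A x y"
    and scale_zero_right: "t \<in> F \<Longrightarrow> Scale A x y t (Zero A x y) = Zero A x y"
proof -
  interpret module "scalar_ring F" "hom_space A x y"
    using assms by (rule hom_vector_space)
  show "Zero A x y \<in> Hom A x y"
    using M.zero_closed by simp
  show "a \<in> Hom A x y \<Longrightarrow> b \<in> Hom A x y \<Longrightarrow> Add A x y a b \<in> Hom A x y"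
    using M.a_closed[of a b] by simp
  show "t \<in> F \<Longrightarrow> a \<in> Hom A x y \<Longrightarrow> Scale A x y t a \<in> Hom A x y"
    using smult_closed[of t a] by simp
  show "\<lbrakk>a \<in> Hom A x y; b \<in> Hom A x y; c \<in> Hom A x y\<rbrakk> \<Longrightarrow>
      Add A x y (Add A x y a b) c = Add A x y a (Add A x y b c)"
    using M.a_assoc[of a b c] by simp
  show "\<lbrakk>a \<in> Hom A x y; b \<in> Hom A x y\<rbrakk> \<Longrightarrow> Add A x y a b = Add A x y b a"
    using M.a_comm[of a b] by simp
  show "a \<in> Hom A x y \<Longrightarrow> Add A x y (Zero A x y) a = a"
    using M.l_zero[of a] by simp
  show "\<lbrakk>t \<in> F; u \<in> F; a \<in> Hom A x y\<rbrakk> \<Longrightarrow>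
      Scale A x y (t + u) a = Add A x y (Scale A x y t a) (Scale A x y u a)"
    using smult_l_distr[of t u a] by simp
  show "\<lbrakk>t \<in> F; a \<in> Hom A x y; b \<in> Hom A x y\<rbrakk> \<Longrightarrow>
      Scale A x y t (Add A x y a b) = Add A x y (Scale A x y t a) (Scale A x y t b)"
    using smult_r_distr[of t a b] by simp
  show "\<lbrakk>t \<in> F; u \<in> F; a \<in> Hom A x y\<rbrakk> \<Longrightarrow>
      Scale A x y t (Scale A x y u a) = Scale A x y (t * u) a"
    using smult_assoc1[of t u a] by simp
  show "a \<in> Hom A x y \<Longrightarrow> Scale A x y 1 a = a"
    using smult_one[of a] by simp
  show "a \<in> Hom A x y \<Longrightarrow> Scale A x y 0 a = Zero A x y"
    using smult_l_null[of a] by simp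
  show "t \<in> F \<Longrightarrow> Scale A x y t (Zero A x y) = Zero A x y"
    using smult_r_null[of t] by simp
qed

text \<open>\<open>F_category\<close> puts no condition on \<open>F\<close> itself. That -1 is a
  scalar is extracted from the ring structure inside the module axiom, hence the two
  objects.\<close>

lemma neg_unit_scalar:
  assumes "x \<in> Ob A" "y \<in> Ob A"
  shows "- 1 \<in> F"
proof -
  interpret module "scalar_ring F" "hom_space A x y"
    using assms by (rule hom_vector_space)
  have "\<ominus>\<^bsub>scalar_ring F\<^esub> (1 :: complex) \<in> F" and "\<ominus>\<^bsub>scalar_ring F\<^esub> (1 :: complex) + 1 = 0"
    using R.a_inv_closed[of 1] R.l_neg[of 1] R.one_closed by simp_all
  then show ?thesis
    by (metis add_eq_0_iff2)
qed

lemma add_neg: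
  assumes "x \<in> Ob A" "y \<in> Ob A" "a \<in> Hom A x y"
  shows "Add A x y (Scale A x y (- 1) a) a = Zero A x y"
proof -
  have one: "1 \<in> F"
    using cring.axioms(1)[OF module.axioms(1)[OF hom_vector_space[OF assms(1,2)]]]
      ring.ring_simprules(6)[of "scalar_ring F"] by simp
  have "Add A x y (Scale A x y (- 1) a) (Scale A x y 1 a) = Scale A x y (- 1 + 1) a"
    using assms one neg_unit_scalar[OF assms(1,2)] by (intro scale_add_left[symmetric]) auto
  then show ?thesis
    using assms by (simp add: scale_one scale_zero_left)
qed

lemma hom_space_inverse:
  assumes "x \<in> Ob A" "y \<in> Ob A" "a \<in> Hom A x y"
  shows "\<ominus>\<^bsub>hom_space A x y\<^esub> a = Scale A x y (- 1) a"
proof -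
  interpret module "scalar_ring F" "hom_space A x y"
    using assms(1,2) by (rule hom_vector_space)
  have "Scale A x y (- 1) a \<in> Hom A x y"
    using assms neg_unit_scalar by (intro scale_closed) auto
  then show ?thesis
    using M.minus_equality[of "Scale A x y (- 1) a" a] add_neg[OF assms] assms(3) by simp
qed

text \<open>\<open>Diff\<close> goes through the inverse of the module, which is given by a
  description; the right-hand side uses only operations that *-functors preserve.\<close>

lemma Diff_eq:
  assumes "x \<in> Ob A" "y \<in> Ob A" "b \<in> Hom A x y"
  shows "Diff A x y a b = Add A x y a (Scale A x y (- 1) b)"
  using hom_space_inverse[OF assms] by (simp add: a_minus_def)

lemma diff_closed:
  assumes "x \<in> Ob A" "y \<in> Ob A" "a \<in> Hom A x y" "b \<in> Hom A x y"
  shows "Diff A x y a b \<in> Hom A x y"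
  using assms neg_unit_scalar by (auto simp: Diff_eq intro!: add_closed scale_closed)

lemma diff_eq_zero_iff:
  assumes "x \<in> Ob A" "y \<in> Ob A" "a \<in> Hom A x y" "b \<in> Hom A x y"
  shows "Diff A x y a b = Zero A x y \<longleftrightarrow> a = b"
proof -
  interpret module "scalar_ring F" "hom_space A x y"
    using assms(1,2) by (rule hom_vector_space)
  have "a \<ominus>\<^bsub>hom_space A x y\<^esub> b = \<zero>\<^bsub>hom_space A x y\<^esub> \<Longrightarrow> a = b"
  proof -
    have "a = (a \<ominus>\<^bsub>hom_space A x y\<^esub> b) \<oplus>\<^bsub>hom_space A x y\<^esub> b"
      using assms(3,4) M.minus_eq M.a_assoc[of a "\<ominus>\<^bsub>hom_space A x y\<^esub> b" b] M.l_neg[of b] M.r_zero[of a] M.a_inv_closed[of b]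
      by simp
    then show "a \<ominus>\<^bsub>hom_space A x y\<^esub> b = \<zero>\<^bsub>hom_space A x y\<^esub> \<Longrightarrow> a = b"
      using M.l_zero[of b] assms(4) by simp
  qed
  then show ?thesis
    using assms(4) M.r_neg[of b] M.minus_eq[of b b] by auto
qed

end

text \<open>Everything in the definition of a C*-category except positivity.\<close>

locale pre_Cstar_category = star_category F A
  for F :: "complex set" and A :: "('o, 'a) normed_star_cat" +
  assumes scalars: "F = \<real> \<or> F = UNIV"
    and norm_nonneg: "\<lbrakk>x \<in> Ob A; y \<in> Ob A; a \<in> Hom A x y\<rbrakk> \<Longrightarrow> 0 \<le> Norm A x y a"
    and norm_eq_zero:
      "\<lbrakk>x \<in> Ob A; y \<in> Ob A; a \<in> Hom A x y\<rbrakk> \<Longrightarrow> Norm A x y a = 0 \<longleftrightarrow> a = Zero A x y"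
    and norm_triangle:
      "\<lbrakk>x \<in> Ob A; y \<in> Ob A; a \<in> Hom A x y; b \<in> Hom A x y\<rbrakk> \<Longrightarrow>
       Norm A x y (Add A x y a b) \<le> Norm A x y a + Norm A x y b"
    and norm_scale:
      "\<lbrakk>x \<in> Ob A; y \<in> Ob A; a \<in> Hom A x y; t \<in> F\<rbrakk> \<Longrightarrow>
       Norm A x y (Scale A x y t a) = cmod t * Norm A x y a"
    and complete: "\<lbrakk>x \<in> Ob A; y \<in> Ob A\<rbrakk> \<Longrightarrow> norm_complete A x y"
    and norm_comp:
      "\<lbrakk>x \<in> Ob A; y \<in> Ob A; z \<in> Ob A; a \<in> Hom A x y; b \<in> Hom A y z\<rbrakk> \<Longrightarrow>
       Norm A x z (Comp A x y z b a) \<le> Norm A y z b * Norm A x y a"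
    and cstar_identity:
      "\<lbrakk>x \<in> Ob A; y \<in> Ob A; a \<in> Hom A x y\<rbrakk> \<Longrightarrow>
       Norm A x x (Comp A x y x (Star A x y a) a) = (Norm A x y a)\<^sup>2"
begin

section \<open>Endomorphisms inside commutative Banach algebras\<close>

lemma real_scalar: "of_real t \<in> F" "1 \<in> F" "- 1 \<in> F" "0 \<in> F"
  using scalars by auto

abbreviation scal :: "'o \<Rightarrow> real \<Rightarrow> 'a" where
  "scal x t \<equiv> Scale A x x (of_real t) (Unit A x)"

lemma scal_closed: "x \<in> Ob A \<Longrightarrow> scal x t \<in> Hom A x x"
  by (intro scale_closed unit_closed real_scalar)

lemma comp_scal:
  assumes "x \<in> Ob A" "a \<in> Hom A x x" "t \<in> F"
  shows "Comp A x x x (Scale A x x t (Unit A x)) a = Scale A x x t a"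
    and "Comp A x x x a (Scale A x x t (Unit A x)) = Scale A x x t a"
  using assms
  by (simp_all add: comp_scale_left comp_scale_right unit_closed comp_unit_left comp_unit_right)

lemma star_unit: "x \<in> Ob A \<Longrightarrow> Star A x x (Unit A x) = Unit A x"
  by (metis comp_unit_right star_closed star_comp star_star unit_closed)

text \<open>By the C*-identity the norm of a unit equals its own square. The value 0 does occur, at
  an object whose unit is zero, so only an upper bound is recorded.\<close>

lemma norm_unit_le: "x \<in> Ob A \<Longrightarrow> Norm A x x (Unit A x) \<le> 1"
proof -
  assume x: "x \<in> Ob A"
  have "Norm A x x (Unit A x) = (Norm A x x (Unit A x))\<^sup>2"
    using cstar_identity[of x x "Unit A x"] x by (simp add: star_unit comp_unit_right unit_closed)
  then show ?thesis
    by (auto simp: power2_eq_square)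
qed

text \<open>Spectra can be computed in the bicommutant, because it contains the inverses of its elements.\<close>

definition bicommutant :: "'o \<Rightarrow> 'a \<Rightarrow> 'a ring" where
  "bicommutant x h = \<lparr>carrier = {a \<in> Hom A x x. \<forall>b\<in>Hom A x x.
       Comp A x x x b h = Comp A x x x h b \<longrightarrow> Comp A x x x a b = Comp A x x x b a},
     mult = Comp A x x x, one = Unit A x, zero = Zero A x x, add = Add A x x\<rparr>"

lemma bicommutant_simps [simp]:
  "mult (bicommutant x h) = Comp A x x x" "one (bicommutant x h) = Unit A x"
  "zero (bicommutant x h) = Zero A x x" "add (bicommutant x h) = Add A x x"
  by (simp_all add: bicommutant_def)

lemma bicommutant_iff:
  "a \<in> carrier (bicommutant x h) \<longleftrightarrow> a \<in> Hom A x x \<and> (\<forall>b\<in>Hom A x x.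
     Comp A x x x b h = Comp A x x x h b \<longrightarrow> Comp A x x x a b = Comp A x x x b a)"
  by (simp add: bicommutant_def)

context
  fixes x h
  assumes x: "x \<in> Ob A" and h: "h \<in> Hom A x x"
begin

lemma bicommutant_Hom: "a \<in> carrier (bicommutant x h) \<Longrightarrow> a \<in> Hom A x x"
  by (simp add: bicommutant_iff)

lemma bicommutant_self: "h \<in> carrier (bicommutant x h)"
  using h by (auto simp: bicommutant_iff)

lemma bicommutant_scalar: "t \<in> F \<Longrightarrow> Scale A x x t (Unit A x) \<in> carrier (bicommutant x h)"
  using x by (auto simp: bicommutant_iff comp_scal intro: scale_closed unit_closed)

lemma comp_zero:
  assumes "a \<in> Hom A x x"
  shows "Comp A x x x (Zero A x x) a = Zero A x x" "Comp A x x x a (Zero A x x) = Zero A x x"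
  using comp_scale_left[OF x x x assms zero_closed[OF x x] real_scalar(4)]
    comp_scale_right[OF x x x zero_closed[OF x x] assms real_scalar(4)] x assms
  by (simp_all add: scale_zero_left zero_closed comp_closed)

lemma bicommutant_closed:
  shows "a \<in> carrier (bicommutant x h) \<Longrightarrow> b \<in> carrier (bicommutant x h) \<Longrightarrow>
      Add A x x a b \<in> carrier (bicommutant x h)"
    and "a \<in> carrier (bicommutant x h) \<Longrightarrow> b \<in> carrier (bicommutant x h) \<Longrightarrow>
      Comp A x x x a b \<in> carrier (bicommutant x h)"
    and "Zero A x x \<in> carrier (bicommutant x h)" "Unit A x \<in> carrier (bicommutant x h)"
    and "a \<in> carrier (bicommutant x h) \<Longrightarrow> t \<in> F \<Longrightarrow> Scale A x x t a \<in> carrier (bicommutant x h)"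
proof -
  show "Add A x x a b \<in> carrier (bicommutant x h)"
    if "a \<in> carrier (bicommutant x h)" "b \<in> carrier (bicommutant x h)"
    using that x by (auto simp: bicommutant_iff add_closed comp_add_left comp_add_right)
  show "Comp A x x x a b \<in> carrier (bicommutant x h)"
    if "a \<in> carrier (bicommutant x h)" "b \<in> carrier (bicommutant x h)"
    unfolding bicommutant_iff
  proof (intro conjI ballI impI)
    show "Comp A x x x a b \<in> Hom A x x"
      using that x by (auto simp: bicommutant_iff comp_closed)
    fix c assume c: "c \<in> Hom A x x" "Comp A x x x c h = Comp A x x x h c"
    then have "Comp A x x x a c = Comp A x x x c a" "Comp A x x x b c = Comp A x x x c b"
      using that by (auto simp: bicommutant_iff)
    with c(1) that show "Comp A x x x (Comp A x x x a b) c = Comp A x x x c (Comp A x x x a b)"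
      unfolding bicommutant_iff by (metis comp_assoc x)
  qed
  show "Zero A x x \<in> carrier (bicommutant x h)"
    by (auto simp: bicommutant_iff zero_closed x comp_zero)
  show "Unit A x \<in> carrier (bicommutant x h)"
    by (auto simp: bicommutant_iff unit_closed x comp_unit_left comp_unit_right)
  show "Scale A x x t a \<in> carrier (bicommutant x h)"
    if "a \<in> carrier (bicommutant x h)" "t \<in> F"
    using that x by (auto simp: bicommutant_iff scale_closed comp_scale_left comp_scale_right)
qed

text \<open>\<open>h\<close> commutes with itself, hence \<open>b\<close> commutes with
  \<open>h\<close>; and \<open>a\<close> commutes with whatever commutes with
  \<open>h\<close>.\<close>

lemma bicommutant_commute:
  assumes "a \<in> carrier (bicommutant x h)" "b \<in> carrier (bicommutant x h)"
  shows "Comp A x x x a b = Comp A x x x b a"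
  using assms h unfolding bicommutant_iff by metis

lemma bicommutant_cring: "cring (bicommutant x h)"
proof (intro cringI abelian_groupI comm_monoidI)
  fix a assume a: "a \<in> carrier (bicommutant x h)"
  then show "\<exists>b\<in>carrier (bicommutant x h). b \<oplus>\<^bsub>bicommutant x h\<^esub> a = \<zero>\<^bsub>bicommutant x h\<^esub>"
    using bicommutant_closed(5)[OF a real_scalar(3)] add_neg[OF x x bicommutant_Hom] by auto
  fix b assume b: "b \<in> carrier (bicommutant x h)"
  show "a \<otimes>\<^bsub>bicommutant x h\<^esub> b = b \<otimes>\<^bsub>bicommutant x h\<^esub> a"
    using bicommutant_commute[OF a b] by simp
qed (use x bicommutant_Hom bicommutant_closed in \<open>auto simp: add_assoc add_zero_left
    comp_assoc comp_unit_left comp_add_left intro: add_commute\<close>)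

lemma bicommutant_minus:
  assumes "a \<in> carrier (bicommutant x h)"
  shows "\<ominus>\<^bsub>bicommutant x h\<^esub> a = Scale A x x (- 1) a"
proof -
  interpret cring "bicommutant x h" by (rule bicommutant_cring)
  show ?thesis
    using minus_equality[of "Scale A x x (- 1) a" a] bicommutant_closed(5)[OF assms real_scalar(3)]
      add_neg[OF x x bicommutant_Hom[OF assms]] assms by simp
qed

lemma bicommutant_diff:
  assumes "b \<in> carrier (bicommutant x h)"
  shows "a \<ominus>\<^bsub>bicommutant x h\<^esub> b = Diff A x x a b"
  using bicommutant_minus[OF assms] Diff_eq[OF x x bicommutant_Hom[OF assms]]
  by (simp add: a_minus_def[of "bicommutant x h"])

lemma norm_neg:
  assumes "y \<in> Ob A" "z \<in> Ob A" "a \<in> Hom A y z"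
  shows "Norm A y z (Scale A y z (- 1) a) = Norm A y z a"
  using norm_scale[OF assms real_scalar(3)] by simp

text \<open>Since \<open>f i\<close> commutes with \<open>b\<close>, the commutator of
  \<open>l\<close> with \<open>b\<close> is, up to sign, that of \<open>f i - l\<close>, so its norm
  is at most a multiple of a null sequence.\<close>

lemma bicommutant_limit:
  assumes f: "range f \<subseteq> carrier (bicommutant x h)" and l: "l \<in> Hom A x x"
    and lim: "(\<lambda>i. Norm A x x (Diff A x x (f i) l)) \<longlonglongrightarrow> 0"
  shows "l \<in> carrier (bicommutant x h)"
  unfolding bicommutant_iff
proof (intro conjI ballI impI l)
  fix b assume b: "b \<in> Hom A x x" "Comp A x x x b h = Comp A x x x h b"
  have fi: "f i \<in> Hom A x x" for i
    using f bicommutant_Hom by blast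
  have comm: "Comp A x x x (f i) b = Comp A x x x b (f i)" for i
    using f b unfolding bicommutant_iff image_subset_iff by blast
  define d where "d = Diff A x x (Comp A x x x l b) (Comp A x x x b l)"
  note cl = comp_closed[OF x x x] add_closed[OF x x] scale_closed[OF x x real_scalar(3)] diff_closed[OF x x]
  have d: "d \<in> Hom A x x" unfolding d_def using l b(1) by (intro cl)
  define g where "g i = Diff A x x (f i) l" for i
  have g: "g i \<in> Hom A x x" for i using fi l by (simp add: g_def cl)
  have neg_neg: "Scale A x x (- 1) (Scale A x x (- 1) a) = a" if "a \<in> Hom A x x" for a
    using scale_scale[OF x x real_scalar(3) real_scalar(3) that] scale_one[OF x x that] by simp
  have "Norm A x x d \<le> 2 * Norm A x x b * Norm A x x (g i)" for i
  proof -
    let ?n = "Scale A x x (- 1)"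
    let ?u = "Comp A x x x (f i) b" and ?v = "Comp A x x x l b" and ?w = "Comp A x x x b l"
    have 1: "Comp A x x x (g i) b = Add A x x ?u (?n ?v)"
      unfolding g_def Diff_eq[OF x x l] using fi l b(1)
      by (simp add: comp_add_left comp_scale_left x cl real_scalar)
    have 2: "Comp A x x x b (g i) = Add A x x ?u (?n ?w)"
      unfolding g_def Diff_eq[OF x x l] comm using fi l b(1)
      by (simp add: comp_add_right comp_scale_right x cl real_scalar)
    have cls: "?u \<in> Hom A x x" "?v \<in> Hom A x x" "?w \<in> Hom A x x" "?n ?u \<in> Hom A x x" "?n ?v \<in> Hom A x x" "?n ?w \<in> Hom A x x"
      using fi l b(1) by (auto intro!: cl)
    \<comment> \<open>The terms \<open>?u\<close> cancel in
      \<open>-(?u - ?v) + (?u - ?w) = ?v - ?w\<close>.\<close>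
    have "Add A x x (?n (Add A x x ?u (?n ?v))) (Add A x x ?u (?n ?w)) =
        Add A x x (Add A x x (?n ?u) ?v) (Add A x x ?u (?n ?w))"
      using cls by (simp add: scale_add_right x real_scalar neg_neg)
    also have "\<dots> = Add A x x (Add A x x ?v (?n ?u)) (Add A x x ?u (?n ?w))"
      using cls by (simp add: add_commute[of x x "?n ?u"] x)
    also have "\<dots> = Add A x x ?v (Add A x x (Add A x x (?n ?u) ?u) (?n ?w))"
      using cls by (simp add: add_assoc x cl)
    also have "\<dots> = d"
      using cls by (simp add: add_neg add_zero_left x d_def Diff_eq)
    finally have "d = Add A x x (?n (Comp A x x x (g i) b)) (Comp A x x x b (g i))"
      unfolding 1 2 by simp
    moreover have "Comp A x x x (g i) b \<in> Hom A x x" "Comp A x x x b (g i) \<in> Hom A x x"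
      using g b(1) by (auto intro!: cl)
    ultimately have "Norm A x x d \<le> Norm A x x (Comp A x x x (g i) b) + Norm A x x (Comp A x x x b (g i))"
      using norm_triangle[OF x x cl(3)] by (metis norm_neg x)
    also have "\<dots> \<le> Norm A x x (g i) * Norm A x x b + Norm A x x b * Norm A x x (g i)"
      using g b(1) by (intro add_mono norm_comp x) auto
    finally show ?thesis by simp
  qed
  moreover have "(\<lambda>i. 2 * Norm A x x b * Norm A x x (g i)) \<longlonglongrightarrow> 2 * Norm A x x b * 0"
    unfolding g_def by (intro tendsto_intros lim)
  ultimately have "Norm A x x d \<le> 0"
    by (intro LIMSEQ_le_const[of _ 0 "Norm A x x d"]) auto
  then have "d = Zero A x x"
    using norm_nonneg[OF x x d] norm_eq_zero[OF x x d] by simp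
  then show "Comp A x x x l b = Comp A x x x b l"
    unfolding d_def using diff_eq_zero_iff[OF x x] l b(1) cl(1) by metis
qed

text \<open>A single endomorphism thus becomes an element of a commutative real Banach algebra,
  although \<open>Hom A x x\<close> need not be commutative. For complex \<open>F\<close> the
  imaginary scalars are forgotten as structure but remain present as elements.\<close>

lemma bicommutant_banach: "real_banach_cring (bicommutant x h) (scal x) (Norm A x x)"
proof (intro real_banach_cring.intro real_banach_cring_axioms.intro)
  show "cring (bicommutant x h)" by (rule bicommutant_cring)
  show "scal x t \<in> carrier (bicommutant x h)" for t
    by (intro bicommutant_scalar real_scalar)
  show "scal x (t + u) = scal x t \<oplus>\<^bsub>bicommutant x h\<^esub> scal x u" for t u
    using scale_add_left[OF x x real_scalar(1) real_scalar(1) unit_closed[OF x], of t u] by simp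
  show "scal x (t * u) = scal x t \<otimes>\<^bsub>bicommutant x h\<^esub> scal x u" for t u
    using x by (simp add: comp_scal scal_closed real_scalar scale_scale unit_closed mult.commute)
  show "scal x 1 = \<one>\<^bsub>bicommutant x h\<^esub>"
    using x by (simp add: scale_one unit_closed)
  fix a assume "a \<in> carrier (bicommutant x h)"
  then have a: "a \<in> Hom A x x" by (rule bicommutant_Hom)
  show "0 \<le> Norm A x x a" "(Norm A x x a = 0) = (a = \<zero>\<^bsub>bicommutant x h\<^esub>)"
    using a x by (simp_all add: norm_nonneg norm_eq_zero)
  show "Norm A x x (scal x t \<otimes>\<^bsub>bicommutant x h\<^esub> a) = \<bar>t\<bar> * Norm A x x a" for t
    using a x by (simp add: comp_scal norm_scale real_scalar)
  fix b assume "b \<in> carrier (bicommutant x h)"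
  then have b: "b \<in> Hom A x x" by (rule bicommutant_Hom)
  show "Norm A x x (a \<oplus>\<^bsub>bicommutant x h\<^esub> b) \<le> Norm A x x a + Norm A x x b"
    and "Norm A x x (a \<otimes>\<^bsub>bicommutant x h\<^esub> b) \<le> Norm A x x a * Norm A x x b"
    using a b x by (simp_all add: norm_triangle norm_comp)
next
  show "Norm A x x \<one>\<^bsub>bicommutant x h\<^esub> \<le> 1"
    using norm_unit_le[OF x] by simp
next
  fix f :: "nat \<Rightarrow> 'a"
  assume f: "range f \<subseteq> carrier (bicommutant x h)"
    and cauchy: "\<forall>e>0. \<exists>N. \<forall>i\<ge>N. \<forall>j\<ge>N. Norm A x x (f i \<ominus>\<^bsub>bicommutant x h\<^esub> f j) < e"
  have fi: "f i \<in> carrier (bicommutant x h)" for i using f by blast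
  have "range f \<subseteq> Hom A x x" using f bicommutant_Hom by blast
  moreover have "\<forall>e>0. \<exists>N. \<forall>i\<ge>N. \<forall>j\<ge>N. Norm A x x (Diff A x x (f i) (f j)) < e"
    using cauchy by (simp add: bicommutant_diff[OF fi])
  ultimately obtain l where l: "l \<in> Hom A x x" "(\<lambda>i. Norm A x x (Diff A x x (f i) l)) \<longlonglongrightarrow> 0"
    using complete[OF x x] unfolding norm_complete_def by blast
  then have "l \<in> carrier (bicommutant x h)"
    using bicommutant_limit[OF f] by blast
  then show "\<exists>l\<in>carrier (bicommutant x h). (\<lambda>i. Norm A x x (f i \<ominus>\<^bsub>bicommutant x h\<^esub> l)) \<longlonglongrightarrow> 0"
    using l(2) by (auto simp: bicommutant_diff)
qed

text \<open>An inverse \<open>b\<close> of \<open>a\<close> commutes with everything that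
  \<open>a\<close> commutes with: \<open>b c = b (c a) b = b (a c) b = c b\<close>. Conversely,
  commutativity makes a one-sided inverse in the bicommutant two-sided.\<close>

lemma invertible_bicommutant_iff:
  assumes a: "a \<in> carrier (bicommutant x h)"
  shows "invertible_endo A x a \<longleftrightarrow> (\<exists>b\<in>carrier (bicommutant x h). Comp A x x x a b = Unit A x)"
proof
  assume "invertible_endo A x a"
  then obtain b where b: "b \<in> Hom A x x" "Comp A x x x b a = Unit A x" "Comp A x x x a b = Unit A x"
    unfolding invertible_endo_def by blast
  have aH: "a \<in> Hom A x x" using a by (rule bicommutant_Hom)
  have "Comp A x x x b c = Comp A x x x c b" if c: "c \<in> Hom A x x" "Comp A x x x c h = Comp A x x x h c" for c
  proof -
    have ac: "Comp A x x x a c = Comp A x x x c a"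
      using a c by (simp add: bicommutant_iff)
    have "Comp A x x x b c = Comp A x x x (Comp A x x x b c) (Comp A x x x a b)"
      using b c x by (simp add: comp_unit_right comp_closed)
    also have "\<dots> = Comp A x x x b (Comp A x x x (Comp A x x x c a) b)"
      using b(1) c(1) aH x by (simp add: comp_assoc comp_closed)
    also have "\<dots> = Comp A x x x (Comp A x x x b a) (Comp A x x x c b)"
      unfolding ac[symmetric] using b(1) c(1) aH x by (simp add: comp_assoc comp_closed)
    also have "\<dots> = Comp A x x x c b"
      using b c x by (simp add: comp_unit_left comp_closed)
    finally show ?thesis .
  qed
  then have "b \<in> carrier (bicommutant x h)"
    using b(1) by (simp add: bicommutant_iff)
  then show "\<exists>b\<in>carrier (bicommutant x h). Comp A x x x a b = Unit A x"
    using b(3) by blast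
next
  assume "\<exists>b\<in>carrier (bicommutant x h). Comp A x x x a b = Unit A x"
  then show "invertible_endo A x a"
    unfolding invertible_endo_def using bicommutant_commute[OF a] bicommutant_Hom by metis
qed

end

section \<open>Positivity expressed by norms\<close>

lemma neumann_invertible:
  assumes x: "x \<in> Ob A" and h: "h \<in> Hom A x x" and lt: "Norm A x x h < t"
  shows "invertible_endo A x (Diff A x x (scal x t) h)"
proof -
  interpret B: real_banach_cring "bicommutant x h" "scal x" "Norm A x x"
    using x h by (rule bicommutant_banach)
  have h': "h \<in> carrier (bicommutant x h)" using x h by (rule bicommutant_self)
  show ?thesis
    using B.shift_invertible[OF h' lt] B.minus_closed[OF B.s_closed h'] invertible_bicommutant_iff[OF x h]
    by (simp add: bicommutant_diff[OF x h h'])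
qed

text \<open>With \<open>r = norm(a)^2\<close> write
  \<open>a^* a + t = (r + t) - (r - a^* a)\<close>; by the inequality the subtracted term has norm
  at most \<open>r\<close>, so the Neumann series excludes negative spectral values. A nonreal
  \<open>z\<close> reduces to this case: with \<open>b = h - Re z\<close> selfadjoint and
  \<open>j\<close> the imaginary part, \<open>(b - j) (b + j) = b^2 + u^2\<close>. As
  \<open>b\<close> is another arrow out of \<open>x\<close>, the inequality is assumed for all of
  these.\<close>

lemma spectrum_nonneg:
  assumes x: "x \<in> Ob A" and y: "y \<in> Ob A" and a: "a \<in> Hom A x y"
    and pos: "\<And>y a. \<lbrakk>y \<in> Ob A; a \<in> Hom A x y\<rbrakk> \<Longrightarrow>
      Norm A x x (Diff A x x (scal x ((Norm A x y a)\<^sup>2)) (Comp A x y x (Star A x y a) a)) \<le> (Norm A x y a)\<^sup>2"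
  shows "spectrum_in F A x (Comp A x y x (Star A x y a) a) \<subseteq> \<real>\<^sub>\<ge>\<^sub>0"
proof
  have neg: "invertible_endo A x (Add A x x (Comp A x y x (Star A x y a) a) (scal x t))"
    if y: "y \<in> Ob A" and a: "a \<in> Hom A x y" and t: "t > 0" for t y a
  proof -
    define h where "h = Comp A x y x (Star A x y a) a"
    have h: "h \<in> Hom A x x" unfolding h_def using x y a by (intro comp_closed star_closed)
    interpret B: real_banach_cring "bicommutant x h" "scal x" "Norm A x x"
      using x h by (rule bicommutant_banach)
    have h': "h \<in> carrier (bicommutant x h)" using x h by (rule bicommutant_self)
    let ?u = "(Norm A x y a)\<^sup>2"
    define g where "g = scal x ?u \<ominus>\<^bsub>bicommutant x h\<^esub> h"
    have g: "g \<in> carrier (bicommutant x h)" unfolding g_def using B.minus_closed[OF B.s_closed h'] .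
    have "Norm A x x g \<le> ?u"
      using pos[OF y a] unfolding g_def bicommutant_diff[OF x h h'] unfolding h_def .
    then have "Norm A x x g < ?u + t" using t by simp
    then obtain b where b: "b \<in> carrier (bicommutant x h)"
      "(scal x (?u + t) \<ominus>\<^bsub>bicommutant x h\<^esub> g) \<otimes>\<^bsub>bicommutant x h\<^esub> b = \<one>\<^bsub>bicommutant x h\<^esub>"
      using B.shift_invertible[OF g] by blast
    have "scal x (?u + t) \<ominus>\<^bsub>bicommutant x h\<^esub> g = h \<oplus>\<^bsub>bicommutant x h\<^esub> scal x t"
      unfolding g_def B.s_add using h' B.s_closed[of ?u] B.s_closed[of t] by algebra
    then show ?thesis
      using b B.add.m_closed[OF h' B.s_closed] invertible_bicommutant_iff[OF x h] by (metis bicommutant_simps h_def)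
  qed
  define h where "h = Comp A x y x (Star A x y a) a"
  have h: "h \<in> Hom A x x" unfolding h_def using x y a by (intro comp_closed star_closed)
  have star_h: "Star A x x h = h"
    unfolding h_def using x y a by (simp add: star_comp star_closed star_star)
  interpret B: real_banach_cring "bicommutant x h" "scal x" "Norm A x x"
    using x h by (rule bicommutant_banach)
  have h': "h \<in> carrier (bicommutant x h)" using x h by (rule bicommutant_self)
  fix z assume "z \<in> spectrum_in F A x (Comp A x y x (Star A x y a) a)"
  then have z: "z \<in> F" "\<not> invertible_endo A x (Diff A x x h (Scale A x x z (Unit A x)))"
    by (auto simp: spectrum_in_def h_def)
  show "z \<in> \<real>\<^sub>\<ge>\<^sub>0"
  proof (rule ccontr)
    assume nn: "z \<notin> \<real>\<^sub>\<ge>\<^sub>0"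
    define t u where "t = Re z" and "u = Im z"
    have zs: "Scale A x x z (Unit A x) \<in> Hom A x x"
      using x z(1) by (intro scale_closed unit_closed)
    have eq: "Diff A x x h (Scale A x x z (Unit A x)) = Add A x x h (Scale A x x (- z) (Unit A x))"
      using x z(1) zs by (simp add: Diff_eq scale_scale real_scalar unit_closed)
    show False
    proof (cases "u = 0")
      case True
      then have "z = of_real t" by (simp add: t_def u_def complex_eq_iff)
      moreover from this nn have "t < 0" by (auto simp: not_le[symmetric])
      ultimately show False
        using neg[OF y a, of "- t"] z(2) eq by (simp add: h_def)
    next
      case False
      then have "\<not> F = \<real>" using z(1) by (auto simp: u_def complex_is_Real_iff)
      then have F: "F = UNIV" using scalars by blast
      \<comment> \<open>The imaginary part of \<open>z\<close> as an endomorphism, with square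
        \<open>- u^2\<close>. It exists because a nonreal scalar in \<open>F\<close> forces
        \<open>F = UNIV\<close>.\<close>
      let ?j = "Scale A x x (u *\<^sub>R \<i>) (Unit A x)"
      have j: "?j \<in> carrier (bicommutant x h)"
        using x h F by (intro bicommutant_scalar) auto
      have jj: "?j \<otimes>\<^bsub>bicommutant x h\<^esub> ?j = \<ominus>\<^bsub>bicommutant x h\<^esub> scal x (u * u)"
      proof -
        have "?j \<otimes>\<^bsub>bicommutant x h\<^esub> ?j = Scale A x x ((u *\<^sub>R \<i>) * (u *\<^sub>R \<i>)) (Unit A x)"
          using x F by (simp add: comp_scal scale_closed scale_scale unit_closed)
        also have "(u *\<^sub>R \<i>) * (u *\<^sub>R \<i>) = of_real (- (u * u))"
          by (simp add: complex_eq_iff)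
        finally show ?thesis by (simp only: B.s_minus)
      qed
      have zsplit: "Scale A x x (- z) (Unit A x) = \<ominus>\<^bsub>bicommutant x h\<^esub> scal x t \<ominus>\<^bsub>bicommutant x h\<^esub> ?j"
      proof -
        have "- z = of_real (- t) + - (u *\<^sub>R \<i>)"
          by (simp add: complex_eq_iff t_def u_def)
        then have "Scale A x x (- z) (Unit A x) = Add A x x (scal x (- t)) (Scale A x x (- (u *\<^sub>R \<i>)) (Unit A x))"
          using scale_add_left[OF x x _ _ unit_closed[OF x], of "of_real (- t)" "- (u *\<^sub>R \<i>)"] F by simp
        moreover have "Scale A x x (- (u *\<^sub>R \<i>)) (Unit A x) = Scale A x x (- 1) ?j"
          using x F by (simp add: scale_scale unit_closed)
        ultimately have "Scale A x x (- z) (Unit A x) = Add A x x (scal x (- t)) (Scale A x x (- 1) ?j)"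
          by simp
        then show ?thesis
          using bicommutant_minus[OF x h j] B.s_minus[of t] by (simp add: B.minus_eq)
      qed
      define b where "b = h \<ominus>\<^bsub>bicommutant x h\<^esub> scal x t"
      have b: "b \<in> carrier (bicommutant x h)" by (simp add: b_def h')
      have uu: "0 < u * u" using False not_real_square_gt_zero by blast
      have bH: "b \<in> Hom A x x" using x h b by (rule bicommutant_Hom)
      have "b = Add A x x h (scal x (- t))"
        unfolding b_def B.minus_eq B.s_minus by simp
      then have "Star A x x b = b"
        using x h by (simp add: star_add star_scale star_unit star_h scal_closed real_scalar unit_closed scale_closed
            del: of_real_minus)
      \<comment> \<open>\<open>b\<close> is selfadjoint, so \<open>b^2\<close> has the form covered
        by \<open>neg\<close>, with \<open>b\<close> as an arrow from \<open>x\<close> to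
        itself.\<close>
      then have "invertible_endo A x (b \<otimes>\<^bsub>bicommutant x h\<^esub> b \<oplus>\<^bsub>bicommutant x h\<^esub> scal x (u * u))"
        using neg[OF x bH uu] by simp
      moreover have "b \<otimes>\<^bsub>bicommutant x h\<^esub> b \<oplus>\<^bsub>bicommutant x h\<^esub> scal x (u * u) \<in> carrier (bicommutant x h)"
        using B.add.m_closed[OF B.m_closed[OF b b] B.s_closed] .
      ultimately obtain c where c: "c \<in> carrier (bicommutant x h)"
        "(b \<otimes>\<^bsub>bicommutant x h\<^esub> b \<oplus>\<^bsub>bicommutant x h\<^esub> scal x (u * u)) \<otimes>\<^bsub>bicommutant x h\<^esub> c = \<one>\<^bsub>bicommutant x h\<^esub>"
        using invertible_bicommutant_iff[OF x h] by (metis bicommutant_simps(1,2))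
      have hz: "Add A x x h (Scale A x x (- z) (Unit A x)) = b \<ominus>\<^bsub>bicommutant x h\<^esub> ?j"
      proof -
        have "h \<oplus>\<^bsub>bicommutant x h\<^esub> (\<ominus>\<^bsub>bicommutant x h\<^esub> scal x t \<ominus>\<^bsub>bicommutant x h\<^esub> ?j) = b \<ominus>\<^bsub>bicommutant x h\<^esub> ?j"
          unfolding b_def using h' j B.s_closed[of t] by algebra
        then show ?thesis unfolding zsplit by simp
      qed
      \<comment> \<open>With \<open>c\<close> the inverse of \<open>b^2 + u^2\<close>, the product
        \<open>(b + j) c\<close> inverts \<open>b - j\<close>.\<close>
      have "(b \<ominus>\<^bsub>bicommutant x h\<^esub> ?j) \<otimes>\<^bsub>bicommutant x h\<^esub> ((b \<oplus>\<^bsub>bicommutant x h\<^esub> ?j) \<otimes>\<^bsub>bicommutant x h\<^esub> c) =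
        (b \<otimes>\<^bsub>bicommutant x h\<^esub> b \<ominus>\<^bsub>bicommutant x h\<^esub> ?j \<otimes>\<^bsub>bicommutant x h\<^esub> ?j) \<otimes>\<^bsub>bicommutant x h\<^esub> c"
        using b j c(1) by algebra
      also have "\<dots> = \<one>\<^bsub>bicommutant x h\<^esub>"
        unfolding jj B.minus_eq B.minus_minus[OF B.s_closed] by (rule c(2))
      finally have "invertible_endo A x (b \<ominus>\<^bsub>bicommutant x h\<^esub> ?j)"
        using invertible_bicommutant_iff[OF x h, of "b \<ominus>\<^bsub>bicommutant x h\<^esub> ?j"] b j c(1)
        by (metis B.add.m_closed B.m_closed B.minus_closed bicommutant_simps(1,2))
      then show False using z(2) eq hz by simp
    qed
  qed
qed

lemma Cstar_categoryI_norm: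
  assumes "\<And>x y a. \<lbrakk>x \<in> Ob A; y \<in> Ob A; a \<in> Hom A x y\<rbrakk> \<Longrightarrow>
      Norm A x x (Diff A x x (scal x ((Norm A x y a)\<^sup>2)) (Comp A x y x (Star A x y a) a)) \<le> (Norm A x y a)\<^sup>2"
  shows "Cstar_category F A"
proof (intro Cstar_category.intro Cstar_category_axioms.intro)
  show "star_category F A" by (rule star_category_axioms)
qed (use spectrum_nonneg assms norm_nonneg norm_eq_zero norm_triangle norm_scale complete norm_comp
    cstar_identity in auto)

end

locale Cstar_category_over = Cstar_category F A
  for F :: "complex set" and A :: "('o, 'a) normed_star_cat" +
  assumes scalars: "F = \<real> \<or> F = UNIV"

sublocale Cstar_category_over \<subseteq> pre_Cstar_category F A
  using scalars norm_nonneg norm_eq_zero norm_triangle norm_scale complete norm_comp cstar_identity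
  by unfold_locales auto

context Cstar_category_over
begin

text \<open>The form of positivity in which both scalar fields look alike: only the scalars
  \<open>-t\<close> are excluded from the spectrum.\<close>

lemma positive_shift_invertible:
  assumes x: "x \<in> Ob A" and y: "y \<in> Ob A" and a: "a \<in> Hom A x y" and t: "t > 0"
  shows "invertible_endo A x (Add A x x (Comp A x y x (Star A x y a) a) (scal x t))"
proof -
  have "of_real (- t) \<notin> (\<real>\<^sub>\<ge>\<^sub>0 :: complex set)"
    using t by (simp only: nonneg_Reals_of_real_iff)
  then have "of_real (- t) \<notin> spectrum_in F A x (Comp A x y x (Star A x y a) a)"
    using positive[OF x y a] by blast
  then have "invertible_endo A x (Diff A x x (Comp A x y x (Star A x y a) a) (scal x (- t)))"
    unfolding spectrum_in_def using real_scalar(1)[of "- t"] by blast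
  then show ?thesis
    using x real_scalar(1)[of "- t"] by (simp add: Diff_eq scal_closed scale_scale real_scalar unit_closed scale_closed)
qed

text \<open>The fixed points of the involution inside the bicommutant serve as \<open>S\<close>.
  Their squares have the form \<open>y^* y\<close>, so the C*-identity and positivity apply to
  them.\<close>

lemma self_adjoint_norm_le:
  assumes x: "x \<in> Ob A" and h: "h \<in> Hom A x x" and star: "Star A x x h = h" and r: "0 \<le> r"
    and inv: "\<And>t. t > r \<Longrightarrow> invertible_endo A x (Diff A x x (scal x t) h)"
      "\<And>t. t > r \<Longrightarrow> invertible_endo A x (Add A x x (scal x t) h)"
  shows "Norm A x x h \<le> r"
proof -
  interpret B: real_banach_cring "bicommutant x h" "scal x" "Norm A x x"
    using x h by (rule bicommutant_banach)
  have h': "h \<in> carrier (bicommutant x h)" using x h by (rule bicommutant_self)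
  note to_bic = invertible_bicommutant_iff[OF x h]
  note toH = bicommutant_Hom[OF x h]
  show ?thesis
  proof (rule B.norm_le_of_invertible[where S = "{y \<in> carrier (bicommutant x h). Star A x x y = y}"])
    show "h \<in> {y \<in> carrier (bicommutant x h). Star A x x y = y}" using h' star by simp
    fix t assume t: "t > r"
    show "\<exists>b\<in>carrier (bicommutant x h). (scal x t \<ominus>\<^bsub>bicommutant x h\<^esub> h) \<otimes>\<^bsub>bicommutant x h\<^esub> b = \<one>\<^bsub>bicommutant x h\<^esub>"
      using inv(1)[OF t] to_bic[OF B.minus_closed[OF B.s_closed h']] by (simp add: bicommutant_diff[OF x h h'])
    show "\<exists>b\<in>carrier (bicommutant x h). (scal x t \<oplus>\<^bsub>bicommutant x h\<^esub> h) \<otimes>\<^bsub>bicommutant x h\<^esub> b = \<one>\<^bsub>bicommutant x h\<^esub>"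
      using inv(2)[OF t] to_bic[OF B.add.m_closed[OF B.s_closed h']] by simp
  next
    fix y assume "y \<in> {y \<in> carrier (bicommutant x h). Star A x x y = y}"
    then have y: "y \<in> carrier (bicommutant x h)" "Star A x x y = y" by auto
    have yH: "y \<in> Hom A x x" using y(1) by (rule toH)
    show "y \<otimes>\<^bsub>bicommutant x h\<^esub> y \<in> {y \<in> carrier (bicommutant x h). Star A x x y = y} \<and>
      Norm A x x (y \<otimes>\<^bsub>bicommutant x h\<^esub> y) = (Norm A x x y)\<^sup>2"
      using y yH x cstar_identity[OF x x yH] B.m_closed[OF y(1) y(1)] by (simp add: star_comp)
    fix t :: real
    show "scal x t \<otimes>\<^bsub>bicommutant x h\<^esub> y \<in> {y \<in> carrier (bicommutant x h). Star A x x y = y}"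
      using y yH x B.m_closed[OF B.s_closed y(1)] by (simp add: comp_scal star_scale real_scalar)
    show "y \<oplus>\<^bsub>bicommutant x h\<^esub> scal x t \<in> {y \<in> carrier (bicommutant x h). Star A x x y = y}"
      using y yH x B.add.m_closed[OF y(1) B.s_closed]
      by (simp add: star_add star_scale star_unit real_scalar scal_closed unit_closed)
    assume "t > 0"
    then show "\<exists>b\<in>carrier (bicommutant x h).
        (y \<otimes>\<^bsub>bicommutant x h\<^esub> y \<oplus>\<^bsub>bicommutant x h\<^esub> scal x t) \<otimes>\<^bsub>bicommutant x h\<^esub> b = \<one>\<^bsub>bicommutant x h\<^esub>"
      using positive_shift_invertible[OF x x yH] to_bic[OF B.add.m_closed[OF B.m_closed[OF y(1) y(1)] B.s_closed]] y(2)
      by simp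
  qed (use r in auto)
qed

lemma norm_positivity:
  assumes x: "x \<in> Ob A" and y: "y \<in> Ob A" and a: "a \<in> Hom A x y" and u: "(Norm A x y a)\<^sup>2 \<le> u"
  shows "Norm A x x (Diff A x x (scal x u) (Comp A x y x (Star A x y a) a)) \<le> u"
proof -
  define h where "h = Comp A x y x (Star A x y a) a"
  have h: "h \<in> Hom A x x" unfolding h_def using x y a by (intro comp_closed star_closed)
  have star_h: "Star A x x h = h"
    unfolding h_def using x y a by (simp add: star_comp star_closed star_star)
  have nh: "Norm A x x h \<le> u"
    unfolding h_def using cstar_identity[OF x y a] u by simp
  have u0: "0 \<le> u" using u zero_le_power2[of "Norm A x y a"] by linarith
  interpret B: real_banach_cring "bicommutant x h" "scal x" "Norm A x x"
    using x h by (rule bicommutant_banach)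
  have h': "h \<in> carrier (bicommutant x h)" using x h by (rule bicommutant_self)
  define g where "g = scal x u \<ominus>\<^bsub>bicommutant x h\<^esub> h"
  have g: "g \<in> carrier (bicommutant x h)" by (simp add: g_def h')
  have gH: "g \<in> Hom A x x" using x h g by (rule bicommutant_Hom)
  have geq: "g = Diff A x x (scal x u) h" by (simp add: g_def bicommutant_diff[OF x h h'])
  have "Norm A x x g \<le> u"
  proof (rule self_adjoint_norm_le[OF x gH _ u0])
    show "Star A x x g = g"
      unfolding geq using x h
      by (simp add: Diff_eq star_add star_scale star_unit star_h real_scalar scal_closed unit_closed scale_closed)
    fix t assume t: "t > u"
    have "scal x t \<ominus>\<^bsub>bicommutant x h\<^esub> g = h \<oplus>\<^bsub>bicommutant x h\<^esub> scal x (t - u)"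
      unfolding g_def B.s_diff using h' B.s_closed[of t] B.s_closed[of u] by algebra
    then show "invertible_endo A x (Diff A x x (scal x t) g)"
      using positive_shift_invertible[OF x y a, of "t - u"] t
      unfolding bicommutant_diff[OF x h g] h_def[symmetric] by simp
    have "scal x t \<oplus>\<^bsub>bicommutant x h\<^esub> g = scal x (t + u) \<ominus>\<^bsub>bicommutant x h\<^esub> h"
      unfolding g_def B.s_add using h' B.s_closed[of t] B.s_closed[of u] by algebra
    moreover have "Norm A x x h < t + u" using nh t u0 by simp
    ultimately show "invertible_endo A x (Add A x x (scal x t) g)"
      using neumann_invertible[OF x h, of "t + u"] unfolding bicommutant_diff[OF x h h'] by simp
  qed
  then show ?thesis by (simp add: geq h_def)
qed

end

section \<open>Contractivity of *-functors\<close>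

context star_functor
begin

lemma map_zero:
  assumes "F_category F A" "F_category F B" "x \<in> Ob A" "y \<in> Ob A" "0 \<in> F"
  shows "\<phi> x y (Zero A x y) = Zero B (f x) (f y)"
proof -
  interpret A: F_category F A by fact
  interpret B: F_category F B by fact
  have "\<phi> x y (Scale A x y 0 (Zero A x y)) = Scale B (f x) (f y) 0 (\<phi> x y (Zero A x y))"
    using assms(3-5) by (intro map_scale A.zero_closed)
  then show ?thesis
    using assms(3-5) by (simp add: A.scale_zero_left A.zero_closed B.scale_zero_left ob_closed hom_closed)
qed

lemma map_diff:
  assumes "F_category F A" "F_category F B" "x \<in> Ob A" "y \<in> Ob A" "a \<in> Hom A x y" "b \<in> Hom A x y"
  shows "\<phi> x y (Diff A x y a b) = Diff B (f x) (f y) (\<phi> x y a) (\<phi> x y b)"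
proof -
  interpret A: F_category F A by fact
  interpret B: F_category F B by fact
  have "- 1 \<in> F" using A.neg_unit_scalar assms(3,4) by blast
  then show ?thesis
    using assms(3-6) by (simp add: A.Diff_eq B.Diff_eq ob_closed hom_closed map_add map_scale A.scale_closed)
qed

lemma map_invertible:
  assumes "x \<in> Ob A" "b \<in> Hom A x x" "invertible_endo A x b"
  shows "invertible_endo B (f x) (\<phi> x x b)"
proof -
  obtain c where c: "c \<in> Hom A x x" "Comp A x x x c b = Unit A x" "Comp A x x x b c = Unit A x"
    using assms(3) unfolding invertible_endo_def by blast
  then show ?thesis
    unfolding invertible_endo_def using assms(1,2)
    by (intro bexI[of _ "\<phi> x x c"]) (auto simp: map_comp[symmetric] map_unit hom_closed)
qed

end

text \<open>The C*-identity reduces the claim to \<open>h = a^* a\<close>. For \<open>t\<close>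
  above the norm of \<open>h\<close> both \<open>t - h\<close> and \<open>t + h\<close> are
  invertible; *-functors preserve invertibility, and invertibility beyond a radius bounds the norm
  of a selfadjoint element.\<close>

lemma star_functor_contractive:
  assumes F: "F = \<real> \<or> F = UNIV" and CA: "Cstar_category F A" and CB: "Cstar_category F B"
    and func: "star_functor F A B f \<phi>"
    and x: "x \<in> Ob A" and y: "y \<in> Ob A" and a: "a \<in> Hom A x y"
  shows "Norm B (f x) (f y) (\<phi> x y a) \<le> Norm A x y a"
proof -
  interpret A: Cstar_category_over F A
    using CA F by (intro Cstar_category_over.intro Cstar_category_over_axioms.intro)
  interpret B: Cstar_category_over F B
    using CB F by (intro Cstar_category_over.intro Cstar_category_over_axioms.intro)
  interpret func: star_functor F A B f \<phi> by fact
  define h where "h = Comp A x y x (Star A x y a) a"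
  have h: "h \<in> Hom A x x" unfolding h_def using x y a by (intro A.comp_closed A.star_closed)
  have fx: "f x \<in> Ob B" and fy: "f y \<in> Ob B" and fa: "\<phi> x y a \<in> Hom B (f x) (f y)"
    and fh: "\<phi> x x h \<in> Hom B (f x) (f x)"
    using x y a h by (simp_all add: func.ob_closed func.hom_closed)
  have fh_eq: "\<phi> x x h = Comp B (f x) (f y) (f x) (Star B (f x) (f y) (\<phi> x y a)) (\<phi> x y a)"
    unfolding h_def using x y a by (simp add: func.map_comp func.map_star A.star_closed)
  have fscal: "\<phi> x x (A.scal x t) = B.scal (f x) t" for t
    using x by (simp add: func.map_scale A.real_scalar A.unit_closed func.map_unit)
  have nh: "Norm A x x h = (Norm A x y a)\<^sup>2" unfolding h_def by (rule A.cstar_identity[OF x y a])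
  have "Norm B (f x) (f x) (\<phi> x x h) \<le> Norm A x x h"
  proof (rule B.self_adjoint_norm_le[OF fx fh])
    show "Star B (f x) (f x) (\<phi> x x h) = \<phi> x x h"
      unfolding fh_eq using fx fy fa by (simp add: B.star_comp B.star_closed B.star_star)
    show "0 \<le> Norm A x x h" using A.norm_nonneg[OF x x h] .
    fix t assume t: "t > Norm A x x h"
    have "invertible_endo A x (Diff A x x (A.scal x t) h)"
      using A.neumann_invertible[OF x h t] .
    then show "invertible_endo B (f x) (Diff B (f x) (f x) (B.scal (f x) t) (\<phi> x x h))"
      using func.map_invertible[OF x A.diff_closed[OF x x A.scal_closed[OF x] h]] x h
      by (simp add: func.map_diff A.F_category_axioms B.F_category_axioms A.scal_closed fscal)
    \<comment> \<open>\<open>t + h\<close> is \<open>t - (-h)\<close>, so the Neumann series covers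
      it as well.\<close>
    have mh: "Scale A x x (- 1) h \<in> Hom A x x" using x h by (intro A.scale_closed A.real_scalar)
    have eq: "Diff A x x (A.scal x t) (Scale A x x (- 1) h) = Add A x x (A.scal x t) h"
      using x h mh by (simp add: A.Diff_eq A.scale_scale A.real_scalar A.scale_one)
    have "invertible_endo A x (Add A x x (A.scal x t) h)"
      using A.neumann_invertible[OF x mh, of t] t h x by (simp add: A.norm_scale A.real_scalar eq)
    then show "invertible_endo B (f x) (Add B (f x) (f x) (B.scal (f x) t) (\<phi> x x h))"
      using func.map_invertible[OF x A.add_closed[OF x x A.scal_closed[OF x] h]] x h
      by (simp add: func.map_add A.scal_closed fscal)
  qed
  then have "(Norm B (f x) (f y) (\<phi> x y a))\<^sup>2 \<le> (Norm A x y a)\<^sup>2"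
    unfolding fh_eq nh B.cstar_identity[OF fx fy fa] .
  then show ?thesis
    using A.norm_nonneg[OF x y a] by (rule power2_le_imp_le)
qed

section \<open>C*-categories from jointly faithful functors\<close>

context pre_Cstar_category
begin

lemma diff_split:
  assumes "x \<in> Ob A" "y \<in> Ob A" "a \<in> Hom A x y" "b \<in> Hom A x y" "c \<in> Hom A x y"
  shows "Diff A x y a c = Add A x y (Diff A x y a b) (Diff A x y b c)"
    and "Diff A x y a b = Scale A x y (- 1) (Diff A x y b a)"
    and "a = Add A x y (Diff A x y a b) b"
proof -
  interpret module "scalar_ring F" "hom_space A x y"
    using assms(1,2) by (rule hom_vector_space)
  have c: "a \<in> carrier (hom_space A x y)" "b \<in> carrier (hom_space A x y)" "c \<in> carrier (hom_space A x y)"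
    using assms by simp_all
  have "a \<ominus>\<^bsub>hom_space A x y\<^esub> c = (a \<ominus>\<^bsub>hom_space A x y\<^esub> b) \<oplus>\<^bsub>hom_space A x y\<^esub> (b \<ominus>\<^bsub>hom_space A x y\<^esub> c)"
    using c M.r_neg1[of b "\<ominus>\<^bsub>hom_space A x y\<^esub> c"] M.r_neg2[of b "\<ominus>\<^bsub>hom_space A x y\<^esub> c"]
    by (simp add: M.minus_eq M.a_assoc del: hom_space_simps)
  then show "Diff A x y a c = Add A x y (Diff A x y a b) (Diff A x y b c)" by simp
  have "a \<ominus>\<^bsub>hom_space A x y\<^esub> b = \<ominus>\<^bsub>hom_space A x y\<^esub> (b \<ominus>\<^bsub>hom_space A x y\<^esub> a)"
    using c by (simp add: M.minus_eq M.minus_add M.a_comm del: hom_space_simps)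
  also have "\<dots> = Scale A x y (- 1) (b \<ominus>\<^bsub>hom_space A x y\<^esub> a)"
    using assms by (intro hom_space_inverse diff_closed)
  finally show "Diff A x y a b = Scale A x y (- 1) (Diff A x y b a)" .
  have "a = (a \<ominus>\<^bsub>hom_space A x y\<^esub> b) \<oplus>\<^bsub>hom_space A x y\<^esub> b"
    using c by (simp add: M.minus_eq M.a_assoc M.l_neg del: hom_space_simps)
  then show "a = Add A x y (Diff A x y a b) b" by simp
qed

lemma norm_diff_sym:
  assumes "x \<in> Ob A" "y \<in> Ob A" "a \<in> Hom A x y" "b \<in> Hom A x y"
  shows "Norm A x y (Diff A x y a b) = Norm A x y (Diff A x y b a)"
proof -
  have "Norm A x y (Scale A x y (- 1) (Diff A x y b a)) = Norm A x y (Diff A x y b a)"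
    using norm_scale[OF assms(1,2) diff_closed[OF assms(1,2,4,3)] real_scalar(3)] by simp
  then show ?thesis
    using diff_split(2)[OF assms assms(3)] by simp
qed

lemma norm_diff_triangle:
  assumes "x \<in> Ob A" "y \<in> Ob A" "a \<in> Hom A x y" "b \<in> Hom A x y" "c \<in> Hom A x y"
  shows "Norm A x y (Diff A x y a c) \<le> Norm A x y (Diff A x y a b) + Norm A x y (Diff A x y b c)"
  using norm_triangle[OF assms(1,2) diff_closed[OF assms(1-4)] diff_closed[OF assms(1,2,4,5)]]
    diff_split(1)[OF assms] by simp

lemma norm_le_diff:
  assumes "x \<in> Ob A" "y \<in> Ob A" "a \<in> Hom A x y" "b \<in> Hom A x y"
  shows "Norm A x y a \<le> Norm A x y (Diff A x y a b) + Norm A x y b"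
  using norm_triangle[OF assms(1,2) diff_closed[OF assms] assms(4)] diff_split(3)[OF assms assms(3)] by simp

lemma norm_diff_eq_zero:
  assumes "x \<in> Ob A" "y \<in> Ob A" "a \<in> Hom A x y" "b \<in> Hom A x y"
  shows "Norm A x y (Diff A x y a b) = 0 \<longleftrightarrow> a = b"
  using norm_eq_zero[OF assms(1,2) diff_closed[OF assms]] diff_eq_zero_iff[OF assms] by simp

lemma limit_bound:
  assumes "x \<in> Ob A" "y \<in> Ob A" "a \<in> Hom A x y" "\<And>n. s n \<in> Hom A x y" "l \<in> Hom A x y"
    and lim: "(\<lambda>n. Norm A x y (Diff A x y (s n) l)) \<longlonglongrightarrow> 0"
    and bd: "\<And>n. n \<ge> N \<Longrightarrow> Norm A x y (Diff A x y a (s n)) \<le> e"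
  shows "Norm A x y (Diff A x y a l) \<le> e"
proof -
  have "(\<lambda>n. e + Norm A x y (Diff A x y (s n) l)) \<longlonglongrightarrow> e + 0"
    by (intro tendsto_intros lim)
  moreover have "Norm A x y (Diff A x y a l) \<le> e + Norm A x y (Diff A x y (s n) l)" if "n \<ge> N" for n
    using norm_diff_triangle[OF assms(1-3) assms(4)[of n] assms(5)] bd[OF that] by simp
  ultimately show ?thesis
    using LIMSEQ_le_const[of "\<lambda>n. e + Norm A x y (Diff A x y (s n) l)" "e + 0" "Norm A x y (Diff A x y a l)"] by auto
qed

lemma limit_unique:
  assumes "x \<in> Ob A" "y \<in> Ob A" "\<And>n. s n \<in> Hom A x y" "l \<in> Hom A x y" "l' \<in> Hom A x y"
    and lim: "(\<lambda>n. Norm A x y (Diff A x y (s n) l)) \<longlonglongrightarrow> 0" "(\<lambda>n. Norm A x y (Diff A x y (s n) l')) \<longlonglongrightarrow> 0"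
  shows "l = l'"
proof -
  have "(\<lambda>n. Norm A x y (Diff A x y (s n) l) + Norm A x y (Diff A x y (s n) l')) \<longlonglongrightarrow> 0 + 0"
    by (intro tendsto_intros lim)
  moreover have "Norm A x y (Diff A x y l l') \<le> Norm A x y (Diff A x y (s n) l) + Norm A x y (Diff A x y (s n) l')" for n
    using norm_diff_triangle[OF assms(1,2,4) assms(3)[of n] assms(5)] norm_diff_sym[OF assms(1,2) assms(3)[of n] assms(4)] by simp
  ultimately have "Norm A x y (Diff A x y l l') \<le> 0 + 0"
    by (intro LIMSEQ_le_const[of _ "0 + 0"]) auto
  then show ?thesis
    using norm_nonneg[OF assms(1,2) diff_closed[OF assms(1,2,4,5)]] norm_diff_eq_zero[OF assms(1,2,4,5)] by simp
qed

lemma norm_star: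
  assumes "x \<in> Ob A" "y \<in> Ob A" "a \<in> Hom A x y"
  shows "Norm A y x (Star A x y a) = Norm A x y a"
proof -
  have le: "Norm A x y b \<le> Norm A y x (Star A x y b)" if "x \<in> Ob A" "y \<in> Ob A" "b \<in> Hom A x y" for x y b
  proof (cases "Norm A x y b = 0")
    case True
    then show ?thesis using norm_nonneg[OF that(2,1) star_closed[OF that]] by simp
  next
    case False
    then have pos: "0 < Norm A x y b" using norm_nonneg[OF that] by simp
    have "Norm A x y b * Norm A x y b \<le> Norm A y x (Star A x y b) * Norm A x y b"
      using cstar_identity[OF that] norm_comp[OF that(1,2,1) that(3) star_closed[OF that]]
      by (simp add: power2_eq_square)
    then show ?thesis using pos by simp
  qed
  show ?thesis
    using le[OF assms] le[OF assms(2,1) star_closed[OF assms]] star_star[OF assms] by simp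
qed

lemma norm_completeD:
  assumes "x \<in> Ob A" "y \<in> Ob A" "\<And>n. s n \<in> Hom A x y"
    and "\<And>e. e > 0 \<Longrightarrow> \<exists>N. \<forall>m\<ge>N. \<forall>n\<ge>N. Norm A x y (Diff A x y (s m) (s n)) < e"
  shows "\<exists>l\<in>Hom A x y. (\<lambda>n. Norm A x y (Diff A x y (s n) l)) \<longlonglongrightarrow> 0"
  using complete[OF assms(1,2)] assms(3,4) unfolding norm_complete_def by blast

end

lemma Cstar_category_overI:
  "F = \<real> \<or> F = UNIV \<Longrightarrow> Cstar_category F A \<Longrightarrow> Cstar_category_over F A"
  by (intro Cstar_category_over.intro Cstar_category_over_axioms.intro)

text \<open>The functors are jointly faithful and the norm of \<open>Q\<close> is the supremum of
  the norms of the images (\<open>ge\<close> and \<open>le\<close>), so equations and norm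
  inequalities may be checked in the \<open>B i\<close>; only closure and completeness have to be
  supplied. Zero is treated by a hypothesis of its own, and \<open>complete\<close> is phrased with
  \<open>Add\<close> and \<open>Scale\<close>, because preservation of zero and the rule for
  \<open>Diff\<close> become available only when \<open>Q\<close> is known to be an
  F-category.\<close>

lemma Cstar_categoryI_faithful:
  fixes Q :: "('o, 'a) normed_star_cat" and B :: "'i \<Rightarrow> ('p, 'b) normed_star_cat"
  assumes F: "F = \<real> \<or> F = UNIV"
    and B: "\<And>i. i \<in> I \<Longrightarrow> Cstar_category F (B i)"
    and unit: "\<And>x. x \<in> Ob Q \<Longrightarrow> Unit Q x \<in> Hom Q x x"
    and comp: "\<And>x y z a b. \<lbrakk>x \<in> Ob Q; y \<in> Ob Q; z \<in> Ob Q; a \<in> Hom Q x y; b \<in> Hom Q y z\<rbrakk> \<Longrightarrow>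
      Comp Q x y z b a \<in> Hom Q x z"
    and zero: "\<And>x y. \<lbrakk>x \<in> Ob Q; y \<in> Ob Q\<rbrakk> \<Longrightarrow> Zero Q x y \<in> Hom Q x y"
    and add: "\<And>x y a b. \<lbrakk>x \<in> Ob Q; y \<in> Ob Q; a \<in> Hom Q x y; b \<in> Hom Q x y\<rbrakk> \<Longrightarrow> Add Q x y a b \<in> Hom Q x y"
    and scale: "\<And>x y t a. \<lbrakk>x \<in> Ob Q; y \<in> Ob Q; a \<in> Hom Q x y; t \<in> F\<rbrakk> \<Longrightarrow> Scale Q x y t a \<in> Hom Q x y"
    and star: "\<And>x y a. \<lbrakk>x \<in> Ob Q; y \<in> Ob Q; a \<in> Hom Q x y\<rbrakk> \<Longrightarrow> Star Q x y a \<in> Hom Q y x"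
    and func: "\<And>i. i \<in> I \<Longrightarrow> star_functor F Q (B i) (f i) (\<phi> i)"
    and map_zero: "\<And>i x y. \<lbrakk>i \<in> I; x \<in> Ob Q; y \<in> Ob Q\<rbrakk> \<Longrightarrow> \<phi> i x y (Zero Q x y) = Zero (B i) (f i x) (f i y)"
    and inj: "\<And>x y a b. \<lbrakk>x \<in> Ob Q; y \<in> Ob Q; a \<in> Hom Q x y; b \<in> Hom Q x y; \<And>i. i \<in> I \<Longrightarrow> \<phi> i x y a = \<phi> i x y b\<rbrakk>
      \<Longrightarrow> a = b"
    and nonneg: "\<And>x y a. \<lbrakk>x \<in> Ob Q; y \<in> Ob Q; a \<in> Hom Q x y\<rbrakk> \<Longrightarrow> 0 \<le> Norm Q x y a"
    and ge: "\<And>i x y a. \<lbrakk>i \<in> I; x \<in> Ob Q; y \<in> Ob Q; a \<in> Hom Q x y\<rbrakk> \<Longrightarrow>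
      Norm (B i) (f i x) (f i y) (\<phi> i x y a) \<le> Norm Q x y a"
    and le: "\<And>x y a r. \<lbrakk>x \<in> Ob Q; y \<in> Ob Q; a \<in> Hom Q x y; 0 \<le> r;
        \<And>i. i \<in> I \<Longrightarrow> Norm (B i) (f i x) (f i y) (\<phi> i x y a) \<le> r\<rbrakk> \<Longrightarrow> Norm Q x y a \<le> r"
    and complete: "\<And>x y s. \<lbrakk>x \<in> Ob Q; y \<in> Ob Q; \<And>n::nat. s n \<in> Hom Q x y;
        \<And>e. e > 0 \<Longrightarrow> \<exists>N. \<forall>m\<ge>N. \<forall>n\<ge>N. Norm Q x y (Add Q x y (s m) (Scale Q x y (- 1) (s n))) < e\<rbrakk> \<Longrightarrow>
      \<exists>l\<in>Hom Q x y. (\<lambda>n. Norm Q x y (Add Q x y (s n) (Scale Q x y (- 1) l))) \<longlonglongrightarrow> 0"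
  shows "Cstar_category F Q"
proof -
  have BO: "Cstar_category_over F (B i)" if "i \<in> I" for i
    using F B[OF that] by (rule Cstar_category_overI)
  have BS: "star_category F (B i)" and BF: "F_category F (B i)" and BP: "pre_Cstar_category F (B i)" if "i \<in> I" for i
  proof -
    interpret Cstar_category_over F "B i" using BO[OF that] .
    show "star_category F (B i)" "F_category F (B i)" "pre_Cstar_category F (B i)"
      by unfold_locales
  qed
  have neg: "- 1 \<in> F" "0 \<in> F" "1 \<in> F" using F by auto
  have scal_closed: "t + u \<in> F" "t * u \<in> F" if "t \<in> F" "u \<in> F" for t u
    using F that by auto
  note closed = unit comp zero add scale star neg scal_closed
  note maps = star_functor.map_unit[OF func] star_functor.map_comp[OF func] star_functor.map_add[OF func]
    star_functor.map_scale[OF func] star_functor.map_star[OF func] star_functor.ob_closed[OF func]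
    star_functor.hom_closed[OF func] map_zero
  note Bclosed = F_category.unit_closed[OF BF] F_category.comp_closed[OF BF] F_category.zero_closed[OF BF]
    F_category.add_closed[OF BF] F_category.scale_closed[OF BF] star_category.star_closed[OF BS]
  note Brules = F_category.comp_assoc[OF BF] F_category.comp_unit_left[OF BF] F_category.comp_unit_right[OF BF]
    F_category.comp_add_left[OF BF] F_category.comp_add_right[OF BF] F_category.comp_scale_left[OF BF]
    F_category.comp_scale_right[OF BF] F_category.add_assoc[OF BF] F_category.add_zero_left[OF BF]
    F_category.scale_add_left[OF BF] F_category.scale_add_right[OF BF]
    F_category.scale_scale[OF BF] F_category.scale_one[OF BF] F_category.add_neg[OF BF]
    star_category.star_add[OF BS] star_category.star_scale[OF BS] star_category.star_comp[OF BS]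
    star_category.star_star[OF BS]
  note all = closed maps Bclosed Brules
  have module: "module (scalar_ring F) (hom_space Q x y)" if xy: "x \<in> Ob Q" "y \<in> Ob Q" for x y
  proof (rule hom_spaceI[OF F])
    show "Add Q x y a b = Add Q x y b a" if "a \<in> Hom Q x y" "b \<in> Hom Q x y" for a b
    proof (rule inj[OF xy])
      fix i assume i: "i \<in> I"
      then show "\<phi> i x y (Add Q x y a b) = \<phi> i x y (Add Q x y b a)"
        using F_category.add_commute[OF BF[OF i], of "f i x" "f i y"] xy that by (simp add: all)
    qed (simp_all add: xy that closed)
  qed (((simp add: closed xy; fail) | (rule inj[OF xy]; simp add: all xy; fail))+)
  have star_cat: "star_category F Q"
  proof (intro star_category.intro F_category.intro star_category_axioms.intro module)
    fix x y a assume x: "x \<in> Ob Q" and y: "y \<in> Ob Q" and a: "a \<in> Hom Q x y"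
    show "Comp Q x x y a (Unit Q x) = a" "Comp Q x y y (Unit Q y) a = a"
      by (rule inj[OF x y]; simp add: all x y a)+
    show "Star Q y x (Star Q x y a) = a"
      by (rule inj[OF x y]; simp add: all x y a)
    show "Star Q x y (Scale Q x y t a) = Scale Q y x (cnj t) (Star Q x y a)" if t: "t \<in> F" for t
    proof -
      have "cnj t \<in> F" using F t by (auto simp: Reals_cnj_iff)
      then show ?thesis by (intro inj[OF y x]; simp add: all x y a t)
    qed
    show "Star Q x y (Add Q x y a b) = Add Q y x (Star Q x y a) (Star Q x y b)" if "b \<in> Hom Q x y" for b
      by (rule inj[OF y x]; simp add: all x y a that)
    fix z b assume z: "z \<in> Ob Q" and b: "b \<in> Hom Q y z"
    show "Comp Q x y z b (Add Q x y a a') = Add Q x z (Comp Q x y z b a) (Comp Q x y z b a')"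
      if "a' \<in> Hom Q x y" for a'
      by (rule inj[OF x z]; simp add: all x y z a b that)
    show "Comp Q x y z (Add Q y z b b') a = Add Q x z (Comp Q x y z b a) (Comp Q x y z b' a)"
      if "b' \<in> Hom Q y z" for b'
      by (rule inj[OF x z]; simp add: all x y z a b that)
    show "Comp Q x y z b (Scale Q x y t a) = Scale Q x z t (Comp Q x y z b a)"
      "Comp Q x y z (Scale Q y z t b) a = Scale Q x z t (Comp Q x y z b a)" if "t \<in> F" for t
      by (rule inj[OF x z]; simp add: all x y z a b that)+
    show "Star Q x z (Comp Q x y z b a) = Comp Q z y x (Star Q x y a) (Star Q y z b)"
      by (rule inj[OF z x]; simp add: all x y z a b)
    show "Comp Q x y w (Comp Q y z w c b) a = Comp Q x z w c (Comp Q x y z b a)"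
      if "w \<in> Ob Q" "c \<in> Hom Q z w" for w c
      by (rule inj[OF x that(1)]; simp add: all x y z a b that)
  qed (simp_all add: closed)
  interpret Q: star_category F Q by (rule star_cat)
  have ge': "Norm (B i) (f i x) (f i y) (\<phi> i x y a) \<le> Norm Q x y a"
    and B0: "0 \<le> Norm (B i) (f i x) (f i y) (\<phi> i x y a)"
    if "i \<in> I" "x \<in> Ob Q" "y \<in> Ob Q" "a \<in> Hom Q x y" for i x y a
    using ge[OF that] pre_Cstar_category.norm_nonneg[OF BP[OF that(1)]] that by (simp_all add: all)
  \<comment> \<open>Half of homogeneity; the other half follows below by applying this to the scalar
    \<open>1 / t\<close>.\<close>
  have norm_scale_le: "Norm Q x y (Scale Q x y t a) \<le> cmod t * Norm Q x y a"
    if "x \<in> Ob Q" "y \<in> Ob Q" "a \<in> Hom Q x y" "t \<in> F" for x y a t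
    using that by (intro le) (auto simp: all nonneg pre_Cstar_category.norm_scale[OF BP] intro: mult_left_mono ge)
  have Qpre: "pre_Cstar_category F Q"
  proof (unfold_locales)
    show "F = \<real> \<or> F = UNIV" by (rule F)
    fix x y a assume x: "x \<in> Ob Q" and y: "y \<in> Ob Q"
    show "norm_complete Q x y"
      unfolding norm_complete_def
    proof (intro allI impI)
      fix s :: "nat \<Rightarrow> 'a"
      assume s: "range s \<subseteq> Hom Q x y \<and>
        (\<forall>e>0. \<exists>N. \<forall>m\<ge>N. \<forall>n\<ge>N. Norm Q x y (Diff Q x y (s m) (s n)) < e)"
      then have sn: "s n \<in> Hom Q x y" for n by blast
      have "\<exists>N. \<forall>m\<ge>N. \<forall>n\<ge>N. Norm Q x y (Add Q x y (s m) (Scale Q x y (- 1) (s n))) < e" if "e > 0" for e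
        using s that by (simp add: Q.Diff_eq[OF x y sn])
      then obtain l where "l \<in> Hom Q x y" "(\<lambda>n. Norm Q x y (Add Q x y (s n) (Scale Q x y (- 1) l))) \<longlonglongrightarrow> 0"
        using complete[of x y s] x y sn by blast
      then show "\<exists>l\<in>Hom Q x y. (\<lambda>n. Norm Q x y (Diff Q x y (s n) l)) \<longlonglongrightarrow> 0"
        by (auto simp: Q.Diff_eq[OF x y])
    qed
    assume a: "a \<in> Hom Q x y"
    show "0 \<le> Norm Q x y a" using nonneg[OF x y a] .
    show "Norm Q x y a = 0 \<longleftrightarrow> a = Zero Q x y"
    proof
      assume 0: "Norm Q x y a = 0"
      show "a = Zero Q x y"
      proof (rule inj[OF x y a zero[OF x y]])
        fix i assume i: "i \<in> I"
        have "Norm (B i) (f i x) (f i y) (\<phi> i x y a) = 0"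
          using ge'[OF i x y a] B0[OF i x y a] 0 by simp
        then show "\<phi> i x y a = \<phi> i x y (Zero Q x y)"
          using pre_Cstar_category.norm_eq_zero[OF BP[OF i], of "f i x" "f i y" "\<phi> i x y a"] i x y a
          by (simp add: all)
      qed
    next
      assume 0: "a = Zero Q x y"
      have "Norm (B i) (f i x) (f i y) (\<phi> i x y a) \<le> 0" if i: "i \<in> I" for i
        using pre_Cstar_category.norm_eq_zero[OF BP[OF i], of "f i x" "f i y" "\<phi> i x y a"] i x y
        by (simp add: 0 all)
      then have "Norm Q x y a \<le> 0"
        using x y a by (intro le) auto
      then show "Norm Q x y a = 0"
        using nonneg[OF x y a] by simp
    qed
    show "Norm Q x y (Add Q x y a b) \<le> Norm Q x y a + Norm Q x y b" if b: "b \<in> Hom Q x y" for b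
    proof (rule le[OF x y add[OF x y a b]])
      show "0 \<le> Norm Q x y a + Norm Q x y b" using nonneg x y a b by simp
      fix i assume i: "i \<in> I"
      show "Norm (B i) (f i x) (f i y) (\<phi> i x y (Add Q x y a b)) \<le> Norm Q x y a + Norm Q x y b"
        using pre_Cstar_category.norm_triangle[OF BP[OF i], of "f i x" "f i y" "\<phi> i x y a" "\<phi> i x y b"]
          ge[OF i x y a] ge[OF i x y b] i x y a b by (simp add: all)
    qed
    show "Norm Q x y (Scale Q x y t a) = cmod t * Norm Q x y a" if t: "t \<in> F" for t
    proof (cases "t = 0")
      case True
      have "Norm Q x y (Scale Q x y t a) \<le> 0"
        using norm_scale_le[OF x y a t] True by simp
      then show ?thesis
        using nonneg[OF x y scale[OF x y a t]] True by simp
    next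
      case False
      have it: "1 / t \<in> F" using t F by auto
      have "Scale Q x y (1 / t) (Scale Q x y t a) = a"
        using False x y a t it by (simp add: Q.scale_scale Q.scale_one)
      then have "Norm Q x y a \<le> cmod (1 / t) * Norm Q x y (Scale Q x y t a)"
        using norm_scale_le[OF x y scale[OF x y a t] it] by simp
      then have "cmod t * Norm Q x y a \<le> Norm Q x y (Scale Q x y t a)"
        using False by (simp add: norm_divide field_simps)
      then show ?thesis
        using norm_scale_le[OF x y a t] by simp
    qed
    show "Norm Q x z (Comp Q x y z b a) \<le> Norm Q y z b * Norm Q x y a"
      if z: "z \<in> Ob Q" and b: "b \<in> Hom Q y z" for z b
    proof (rule le[OF x z comp[OF x y z a b]])
      show "0 \<le> Norm Q y z b * Norm Q x y a" using nonneg x y z a b by simp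
      fix i assume i: "i \<in> I"
      have "Norm (B i) (f i x) (f i z) (\<phi> i x z (Comp Q x y z b a)) \<le>
          Norm (B i) (f i y) (f i z) (\<phi> i y z b) * Norm (B i) (f i x) (f i y) (\<phi> i x y a)"
        using pre_Cstar_category.norm_comp[OF BP[OF i]] i x y z a b by (simp add: all)
      also have "\<dots> \<le> Norm Q y z b * Norm Q x y a"
        using ge B0 i x y z a b nonneg by (intro mult_mono) auto
      finally show "Norm (B i) (f i x) (f i z) (\<phi> i x z (Comp Q x y z b a)) \<le> Norm Q y z b * Norm Q x y a" .
    qed
    have sa: "Comp Q x y x (Star Q x y a) a \<in> Hom Q x x" using x y a by (intro comp star)
    have eq: "Norm (B i) (f i x) (f i x) (\<phi> i x x (Comp Q x y x (Star Q x y a) a)) =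
        (Norm (B i) (f i x) (f i y) (\<phi> i x y a))\<^sup>2" if i: "i \<in> I" for i
      using pre_Cstar_category.cstar_identity[OF BP[OF i]] i x y a by (simp add: all)
    show "Norm Q x x (Comp Q x y x (Star Q x y a) a) = (Norm Q x y a)\<^sup>2"
    proof (rule antisym)
      show "Norm Q x x (Comp Q x y x (Star Q x y a) a) \<le> (Norm Q x y a)\<^sup>2"
        using ge B0 x y a by (intro le[OF x x sa]) (auto simp: eq intro: power_mono)
      \<comment> \<open>The supremum property bounds \<open>a\<close> itself and not its square,
        hence the C*-identity in a form with a root.\<close>
      have "Norm Q x y a \<le> sqrt (Norm Q x x (Comp Q x y x (Star Q x y a) a))"
      proof (rule le[OF x y a])
        show "0 \<le> sqrt (Norm Q x x (Comp Q x y x (Star Q x y a) a))" using nonneg[OF x x sa] by simp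
        fix i assume i: "i \<in> I"
        show "Norm (B i) (f i x) (f i y) (\<phi> i x y a) \<le> sqrt (Norm Q x x (Comp Q x y x (Star Q x y a) a))"
          using ge[OF i x x sa] unfolding eq[OF i] by (rule real_le_rsqrt)
      qed
      then have "(Norm Q x y a)\<^sup>2 \<le> (sqrt (Norm Q x x (Comp Q x y x (Star Q x y a) a)))\<^sup>2"
        using nonneg[OF x y a] by (rule power_mono)
      then show "(Norm Q x y a)\<^sup>2 \<le> Norm Q x x (Comp Q x y x (Star Q x y a) a)"
        using nonneg[OF x x sa] by simp
    qed
  qed
  interpret Q: pre_Cstar_category F Q by (rule Qpre)
  show ?thesis
  proof (rule Q.Cstar_categoryI_norm)
    fix x y a assume x: "x \<in> Ob Q" and y: "y \<in> Ob Q" and a: "a \<in> Hom Q x y"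
    have sa: "Comp Q x y x (Star Q x y a) a \<in> Hom Q x x" using x y a by (intro comp star)
    let ?u = "(Norm Q x y a)\<^sup>2"
    show "Norm Q x x (Diff Q x x (Q.scal x ?u) (Comp Q x y x (Star Q x y a) a)) \<le> ?u"
    proof (rule le[OF x x Q.diff_closed[OF x x Q.scal_closed[OF x] sa]])
      fix i assume i: "i \<in> I"
      interpret Bi: Cstar_category_over F "B i" using BO[OF i] .
      \<comment> \<open>The norm in \<open>Q\<close> dominates that of each component, and
        \<open>norm_positivity\<close> accepts any such upper bound.\<close>
      have u: "(Norm (B i) (f i x) (f i y) (\<phi> i x y a))\<^sup>2 \<le> ?u"
        using ge[OF i x y a] B0[OF i x y a] by (rule power_mono)
      have "Norm (B i) (f i x) (f i x) (Diff (B i) (f i x) (f i x) (Bi.scal (f i x) ?u)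
          (Comp (B i) (f i x) (f i y) (f i x) (Star (B i) (f i x) (f i y) (\<phi> i x y a)) (\<phi> i x y a))) \<le> ?u"
        using i x y a u by (intro Bi.norm_positivity) (auto simp: maps)
      also have "Diff (B i) (f i x) (f i x) (Bi.scal (f i x) ?u)
          (Comp (B i) (f i x) (f i y) (f i x) (Star (B i) (f i x) (f i y) (\<phi> i x y a)) (\<phi> i x y a)) =
          \<phi> i x x (Diff Q x x (Q.scal x ?u) (Comp Q x y x (Star Q x y a) a))"
        using star_functor.map_diff[OF func[OF i] Q.F_category_axioms BF[OF i] x x Q.scal_closed[OF x, of ?u] sa]
          i x y a Q.real_scalar(1)[of ?u]
        by (simp only: star_functor.map_comp[OF func] star_functor.map_scale[OF func] star_functor.map_star[OF func]
            star_functor.map_unit[OF func] star unit)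
      finally show "Norm (B i) (f i x) (f i x) (\<phi> i x x (Diff Q x x (Q.scal x ?u) (Comp Q x y x (Star Q x y a) a))) \<le> ?u" .
    qed simp
  qed
qed


lemma Cstar_pre:
  assumes "F = \<real> \<or> F = UNIV" "Cstar_category F A"
  shows "pre_Cstar_category F A"
proof -
  interpret Cstar_category_over F A using assms by (rule Cstar_category_overI)
  show ?thesis by unfold_locales
qed

subsection \<open>Full subcategories along a map of objects\<close>

text \<open>\<open>g\<close> need not be injective: objects with the same image under
  \<open>g\<close> become unitarily isomorphic copies. Both factorizations have a middle object of
  this form.\<close>

definition pull_cat ::
    "('o, 'a) normed_star_cat \<Rightarrow> 'p set \<Rightarrow> ('p \<Rightarrow> 'o) \<Rightarrow> ('p, 'a) normed_star_cat" where
  "pull_cat A P g = \<lparr>Ob = P, Hom = (\<lambda>x y. Hom A (g x) (g y)), Unit = (\<lambda>x. Unit A (g x)),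
     Comp = (\<lambda>x y z. Comp A (g x) (g y) (g z)), Zero = (\<lambda>x y. Zero A (g x) (g y)),
     Add = (\<lambda>x y. Add A (g x) (g y)), Scale = (\<lambda>x y. Scale A (g x) (g y)),
     Star = (\<lambda>x y. Star A (g x) (g y)), Norm = (\<lambda>x y. Norm A (g x) (g y))\<rparr>"

lemma pull_cat_simps [simp]:
  "Ob (pull_cat A P g) = P" "Hom (pull_cat A P g) x y = Hom A (g x) (g y)"
  "Unit (pull_cat A P g) x = Unit A (g x)"
  "Comp (pull_cat A P g) x y z = Comp A (g x) (g y) (g z)"
  "Zero (pull_cat A P g) x y = Zero A (g x) (g y)" "Add (pull_cat A P g) x y = Add A (g x) (g y)"
  "Scale (pull_cat A P g) x y = Scale A (g x) (g y)" "Star (pull_cat A P g) x y = Star A (g x) (g y)"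
  "Norm (pull_cat A P g) x y = Norm A (g x) (g y)"
  by (simp_all add: pull_cat_def)

lemma pull_cat_functor:
  assumes "g ` P \<subseteq> Ob A"
  shows "star_functor F (pull_cat A P g) A g (\<lambda>x y. id)"
  using assms by unfold_locales auto

text \<open>One isometric faithful functor with norm-closed image. Completeness is inherited because
  a Cauchy sequence converges in \<open>A\<close> and its limit has a preimage.\<close>

lemma Cstar_single_faithful:
  assumes F: "F = \<real> \<or> F = UNIV" and A: "Cstar_category F A"
    and closed: "\<And>x. x \<in> Ob Q \<Longrightarrow> Unit Q x \<in> Hom Q x x"
      "\<And>x y z a b. \<lbrakk>x \<in> Ob Q; y \<in> Ob Q; z \<in> Ob Q; a \<in> Hom Q x y; b \<in> Hom Q y z\<rbrakk> \<Longrightarrow> Comp Q x y z b a \<in> Hom Q x z"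
      "\<And>x y. \<lbrakk>x \<in> Ob Q; y \<in> Ob Q\<rbrakk> \<Longrightarrow> Zero Q x y \<in> Hom Q x y"
      "\<And>x y a b. \<lbrakk>x \<in> Ob Q; y \<in> Ob Q; a \<in> Hom Q x y; b \<in> Hom Q x y\<rbrakk> \<Longrightarrow> Add Q x y a b \<in> Hom Q x y"
      "\<And>x y t a. \<lbrakk>x \<in> Ob Q; y \<in> Ob Q; a \<in> Hom Q x y; t \<in> F\<rbrakk> \<Longrightarrow> Scale Q x y t a \<in> Hom Q x y"
      "\<And>x y a. \<lbrakk>x \<in> Ob Q; y \<in> Ob Q; a \<in> Hom Q x y\<rbrakk> \<Longrightarrow> Star Q x y a \<in> Hom Q y x"
    and func: "star_functor F Q A f \<phi>"
    and zero: "\<And>x y. \<lbrakk>x \<in> Ob Q; y \<in> Ob Q\<rbrakk> \<Longrightarrow> \<phi> x y (Zero Q x y) = Zero A (f x) (f y)"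
    and inj: "\<And>x y. \<lbrakk>x \<in> Ob Q; y \<in> Ob Q\<rbrakk> \<Longrightarrow> inj_on (\<phi> x y) (Hom Q x y)"
    and norm: "\<And>x y a. \<lbrakk>x \<in> Ob Q; y \<in> Ob Q; a \<in> Hom Q x y\<rbrakk> \<Longrightarrow> Norm Q x y a = Norm A (f x) (f y) (\<phi> x y a)"
    and limit: "\<And>x y s l. \<lbrakk>x \<in> Ob Q; y \<in> Ob Q; \<And>n::nat. s n \<in> Hom Q x y; l \<in> Hom A (f x) (f y);
      (\<lambda>n. Norm A (f x) (f y) (Diff A (f x) (f y) (\<phi> x y (s n)) l)) \<longlonglongrightarrow> 0\<rbrakk> \<Longrightarrow> l \<in> \<phi> x y ` Hom Q x y"
  shows "Cstar_category F Q"
proof -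
  interpret A: pre_Cstar_category F A using F A by (rule Cstar_pre)
  interpret func: star_functor F Q A f \<phi> by (rule func)
  have neg: "- 1 \<in> F" using F by auto
  have diff: "Norm Q x y (Add Q x y a (Scale Q x y (- 1) b)) = Norm A (f x) (f y) (Diff A (f x) (f y) (\<phi> x y a) (\<phi> x y b))"
    if "x \<in> Ob Q" "y \<in> Ob Q" "a \<in> Hom Q x y" "b \<in> Hom Q x y" for x y a b
    using that neg by (simp add: norm closed func.map_add func.map_scale A.Diff_eq func.ob_closed func.hom_closed)
  show ?thesis
  proof (rule Cstar_categoryI_faithful[where I = "{()}" and B = "\<lambda>_. A" and f = "\<lambda>_. f" and \<phi> = "\<lambda>_. \<phi>"])
    fix x y and s :: "nat \<Rightarrow> 'd"
    assume x: "x \<in> Ob Q" and y: "y \<in> Ob Q" and s: "\<And>n. s n \<in> Hom Q x y"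
      and cauchy: "\<And>e. e > 0 \<Longrightarrow> \<exists>N. \<forall>m\<ge>N. \<forall>n\<ge>N. Norm Q x y (Add Q x y (s m) (Scale Q x y (- 1) (s n))) < e"
    obtain l where l: "l \<in> Hom A (f x) (f y)"
      "(\<lambda>n. Norm A (f x) (f y) (Diff A (f x) (f y) (\<phi> x y (s n)) l)) \<longlonglongrightarrow> 0"
      using A.norm_completeD[of "f x" "f y" "\<lambda>n. \<phi> x y (s n)"] cauchy x y s
      by (auto simp: diff func.ob_closed func.hom_closed)
    then obtain k where "k \<in> Hom Q x y" "l = \<phi> x y k"
      using limit[of x y s l] x y s by blast
    then show "\<exists>l\<in>Hom Q x y. (\<lambda>n. Norm Q x y (Add Q x y (s n) (Scale Q x y (- 1) l))) \<longlonglongrightarrow> 0"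
      using l(2) x y s by (intro bexI[of _ k]) (auto simp: diff)
  next
    show "0 \<le> Norm Q x y a" if "x \<in> Ob Q" "y \<in> Ob Q" "a \<in> Hom Q x y" for x y a
      using that by (simp add: norm A.norm_nonneg func.ob_closed func.hom_closed)
  next
    fix x y a b assume "x \<in> Ob Q" "y \<in> Ob Q" "a \<in> Hom Q x y" "b \<in> Hom Q x y"
      and "\<And>i. i \<in> {()} \<Longrightarrow> \<phi> x y a = \<phi> x y b"
    then show "a = b" using inj_onD[OF inj] by blast
  qed (simp_all add: F A closed func zero norm)
qed

lemma pull_cat_Cstar:
  assumes F: "F = \<real> \<or> F = UNIV" and A: "Cstar_category F A" and g: "g ` P \<subseteq> Ob A"
  shows "Cstar_category F (pull_cat A P g)"
proof -
  interpret A: pre_Cstar_category F A using F A by (rule Cstar_pre)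
  have "g x \<in> Ob A" if "x \<in> P" for x using g that by blast
  then show ?thesis
    by (intro Cstar_single_faithful[OF F A _ _ _ _ _ _ pull_cat_functor[OF g]])
      (use g in \<open>auto simp: A.unit_closed A.comp_closed A.zero_closed A.add_closed A.scale_closed A.star_closed\<close>)
qed

subsection \<open>Relabelling arrows\<close>

text \<open>Arrows of products are functions; this renaming brings them back to the arrow type of
  \<open>C1star_cat\<close>. It is chosen separately on each hom set, so arrows of different hom
  sets may receive the same name.\<close>

definition relabel_homs ::
    "('o, 'a) normed_star_cat \<Rightarrow> ('o \<Rightarrow> 'o \<Rightarrow> 'a \<Rightarrow> 'b) \<Rightarrow> ('o, 'b) normed_star_cat" where
  "relabel_homs A e = (let d = (\<lambda>x y. inv_into (Hom A x y) (e x y)) in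
     \<lparr>Ob = Ob A, Hom = (\<lambda>x y. e x y ` Hom A x y), Unit = (\<lambda>x. e x x (Unit A x)),
     Comp = (\<lambda>x y z b a. e x z (Comp A x y z (d y z b) (d x y a))), Zero = (\<lambda>x y. e x y (Zero A x y)),
     Add = (\<lambda>x y a b. e x y (Add A x y (d x y a) (d x y b))),
     Scale = (\<lambda>x y t a. e x y (Scale A x y t (d x y a))),
     Star = (\<lambda>x y a. e y x (Star A x y (d x y a))), Norm = (\<lambda>x y a. Norm A x y (d x y a))\<rparr>)"

lemma relabel_homs_simps [simp]:
  "Ob (relabel_homs A e) = Ob A" "Hom (relabel_homs A e) x y = e x y ` Hom A x y"
  by (simp_all add: relabel_homs_def)

context
  fixes F :: "complex set" and A :: "('o, 'a) normed_star_cat" and e :: "'o \<Rightarrow> 'o \<Rightarrow> 'a \<Rightarrow> 'b"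
  assumes F: "F = \<real> \<or> F = UNIV" and A: "Cstar_category F A"
    and e: "\<And>x y. x \<in> Ob A \<Longrightarrow> y \<in> Ob A \<Longrightarrow> inj_on (e x y) (Hom A x y)"
begin

interpretation A: pre_Cstar_category F A using F A by (rule Cstar_pre)

lemma decode [simp]:
  "\<lbrakk>x \<in> Ob A; y \<in> Ob A; a \<in> Hom A x y\<rbrakk> \<Longrightarrow> inv_into (Hom A x y) (e x y) (e x y a) = a"
  using e by (simp add: inv_into_f_f)

lemma relabel_homs_encode: "star_functor F A (relabel_homs A e) id e"
  by unfold_locales
    (auto simp: relabel_homs_def A.unit_closed A.comp_closed A.add_closed A.scale_closed A.star_closed)

lemma relabel_homs_decode: "star_functor F (relabel_homs A e) A id (\<lambda>x y. inv_into (Hom A x y) (e x y))"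
  by unfold_locales
    (auto simp: relabel_homs_def A.unit_closed A.comp_closed A.add_closed A.scale_closed A.star_closed)

lemma relabel_homs_Cstar: "Cstar_category F (relabel_homs A e)"
proof (rule Cstar_single_faithful[OF F A _ _ _ _ _ _ relabel_homs_decode])
  fix x y assume x: "x \<in> Ob (relabel_homs A e)" and y: "y \<in> Ob (relabel_homs A e)"
  show "inj_on (inv_into (Hom A x y) (e x y)) (Hom (relabel_homs A e) x y)"
    using x y by (auto intro!: inj_on_inv_into)
  fix l assume "l \<in> Hom A (id x) (id y)"
  then show "l \<in> inv_into (Hom A x y) (e x y) ` Hom (relabel_homs A e) x y"
    using x y by (auto simp: image_iff)
qed (auto simp: relabel_homs_def A.unit_closed A.comp_closed A.zero_closed A.add_closed A.scale_closed
    A.star_closed)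

end

subsection \<open>Closed subcategories\<close>

definition sub_cat ::
    "('o, 'a) normed_star_cat \<Rightarrow> 'o set \<Rightarrow> ('o \<Rightarrow> 'o \<Rightarrow> 'a set) \<Rightarrow> ('o, 'a) normed_star_cat" where
  "sub_cat A P S = A\<lparr>Ob := P, Hom := S\<rparr>"

lemma sub_cat_simps [simp]:
  "Ob (sub_cat A P S) = P" "Hom (sub_cat A P S) = S" "Unit (sub_cat A P S) = Unit A"
  "Comp (sub_cat A P S) = Comp A" "Zero (sub_cat A P S) = Zero A" "Add (sub_cat A P S) = Add A"
  "Scale (sub_cat A P S) = Scale A" "Star (sub_cat A P S) = Star A" "Norm (sub_cat A P S) = Norm A"
  by (simp_all add: sub_cat_def)

lemma sub_cat_functor:
  assumes "P \<subseteq> Ob A" "\<And>x y. x \<in> P \<Longrightarrow> y \<in> P \<Longrightarrow> S x y \<subseteq> Hom A x y"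
  shows "star_functor F (sub_cat A P S) A id (\<lambda>x y. id)"
  using assms by unfold_locales auto

lemma sub_cat_Cstar:
  assumes F: "F = \<real> \<or> F = UNIV" and A: "Cstar_category F A"
    and P: "P \<subseteq> Ob A" and S: "\<And>x y. x \<in> P \<Longrightarrow> y \<in> P \<Longrightarrow> S x y \<subseteq> Hom A x y"
    and "\<And>x. x \<in> P \<Longrightarrow> Unit A x \<in> S x x"
      "\<And>x y z a b. \<lbrakk>x \<in> P; y \<in> P; z \<in> P; a \<in> S x y; b \<in> S y z\<rbrakk> \<Longrightarrow> Comp A x y z b a \<in> S x z"
      "\<And>x y. \<lbrakk>x \<in> P; y \<in> P\<rbrakk> \<Longrightarrow> Zero A x y \<in> S x y"
      "\<And>x y a b. \<lbrakk>x \<in> P; y \<in> P; a \<in> S x y; b \<in> S x y\<rbrakk> \<Longrightarrow> Add A x y a b \<in> S x y"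
      "\<And>x y t a. \<lbrakk>x \<in> P; y \<in> P; a \<in> S x y; t \<in> F\<rbrakk> \<Longrightarrow> Scale A x y t a \<in> S x y"
      "\<And>x y a. \<lbrakk>x \<in> P; y \<in> P; a \<in> S x y\<rbrakk> \<Longrightarrow> Star A x y a \<in> S y x"
    and limit: "\<And>x y s l. \<lbrakk>x \<in> P; y \<in> P; \<And>n::nat. s n \<in> S x y; l \<in> Hom A x y;
      (\<lambda>n. Norm A x y (Diff A x y (s n) l)) \<longlonglongrightarrow> 0\<rbrakk> \<Longrightarrow> l \<in> S x y"
  shows "Cstar_category F (sub_cat A P S)"
proof (rule Cstar_single_faithful[OF F A _ _ _ _ _ _ sub_cat_functor[OF P S]])
  fix x y l and s :: "nat \<Rightarrow> 'b" assume "x \<in> Ob (sub_cat A P S)" "y \<in> Ob (sub_cat A P S)"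
    "\<And>n. s n \<in> Hom (sub_cat A P S) x y" "l \<in> Hom A (id x) (id y)"
    "(\<lambda>n. Norm A (id x) (id y) (Diff A (id x) (id y) (id (s n)) l)) \<longlonglongrightarrow> 0"
  then show "l \<in> id ` Hom (sub_cat A P S) x y"
    using limit[of x y s l] by simp
qed (simp_all add: assms(5-10))


lemma star_functor_id: "star_functor F A A id (\<lambda>x y. id)"
  by unfold_locales auto

lemma star_functor_comp:
  assumes "star_functor F A B f \<phi>" "star_functor F B C g \<psi>"
  shows "star_functor F A C (g \<circ> f) (\<lambda>x y. \<psi> (f x) (f y) \<circ> \<phi> x y)"
proof -
  interpret f: star_functor F A B f \<phi> by fact
  interpret g: star_functor F B C g \<psi> by fact
  show ?thesis
    by unfold_locales
      (simp_all add: f.ob_closed f.hom_closed f.map_unit f.map_comp f.map_add f.map_scale f.map_star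
        g.ob_closed g.hom_closed g.map_unit g.map_comp g.map_add g.map_scale g.map_star)
qed

subsection \<open>Products\<close>

text \<open>Only bounded families have a finite supremum norm. Inserting 0 gives the supremum a
  value for empty \<open>I\<close>, where the product is terminal.\<close>

definition prod_cat ::
    "'i set \<Rightarrow> ('i \<Rightarrow> ('o, 'a) normed_star_cat) \<Rightarrow> ('i \<Rightarrow> 'o, 'i \<Rightarrow> 'a) normed_star_cat" where
  "prod_cat I B = \<lparr>Ob = (\<Pi>\<^sub>E i\<in>I. Ob (B i)),
     Hom = (\<lambda>x y. {a \<in> \<Pi>\<^sub>E i\<in>I. Hom (B i) (x i) (y i). \<exists>M. \<forall>i\<in>I. Norm (B i) (x i) (y i) (a i) \<le> M}),
     Unit = (\<lambda>x. \<lambda>i\<in>I. Unit (B i) (x i)),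
     Comp = (\<lambda>x y z b a. \<lambda>i\<in>I. Comp (B i) (x i) (y i) (z i) (b i) (a i)),
     Zero = (\<lambda>x y. \<lambda>i\<in>I. Zero (B i) (x i) (y i)),
     Add = (\<lambda>x y a b. \<lambda>i\<in>I. Add (B i) (x i) (y i) (a i) (b i)),
     Scale = (\<lambda>x y t a. \<lambda>i\<in>I. Scale (B i) (x i) (y i) t (a i)),
     Star = (\<lambda>x y a. \<lambda>i\<in>I. Star (B i) (x i) (y i) (a i)),
     Norm = (\<lambda>x y a. Sup (insert 0 ((\<lambda>i. Norm (B i) (x i) (y i) (a i)) ` I)))\<rparr>"

context
  fixes F :: "complex set" and I :: "'i set" and B :: "'i \<Rightarrow> ('o, 'a) normed_star_cat"
  assumes F: "F = \<real> \<or> F = UNIV" and B: "\<And>i. i \<in> I \<Longrightarrow> Cstar_category F (B i)"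
begin

lemma prod_cat_pre: "i \<in> I \<Longrightarrow> pre_Cstar_category F (B i)"
  using Cstar_pre[OF F B] .

lemma prod_cat_sets:
  "x \<in> Ob (prod_cat I B) \<longleftrightarrow> x \<in> (\<Pi>\<^sub>E i\<in>I. Ob (B i))"
  "a \<in> Hom (prod_cat I B) x y \<longleftrightarrow> a \<in> (\<Pi>\<^sub>E i\<in>I. Hom (B i) (x i) (y i)) \<and> (\<exists>M. \<forall>i\<in>I. Norm (B i) (x i) (y i) (a i) \<le> M)"
  by (simp_all add: prod_cat_def)

lemma prod_cat_Ob: "x \<in> Ob (prod_cat I B) \<Longrightarrow> i \<in> I \<Longrightarrow> x i \<in> Ob (B i)"
  by (auto simp: prod_cat_sets)

lemma prod_cat_Hom: "a \<in> Hom (prod_cat I B) x y \<Longrightarrow> i \<in> I \<Longrightarrow> a i \<in> Hom (B i) (x i) (y i)"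
  by (auto simp: prod_cat_sets)

lemma prod_cat_bound:
  assumes "a \<in> Hom (prod_cat I B) x y"
  obtains M where "\<And>i. i \<in> I \<Longrightarrow> Norm (B i) (x i) (y i) (a i) \<le> M" "0 \<le> M"
proof -
  obtain M where "\<And>i. i \<in> I \<Longrightarrow> Norm (B i) (x i) (y i) (a i) \<le> M"
    using assms by (auto simp: prod_cat_sets)
  then show thesis
    by (intro that[of "max M 0"]) (auto simp: le_max_iff_disj)
qed

lemma prod_cat_norm_ge:
  assumes "a \<in> Hom (prod_cat I B) x y" "i \<in> I"
  shows "Norm (B i) (x i) (y i) (a i) \<le> Norm (prod_cat I B) x y a"
proof -
  obtain M where "\<And>i. i \<in> I \<Longrightarrow> Norm (B i) (x i) (y i) (a i) \<le> M" "0 \<le> M"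
    using prod_cat_bound[OF assms(1)] by metis
  then have "bdd_above (insert 0 ((\<lambda>i. Norm (B i) (x i) (y i) (a i)) ` I))"
    by (auto intro!: bdd_aboveI[of _ M])
  then show ?thesis
    using assms(2) by (auto simp: prod_cat_def intro!: cSup_upper)
qed

lemma prod_cat_norm_nonneg:
  assumes "a \<in> Hom (prod_cat I B) x y"
  shows "0 \<le> Norm (prod_cat I B) x y a"
proof -
  obtain M where "\<And>i. i \<in> I \<Longrightarrow> Norm (B i) (x i) (y i) (a i) \<le> M" "0 \<le> M"
    using prod_cat_bound[OF assms(1)] by metis
  then have "bdd_above (insert 0 ((\<lambda>i. Norm (B i) (x i) (y i) (a i)) ` I))"
    by (auto intro!: bdd_aboveI[of _ M])
  then show ?thesis
    by (auto simp: prod_cat_def intro!: cSup_upper)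
qed

lemma prod_cat_norm_le:
  assumes "\<And>i. i \<in> I \<Longrightarrow> Norm (B i) (x i) (y i) (a i) \<le> r" "0 \<le> r"
  shows "Norm (prod_cat I B) x y a \<le> r"
  using assms by (auto simp: prod_cat_def intro!: cSup_least)

lemma prod_cat_HomI:
  assumes "\<And>i. i \<in> I \<Longrightarrow> a i \<in> Hom (B i) (x i) (y i)" "\<And>i. i \<in> I \<Longrightarrow> Norm (B i) (x i) (y i) (a i) \<le> M"
  shows "restrict a I \<in> Hom (prod_cat I B) x y"
  using assms by (auto simp: prod_cat_sets)

lemma prod_cat_closed:
  assumes x: "x \<in> Ob (prod_cat I B)" and y: "y \<in> Ob (prod_cat I B)"
  shows "Unit (prod_cat I B) x \<in> Hom (prod_cat I B) x x"
    and "\<lbrakk>z \<in> Ob (prod_cat I B); a \<in> Hom (prod_cat I B) x y; b \<in> Hom (prod_cat I B) y z\<rbrakk> \<Longrightarrow>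
      Comp (prod_cat I B) x y z b a \<in> Hom (prod_cat I B) x z"
    and "Zero (prod_cat I B) x y \<in> Hom (prod_cat I B) x y"
    and "\<lbrakk>a \<in> Hom (prod_cat I B) x y; b \<in> Hom (prod_cat I B) x y\<rbrakk> \<Longrightarrow>
      Add (prod_cat I B) x y a b \<in> Hom (prod_cat I B) x y"
    and "\<lbrakk>a \<in> Hom (prod_cat I B) x y; t \<in> F\<rbrakk> \<Longrightarrow> Scale (prod_cat I B) x y t a \<in> Hom (prod_cat I B) x y"
    and "a \<in> Hom (prod_cat I B) x y \<Longrightarrow> Star (prod_cat I B) x y a \<in> Hom (prod_cat I B) y x"
proof -
  note O = prod_cat_Ob[OF x] prod_cat_Ob[OF y]
  show "Unit (prod_cat I B) x \<in> Hom (prod_cat I B) x x"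
  proof -
    have "(\<lambda>i\<in>I. Unit (B i) (x i)) \<in> Hom (prod_cat I B) x x"
    proof (rule prod_cat_HomI)
      fix i assume i: "i \<in> I"
      interpret Bi: pre_Cstar_category F "B i" using prod_cat_pre[OF i] .
      show "Unit (B i) (x i) \<in> Hom (B i) (x i) (x i)" "Norm (B i) (x i) (x i) (Unit (B i) (x i)) \<le> 1"
        using O(1)[OF i] by (simp_all add: Bi.unit_closed Bi.norm_unit_le)
    qed
    then show ?thesis by (simp add: prod_cat_def)
  qed
  show "Comp (prod_cat I B) x y z b a \<in> Hom (prod_cat I B) x z"
    if z: "z \<in> Ob (prod_cat I B)" and a: "a \<in> Hom (prod_cat I B) x y" and b: "b \<in> Hom (prod_cat I B) y z"
  proof -
    obtain M where M: "\<And>i. i \<in> I \<Longrightarrow> Norm (B i) (x i) (y i) (a i) \<le> M" "0 \<le> M"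
      using prod_cat_bound[OF a] by metis
    obtain N where N: "\<And>i. i \<in> I \<Longrightarrow> Norm (B i) (y i) (z i) (b i) \<le> N" "0 \<le> N"
      using prod_cat_bound[OF b] by metis
    have "(\<lambda>i\<in>I. Comp (B i) (x i) (y i) (z i) (b i) (a i)) \<in> Hom (prod_cat I B) x z"
    proof (rule prod_cat_HomI)
      fix i assume i: "i \<in> I"
      interpret Bi: pre_Cstar_category F "B i" using prod_cat_pre[OF i] .
      note h = O(1)[OF i] O(2)[OF i] prod_cat_Ob[OF z i] prod_cat_Hom[OF a i] prod_cat_Hom[OF b i]
      show "Comp (B i) (x i) (y i) (z i) (b i) (a i) \<in> Hom (B i) (x i) (z i)"
        by (rule Bi.comp_closed[OF h])
      show "Norm (B i) (x i) (z i) (Comp (B i) (x i) (y i) (z i) (b i) (a i)) \<le> N * M"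
        using Bi.norm_comp[OF h] mult_mono[OF N(1)[OF i] M(1)[OF i] N(2) Bi.norm_nonneg[OF h(1,2,4)]]
        by (rule order_trans)
    qed
    then show ?thesis by (simp add: prod_cat_def)
  qed
  show "Zero (prod_cat I B) x y \<in> Hom (prod_cat I B) x y"
  proof -
    have "(\<lambda>i\<in>I. Zero (B i) (x i) (y i)) \<in> Hom (prod_cat I B) x y"
    proof (rule prod_cat_HomI)
      fix i assume i: "i \<in> I"
      interpret Bi: pre_Cstar_category F "B i" using prod_cat_pre[OF i] .
      show "Zero (B i) (x i) (y i) \<in> Hom (B i) (x i) (y i)"
        by (rule Bi.zero_closed[OF O(1)[OF i] O(2)[OF i]])
      then show "Norm (B i) (x i) (y i) (Zero (B i) (x i) (y i)) \<le> 0"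
        using Bi.norm_eq_zero[OF O(1)[OF i] O(2)[OF i], of "Zero (B i) (x i) (y i)"] by simp
    qed
    then show ?thesis by (simp add: prod_cat_def)
  qed
  show "Add (prod_cat I B) x y a b \<in> Hom (prod_cat I B) x y"
    if a: "a \<in> Hom (prod_cat I B) x y" and b: "b \<in> Hom (prod_cat I B) x y"
  proof -
    obtain M where M: "\<And>i. i \<in> I \<Longrightarrow> Norm (B i) (x i) (y i) (a i) \<le> M" "0 \<le> M"
      using prod_cat_bound[OF a] by metis
    obtain N where N: "\<And>i. i \<in> I \<Longrightarrow> Norm (B i) (x i) (y i) (b i) \<le> N" "0 \<le> N"
      using prod_cat_bound[OF b] by metis
    have "(\<lambda>i\<in>I. Add (B i) (x i) (y i) (a i) (b i)) \<in> Hom (prod_cat I B) x y"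
    proof (rule prod_cat_HomI)
      fix i assume i: "i \<in> I"
      interpret Bi: pre_Cstar_category F "B i" using prod_cat_pre[OF i] .
      note h = O(1)[OF i] O(2)[OF i] prod_cat_Hom[OF a i] prod_cat_Hom[OF b i]
      show "Add (B i) (x i) (y i) (a i) (b i) \<in> Hom (B i) (x i) (y i)"
        by (rule Bi.add_closed[OF h])
      show "Norm (B i) (x i) (y i) (Add (B i) (x i) (y i) (a i) (b i)) \<le> M + N"
        using Bi.norm_triangle[OF h] add_mono[OF M(1)[OF i] N(1)[OF i]] by (rule order_trans)
    qed
    then show ?thesis by (simp add: prod_cat_def)
  qed
  show "Scale (prod_cat I B) x y t a \<in> Hom (prod_cat I B) x y"
    if a: "a \<in> Hom (prod_cat I B) x y" and t: "t \<in> F"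
  proof -
    obtain M where M: "\<And>i. i \<in> I \<Longrightarrow> Norm (B i) (x i) (y i) (a i) \<le> M" "0 \<le> M"
      using prod_cat_bound[OF a] by metis
    have "(\<lambda>i\<in>I. Scale (B i) (x i) (y i) t (a i)) \<in> Hom (prod_cat I B) x y"
    proof (rule prod_cat_HomI)
      fix i assume i: "i \<in> I"
      interpret Bi: pre_Cstar_category F "B i" using prod_cat_pre[OF i] .
      note h = O(1)[OF i] O(2)[OF i]
      show "Scale (B i) (x i) (y i) t (a i) \<in> Hom (B i) (x i) (y i)"
        by (rule Bi.scale_closed[OF h t prod_cat_Hom[OF a i]])
      show "Norm (B i) (x i) (y i) (Scale (B i) (x i) (y i) t (a i)) \<le> cmod t * M"
        using Bi.norm_scale[OF h prod_cat_Hom[OF a i] t] M(1)[OF i] by (simp add: mult_left_mono)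
    qed
    then show ?thesis by (simp add: prod_cat_def)
  qed
  show "Star (prod_cat I B) x y a \<in> Hom (prod_cat I B) y x" if a: "a \<in> Hom (prod_cat I B) x y"
  proof -
    obtain M where M: "\<And>i. i \<in> I \<Longrightarrow> Norm (B i) (x i) (y i) (a i) \<le> M" "0 \<le> M"
      using prod_cat_bound[OF a] by metis
    have "(\<lambda>i\<in>I. Star (B i) (x i) (y i) (a i)) \<in> Hom (prod_cat I B) y x"
    proof (rule prod_cat_HomI)
      fix i assume i: "i \<in> I"
      interpret Bi: pre_Cstar_category F "B i" using prod_cat_pre[OF i] .
      note h = O(1)[OF i] O(2)[OF i] prod_cat_Hom[OF a i]
      show "Star (B i) (x i) (y i) (a i) \<in> Hom (B i) (y i) (x i)"
        by (rule Bi.star_closed[OF h])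
      show "Norm (B i) (y i) (x i) (Star (B i) (x i) (y i) (a i)) \<le> M"
        using Bi.norm_star[OF h] M(1)[OF i] by simp
    qed
    then show ?thesis by (simp add: prod_cat_def)
  qed
qed

lemma prod_cat_proj: "i \<in> I \<Longrightarrow> star_functor F (prod_cat I B) (B i) (\<lambda>x. x i) (\<lambda>x y a. a i)"
  using prod_cat_Ob prod_cat_Hom by unfold_locales (auto simp: prod_cat_def)

lemma prod_cat_Cstar: "Cstar_category F (prod_cat I B)"
proof (rule Cstar_categoryI_faithful[where I = I and B = B and f = "\<lambda>i x. x i" and \<phi> = "\<lambda>i x y a. a i"])
  fix x y a b assume a: "a \<in> Hom (prod_cat I B) x y" and b: "b \<in> Hom (prod_cat I B) x y"
    and eq: "\<And>i. i \<in> I \<Longrightarrow> a i = b i"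
  have "a \<in> (\<Pi>\<^sub>E i\<in>I. Hom (B i) (x i) (y i))" "b \<in> (\<Pi>\<^sub>E i\<in>I. Hom (B i) (x i) (y i))"
    using a b by (simp_all add: prod_cat_sets)
  then show "a = b" using eq by (rule PiE_ext)
next
  fix x y and s :: "nat \<Rightarrow> 'i \<Rightarrow> 'a"
  assume x: "x \<in> Ob (prod_cat I B)" and y: "y \<in> Ob (prod_cat I B)" and s: "\<And>n. s n \<in> Hom (prod_cat I B) x y"
    and cauchy: "\<And>e. e > 0 \<Longrightarrow> \<exists>N. \<forall>m\<ge>N. \<forall>n\<ge>N.
      Norm (prod_cat I B) x y (Add (prod_cat I B) x y (s m) (Scale (prod_cat I B) x y (- 1) (s n))) < e"
  have neg: "- 1 \<in> F" using F by auto
  have diff_i: "Add (prod_cat I B) x y a (Scale (prod_cat I B) x y (- 1) b) i = Diff (B i) (x i) (y i) (a i) (b i)"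
    if "i \<in> I" "a \<in> Hom (prod_cat I B) x y" "b \<in> Hom (prod_cat I B) x y" for i a b
  proof -
    interpret Bi: pre_Cstar_category F "B i" using prod_cat_pre[OF that(1)] .
    show ?thesis
      using that(1) Bi.Diff_eq[OF prod_cat_Ob[OF x that(1)] prod_cat_Ob[OF y that(1)] prod_cat_Hom[OF that(3,1)]]
      by (simp add: prod_cat_def)
  qed
  have diff_closed: "Add (prod_cat I B) x y a (Scale (prod_cat I B) x y (- 1) b) \<in> Hom (prod_cat I B) x y"
    if "a \<in> Hom (prod_cat I B) x y" "b \<in> Hom (prod_cat I B) x y" for a b
    using that neg x y by (intro prod_cat_closed)
  have comp: "Norm (B i) (x i) (y i) (Diff (B i) (x i) (y i) (s m i) (s n i)) \<le>
      Norm (prod_cat I B) x y (Add (prod_cat I B) x y (s m) (Scale (prod_cat I B) x y (- 1) (s n)))"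
    if "i \<in> I" for i m n
    using prod_cat_norm_ge[OF diff_closed[OF s s] that] diff_i[OF that s s] by simp
  have "\<forall>i\<in>I. \<exists>l. l \<in> Hom (B i) (x i) (y i) \<and> (\<lambda>n. Norm (B i) (x i) (y i) (Diff (B i) (x i) (y i) (s n i) l)) \<longlonglongrightarrow> 0"
  proof
    fix i assume i: "i \<in> I"
    interpret Bi: pre_Cstar_category F "B i" using prod_cat_pre[OF i] .
    have "\<exists>N. \<forall>m\<ge>N. \<forall>n\<ge>N. Norm (B i) (x i) (y i) (Diff (B i) (x i) (y i) (s m i) (s n i)) < e" if e: "e > 0" for e
    proof -
      obtain N where "\<forall>m\<ge>N. \<forall>n\<ge>N. Norm (prod_cat I B) x y (Add (prod_cat I B) x y (s m) (Scale (prod_cat I B) x y (- 1) (s n))) < e"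
        using cauchy[OF e] by blast
      then show ?thesis
        by (intro exI[of _ N] allI impI le_less_trans[OF comp[OF i]]) blast
    qed
    from Bi.norm_completeD[OF prod_cat_Ob[OF x i] prod_cat_Ob[OF y i] prod_cat_Hom[OF s i] this]
    show "\<exists>l. l \<in> Hom (B i) (x i) (y i) \<and> (\<lambda>n. Norm (B i) (x i) (y i) (Diff (B i) (x i) (y i) (s n i) l)) \<longlonglongrightarrow> 0"
      by blast
  qed
  from bchoice[OF this]
  obtain l where l: "\<And>i. i \<in> I \<Longrightarrow> l i \<in> Hom (B i) (x i) (y i)"
    "\<And>i. i \<in> I \<Longrightarrow> (\<lambda>n. Norm (B i) (x i) (y i) (Diff (B i) (x i) (y i) (s n i) (l i))) \<longlonglongrightarrow> 0"
    by blast
  \<comment> \<open>The Cauchy bound passes to the limit with the same \<open>N\<close> for all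
    \<open>i\<close>; this turns componentwise limits into a limit for the supremum norm.\<close>
  have close: "Norm (B i) (x i) (y i) (Diff (B i) (x i) (y i) (s m i) (l i)) \<le> e"
    if N: "\<forall>m\<ge>N. \<forall>n\<ge>N. Norm (prod_cat I B) x y (Add (prod_cat I B) x y (s m) (Scale (prod_cat I B) x y (- 1) (s n))) < e"
      and i: "i \<in> I" and m: "m \<ge> N" for i m N e
  proof -
    interpret Bi: pre_Cstar_category F "B i" using prod_cat_pre[OF i] .
    have "Norm (B i) (x i) (y i) (Diff (B i) (x i) (y i) (s m i) (s n i)) \<le> e" if "n \<ge> N" for n
      using comp[OF i, of m n] N[rule_format, OF m that] by simp
    then show ?thesis
      by (rule Bi.limit_bound[OF prod_cat_Ob[OF x i] prod_cat_Ob[OF y i] prod_cat_Hom[OF s i] prod_cat_Hom[OF s i] l(1)[OF i] l(2)[OF i]])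
  qed
  define k where "k = restrict l I"
  \<comment> \<open>The limit family is bounded because one member \<open>s N\<close> of the
    sequence is, and each component of the limit is within 1 of it.\<close>
  have k: "k \<in> Hom (prod_cat I B) x y"
  proof -
    obtain N where N: "\<forall>m\<ge>N. \<forall>n\<ge>N. Norm (prod_cat I B) x y (Add (prod_cat I B) x y (s m) (Scale (prod_cat I B) x y (- 1) (s n))) < 1"
      using cauchy[of 1] by auto
    obtain M where M: "\<And>i. i \<in> I \<Longrightarrow> Norm (B i) (x i) (y i) (s N i) \<le> M"
      using prod_cat_bound[OF s] by metis
    have "Norm (B i) (x i) (y i) (l i) \<le> 1 + M" if i: "i \<in> I" for i
    proof -
      interpret Bi: pre_Cstar_category F "B i" using prod_cat_pre[OF i] .
      note h = prod_cat_Ob[OF x i] prod_cat_Ob[OF y i] l(1)[OF i] prod_cat_Hom[OF s[of N] i]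
      show ?thesis
        using Bi.norm_le_diff[OF h] Bi.norm_diff_sym[OF h] close[OF N i order_refl] M[OF i] by simp
    qed
    then show ?thesis unfolding k_def using l(1) by (intro prod_cat_HomI)
  qed
  have "(\<lambda>n. Norm (prod_cat I B) x y (Add (prod_cat I B) x y (s n) (Scale (prod_cat I B) x y (- 1) k))) \<longlonglongrightarrow> 0"
  proof (rule LIMSEQ_I)
    fix e :: real assume e: "e > 0"
    then obtain N where N: "\<forall>m\<ge>N. \<forall>n\<ge>N. Norm (prod_cat I B) x y (Add (prod_cat I B) x y (s m) (Scale (prod_cat I B) x y (- 1) (s n))) < e / 2"
      using cauchy[of "e / 2"] by auto
    have "Norm (prod_cat I B) x y (Add (prod_cat I B) x y (s n) (Scale (prod_cat I B) x y (- 1) k)) \<le> e / 2" if "n \<ge> N" for n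
      using e close[OF N _ that] by (intro prod_cat_norm_le) (auto simp: diff_i[OF _ s k], auto simp: k_def)
    then show "\<exists>N. \<forall>n\<ge>N. norm (Norm (prod_cat I B) x y (Add (prod_cat I B) x y (s n) (Scale (prod_cat I B) x y (- 1) k)) - 0) < e"
      using e prod_cat_norm_nonneg[OF diff_closed[OF s k]] by (intro exI[of _ N]) (simp add: order_le_less_trans[of _ "e / 2"])
  qed
  with k show "\<exists>l\<in>Hom (prod_cat I B) x y.
      (\<lambda>n. Norm (prod_cat I B) x y (Add (prod_cat I B) x y (s n) (Scale (prod_cat I B) x y (- 1) l))) \<longlonglongrightarrow> 0"
    by blast
next
  fix i x y assume "i \<in> I"
  then show "Zero (prod_cat I B) x y i = Zero (B i) (x i) (y i)" by (simp add: prod_cat_def)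
qed (assumption | rule F B prod_cat_closed prod_cat_proj prod_cat_norm_nonneg prod_cat_norm_ge prod_cat_norm_le)+

text \<open>Contractivity bounds all components of the image of \<open>a\<close> by
  \<open>Norm K x y a\<close>, so the family is an arrow of the bounded product.\<close>

lemma prod_cat_pair:
  assumes K: "Cstar_category F K" and func: "\<And>i. i \<in> I \<Longrightarrow> star_functor F K (B i) (f i) (\<phi> i)"
  shows "star_functor F K (prod_cat I B) (\<lambda>x. \<lambda>i\<in>I. f i x) (\<lambda>x y a. \<lambda>i\<in>I. \<phi> i x y a)"
proof
  fix x y a assume x: "x \<in> Ob K" and y: "y \<in> Ob K" and a: "a \<in> Hom K x y"
  show "(\<lambda>i\<in>I. \<phi> i x y a) \<in> Hom (prod_cat I B) (\<lambda>i\<in>I. f i x) (\<lambda>i\<in>I. f i y)"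
    using star_functor.hom_closed[OF func x y a] star_functor_contractive[OF F K B func x y a]
    by (intro prod_cat_HomI[where M = "Norm K x y a"]) auto
qed (auto simp: prod_cat_def restrict_def fun_eq_iff star_functor.ob_closed[OF func] star_functor.map_unit[OF func]
    star_functor.map_comp[OF func] star_functor.map_add[OF func] star_functor.map_scale[OF func] star_functor.map_star[OF func])

end

section \<open>Smallness\<close>

locale size_bounded =
  fixes \<mu> :: "'j rel" and \<kappa> :: "'u rel"
  assumes size_bounds: "size_bounds \<mu> \<kappa>"
begin

lemma Card_order: "Card_order \<mu>" "Card_order \<kappa>"
  and \<mu>_le: "\<mu> \<le>o \<kappa>" and nat_less_\<mu>: "natLeq <o \<mu>" and regular: "regularCard \<kappa>"
  and power_less: "|X| <o \<kappa> \<Longrightarrow> |I| <o \<mu> \<Longrightarrow> |X :: 'u set| ^c |I :: 'j set| <o \<kappa>"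
  using size_bounds unfolding size_bounds_def by blast+

lemma nat_less: "natLeq <o \<kappa>"
  using nat_less_\<mu> \<mu>_le by (rule ordLess_ordLeq_trans)

lemma infinite_Field: "infinite (Field \<kappa>)"
  using cinfinite_mono[OF ordLess_imp_ordLeq[OF nat_less] natLeq_cinfinite]
  by (simp add: cinfinite_def)

lemma stable: "stable \<kappa>"
  using Card_order(2) infinite_Field regular by (rule regularCard_stable)

lemma less_\<mu>_less_\<kappa>: "|I| <o \<mu> \<Longrightarrow> |I| <o \<kappa>"
  using \<mu>_le ordLess_ordLeq_trans by blast

lemma small_subset: "|Y| <o \<kappa> \<Longrightarrow> X \<subseteq> Y \<Longrightarrow> |X| <o \<kappa>"
  using card_of_mono1 ordLeq_ordLess_trans by blast

lemma small_image: "|X| <o \<kappa> \<Longrightarrow> |f ` X| <o \<kappa>"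
  using card_of_image ordLeq_ordLess_trans by blast

lemma small_UN: "|I| <o \<kappa> \<Longrightarrow> (\<And>i. i \<in> I \<Longrightarrow> |X i| <o \<kappa>) \<Longrightarrow> |\<Union>i\<in>I. X i| <o \<kappa>"
  using stable by (rule stable_UNION)

lemma small_Sigma: "|I| <o \<kappa> \<Longrightarrow> (\<And>i. i \<in> I \<Longrightarrow> |X i| <o \<kappa>) \<Longrightarrow> |Sigma I X| <o \<kappa>"
  using stable by (rule stable_elim)

lemma small_Un: "|X| <o \<kappa> \<Longrightarrow> |Y| <o \<kappa> \<Longrightarrow> |X \<union> Y| <o \<kappa>"
  using infinite_Field Card_order(2) by (rule card_of_Un_ordLess_infinite_Field)

lemma small_nat: "|UNIV :: nat set| <o \<kappa>" "|UNIV :: nat set| <o \<mu>"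
  using nat_less nat_less_\<mu> card_of_nat ordIso_ordLess_trans by blast+

lemma small_encode:
  assumes "|X :: 'x set| <o \<kappa>"
  obtains e :: "'x \<Rightarrow> 'u" where "inj_on e X"
proof -
  obtain Y :: "'u set" where "|X| =o |Y|"
    using internalize_card_of_ordLeq[of X \<kappa>] ordLess_imp_ordLeq[OF assms] by blast
  then show thesis
    using that unfolding card_of_ordIso[symmetric] bij_betw_def by blast
qed

text \<open>Powers are controlled only for sets of the types \<open>'u\<close> and
  \<open>'j\<close>, so the values and the index set are first replaced by copies there. The union
  of the \<open>X i\<close> is small by regularity.\<close>

lemma small_PiE:
  fixes I :: "'i set" and X :: "'i \<Rightarrow> 'x set"
  assumes I: "|I| <o \<mu>" and X: "\<And>i. i \<in> I \<Longrightarrow> |X i| <o \<kappa>"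
  shows "|\<Pi>\<^sub>E i\<in>I. X i| <o \<kappa>"
proof -
  define U where "U = (\<Union>i\<in>I. X i)"
  have U: "|U| <o \<kappa>" unfolding U_def using less_\<mu>_less_\<kappa>[OF I] X by (rule small_UN)
  obtain e :: "'x \<Rightarrow> 'u" where e: "inj_on e U" using small_encode[OF U] by blast
  obtain J :: "'j set" where J: "|I| =o |J|"
    using internalize_card_of_ordLeq[of I \<mu>] ordLess_imp_ordLeq[OF I] by blast
  then obtain h where h: "bij_betw h J I"
    using ordIso_symmetric card_of_ordIso[of J I] by blast
  have "|\<Pi>\<^sub>E i\<in>I. X i| \<le>o |e ` U| ^c |J|"
    unfolding cexp_def Field_card_of
  \<comment> \<open>Families are reindexed by \<open>h\<close> and encoded by \<open>e\<close>;
    \<open>undefined\<close> is the value that \<open>Func\<close> prescribes outside its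
    domain.\<close>
  proof (rule card_of_ordLeqI[where f = "\<lambda>g j. if j \<in> J then e (g (h j)) else undefined"])
    show "inj_on (\<lambda>g j. if j \<in> J then e (g (h j)) else undefined) (\<Pi>\<^sub>E i\<in>I. X i)"
    proof (rule inj_onI)
      fix g g' assume g: "g \<in> (\<Pi>\<^sub>E i\<in>I. X i)" and g': "g' \<in> (\<Pi>\<^sub>E i\<in>I. X i)"
        and eq: "(\<lambda>j. if j \<in> J then e (g (h j)) else undefined) = (\<lambda>j. if j \<in> J then e (g' (h j)) else undefined)"
      show "g = g'"
      proof (rule PiE_ext[OF g g'])
        fix i assume i: "i \<in> I"
        then obtain j where j: "j \<in> J" "h j = i" using h by (auto simp: bij_betw_def)
        then have "e (g i) = e (g' i)" using fun_cong[OF eq, of j] by simp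
        moreover have "g i \<in> U" "g' i \<in> U" using g g' i by (auto simp: U_def)
        ultimately show "g i = g' i" using e by (auto dest: inj_onD)
      qed
    qed
    fix g assume "g \<in> (\<Pi>\<^sub>E i\<in>I. X i)"
    then show "(\<lambda>j. if j \<in> J then e (g (h j)) else undefined) \<in> Func J (e ` U)"
      using h by (fastforce simp: Func_def U_def bij_betw_def)
  qed
  moreover have "|e ` U| ^c |J| <o \<kappa>"
    using small_image[OF U] ordIso_ordLess_trans[OF ordIso_symmetric[OF J] I] by (rule power_less)
  ultimately show ?thesis by (rule ordLeq_ordLess_trans)
qed

text \<open>A countable power, available because \<mu> is uncountable. It keeps closures under
  limits of sequences small.\<close>

lemma small_sequences:
  assumes "|X| <o \<kappa>"
  shows "|{s :: nat \<Rightarrow> 'x. range s \<subseteq> X}| <o \<kappa>"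
proof -
  have "{s :: nat \<Rightarrow> 'x. range s \<subseteq> X} = (\<Pi>\<^sub>E i\<in>UNIV. X)"
    by (auto simp: PiE_def extensional_def)
  then show ?thesis
    using small_PiE[OF small_nat(2), of "\<lambda>_. X"] assms by simp
qed

text \<open>A small set closed under scalar multiples stays small because the field itself is small.
  A real number is determined by a sequence of rational approximations with error below
  \<open>1 / (n + 1)\<close>, so the reals embed into a countable power of the rationals.\<close>

lemma small_complex: "|UNIV :: complex set| <o \<kappa>"
proof -
  have real: "|UNIV :: real set| <o \<kappa>"
  proof -
    have Q: "|UNIV :: rat set| <o \<kappa>"
    proof -
      have "(UNIV :: int set) = (\<lambda>(m, n). int m - int n) ` (UNIV \<times> UNIV)"
        by (auto simp: image_iff) (metis int_diff_cases)
      then have Z: "|UNIV :: int set| <o \<kappa>"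
        using small_image[OF small_Sigma[OF small_nat(1) small_nat(1)], of "\<lambda>(m, n). int m - int n"] by simp
      have "(UNIV :: rat set) = (\<lambda>(m, n). Fract m n) ` (UNIV \<times> UNIV)"
        by (auto simp: image_iff) (metis Rat_cases)
      then show ?thesis
        using small_image[OF small_Sigma[OF Z Z], of "\<lambda>(m, n). Fract m n"] by simp
    qed
    have "|{s :: nat \<Rightarrow> rat. range s \<subseteq> UNIV}| <o \<kappa>" using Q by (rule small_sequences)
    moreover have "|UNIV :: real set| \<le>o |{s :: nat \<Rightarrow> rat. range s \<subseteq> UNIV}|"
    proof (rule card_of_ordLeqI[where f = "\<lambda>r n. SOME q. \<bar>real_of_rat q - r\<bar> < 1 / Suc n"])
      show "inj (\<lambda>r (n::nat). SOME q. \<bar>real_of_rat q - r\<bar> < 1 / Suc n)"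
      proof (rule injI)
        fix r r' :: real
        assume eq: "(\<lambda>n::nat. SOME q. \<bar>real_of_rat q - r\<bar> < 1 / Suc n) = (\<lambda>n. SOME q. \<bar>real_of_rat q - r'\<bar> < 1 / Suc n)"
        have approx: "\<bar>real_of_rat (SOME q. \<bar>real_of_rat q - r\<bar> < 1 / Suc n) - r\<bar> < 1 / Suc n" for r and n :: nat
        proof -
          have "\<exists>q. \<bar>real_of_rat q - r\<bar> < 1 / Suc n"
          proof -
            have "r - 1 / Suc n < r + 1 / Suc n" by simp
            then obtain q where "r - 1 / Suc n < of_rat q" "of_rat q < r + 1 / Suc n"
              using of_rat_dense by blast
            then show ?thesis by (intro exI[of _ q]) linarith
          qed
          then show ?thesis by (rule someI_ex)
        qed
        have close: "\<bar>r - r'\<bar> < 2 / Suc n" for n :: nat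
        proof -
          have "2 / real (Suc n) = 1 / Suc n + 1 / Suc n" by simp
          then show ?thesis
            using approx[of r n] approx[of r' n] unfolding fun_cong[OF eq, of n] by linarith
        qed
        show "r = r'"
        proof (rule ccontr)
          assume "r \<noteq> r'"
          then obtain n :: nat where "inverse (Suc n) < \<bar>r - r'\<bar> / 2"
            using reals_Archimedean[of "\<bar>r - r'\<bar> / 2"] by auto
          then show False using close[of n] by (simp add: inverse_eq_divide)
        qed
      qed
    qed auto
    ultimately show ?thesis by (rule ordLeq_ordLess_trans[rotated])
  qed
  have "|(UNIV :: real set) \<times> (UNIV :: real set)| <o \<kappa>"
    using small_Sigma[OF real real] .
  then have "|(\<lambda>(x, y). Complex x y) ` (UNIV \<times> UNIV)| <o \<kappa>" by (rule small_image)
  moreover have "(UNIV :: complex set) = (\<lambda>(x, y). Complex x y) ` (UNIV \<times> UNIV)"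
    by (auto simp: image_iff) (metis complex.exhaust)
  ultimately show ?thesis by simp
qed

lemma infinite_UNIV: "infinite (UNIV :: 'u set)"
  using infinite_super[OF subset_UNIV infinite_Field] .

text \<open>The injection is defined on the whole type, so that one fixed choice codes the objects
  of all path objects at once; a choice made for each functor separately would complicate
  functoriality.\<close>

lemma encode_pairs: "\<exists>e :: 'u \<times> 'u \<Rightarrow> 'u. inj e"
proof -
  have "|(UNIV :: 'u set) \<times> (UNIV :: 'u set)| =o |UNIV :: 'u set|"
    using infinite_UNIV by (rule card_of_Times_same_infinite)
  then obtain e :: "'u \<times> 'u \<Rightarrow> 'u" where "bij_betw e (UNIV \<times> UNIV) UNIV"
    unfolding card_of_ordIso[symmetric] by (rule exE)
  then show ?thesis by (intro exI[of _ e]) (simp add: bij_betw_def)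
qed

lemma encode_sums: "\<exists>e :: 'u + 'u \<Rightarrow> 'u. inj e"
proof -
  obtain p :: "'u \<times> 'u \<Rightarrow> 'u" where p: "inj p" using encode_pairs by blast
  have "UNIV \<noteq> {undefined :: 'u}"
  proof
    assume eq: "UNIV = {undefined :: 'u}"
    show False using infinite_UNIV unfolding eq by simp
  qed
  then obtain a :: 'u where a: "a \<noteq> undefined" by auto
  \<comment> \<open>The summands are separated by the tags \<open>a\<close> and
    \<open>undefined\<close>.\<close>
  have "inj (case_sum (\<lambda>x. p (a, x)) (\<lambda>x. p (undefined, x)))"
    using a by (intro injI) (simp add: inj_eq[OF p] split: sum.splits)
  then show ?thesis by (rule exI[of inj])
qed

text \<open>Limits and colimits are built in function types and then moved into \<open>'u\<close>.
  The two functors are inverse on the nose, objects included, so universal properties, which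
  determine functors up to equality, move along.\<close>

lemma small_copy:
  fixes A :: "('o, 'a) normed_star_cat"
  assumes F: "F = \<real> \<or> F = UNIV" and A: "Cstar_category F A"
    and Ob: "|Ob A| <o \<kappa>" and Hom: "\<And>x y. x \<in> Ob A \<Longrightarrow> y \<in> Ob A \<Longrightarrow> |Hom A x y| <o \<kappa>"
  obtains A' :: "('u, 'u) normed_star_cat" and e \<epsilon> d \<delta> where
    "A' \<in> small_Cstar_categories F \<kappa>" "star_functor F A A' e \<epsilon>" "star_functor F A' A d \<delta>"
    "\<And>x. x \<in> Ob A \<Longrightarrow> d (e x) = x"
    "\<And>x y a. \<lbrakk>x \<in> Ob A; y \<in> Ob A; a \<in> Hom A x y\<rbrakk> \<Longrightarrow> \<delta> (e x) (e y) (\<epsilon> x y a) = a"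
    "\<And>x. x \<in> Ob A' \<Longrightarrow> e (d x) = x"
    "\<And>x y a. \<lbrakk>x \<in> Ob A'; y \<in> Ob A'; a \<in> Hom A' x y\<rbrakk> \<Longrightarrow> \<epsilon> (d x) (d y) (\<delta> x y a) = a"
proof -
  obtain e :: "'o \<Rightarrow> 'u" where e: "inj_on e (Ob A)" using small_encode[OF Ob] by blast
  define d where "d = inv_into (Ob A) e"
  define P where "P = pull_cat A (e ` Ob A) d"
  define c where "c x y = (SOME h :: 'a \<Rightarrow> 'u. inj_on h (Hom A (d x) (d y)))" for x y
  have d_in: "d x \<in> Ob A" if "x \<in> e ` Ob A" for x using that by (simp add: d_def inv_into_into)
  have de: "d (e x) = x" if "x \<in> Ob A" for x using that e by (simp add: d_def)
  have ed: "e (d x) = x" if "x \<in> e ` Ob A" for x using that by (simp add: d_def f_inv_into_f)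
  have P: "Cstar_category F P" unfolding P_def using d_in by (intro pull_cat_Cstar[OF F A]) auto
  have c: "inj_on (c x y) (Hom P x y)" if "x \<in> Ob P" "y \<in> Ob P" for x y
  proof -
    have "d x \<in> Ob A" "d y \<in> Ob A" using d_in that by (simp_all add: P_def)
    from small_encode[OF Hom[OF this]]
    have "\<exists>h :: 'a \<Rightarrow> 'u. inj_on h (Hom A (d x) (d y))" by blast
    then show ?thesis unfolding c_def P_def pull_cat_simps by (rule someI_ex)
  qed
  define A' where "A' = relabel_homs P c"
  define \<delta> where "\<delta> x y = inv_into (Hom P x y) (c x y)" for x y
  have "Cstar_category F A'" unfolding A'_def by (rule relabel_homs_Cstar[OF F P c])
  moreover have "|Ob A'| <o \<kappa>" using small_image[OF Ob] by (simp add: A'_def P_def)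
  moreover have "|Hom A' x y| <o \<kappa>" if "x \<in> Ob A'" "y \<in> Ob A'" for x y
    using that small_image[OF Hom[OF d_in d_in], of x y "c x y"] by (simp add: A'_def P_def)
  ultimately have A': "A' \<in> small_Cstar_categories F \<kappa>"
    unfolding small_Cstar_categories_def by blast
  have "star_functor F A P e (\<lambda>x y. id)"
    by unfold_locales (auto simp: P_def de)
  moreover have "star_functor F P A' id c"
    unfolding A'_def by (rule relabel_homs_encode[OF F P c])
  ultimately have enc: "star_functor F A A' (id \<circ> e) (\<lambda>x y. c (e x) (e y) \<circ> id)"
    by (rule star_functor_comp)
  have "star_functor F A' P id \<delta>"
    unfolding A'_def \<delta>_def by (rule relabel_homs_decode[OF F P c])
  moreover have "star_functor F P A d (\<lambda>x y. id)"
    unfolding P_def using d_in by (intro pull_cat_functor) auto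
  ultimately have dec: "star_functor F A' A (d \<circ> id) (\<lambda>x y. id \<circ> \<delta> x y)"
    using star_functor_comp[of F A' P id \<delta> A d "\<lambda>x y. id"] by simp
  show thesis
  proof (rule that[OF A' enc dec])
    fix x y a assume x: "x \<in> Ob A" and y: "y \<in> Ob A" and a: "a \<in> Hom A x y"
    show "(id \<circ> \<delta> ((id \<circ> e) x) ((id \<circ> e) y)) ((c (e x) (e y) \<circ> id) a) = a"
      using inv_into_f_f[OF c[of "e x" "e y"], of a] x y a by (simp add: \<delta>_def P_def de)
  next
    fix x y a assume x: "x \<in> Ob A'" and y: "y \<in> Ob A'" and a: "a \<in> Hom A' x y"
    then have x': "x \<in> e ` Ob A" and y': "y \<in> e ` Ob A" by (simp_all add: A'_def P_def)
    show "(c (e ((d \<circ> id) x)) (e ((d \<circ> id) y)) \<circ> id) ((id \<circ> \<delta> x y) a) = a"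
      using a f_inv_into_f[of a "c x y" "Hom P x y"] by (simp add: ed[OF x'] ed[OF y'] \<delta>_def A'_def)
  qed (simp_all add: A'_def P_def de ed)
qed

end

section \<open>Generated closed subcategories\<close>

context pre_Cstar_category
begin

definition converges :: "'o \<Rightarrow> 'o \<Rightarrow> (nat \<Rightarrow> 'a) \<Rightarrow> 'a \<Rightarrow> bool" where
  "converges x y s l \<longleftrightarrow> (\<lambda>n. Norm A x y (Diff A x y (s n) l)) \<longlonglongrightarrow> 0"

lemma converges_bound:
  assumes "x \<in> Ob A" "y \<in> Ob A" "\<And>n. s n \<in> Hom A x y" "l \<in> Hom A x y"
    and "\<And>n. Norm A x y (Diff A x y (s n) l) \<le> r n" "r \<longlonglongrightarrow> 0"
  shows "converges x y s l"
  unfolding converges_def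
  by (rule tendsto_sandwich[OF _ _ tendsto_const assms(6)])
    (use assms norm_nonneg diff_closed in auto)

lemma converges_add:
  assumes x: "x \<in> Ob A" and y: "y \<in> Ob A" and s: "\<And>n. s n \<in> Hom A x y" and t: "\<And>n. t n \<in> Hom A x y"
    and k: "k \<in> Hom A x y" and l: "l \<in> Hom A x y" and lim: "converges x y s k" "converges x y t l"
  shows "converges x y (\<lambda>n. Add A x y (s n) (t n)) (Add A x y k l)"
proof (rule converges_bound[OF x y])
  interpret module "scalar_ring F" "hom_space A x y"
    using x y by (rule hom_vector_space)
  show "Add A x y (s n) (t n) \<in> Hom A x y" "Add A x y k l \<in> Hom A x y" for n
    using x y s t k l by (auto intro: add_closed)
  show "(\<lambda>n. Norm A x y (Diff A x y (s n) k) + Norm A x y (Diff A x y (t n) l)) \<longlonglongrightarrow> 0"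
    using tendsto_add[OF lim[unfolded converges_def]] by simp
  fix n
  have c: "s n \<in> carrier (hom_space A x y)" "t n \<in> carrier (hom_space A x y)"
    "k \<in> carrier (hom_space A x y)" "l \<in> carrier (hom_space A x y)"
    using s t k l by simp_all
  have "(s n \<oplus>\<^bsub>hom_space A x y\<^esub> t n) \<ominus>\<^bsub>hom_space A x y\<^esub> (k \<oplus>\<^bsub>hom_space A x y\<^esub> l) =
      (s n \<ominus>\<^bsub>hom_space A x y\<^esub> k) \<oplus>\<^bsub>hom_space A x y\<^esub> (t n \<ominus>\<^bsub>hom_space A x y\<^esub> l)"
    using c by (simp add: M.minus_eq M.minus_add M.a_ac del: hom_space_simps)
  then show "Norm A x y (Diff A x y (Add A x y (s n) (t n)) (Add A x y k l)) \<le>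
      Norm A x y (Diff A x y (s n) k) + Norm A x y (Diff A x y (t n) l)"
    using norm_triangle[OF x y diff_closed[OF x y s k] diff_closed[OF x y t l], of n n] by simp
qed

lemma converges_scale:
  assumes x: "x \<in> Ob A" and y: "y \<in> Ob A" and s: "\<And>n. s n \<in> Hom A x y" and t: "t \<in> F"
    and k: "k \<in> Hom A x y" and lim: "converges x y s k"
  shows "converges x y (\<lambda>n. Scale A x y t (s n)) (Scale A x y t k)"
proof (rule converges_bound[OF x y])
  show "Scale A x y t (s n) \<in> Hom A x y" "Scale A x y t k \<in> Hom A x y" for n
    using x y s t k by (auto intro: scale_closed)
  show "(\<lambda>n. cmod t * Norm A x y (Diff A x y (s n) k)) \<longlonglongrightarrow> 0"
    using tendsto_mult_right_zero[OF lim[unfolded converges_def]] .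
  fix n
  have "Diff A x y (Scale A x y t (s n)) (Scale A x y t k) = Scale A x y t (Diff A x y (s n) k)"
    using x y s t k by (simp add: Diff_eq scale_closed scale_add_right scale_scale real_scalar mult.commute)
  then show "Norm A x y (Diff A x y (Scale A x y t (s n)) (Scale A x y t k)) \<le> cmod t * Norm A x y (Diff A x y (s n) k)"
    using norm_scale[OF x y diff_closed[OF x y s k] t] by simp
qed

lemma converges_star:
  assumes x: "x \<in> Ob A" and y: "y \<in> Ob A" and s: "\<And>n. s n \<in> Hom A x y"
    and k: "k \<in> Hom A x y" and lim: "converges x y s k"
  shows "converges y x (\<lambda>n. Star A x y (s n)) (Star A x y k)"
proof (rule converges_bound[OF y x])
  show "Star A x y (s n) \<in> Hom A y x" "Star A x y k \<in> Hom A y x" for n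
    using x y s k by (auto intro: star_closed)
  show "(\<lambda>n. Norm A x y (Diff A x y (s n) k)) \<longlonglongrightarrow> 0"
    using lim unfolding converges_def .
  fix n
  have "Diff A y x (Star A x y (s n)) (Star A x y k) = Star A x y (Diff A x y (s n) k)"
    using x y s k by (simp add: Diff_eq star_closed scale_closed star_add star_scale real_scalar)
  then show "Norm A y x (Diff A y x (Star A x y (s n)) (Star A x y k)) \<le> Norm A x y (Diff A x y (s n) k)"
    using norm_star[OF x y diff_closed[OF x y s k]] by simp
qed

lemma converges_comp:
  assumes x: "x \<in> Ob A" and y: "y \<in> Ob A" and z: "z \<in> Ob A"
    and s: "\<And>n. s n \<in> Hom A x y" and t: "\<And>n. t n \<in> Hom A y z"
    and k: "k \<in> Hom A x y" and l: "l \<in> Hom A y z" and lim: "converges x y s k" "converges y z t l"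
  shows "converges x z (\<lambda>n. Comp A x y z (t n) (s n)) (Comp A x y z l k)"
proof (rule converges_bound[OF x z])
  show cl: "Comp A x y z (t n) (s n) \<in> Hom A x z" "Comp A x y z l k \<in> Hom A x z" for n
    using x y z s t k l by (auto intro: comp_closed)
  let ?d = "\<lambda>n. Norm A x y (Diff A x y (s n) k)" and ?e = "\<lambda>n. Norm A y z (Diff A y z (t n) l)"
  \<comment> \<open>From \<open>t s - l k = (t - l) s + l (s - k)\<close>, with the norm of
    \<open>s\<close> estimated by that of \<open>s - k\<close> plus that of
    \<open>k\<close>.\<close>
  let ?r = "\<lambda>n. ?e n * (?d n + Norm A x y k) + Norm A y z l * ?d n"
  have "?r \<longlonglongrightarrow> 0 * (0 + Norm A x y k) + Norm A y z l * 0"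
    by (intro tendsto_intros lim[unfolded converges_def])
  then show "?r \<longlonglongrightarrow> 0" by simp
  fix n
  have cl2: "Comp A x y z l (s n) \<in> Hom A x z"
    using x y z s l by (auto intro: comp_closed)
  have 1: "Diff A x z (Comp A x y z (t n) (s n)) (Comp A x y z l (s n)) = Comp A x y z (Diff A y z (t n) l) (s n)"
    using x y z s t l cl2 by (simp add: Diff_eq comp_add_left comp_scale_left scale_closed real_scalar)
  have 2: "Diff A x z (Comp A x y z l (s n)) (Comp A x y z l k) = Comp A x y z l (Diff A x y (s n) k)"
    using x y z s k l cl by (simp add: Diff_eq comp_add_right comp_scale_right scale_closed real_scalar)
  have "Norm A x z (Diff A x z (Comp A x y z (t n) (s n)) (Comp A x y z l k)) \<le>
      Norm A x z (Comp A x y z (Diff A y z (t n) l) (s n)) + Norm A x z (Comp A x y z l (Diff A x y (s n) k))"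
    using norm_diff_triangle[OF x z cl(1)[of n] cl2 cl(2)] unfolding 1 2 .
  also have "\<dots> \<le> ?e n * Norm A x y (s n) + Norm A y z l * ?d n"
    using norm_comp[OF x y z s diff_closed[OF y z t l]] norm_comp[OF x y z diff_closed[OF x y s k] l]
    by (intro add_mono)
  also have "\<dots> \<le> ?r n"
    using norm_le_diff[OF x y s k] norm_nonneg[OF y z diff_closed[OF y z t l]] norm_nonneg[OF y z l]
    by (intro add_mono mult_left_mono) auto
  finally show "Norm A x z (Diff A x z (Comp A x y z (t n) (s n)) (Comp A x y z l k)) \<le> ?r n" .
qed

lemma converges_const:
  assumes "x \<in> Ob A" "y \<in> Ob A" "l \<in> Hom A x y"
  shows "converges x y (\<lambda>_. l) l"
  using norm_diff_eq_zero[OF assms assms(3)] by (simp add: converges_def)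

end

text \<open>Contractive functors are continuous, and limits in a hom space are unique. Agreement of
  the object maps at \<open>x\<close> and \<open>y\<close> puts both images into the same hom
  space.\<close>

lemma functors_agree_limit:
  assumes F: "F = \<real> \<or> F = UNIV" and A: "Cstar_category F A" and B: "Cstar_category F B"
    and fun1: "star_functor F A B f \<phi>" and fun2: "star_functor F A B g \<psi>"
    and x: "x \<in> Ob A" and y: "y \<in> Ob A" and ob: "f x = g x" "f y = g y"
    and s: "\<And>n. s n \<in> Hom A x y" and l: "l \<in> Hom A x y"
    and lim: "(\<lambda>n. Norm A x y (Diff A x y (s n) l)) \<longlonglongrightarrow> 0" and eq: "\<And>n. \<phi> x y (s n) = \<psi> x y (s n)"
  shows "\<phi> x y l = \<psi> x y l"
proof -
  interpret A: pre_Cstar_category F A using F A by (rule Cstar_pre)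
  interpret B: pre_Cstar_category F B using F B by (rule Cstar_pre)
  have conv: "B.converges (h x) (h y) (\<lambda>n. \<theta> x y (s n)) (\<theta> x y l)" if "star_functor F A B h \<theta>" for h \<theta>
  proof -
    interpret h: star_functor F A B h \<theta> by (rule that)
    show ?thesis
    proof (rule B.converges_bound[OF _ _ _ _ _ lim])
      show "Norm B (h x) (h y) (Diff B (h x) (h y) (\<theta> x y (s n)) (\<theta> x y l)) \<le> Norm A x y (Diff A x y (s n) l)" for n
        using star_functor_contractive[OF F A B that x y A.diff_closed[OF x y s l]]
          h.map_diff[OF A.F_category_axioms B.F_category_axioms x y s l] by simp
    qed (use x y s l in \<open>auto intro: h.ob_closed h.hom_closed\<close>)
  qed
  interpret f: star_functor F A B f \<phi> by (rule fun1)
  interpret g: star_functor F A B g \<psi> by (rule fun2)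
  show ?thesis
    using B.limit_unique[of "f x" "f y" "\<lambda>n. \<phi> x y (s n)" "\<phi> x y l" "\<psi> x y l"] conv[OF fun1] conv[OF fun2]
      f.ob_closed[OF x] f.ob_closed[OF y] f.hom_closed[OF x y l] f.hom_closed[OF x y s] g.hom_closed[OF x y l] ob eq
    by (simp add: B.converges_def)
qed

text \<open>Continuity of *-functors makes the agreement of arrows a closed condition. A family of
  pairs with varying targets is equalized at once, one pair for each arrow of a diagram.\<close>

lemma equalizer_Cstar:
  fixes B :: "'t \<Rightarrow> ('p, 'b) normed_star_cat"
  assumes F: "F = \<real> \<or> F = UNIV" and A: "Cstar_category F A" and B: "\<And>t. t \<in> T \<Longrightarrow> Cstar_category F (B t)"
    and fun1: "\<And>t. t \<in> T \<Longrightarrow> star_functor F A (B t) (f t) (\<phi> t)"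
    and fun2: "\<And>t. t \<in> T \<Longrightarrow> star_functor F A (B t) (g t) (\<psi> t)"
  shows "Cstar_category F (sub_cat A {x \<in> Ob A. \<forall>t\<in>T. f t x = g t x}
    (\<lambda>x y. {a \<in> Hom A x y. \<forall>t\<in>T. \<phi> t x y a = \<psi> t x y a}))"
proof -
  interpret A: pre_Cstar_category F A using F A by (rule Cstar_pre)
  have z1: "\<phi> t x y (Zero A x y) = Zero (B t) (f t x) (f t y)" and z2: "\<psi> t x y (Zero A x y) = Zero (B t) (g t x) (g t y)"
    if "t \<in> T" "x \<in> Ob A" "y \<in> Ob A" for t x y
  proof -
    interpret Bt: pre_Cstar_category F "B t" using F B[OF that(1)] by (rule Cstar_pre)
    show "\<phi> t x y (Zero A x y) = Zero (B t) (f t x) (f t y)"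
      using star_functor.map_zero[OF fun1[OF that(1)] A.F_category_axioms Bt.F_category_axioms that(2,3) A.real_scalar(4)] .
    show "\<psi> t x y (Zero A x y) = Zero (B t) (g t x) (g t y)"
      using star_functor.map_zero[OF fun2[OF that(1)] A.F_category_axioms Bt.F_category_axioms that(2,3) A.real_scalar(4)] .
  qed
  note maps = star_functor.map_unit[OF fun1] star_functor.map_comp[OF fun1] star_functor.map_add[OF fun1]
    star_functor.map_scale[OF fun1] star_functor.map_star[OF fun1] star_functor.map_unit[OF fun2]
    star_functor.map_comp[OF fun2] star_functor.map_add[OF fun2] star_functor.map_scale[OF fun2]
    star_functor.map_star[OF fun2] z1 z2
  show ?thesis
  proof (rule sub_cat_Cstar[OF F A])
    fix x y l s
    assume x: "x \<in> {x \<in> Ob A. \<forall>t\<in>T. f t x = g t x}" and y: "y \<in> {x \<in> Ob A. \<forall>t\<in>T. f t x = g t x}"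
      and s: "\<And>n. s n \<in> {a \<in> Hom A x y. \<forall>t\<in>T. \<phi> t x y a = \<psi> t x y a}" and l: "l \<in> Hom A x y"
      and lim: "(\<lambda>n. Norm A x y (Diff A x y (s n) l)) \<longlonglongrightarrow> 0"
    have "\<phi> t x y l = \<psi> t x y l" if t: "t \<in> T" for t
      using functors_agree_limit[OF F A B[OF t] fun1[OF t] fun2[OF t], of x y s l] x y s l lim t by simp
    with l show "l \<in> {a \<in> Hom A x y. \<forall>t\<in>T. \<phi> t x y a = \<psi> t x y a}" by simp
  qed (auto simp: maps A.unit_closed A.comp_closed A.zero_closed A.add_closed A.scale_closed A.star_closed)
qed

lemma sub_cat_corestrict:
  assumes "star_functor F K A f \<phi>" "\<And>x. x \<in> Ob K \<Longrightarrow> f x \<in> P"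
    "\<And>x y a. \<lbrakk>x \<in> Ob K; y \<in> Ob K; a \<in> Hom K x y\<rbrakk> \<Longrightarrow> \<phi> x y a \<in> S (f x) (f y)"
  shows "star_functor F K (sub_cat A P S) f \<phi>"
proof -
  interpret f: star_functor F K A f \<phi> by fact
  show ?thesis
    using assms(2,3) by unfold_locales
      (auto simp: f.map_unit f.map_comp f.map_add f.map_scale f.map_star)
qed

section \<open>Generation, density and uniqueness\<close>

inductive generated ::
    "complex set \<Rightarrow> ('o, 'a) normed_star_cat \<Rightarrow> 'o set \<Rightarrow> ('o \<Rightarrow> 'o \<Rightarrow> 'a set) \<Rightarrow> 'o \<Rightarrow> 'o \<Rightarrow> 'a \<Rightarrow> bool"
  for F A P g where
    base: "x \<in> P \<Longrightarrow> y \<in> P \<Longrightarrow> a \<in> g x y \<Longrightarrow> generated F A P g x y a"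
  | unit: "x \<in> P \<Longrightarrow> generated F A P g x x (Unit A x)"
  | zero: "x \<in> P \<Longrightarrow> y \<in> P \<Longrightarrow> generated F A P g x y (Zero A x y)"
  | comp: "generated F A P g x y a \<Longrightarrow> generated F A P g y z b \<Longrightarrow> generated F A P g x z (Comp A x y z b a)"
  | add: "generated F A P g x y a \<Longrightarrow> generated F A P g x y b \<Longrightarrow> generated F A P g x y (Add A x y a b)"
  | scale: "generated F A P g x y a \<Longrightarrow> t \<in> F \<Longrightarrow> generated F A P g x y (Scale A x y t a)"
  | star: "generated F A P g x y a \<Longrightarrow> generated F A P g y x (Star A x y a)"

definition closure_generated ::
    "complex set \<Rightarrow> ('o, 'a) normed_star_cat \<Rightarrow> 'o set \<Rightarrow> ('o \<Rightarrow> 'o \<Rightarrow> 'a set) \<Rightarrow> 'o \<Rightarrow> 'o \<Rightarrow> 'a set" where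
  "closure_generated F A P g x y = {l \<in> Hom A x y. \<exists>s. (\<forall>n. generated F A P g x y (s n)) \<and>
     (\<lambda>n. Norm A x y (Diff A x y (s n) l)) \<longlonglongrightarrow> 0}"

context
  fixes F :: "complex set" and A :: "('o, 'a) normed_star_cat" and P :: "'o set" and g :: "'o \<Rightarrow> 'o \<Rightarrow> 'a set"
  assumes F: "F = \<real> \<or> F = UNIV" and A: "Cstar_category F A" and P: "P \<subseteq> Ob A"
    and g: "\<And>x y. x \<in> P \<Longrightarrow> y \<in> P \<Longrightarrow> g x y \<subseteq> Hom A x y"
begin

interpretation A: pre_Cstar_category F A using F A by (rule Cstar_pre)

lemma generated_in: "generated F A P g x y a \<Longrightarrow> x \<in> P \<and> y \<in> P \<and> a \<in> Hom A x y"
  by (induction rule: generated.induct)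
    (use P g in \<open>auto intro!: A.unit_closed A.zero_closed A.comp_closed A.add_closed A.scale_closed A.star_closed\<close>)

lemma generated_Hom: "generated F A P g x y a \<Longrightarrow> a \<in> Hom A x y"
  using generated_in by blast

lemma closure_generatedE:
  assumes "l \<in> closure_generated F A P g x y"
  obtains s where "\<And>n. generated F A P g x y (s n)" "\<And>n. s n \<in> Hom A x y" "A.converges x y s l" "l \<in> Hom A x y"
  using assms generated_Hom unfolding closure_generated_def A.converges_def by blast

lemma closure_generatedI:
  assumes "\<And>n. generated F A P g x y (s n)" "A.converges x y s l" "l \<in> Hom A x y"
  shows "l \<in> closure_generated F A P g x y"
  using assms unfolding closure_generated_def A.converges_def by blast

lemma generated_closure:
  assumes "generated F A P g x y a"
  shows "a \<in> closure_generated F A P g x y"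
proof -
  have "x \<in> Ob A" "y \<in> Ob A" "a \<in> Hom A x y" using generated_in[OF assms] P by auto
  then show ?thesis
    using assms by (intro closure_generatedI[of x y "\<lambda>_. a"] A.converges_const)
qed

lemma closure_generated_Cstar: "Cstar_category F (sub_cat A P (closure_generated F A P g))"
proof (rule sub_cat_Cstar[OF F A P])
  fix x y assume x: "x \<in> P" and y: "y \<in> P"
  then have xA: "x \<in> Ob A" and yA: "y \<in> Ob A" using P by auto
  show "closure_generated F A P g x y \<subseteq> Hom A x y" by (auto simp: closure_generated_def)
  show "Zero A x y \<in> closure_generated F A P g x y"
    using generated.zero[of x P y] x y by (intro generated_closure) blast
  fix a assume a: "a \<in> closure_generated F A P g x y"
  obtain s where s: "\<And>n. generated F A P g x y (s n)" "\<And>n. s n \<in> Hom A x y" "A.converges x y s a" "a \<in> Hom A x y"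
    using a by (rule closure_generatedE) (rule that)
  show "Star A x y a \<in> closure_generated F A P g y x"
    using s xA yA by (intro closure_generatedI[OF generated.star[OF s(1)]] A.converges_star A.star_closed)
  show "Scale A x y t a \<in> closure_generated F A P g x y" if "t \<in> F" for t
    using s xA yA that by (intro closure_generatedI[OF generated.scale[OF s(1) that]] A.converges_scale A.scale_closed)
  show "Add A x y a b \<in> closure_generated F A P g x y" if b: "b \<in> closure_generated F A P g x y" for b
  proof -
    obtain t where t: "\<And>n. generated F A P g x y (t n)" "\<And>n. t n \<in> Hom A x y" "A.converges x y t b" "b \<in> Hom A x y"
      using b by (rule closure_generatedE) (rule that)
    show ?thesis
      using s t xA yA by (intro closure_generatedI[OF generated.add[OF s(1) t(1)]] A.converges_add A.add_closed)
  qed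
  show "Comp A x y z b a \<in> closure_generated F A P g x z"
    if z: "z \<in> P" and b: "b \<in> closure_generated F A P g y z" for z b
  proof -
    have zA: "z \<in> Ob A" using z P by auto
    obtain t where t: "\<And>n. generated F A P g y z (t n)" "\<And>n. t n \<in> Hom A y z" "A.converges y z t b" "b \<in> Hom A y z"
      using b by (rule closure_generatedE) (rule that)
    show ?thesis
      using s t xA yA zA by (intro closure_generatedI[OF generated.comp[OF s(1) t(1)]] A.converges_comp A.comp_closed)
  qed
next
  fix x assume "x \<in> P"
  then show "Unit A x \<in> closure_generated F A P g x x"
    using generated.unit[of x P] by (intro generated_closure) blast
next
  fix x y l and s :: "nat \<Rightarrow> 'a"
  assume x: "x \<in> P" and y: "y \<in> P" and s: "\<And>n. s n \<in> closure_generated F A P g x y" and l: "l \<in> Hom A x y"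
    and lim: "(\<lambda>n. Norm A x y (Diff A x y (s n) l)) \<longlonglongrightarrow> 0"
  have xA: "x \<in> Ob A" and yA: "y \<in> Ob A" using x y P by auto
  have sH: "s n \<in> Hom A x y" for n using s[of n] by (simp add: closure_generated_def)
  \<comment> \<open>Each \<open>s n\<close> is itself a limit of generated arrows. One of them
    within \<open>1 / (n + 1)\<close> of \<open>s n\<close> is selected, and the selected arrows
    converge to \<open>l\<close>.\<close>
  have "\<exists>a. generated F A P g x y a \<and> Norm A x y (Diff A x y a (s n)) < inverse (real (Suc n))" for n
  proof -
    obtain t where t: "\<And>n. generated F A P g x y (t n)" "A.converges x y t (s n)"
      using s[of n] by (rule closure_generatedE) (rule that)
    have "\<forall>\<^sub>F m in sequentially. Norm A x y (Diff A x y (t m) (s n)) < inverse (real (Suc n))"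
      using t(2) unfolding A.converges_def by (rule order_tendstoD) simp
    then obtain m where "Norm A x y (Diff A x y (t m) (s n)) < inverse (real (Suc n))"
      unfolding eventually_sequentially by blast
    then show ?thesis using t(1) by blast
  qed
  then have "\<exists>t. \<forall>n. generated F A P g x y (t n) \<and> Norm A x y (Diff A x y (t n) (s n)) < inverse (real (Suc n))"
    by (intro choice allI)
  then obtain t where t: "\<And>n. generated F A P g x y (t n)"
    "\<And>n. Norm A x y (Diff A x y (t n) (s n)) < inverse (real (Suc n))" by blast
  show "l \<in> closure_generated F A P g x y"
  proof (rule closure_generatedI[OF t(1) A.converges_bound[OF xA yA generated_Hom[OF t(1)] l] l])
    show "Norm A x y (Diff A x y (t n) l) \<le> inverse (real (Suc n)) + Norm A x y (Diff A x y (s n) l)" for n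
      using A.norm_diff_triangle[OF xA yA generated_Hom[OF t(1)] sH l, of n n] t(2)[of n] by simp
    show "(\<lambda>n. inverse (real (Suc n)) + Norm A x y (Diff A x y (s n) l)) \<longlonglongrightarrow> 0"
      using tendsto_add[OF LIMSEQ_inverse_real_of_nat lim] by simp
  qed
qed

text \<open>Agreement spreads from the generators by induction to generated arrows and by continuity
  to their limits. This yields the uniqueness of arrows out of a colimit.\<close>

lemma closure_generated_functors_agree:
  assumes B: "Cstar_category F B"
    and fun1: "star_functor F (sub_cat A P (closure_generated F A P g)) B f \<phi>"
    and fun2: "star_functor F (sub_cat A P (closure_generated F A P g)) B h \<psi>"
    and ob: "\<And>x. x \<in> P \<Longrightarrow> f x = h x"
    and eq: "\<And>x y a. \<lbrakk>x \<in> P; y \<in> P; a \<in> g x y\<rbrakk> \<Longrightarrow> \<phi> x y a = \<psi> x y a"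
    and x: "x \<in> P" and y: "y \<in> P" and l: "l \<in> closure_generated F A P g x y"
  shows "\<phi> x y l = \<psi> x y l"
proof -
  let ?Q = "sub_cat A P (closure_generated F A P g)"
  interpret Q: pre_Cstar_category F ?Q using F closure_generated_Cstar by (rule Cstar_pre)
  interpret B: pre_Cstar_category F B using F B by (rule Cstar_pre)
  interpret f: star_functor F ?Q B f \<phi> by (rule fun1)
  interpret h: star_functor F ?Q B h \<psi> by (rule fun2)
  have gen: "generated F A P g x y a \<Longrightarrow> \<phi> x y a = \<psi> x y a" for x y a
  proof (induction rule: generated.induct)
    case (unit x)
    then show ?case using f.map_unit[of x] h.map_unit[of x] ob by simp
  next
    case (zero x y)
    then show ?case
      using f.map_zero[OF Q.F_category_axioms B.F_category_axioms, of x y]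
        h.map_zero[OF Q.F_category_axioms B.F_category_axioms, of x y] ob Q.real_scalar(4) by simp
  next
    case (comp x y a z b)
    then show ?case
      using f.map_comp[of x y z a b] h.map_comp[of x y z a b] ob generated_in generated_closure by simp
  next
    case (add x y a b)
    then show ?case
      using f.map_add[of x y a b] h.map_add[of x y a b] ob generated_in[of x y] generated_closure by simp
  next
    case (scale x y a t)
    then show ?case
      using f.map_scale[of x y a t] h.map_scale[of x y a t] ob generated_in[of x y] generated_closure by simp
  next
    case (star x y a)
    then show ?case
      using f.map_star[of x y a] h.map_star[of x y a] ob generated_in[of x y] generated_closure by simp
  qed (rule eq)
  obtain s where s: "\<And>n. generated F A P g x y (s n)" "A.converges x y s l"
    using l by (rule closure_generatedE) (rule that)
  \<comment> \<open>The hom modules of \<open>?Q\<close> and of \<open>A\<close> have different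
    carriers, so their differences are a priori different functions; in both, the negative of an
    arrow is its multiple by -1.\<close>
  have Diff: "Diff ?Q x y a b = Diff A x y a b" if "a \<in> Hom ?Q x y" "b \<in> Hom ?Q x y" for a b
  proof -
    have "x \<in> Ob A" "y \<in> Ob A" "b \<in> Hom A x y"
      using that x y P by (auto simp: closure_generated_def)
    then show ?thesis
      using that x y Q.Diff_eq[of x y b a] A.Diff_eq[of x y b a] by simp
  qed
  show ?thesis
  proof (rule functors_agree_limit[OF F closure_generated_Cstar B fun1 fun2])
    show "s n \<in> Hom ?Q x y" for n using generated_closure[OF s(1)] by simp
    then show "(\<lambda>n. Norm ?Q x y (Diff ?Q x y (s n) l)) \<longlonglongrightarrow> 0"
      using s(2) l by (simp add: Diff A.converges_def)
  qed (use x y l ob gen[OF s(1)] in auto)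
qed

end

context size_bounded
begin

text \<open>Every generated arrow is reached after finitely many rounds, and a round adds no more
  than images of pairs, of scalar multiples and of single arrows. A countable union of small sets
  therefore covers them.\<close>

lemma small_generated:
  fixes A :: "('o, 'a) normed_star_cat"
  assumes P: "|P| <o \<kappa>" and g: "\<And>x y. x \<in> P \<Longrightarrow> y \<in> P \<Longrightarrow> |g x y| <o \<kappa>"
  shows "|{a. generated F A P g x y a}| <o \<kappa>"
proof -
  define G0 where "G0 = (SIGMA x:P. SIGMA y:P. g x y) \<union> (\<lambda>x. (x, x, Unit A x)) ` P \<union>
    (\<lambda>(x, y). (x, y, Zero A x y)) ` (P \<times> P)"
  \<comment> \<open>Triples record source and target. Pairs that are not composable or not parallel
    are combined too, which only enlarges a set whose size is to be bounded from above.\<close>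
  define step where "step G = G \<union> (\<lambda>((x, y, a), (y', z, b)). (x, z, Comp A x y z b a)) ` (G \<times> G) \<union>
    (\<lambda>((x, y, a), (x', y', b)). (x, y, Add A x y a b)) ` (G \<times> G) \<union>
    (\<lambda>(t, (x, y, a)). (x, y, Scale A x y t a)) ` (F \<times> G) \<union> (\<lambda>(x, y, a). (y, x, Star A x y a)) ` G" for G
  define G where "G n = (step ^^ n) G0" for n
  have GS: "G (Suc n) = step (G n)" for n by (simp add: G_def)
  have F: "|F| <o \<kappa>" using small_complex by (rule small_subset) simp
  have "|G n| <o \<kappa>" for n
  proof (induction n)
    case 0
    have "|SIGMA x:P. SIGMA y:P. g x y| <o \<kappa>"
      using P g by (intro small_Sigma)
    then show ?case
      unfolding G_def G0_def funpow_0 using P g by (intro small_Un small_image small_Sigma)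
  next
    case (Suc n)
    then show ?case
      unfolding GS step_def using F by (intro small_Un small_image small_Sigma)
  qed
  then have small: "|\<Union>n. G n| <o \<kappa>" using small_nat(1) by (intro small_UN)
  have mono: "m \<le> n \<Longrightarrow> G m \<subseteq> G n" for m n
    by (rule lift_Suc_mono_le[of G]) (auto simp: GS step_def)
  have "generated F A P g x y a \<Longrightarrow> \<exists>n. (x, y, a) \<in> G n" for x y a
  proof (induction rule: generated.induct)
    case (base x y a)
    then have "(x, y, a) \<in> G 0" by (auto simp: G_def G0_def)
    then show ?case ..
  next
    case (unit x)
    then have "(x, x, Unit A x) \<in> G 0" by (auto simp: G_def G0_def)
    then show ?case ..
  next
    case (zero x y)
    then have "(x, y, Zero A x y) \<in> G 0" by (auto simp: G_def G0_def)
    then show ?case ..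
  next
    case (comp x y a z b)
    then obtain m n where mn: "(x, y, a) \<in> G m" "(y, z, b) \<in> G n" by blast
    then have "((x, y, a), (y, z, b)) \<in> G (max m n) \<times> G (max m n)"
      using mono[of m "max m n"] mono[of n "max m n"] by auto
    then have "(x, z, Comp A x y z b a) \<in> G (Suc (max m n))"
      unfolding GS step_def by (force intro: rev_image_eqI)
    then show ?case ..
  next
    case (add x y a b)
    then obtain m n where mn: "(x, y, a) \<in> G m" "(x, y, b) \<in> G n" by blast
    then have "((x, y, a), (x, y, b)) \<in> G (max m n) \<times> G (max m n)"
      using mono[of m "max m n"] mono[of n "max m n"] by auto
    then have "(x, y, Add A x y a b) \<in> G (Suc (max m n))"
      unfolding GS step_def by (force intro: rev_image_eqI)
    then show ?case ..
  next
    case (scale x y a t)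
    then obtain n where "(t, (x, y, a)) \<in> F \<times> G n" by blast
    then have "(x, y, Scale A x y t a) \<in> G (Suc n)"
      unfolding GS step_def by (force intro: rev_image_eqI)
    then show ?case ..
  next
    case (star x y a)
    then obtain n where "(x, y, a) \<in> G n" by blast
    then have "(y, x, Star A x y a) \<in> G (Suc n)"
      unfolding GS step_def by (force intro: rev_image_eqI)
    then show ?case ..
  qed
  then have "{a. generated F A P g x y a} \<subseteq> (\<lambda>(x, y, a). a) ` (\<Union>n. G n)"
    by (force intro: rev_image_eqI)
  then show ?thesis
    using small_image[OF small] by (rule small_subset[rotated])
qed

text \<open>Limits are unique, so sending a sequence of generated arrows to its limit covers the
  closure by an image of a small set.\<close>

lemma small_closure_generated:
  fixes A :: "('o, 'a) normed_star_cat"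
  assumes F: "F = \<real> \<or> F = UNIV" and A: "Cstar_category F A" and P: "P \<subseteq> Ob A"
    and gH: "\<And>x y. x \<in> P \<Longrightarrow> y \<in> P \<Longrightarrow> g x y \<subseteq> Hom A x y"
    and "|P| <o \<kappa>" and "\<And>x y. x \<in> P \<Longrightarrow> y \<in> P \<Longrightarrow> |g x y| <o \<kappa>" and x: "x \<in> P" and y: "y \<in> P"
  shows "|closure_generated F A P g x y| <o \<kappa>"
proof -
  interpret A: pre_Cstar_category F A using F A by (rule Cstar_pre)
  define lim where "lim s = (SOME l. l \<in> Hom A x y \<and> (\<lambda>n. Norm A x y (Diff A x y (s n) l)) \<longlonglongrightarrow> 0)" for s :: "nat \<Rightarrow> 'a"
  have "|{s :: nat \<Rightarrow> 'a. range s \<subseteq> {a. generated F A P g x y a}}| <o \<kappa>"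
    using assms by (intro small_sequences small_generated)
  moreover have "closure_generated F A P g x y \<subseteq> lim ` {s. range s \<subseteq> {a. generated F A P g x y a}}"
  proof
    fix l assume "l \<in> closure_generated F A P g x y"
    then obtain s where s: "\<And>n. generated F A P g x y (s n)" "l \<in> Hom A x y"
      "(\<lambda>n. Norm A x y (Diff A x y (s n) l)) \<longlonglongrightarrow> 0"
      unfolding closure_generated_def by blast
    have sH: "s n \<in> Hom A x y" for n using generated_in[OF F A P gH s(1)] by simp
    have "lim s \<in> Hom A x y \<and> (\<lambda>n. Norm A x y (Diff A x y (s n) (lim s))) \<longlonglongrightarrow> 0"
      unfolding lim_def by (rule someI[of _ l]) (use s in blast)
    then have "lim s = l"
      using A.limit_unique[of x y s "lim s" l] x y P sH s by blast
    then show "l \<in> lim ` {s. range s \<subseteq> {a. generated F A P g x y a}}"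
      using s(1) by blast
  qed
  ultimately show ?thesis
    by (meson small_image small_subset)
qed

end

section \<open>Limits and colimits\<close>

lemma mk_arrow_simps [simp]:
  "Src (mk_arrow A B f \<phi>) = A" "Tgt (mk_arrow A B f \<phi>) = B"
  "x \<in> Ob A \<Longrightarrow> obmap (mk_arrow A B f \<phi>) x = f x"
  "x \<in> Ob A \<Longrightarrow> y \<in> Ob A \<Longrightarrow> a \<in> Hom A x y \<Longrightarrow> hommap (mk_arrow A B f \<phi>) x y a = \<phi> x y a"
  by (simp_all add: mk_arrow_def)

lemma mk_arrow_cong:
  assumes "\<And>x. x \<in> Ob A \<Longrightarrow> f x = g x"
    and "\<And>x y a. \<lbrakk>x \<in> Ob A; y \<in> Ob A; a \<in> Hom A x y\<rbrakk> \<Longrightarrow> \<phi> x y a = \<psi> x y a"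
  shows "mk_arrow A B f \<phi> = mk_arrow A B g \<psi>"
  using assms by (auto simp: mk_arrow_def fun_eq_iff)

text \<open>\<open>mk_arrow\<close> alters maps outside the category. Being a *-functor is
  insensitive to this, because all operations stay inside the hom sets.\<close>

lemma star_functor_cong:
  assumes A: "star_category F A" and func: "star_functor F A B f \<phi>"
    and ob: "\<And>x. x \<in> Ob A \<Longrightarrow> g x = f x"
    and hom: "\<And>x y a. \<lbrakk>x \<in> Ob A; y \<in> Ob A; a \<in> Hom A x y\<rbrakk> \<Longrightarrow> \<psi> x y a = \<phi> x y a"
  shows "star_functor F A B g \<psi>"
proof -
  interpret A: star_category F A by (rule A)
  interpret f: star_functor F A B f \<phi> by (rule func)
  show ?thesis
    by unfold_locales
      (simp_all add: ob hom A.unit_closed A.comp_closed A.add_closed A.scale_closed A.star_closed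
        f.ob_closed f.hom_closed f.map_unit f.map_comp f.map_add f.map_scale f.map_star)
qed

lemma C1star_cat_simps [simp]:
  "Obj (C1star_cat F \<kappa>) = small_Cstar_categories F \<kappa>" "Dom (C1star_cat F \<kappa>) = Src" "Cod (C1star_cat F \<kappa>) = Tgt"
  "Ide (C1star_cat F \<kappa>) A = mk_arrow A A id (\<lambda>x y. id)"
  "Cmp (C1star_cat F \<kappa>) \<Psi> \<Phi> = mk_arrow (Src \<Phi>) (Tgt \<Psi>) (obmap \<Psi> \<circ> obmap \<Phi>)
     (\<lambda>x y. hommap \<Psi> (obmap \<Phi> x) (obmap \<Phi> y) \<circ> hommap \<Phi> x y)"
  by (simp_all add: C1star_cat_def)

lemma small_CstarD: "A \<in> small_Cstar_categories F \<kappa> \<Longrightarrow> Cstar_category F A"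
  by (simp add: small_Cstar_categories_def)

locale unitary_model = size_bounded \<mu> \<kappa>
  for \<mu> :: "'j rel" and \<kappa> :: "'u rel" +
  fixes F :: "complex set"
  assumes F: "F = \<real> \<or> F = UNIV"
begin

abbreviation C :: "(('u, 'u) normed_star_cat, ('u, 'u) fun_arrow) cat" where
  "C \<equiv> C1star_cat F \<kappa>"

abbreviation small_cats :: "('u, 'u) normed_star_cat set" where
  "small_cats \<equiv> small_Cstar_categories F \<kappa>"

lemma small_pre: "A \<in> small_cats \<Longrightarrow> pre_Cstar_category F A"
  using Cstar_pre[OF F small_CstarD] .

lemma small_star: "A \<in> small_cats \<Longrightarrow> star_category F A"
  using pre_Cstar_category.axioms(1)[OF small_pre] .

lemma in_hom_mk:
  assumes "A \<in> small_cats" "B \<in> small_cats" "star_functor F A B f \<phi>"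
  shows "in_hom C (mk_arrow A B f \<phi>) A B"
  using assms by (auto simp: in_hom_def C1star_cat_def)

lemma in_homD:
  assumes "in_hom C \<Phi> A B"
  shows "A \<in> small_cats" "B \<in> small_cats" "star_functor F A B (obmap \<Phi>) (hommap \<Phi>)"
    "Src \<Phi> = A" "Tgt \<Phi> = B" "\<Phi> = mk_arrow A B (obmap \<Phi>) (hommap \<Phi>)"
proof -
  obtain f \<phi> where 1: "A \<in> small_cats" "B \<in> small_cats" "star_functor F A B f \<phi>" "\<Phi> = mk_arrow A B f \<phi>"
    using assms by (auto simp: in_hom_def C1star_cat_def)
  then show "A \<in> small_cats" "B \<in> small_cats" "Src \<Phi> = A" "Tgt \<Phi> = B" by simp_all
  show "star_functor F A B (obmap \<Phi>) (hommap \<Phi>)"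
    using small_star[OF 1(1)] 1(3) unfolding 1(4) by (rule star_functor_cong) simp_all
  show "\<Phi> = mk_arrow A B (obmap \<Phi>) (hommap \<Phi>)"
    unfolding 1(4) by (rule mk_arrow_cong) simp_all
qed

lemma arr_in_hom: "\<Phi> \<in> Arr C \<longleftrightarrow> in_hom C \<Phi> (Src \<Phi>) (Tgt \<Phi>)"
  by (simp add: in_hom_def)

lemma arrow_eqI:
  assumes "in_hom C \<Phi> A B" "in_hom C \<Psi> A B" "\<And>x. x \<in> Ob A \<Longrightarrow> obmap \<Phi> x = obmap \<Psi> x"
    "\<And>x y a. \<lbrakk>x \<in> Ob A; y \<in> Ob A; a \<in> Hom A x y\<rbrakk> \<Longrightarrow> hommap \<Phi> x y a = hommap \<Psi> x y a"
  shows "\<Phi> = \<Psi>"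
  using in_homD(6)[OF assms(1)] in_homD(6)[OF assms(2)] mk_arrow_cong[OF assms(3,4)] by simp

lemma in_hom_closed:
  assumes "in_hom C \<Phi> A B"
  shows "x \<in> Ob A \<Longrightarrow> obmap \<Phi> x \<in> Ob B"
    and "\<lbrakk>x \<in> Ob A; y \<in> Ob A; a \<in> Hom A x y\<rbrakk> \<Longrightarrow> hommap \<Phi> x y a \<in> Hom B (obmap \<Phi> x) (obmap \<Phi> y)"
  using star_functor.ob_closed[OF in_homD(3)[OF assms]] star_functor.hom_closed[OF in_homD(3)[OF assms]]
  by blast+

lemma cmp_in_hom:
  assumes "in_hom C \<Phi> A B" "in_hom C \<Psi> B D"
  shows "in_hom C (Cmp C \<Psi> \<Phi>) A D"
  using star_functor_comp[OF in_homD(3)[OF assms(1)] in_homD(3)[OF assms(2)]] in_homD[OF assms(1)] in_homD[OF assms(2)]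
  by (simp add: in_hom_mk)

lemma cmp_apply:
  assumes "in_hom C \<Phi> A B"
  shows "x \<in> Ob A \<Longrightarrow> obmap (Cmp C \<Psi> \<Phi>) x = obmap \<Psi> (obmap \<Phi> x)"
    and "\<lbrakk>x \<in> Ob A; y \<in> Ob A; a \<in> Hom A x y\<rbrakk> \<Longrightarrow>
      hommap (Cmp C \<Psi> \<Phi>) x y a = hommap \<Psi> (obmap \<Phi> x) (obmap \<Phi> y) (hommap \<Phi> x y a)"
  using in_homD(4)[OF assms] by simp_all

lemma ide_in_hom: "A \<in> small_cats \<Longrightarrow> in_hom C (Ide C A) A A"
  by (simp add: in_hom_mk star_functor_id)

lemma C_category: "category C"
proof
  fix f assume "f \<in> Arr C"
  then have "in_hom C f (Src f) (Tgt f)" by (simp add: arr_in_hom)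
  then show "Dom C f \<in> Obj C" "Cod C f \<in> Obj C" using in_homD(1,2) by simp_all
next
  fix x assume "x \<in> Obj C"
  then show "in_hom C (Ide C x) x x" using ide_in_hom by simp
next
  fix f g x y z assume "in_hom C f x y" "in_hom C g y z"
  then show "in_hom C (Cmp C g f) x z" by (rule cmp_in_hom)
next
  fix f g h w x y z assume f: "in_hom C f w x" and g: "in_hom C g x y" and h: "in_hom C h y z"
  show "Cmp C h (Cmp C g f) = Cmp C (Cmp C h g) f"
    by (rule arrow_eqI[OF cmp_in_hom[OF cmp_in_hom[OF f g] h] cmp_in_hom[OF f cmp_in_hom[OF g h]]])
      (simp_all add: cmp_apply[OF f] cmp_apply[OF g] cmp_apply[OF cmp_in_hom[OF f g]] in_hom_closed[OF f]
        del: C1star_cat_simps)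
next
  fix f x y assume f: "in_hom C f x y"
  note i = ide_in_hom[OF in_homD(1)[OF f]] ide_in_hom[OF in_homD(2)[OF f]]
  show "Cmp C f (Ide C x) = f"
    by (rule arrow_eqI[OF cmp_in_hom[OF i(1) f] f]) simp_all
  show "Cmp C (Ide C y) f = f"
    by (rule arrow_eqI[OF cmp_in_hom[OF f i(2)] f])
      (simp_all add: cmp_apply[OF f] in_hom_closed[OF f] del: C1star_cat_simps(5))
qed

lemma limits: "small_limits \<mu> C"
  unfolding small_limits_def
proof (intro allI impI)
  fix J :: "('j, 'j) cat" and D \<Delta>
  assume *: "category J \<and> |Obj J| <o \<mu> \<and> |Arr J| <o \<mu> \<and> diagram J C D \<Delta>"
  then have J: "category J" and I: "|Obj J| <o \<mu>" and diag: "diagram J C D \<Delta>" by simp_all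
  define I where "I = Obj J"
  \<comment> \<open>The equalizer conditions are indexed by arrows together with their ends, since
    the target \<open>D j\<close> of a condition depends on the end.\<close>
  define T where "T = {(t, i, j). in_hom J t i j}"
  have T: "i \<in> I" "j \<in> I" "in_hom C (\<Delta> t) (D i) (D j)" if "(t, i, j) \<in> T" for t i j
  proof -
    have "in_hom J t i j" using that by (simp add: T_def)
    then show "i \<in> I" "j \<in> I" "in_hom C (\<Delta> t) (D i) (D j)"
      using category.dom_obj[OF J, of t] category.cod_obj[OF J, of t] diag
      by (auto simp: in_hom_def diagram_def I_def)
  qed
  have D: "D i \<in> small_cats" "Cstar_category F (D i)" if "i \<in> I" for i
  proof -
    show "D i \<in> small_cats" using diag that by (auto simp: diagram_def I_def)
    then show "Cstar_category F (D i)" by (rule small_CstarD)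
  qed
  let ?P = "prod_cat I D"
  have P: "Cstar_category F ?P" by (rule prod_cat_Cstar[OF F D(2)])
  have proj: "star_functor F ?P (D i) (\<lambda>x. x i) (\<lambda>x y a. a i)" if "i \<in> I" for i
    by (rule prod_cat_proj[OF F D(2) that])
  define Q where "Q = sub_cat ?P {x \<in> Ob ?P. \<forall>p\<in>T. (case p of (t, i, j) \<Rightarrow> obmap (\<Delta> t) (x i)) = (case p of (t, i, j) \<Rightarrow> x j)}
    (\<lambda>x y. {a \<in> Hom ?P x y. \<forall>p\<in>T. (case p of (t, i, j) \<Rightarrow> hommap (\<Delta> t) (x i) (y i) (a i)) = (case p of (t, i, j) \<Rightarrow> a j)})"
  have Q: "Cstar_category F Q"
    unfolding Q_def
  proof (rule equalizer_Cstar[OF F P, where B = "\<lambda>(t, i, j). D j"])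
    fix p assume p: "p \<in> T"
    obtain t i j where [simp]: "p = (t, i, j)" by (cases p)
    show "Cstar_category F (case p of (t, i, j) \<Rightarrow> D j)" using T[of t i j] D p by simp
    show "star_functor F ?P (case p of (t, i, j) \<Rightarrow> D j) (\<lambda>x. case p of (t, i, j) \<Rightarrow> x j)
        (\<lambda>x y a. case p of (t, i, j) \<Rightarrow> a j)"
      using proj[of j] T[of t i j] p by simp
    show "star_functor F ?P (case p of (t, i, j) \<Rightarrow> D j) (\<lambda>x. case p of (t, i, j) \<Rightarrow> obmap (\<Delta> t) (x i))
        (\<lambda>x y a. case p of (t, i, j) \<Rightarrow> hommap (\<Delta> t) (x i) (y i) (a i))"
      using star_functor_comp[OF proj[of i] in_homD(3)[OF T(3)[of t i j]]] T[of t i j] p by (simp add: comp_def)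
  qed
  have ObQ: "x \<in> Ob Q \<longleftrightarrow> x \<in> Ob ?P \<and> (\<forall>t i j. in_hom J t i j \<longrightarrow> obmap (\<Delta> t) (x i) = x j)" for x
    by (auto simp: Q_def T_def)
  have HomQ: "a \<in> Hom Q x y \<longleftrightarrow> a \<in> Hom ?P x y \<and> (\<forall>t i j. in_hom J t i j \<longrightarrow> hommap (\<Delta> t) (x i) (y i) (a i) = a j)" for a x y
    by (auto simp: Q_def T_def)
  have QP: "star_functor F Q ?P id (\<lambda>x y. id)"
    unfolding Q_def by (rule sub_cat_functor) auto
  \<comment> \<open>Objects and arrows of the product are families with fewer than \<mu> entries;
    this is where powers with such exponents have to be small.\<close>
  have "|Ob ?P| <o \<kappa>"
    unfolding prod_cat_def using D(1) I by (auto simp: I_def small_Cstar_categories_def intro: small_PiE)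
  then have sQ: "|Ob Q| <o \<kappa>" by (rule small_subset) (auto simp: ObQ)
  have hQ: "|Hom Q x y| <o \<kappa>" if "x \<in> Ob Q" "y \<in> Ob Q" for x y
  proof -
    have "|\<Pi>\<^sub>E i\<in>I. Hom (D i) (x i) (y i)| <o \<kappa>"
    proof (rule small_PiE)
      fix i assume i: "i \<in> I"
      have "x i \<in> Ob (D i)" "y i \<in> Ob (D i)"
        using that i by (auto simp: ObQ prod_cat_def)
      then show "|Hom (D i) (x i) (y i)| <o \<kappa>"
        using D(1)[OF i] by (simp add: small_Cstar_categories_def)
    qed (simp add: I_def I)
    then show ?thesis
      by (rule small_subset) (auto simp: HomQ prod_cat_def)
  qed
  obtain L :: "('u, 'u) normed_star_cat" and e \<epsilon> d \<delta> where L: "L \<in> small_cats"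
    and enc: "star_functor F Q L e \<epsilon>" and dec: "star_functor F L Q d \<delta>"
    and de: "\<And>x. x \<in> Ob Q \<Longrightarrow> d (e x) = x"
      "\<And>x y a. \<lbrakk>x \<in> Ob Q; y \<in> Ob Q; a \<in> Hom Q x y\<rbrakk> \<Longrightarrow> \<delta> (e x) (e y) (\<epsilon> x y a) = a"
    and ed: "\<And>x. x \<in> Ob L \<Longrightarrow> e (d x) = x"
      "\<And>x y a. \<lbrakk>x \<in> Ob L; y \<in> Ob L; a \<in> Hom L x y\<rbrakk> \<Longrightarrow> \<epsilon> (d x) (d y) (\<delta> x y a) = a"
    by (rule small_copy[OF F Q sQ hQ]; (assumption | rule that))
  interpret enc: star_functor F Q L e \<epsilon> by (rule enc)
  interpret dec: star_functor F L Q d \<delta> by (rule dec)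
  define \<pi> where "\<pi> i = mk_arrow L (D i) (\<lambda>x. d x i) (\<lambda>x y a. \<delta> x y a i)" for i
  have \<pi>: "in_hom C (\<pi> i) L (D i)" if "i \<in> I" for i
    unfolding \<pi>_def
    using star_functor_comp[OF star_functor_comp[OF dec QP] proj[OF that]] L D(1)[OF that]
    by (intro in_hom_mk) (simp_all add: comp_def)
  have cone: "cone J C D \<Delta> L \<pi>"
    unfolding cone_def
  proof (intro conjI allI impI ballI)
    show "L \<in> Obj C" using L by simp
    show "in_hom C (\<pi> i) L (D i)" if "i \<in> Obj J" for i using \<pi> that by (simp add: I_def)
    fix t i j assume t: "in_hom J t i j"
    then have tT: "(t, i, j) \<in> T" by (simp add: T_def)
    show "Cmp C (\<Delta> t) (\<pi> i) = \<pi> j"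
    proof (rule arrow_eqI[OF cmp_in_hom[OF \<pi>[OF T(1)[OF tT]] T(3)[OF tT]] \<pi>[OF T(2)[OF tT]]])
      fix x assume x: "x \<in> Ob L"
      show "obmap (Cmp C (\<Delta> t) (\<pi> i)) x = obmap (\<pi> j) x"
        using dec.ob_closed[OF x] t x by (simp add: \<pi>_def ObQ)
      fix y a assume y: "y \<in> Ob L" and a: "a \<in> Hom L x y"
      show "hommap (Cmp C (\<Delta> t) (\<pi> i)) x y a = hommap (\<pi> j) x y a"
        using dec.hom_closed[OF x y a] t x y a by (simp add: \<pi>_def HomQ)
    qed
  qed
  have "\<exists>!h. in_hom C h K L \<and> (\<forall>i\<in>Obj J. Cmp C (\<pi> i) h = \<rho> i)" if "cone J C D \<Delta> K \<rho>" for K \<rho>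
  proof -
    have K: "K \<in> small_cats" and \<rho>: "\<And>i. i \<in> I \<Longrightarrow> in_hom C (\<rho> i) K (D i)"
      and comm: "\<And>t i j. in_hom J t i j \<Longrightarrow> Cmp C (\<Delta> t) (\<rho> i) = \<rho> j"
      using that by (auto simp: cone_def I_def)
    define f where "f x = (\<lambda>i\<in>I. obmap (\<rho> i) x)" for x
    define \<phi> where "\<phi> x y a = (\<lambda>i\<in>I. hommap (\<rho> i) x y a)" for x y a
    have KP: "star_functor F K ?P f \<phi>"
      unfolding f_def \<phi>_def by (rule prod_cat_pair[OF F D(2) small_CstarD[OF K] in_homD(3)[OF \<rho>]])
    interpret KP: star_functor F K ?P f \<phi> by (rule KP)
    have KQ: "star_functor F K Q f \<phi>"
      unfolding Q_def
    proof (rule sub_cat_corestrict[OF KP]; unfold mem_Collect_eq; intro conjI ballI)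
      fix x p assume x: "x \<in> Ob K" and p: "p \<in> T"
      obtain t i j where [simp]: "p = (t, i, j)" by (cases p)
      have t: "in_hom J t i j" "i \<in> I" "j \<in> I" using p T[of t i j] by (auto simp: T_def)
      show "(case p of (t, i, j) \<Rightarrow> obmap (\<Delta> t) (f x i)) = (case p of (t, i, j) \<Rightarrow> f x j)"
        using t x comm[OF t(1)] cmp_apply(1)[OF \<rho>[OF t(2)] x, of "\<Delta> t"] by (simp add: f_def)
      fix y a assume y: "y \<in> Ob K" and a: "a \<in> Hom K x y"
      show "(case p of (t, i, j) \<Rightarrow> hommap (\<Delta> t) (f x i) (f y i) (\<phi> x y a i)) = (case p of (t, i, j) \<Rightarrow> \<phi> x y a j)"
        using t x y a comm[OF t(1)] cmp_apply(2)[OF \<rho>[OF t(2)] x y a, of "\<Delta> t"] by (simp add: f_def \<phi>_def)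
    qed (use KP.ob_closed KP.hom_closed in auto)
    interpret KQ: star_functor F K Q f \<phi> by (rule KQ)
    \<comment> \<open>The legs of the cone are paired into the bounded product; the pairing lands in
      the equalizer and is then encoded.\<close>
    define h where "h = mk_arrow K L (e \<circ> f) (\<lambda>x y. \<epsilon> (f x) (f y) \<circ> \<phi> x y)"
    have h: "in_hom C h K L"
      unfolding h_def by (rule in_hom_mk[OF K L star_functor_comp[OF KQ enc]])
    show ?thesis
    proof (rule ex1I[of _ h], intro conjI ballI h)
      fix i assume "i \<in> Obj J"
      then have i: "i \<in> I" by (simp add: I_def)
      show "Cmp C (\<pi> i) h = \<rho> i"
      proof (rule arrow_eqI[OF cmp_in_hom[OF h \<pi>[OF i]] \<rho>[OF i]])
        fix x assume x: "x \<in> Ob K"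
        show "obmap (Cmp C (\<pi> i) h) x = obmap (\<rho> i) x"
          unfolding cmp_apply(1)[OF h x] using x i by (simp add: h_def \<pi>_def enc.ob_closed KQ.ob_closed de) (simp add: f_def)
        fix y a assume y: "y \<in> Ob K" and a: "a \<in> Hom K x y"
        show "hommap (Cmp C (\<pi> i) h) x y a = hommap (\<rho> i) x y a"
          unfolding cmp_apply(2)[OF h x y a] using x y a i
          by (simp add: h_def \<pi>_def enc.ob_closed enc.hom_closed KQ.ob_closed KQ.hom_closed de) (simp add: \<phi>_def)
      qed
    next
      fix h' assume "in_hom C h' K L \<and> (\<forall>i\<in>Obj J. Cmp C (\<pi> i) h' = \<rho> i)"
      then have h': "in_hom C h' K L" and eq: "\<And>i. i \<in> I \<Longrightarrow> Cmp C (\<pi> i) h' = \<rho> i" by (auto simp: I_def)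
      note h'c = in_hom_closed[OF h']
      have ob: "d (obmap h' x) = f x" if x: "x \<in> Ob K" for x
      proof -
        have "d (obmap h' x) \<in> Ob ?P" "f x \<in> Ob ?P"
          using dec.ob_closed[OF h'c(1)[OF x]] KP.ob_closed[OF x] by (simp_all add: ObQ)
        moreover have "d (obmap h' x) i = f x i" if i: "i \<in> I" for i
          using cmp_apply(1)[OF h' x, of "\<pi> i"] eq[OF i] i h'c(1)[OF x] by (simp add: \<pi>_def f_def)
        ultimately show ?thesis by (auto simp: prod_cat_def intro: PiE_ext)
      qed
      have hom: "\<delta> (obmap h' x) (obmap h' y) (hommap h' x y a) = \<phi> x y a"
        if x: "x \<in> Ob K" and y: "y \<in> Ob K" and a: "a \<in> Hom K x y" for x y a
      proof -
        have "\<delta> (obmap h' x) (obmap h' y) (hommap h' x y a) \<in> Hom ?P (f x) (f y)" "\<phi> x y a \<in> Hom ?P (f x) (f y)"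
          using dec.hom_closed[OF h'c(1)[OF x] h'c(1)[OF y] h'c(2)[OF x y a]] KP.hom_closed[OF x y a]
          by (simp_all add: HomQ ob x y)
        moreover have "\<delta> (obmap h' x) (obmap h' y) (hommap h' x y a) i = \<phi> x y a i" if i: "i \<in> I" for i
          using cmp_apply(2)[OF h' x y a, of "\<pi> i"] eq[OF i] i h'c(1)[OF x] h'c(1)[OF y] h'c(2)[OF x y a]
          by (simp add: \<pi>_def \<phi>_def)
        ultimately show ?thesis by (auto simp: prod_cat_def intro: PiE_ext)
      qed
      show "h' = h"
      proof (rule arrow_eqI[OF h' h])
        fix x assume x: "x \<in> Ob K"
        show "obmap h' x = obmap h x"
          using ed(1)[OF h'c(1)[OF x]] ob[OF x] x by (simp add: h_def)
        fix y a assume y: "y \<in> Ob K" and a: "a \<in> Hom K x y"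
        show "hommap h' x y a = hommap h x y a"
          using ed(2)[OF h'c(1)[OF x] h'c(1)[OF y] h'c(2)[OF x y a]] ob[OF x] ob[OF y] hom[OF x y a] x y a
          by (simp add: h_def)
      qed
    qed
  qed
  then show "\<exists>l \<pi>. is_limit J C D \<Delta> l \<pi>"
    using cone unfolding is_limit_def by blast
qed

text \<open>
  The colimit is the closed subcategory generated by the diagram inside the product of all cocones.
  That product need not be small, but the subcategory is, and every cocone is one of the projections.
\<close>

lemma colimits: "small_colimits \<mu> C"
  unfolding small_colimits_def
proof (intro allI impI)
  fix J :: "('j, 'j) cat" and D \<Delta>
  assume *: "category J \<and> |Obj J| <o \<mu> \<and> |Arr J| <o \<mu> \<and> diagram J C D \<Delta>"
  then have J: "category J" and I: "|Obj J| <o \<mu>" and diag: "diagram J C D \<Delta>" by simp_all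
  define I where "I = Obj J"
  have D: "D i \<in> small_cats" "Cstar_category F (D i)" if "i \<in> I" for i
  proof -
    show "D i \<in> small_cats" using diag that by (auto simp: diagram_def I_def)
    then show "Cstar_category F (D i)" by (rule small_CstarD)
  qed
  \<comment> \<open>All cocones with small vertex, in any number: \<open>prod_cat\<close> accepts
    index sets of every size.\<close>
  define W where "W = {(K, \<rho>). cocone J C D \<Delta> K \<rho>}"
  have W: "fst c \<in> small_cats" "Cstar_category F (fst c)" "\<And>i. i \<in> I \<Longrightarrow> in_hom C (snd c i) (D i) (fst c)"
    "\<And>t i j. in_hom J t i j \<Longrightarrow> Cmp C (snd c j) (\<Delta> t) = snd c i" if "c \<in> W" for c
  proof -
    show "fst c \<in> small_cats" "\<And>i. i \<in> I \<Longrightarrow> in_hom C (snd c i) (D i) (fst c)"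
      "\<And>t i j. in_hom J t i j \<Longrightarrow> Cmp C (snd c j) (\<Delta> t) = snd c i"
      using that by (auto simp: W_def cocone_def I_def)
    then show "Cstar_category F (fst c)" by (intro small_CstarD)
  qed
  let ?P = "prod_cat W fst"
  have P: "Cstar_category F ?P" by (rule prod_cat_Cstar[OF F W(2)])
  have proj: "star_functor F ?P (fst c) (\<lambda>x. x c) (\<lambda>x y a. a c)" if "c \<in> W" for c
    by (rule prod_cat_proj[OF F W(2) that])
  define k where "k i x = (\<lambda>c\<in>W. obmap (snd c i) x)" for i x
  define \<eta> where "\<eta> i x y a = (\<lambda>c\<in>W. hommap (snd c i) x y a)" for i x y a
  have DP: "star_functor F (D i) ?P (k i) (\<eta> i)" if i: "i \<in> I" for i
    unfolding k_def \<eta>_def by (rule prod_cat_pair[OF F W(2) D(2)[OF i] in_homD(3)[OF W(3)[OF _ i]]])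
  define V where "V = (\<Union>i\<in>I. k i ` Ob (D i))"
  \<comment> \<open>\<open>k i\<close> may identify objects, and different \<open>D i\<close> may
    meet in \<open>V\<close>, so all preimages of both ends contribute arrows.\<close>
  define g where "g x y = (\<Union>i\<in>I. \<Union>x'\<in>{x'\<in>Ob (D i). k i x' = x}. \<Union>y'\<in>{y'\<in>Ob (D i). k i y' = y}. \<eta> i x' y' ` Hom (D i) x' y')" for x y
  have V: "V \<subseteq> Ob ?P"
    using star_functor.ob_closed[OF DP] by (auto simp: V_def)
  have g: "g x y \<subseteq> Hom ?P x y" for x y
    using star_functor.hom_closed[OF DP] by (auto simp: g_def)
  let ?S = "closure_generated F ?P V g"
  define Q where "Q = sub_cat ?P V ?S"
  have Q: "Cstar_category F Q"
    unfolding Q_def using F P V g by (rule closure_generated_Cstar)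
  have smallI: "|I| <o \<kappa>" using less_\<mu>_less_\<kappa>[OF I] by (simp add: I_def)
  have smallD: "|Ob (D i)| <o \<kappa>" "\<And>x y. x \<in> Ob (D i) \<Longrightarrow> y \<in> Ob (D i) \<Longrightarrow> |Hom (D i) x y| <o \<kappa>" if "i \<in> I" for i
    using D(1)[OF that] by (auto simp: small_Cstar_categories_def)
  have smallV: "|V| <o \<kappa>"
    unfolding V_def using smallI smallD by (intro small_UN small_image)
  have smallg: "|g x y| <o \<kappa>" for x y
    unfolding g_def
  proof (rule small_UN[OF smallI], rule small_UN)
    fix i assume i: "i \<in> I"
    have sub: "|{z \<in> Ob (D i). k i z = w}| <o \<kappa>" for w using smallD(1)[OF i] by (rule small_subset) auto
    show "|{x' \<in> Ob (D i). k i x' = x}| <o \<kappa>" by (rule sub)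
    fix x' assume x': "x' \<in> {x' \<in> Ob (D i). k i x' = x}"
    show "|\<Union>y'\<in>{y' \<in> Ob (D i). k i y' = y}. \<eta> i x' y' ` Hom (D i) x' y'| <o \<kappa>"
      using sub smallD(2)[OF i] x' by (intro small_UN small_image) auto
  qed
  have sQ: "|Ob Q| <o \<kappa>" using smallV by (simp add: Q_def)
  have hQ: "|Hom Q x y| <o \<kappa>" if "x \<in> Ob Q" "y \<in> Ob Q" for x y
    using small_closure_generated[OF F P V g smallV smallg] that by (simp add: Q_def)
  obtain L :: "('u, 'u) normed_star_cat" and e \<epsilon> d \<delta> where L: "L \<in> small_cats"
    and enc: "star_functor F Q L e \<epsilon>" and dec: "star_functor F L Q d \<delta>"
    and de: "\<And>x. x \<in> Ob Q \<Longrightarrow> d (e x) = x"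
      "\<And>x y a. \<lbrakk>x \<in> Ob Q; y \<in> Ob Q; a \<in> Hom Q x y\<rbrakk> \<Longrightarrow> \<delta> (e x) (e y) (\<epsilon> x y a) = a"
    and ed: "\<And>x. x \<in> Ob L \<Longrightarrow> e (d x) = x"
      "\<And>x y a. \<lbrakk>x \<in> Ob L; y \<in> Ob L; a \<in> Hom L x y\<rbrakk> \<Longrightarrow> \<epsilon> (d x) (d y) (\<delta> x y a) = a"
    by (rule small_copy[OF F Q sQ hQ]; (assumption | rule that))
  interpret enc: star_functor F Q L e \<epsilon> by (rule enc)
  interpret dec: star_functor F L Q d \<delta> by (rule dec)
  have gI: "\<eta> i x y a \<in> g (k i x) (k i y)" if "i \<in> I" "x \<in> Ob (D i)" "y \<in> Ob (D i)" "a \<in> Hom (D i) x y" for i x y a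
    using that unfolding g_def by blast
  have DQ: "star_functor F (D i) Q (k i) (\<eta> i)" if i: "i \<in> I" for i
    unfolding Q_def
  proof (rule sub_cat_corestrict[OF DP[OF i]])
    show kV: "k i x \<in> V" if "x \<in> Ob (D i)" for x using i that by (auto simp: V_def)
    fix x y a assume x: "x \<in> Ob (D i)" and y: "y \<in> Ob (D i)" and a: "a \<in> Hom (D i) x y"
    show "\<eta> i x y a \<in> ?S (k i x) (k i y)"
      using generated.base[of "k i x" V "k i y" "\<eta> i x y a" g F ?P] kV[OF x] kV[OF y] gI[OF i x y a]
      by (intro generated_closure[OF F P V g]) simp
  qed
  define \<iota> where "\<iota> i = mk_arrow (D i) L (e \<circ> k i) (\<lambda>x y. \<epsilon> (k i x) (k i y) \<circ> \<eta> i x y)" for i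
  have \<iota>: "in_hom C (\<iota> i) (D i) L" if "i \<in> I" for i
    unfolding \<iota>_def by (rule in_hom_mk[OF D(1)[OF that] L star_functor_comp[OF DQ[OF that] enc]])
  have cocone: "cocone J C D \<Delta> L \<iota>"
    unfolding cocone_def
  proof (intro conjI allI impI ballI)
    show "L \<in> Obj C" using L by simp
    show "in_hom C (\<iota> i) (D i) L" if "i \<in> Obj J" for i using \<iota> that by (simp add: I_def)
    fix t i j assume t: "in_hom J t i j"
    then have ij: "i \<in> I" "j \<in> I" and \<Delta>: "in_hom C (\<Delta> t) (D i) (D j)"
      using category.dom_obj[OF J, of t] category.cod_obj[OF J, of t] diag
      by (auto simp: in_hom_def diagram_def I_def)
    have k: "k j (obmap (\<Delta> t) x) = k i x" if x: "x \<in> Ob (D i)" for x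
      unfolding k_def
    proof (rule restrict_ext)
      fix c assume c: "c \<in> W"
      show "obmap (snd c j) (obmap (\<Delta> t) x) = obmap (snd c i) x"
        using W(4)[OF c t] cmp_apply(1)[OF \<Delta> x, of "snd c j"] by simp
    qed
    have \<eta>: "\<eta> j (obmap (\<Delta> t) x) (obmap (\<Delta> t) y) (hommap (\<Delta> t) x y a) = \<eta> i x y a"
      if x: "x \<in> Ob (D i)" and y: "y \<in> Ob (D i)" and a: "a \<in> Hom (D i) x y" for x y a
      unfolding \<eta>_def
    proof (rule restrict_ext)
      fix c assume c: "c \<in> W"
      show "hommap (snd c j) (obmap (\<Delta> t) x) (obmap (\<Delta> t) y) (hommap (\<Delta> t) x y a) = hommap (snd c i) x y a"
        using W(4)[OF c t] cmp_apply(2)[OF \<Delta> x y a, of "snd c j"] by simp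
    qed
    show "Cmp C (\<iota> j) (\<Delta> t) = \<iota> i"
    proof (rule arrow_eqI[OF cmp_in_hom[OF \<Delta> \<iota>[OF ij(2)]] \<iota>[OF ij(1)]])
      fix x assume x: "x \<in> Ob (D i)"
      show "obmap (Cmp C (\<iota> j) (\<Delta> t)) x = obmap (\<iota> i) x"
        unfolding cmp_apply(1)[OF \<Delta> x] using in_hom_closed(1)[OF \<Delta> x] x by (simp add: \<iota>_def k)
      fix y a assume y: "y \<in> Ob (D i)" and a: "a \<in> Hom (D i) x y"
      show "hommap (Cmp C (\<iota> j) (\<Delta> t)) x y a = hommap (\<iota> i) x y a"
        unfolding cmp_apply(2)[OF \<Delta> x y a]
        using in_hom_closed(1)[OF \<Delta> x] in_hom_closed(1)[OF \<Delta> y] in_hom_closed(2)[OF \<Delta> x y a] x y a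
        by (simp add: \<iota>_def k \<eta>)
    qed
  qed
  have "\<exists>!h. in_hom C h L K \<and> (\<forall>i\<in>Obj J. Cmp C h (\<iota> i) = \<rho> i)" if "cocone J C D \<Delta> K \<rho>" for K \<rho>
  proof -
    \<comment> \<open>The given cocone is itself one of the indices; the projection to it,
      restricted to the generated subcategory, is the mediating arrow.\<close>
    define c where "c = (K, \<rho>)"
    have c: "c \<in> W" using that by (simp add: W_def c_def)
    have K: "K \<in> small_cats" and \<rho>: "\<And>i. i \<in> I \<Longrightarrow> in_hom C (\<rho> i) (D i) K"
      using W(1,3)[OF c] by (simp_all add: c_def)
    have QP: "star_functor F Q ?P id (\<lambda>x y. id)"
      unfolding Q_def using V by (rule sub_cat_functor) (auto simp: closure_generated_def)
    have "star_functor F ?P K (\<lambda>x. x c) (\<lambda>x y a. a c)"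
      using proj[OF c] by (simp add: c_def)
    from star_functor_comp[OF star_functor_comp[OF dec QP] this]
    have LK: "star_functor F L K (\<lambda>x. d x c) (\<lambda>x y a. \<delta> x y a c)" by (simp add: comp_def)
    define h where "h = mk_arrow L K (\<lambda>x. d x c) (\<lambda>x y a. \<delta> x y a c)"
    have h: "in_hom C h L K" unfolding h_def by (rule in_hom_mk[OF L K LK])
    have h\<iota>: "Cmp C h (\<iota> i) = \<rho> i" if i: "i \<in> I" for i
    proof -
      interpret DQ: star_functor F "D i" Q "k i" "\<eta> i" by (rule DQ[OF i])
      show ?thesis
      proof (rule arrow_eqI[OF cmp_in_hom[OF \<iota>[OF i] h] \<rho>[OF i]])
        fix x assume x: "x \<in> Ob (D i)"
        show "obmap (Cmp C h (\<iota> i)) x = obmap (\<rho> i) x"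
          unfolding cmp_apply(1)[OF \<iota>[OF i] x] using x c
          by (simp add: h_def \<iota>_def enc.ob_closed DQ.ob_closed de) (simp add: k_def c_def)
        fix y a assume y: "y \<in> Ob (D i)" and a: "a \<in> Hom (D i) x y"
        show "hommap (Cmp C h (\<iota> i)) x y a = hommap (\<rho> i) x y a"
          unfolding cmp_apply(2)[OF \<iota>[OF i] x y a] using x y a c
          by (simp add: h_def \<iota>_def enc.ob_closed enc.hom_closed DQ.ob_closed DQ.hom_closed de) (simp add: \<eta>_def c_def)
      qed
    qed
    show ?thesis
    proof (rule ex1I[of _ h], intro conjI ballI h)
      show "Cmp C h (\<iota> i) = \<rho> i" if "i \<in> Obj J" for i using h\<iota> that by (simp add: I_def)
      fix h' assume "in_hom C h' L K \<and> (\<forall>i\<in>Obj J. Cmp C h' (\<iota> i) = \<rho> i)"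
      then have h': "in_hom C h' L K" and eq: "\<And>i. i \<in> I \<Longrightarrow> Cmp C h' (\<iota> i) = Cmp C h (\<iota> i)"
        by (simp_all add: I_def h\<iota> del: C1star_cat_simps)
      have ob: "obmap h' (e x) = obmap h (e x)" if x: "x \<in> V" for x
      proof -
        obtain i z where i: "i \<in> I" and z: "z \<in> Ob (D i)" and [simp]: "x = k i z" using x by (auto simp: V_def)
        show ?thesis
          using arg_cong[OF eq[OF i], of "\<lambda>\<Phi>. obmap \<Phi> z"] unfolding cmp_apply(1)[OF \<iota>[OF i] z]
          using z by (simp add: \<iota>_def)
      qed
      have hom: "hommap h' (e x) (e y) (\<epsilon> x y a) = hommap h (e x) (e y) (\<epsilon> x y a)" if "a \<in> g x y" for x y a
      proof -
        obtain i x' y' a' where i: "i \<in> I" and x': "x' \<in> Ob (D i)" "k i x' = x" and y': "y' \<in> Ob (D i)" "k i y' = y"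
          and a': "a' \<in> Hom (D i) x' y'" "a = \<eta> i x' y' a'"
          using \<open>a \<in> g x y\<close> unfolding g_def by blast
        show ?thesis
          using arg_cong[OF eq[OF i], of "\<lambda>\<Phi>. hommap \<Phi> x' y' a'"] unfolding cmp_apply(2)[OF \<iota>[OF i] x'(1) y'(1) a'(1)]
          using x' y' a' by (simp add: \<iota>_def)
      qed
      \<comment> \<open>Both arrows agree on the image of the diagram, whose generated arrows are
        dense, so \<open>closure_generated_functors_agree\<close> applies.\<close>
      have agree: "hommap h' (e x) (e y) (\<epsilon> x y a) = hommap h (e x) (e y) (\<epsilon> x y a)"
        if "x \<in> V" "y \<in> V" "a \<in> ?S x y" for x y a
        using closure_generated_functors_agree[OF F P V g small_CstarD[OF K]
            star_functor_comp[OF enc[unfolded Q_def] in_homD(3)[OF h']] star_functor_comp[OF enc[unfolded Q_def] in_homD(3)[OF h]]]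
          that ob hom by simp
      show "h' = h"
      proof (rule arrow_eqI[OF h' h])
        fix x assume x: "x \<in> Ob L"
        show "obmap h' x = obmap h x"
          using ob[of "d x"] dec.ob_closed[OF x] ed(1)[OF x] by (simp add: Q_def)
        fix y a assume y: "y \<in> Ob L" and a: "a \<in> Hom L x y"
        show "hommap h' x y a = hommap h x y a"
          using agree[of "d x" "d y" "\<delta> x y a"] dec.ob_closed[OF x] dec.ob_closed[OF y] dec.hom_closed[OF x y a]
            ed(1)[OF x] ed(1)[OF y] ed(2)[OF x y a] by (simp add: Q_def)
      qed
    qed
  qed
  then show "\<exists>l \<iota>. is_colimit J C D \<Delta> l \<iota>"
    using cocone unfolding is_colimit_def by blast
qed

end

section \<open>Unitary equivalences\<close>

text \<open>\<open>v a u\<^sup>*\<close> for \<open>u\<close> from \<open>x\<close> to \<open>x'\<close>, \<open>v\<close> from \<open>y\<close> to \<open>y'\<close> and \<open>a\<close> from \<open>x\<close> to \<open>y\<close>.\<close>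

definition conjugate ::
    "('o, 'a) normed_star_cat \<Rightarrow> 'o \<Rightarrow> 'o \<Rightarrow> 'o \<Rightarrow> 'o \<Rightarrow> 'a \<Rightarrow> 'a \<Rightarrow> 'a \<Rightarrow> 'a" where
  "conjugate A x x' y y' u v a = Comp A x' x y' (Comp A x y y' v a) (Star A x x' u)"

context star_category
begin

lemma unitaryD:
  assumes "unitary A x y u"
  shows "u \<in> Hom A x y" "Comp A x y x (Star A x y u) u = Unit A x" "Comp A y x y u (Star A x y u) = Unit A y"
  using assms by (simp_all add: unitary_def)

lemma star_unit: "x \<in> Ob A \<Longrightarrow> Star A x x (Unit A x) = Unit A x"
  by (metis comp_unit_right star_closed star_comp star_star unit_closed)

lemma unitary_unit: "x \<in> Ob A \<Longrightarrow> unitary A x x (Unit A x)"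
  by (simp add: unitary_def unit_closed star_unit comp_unit_left)

lemma unitary_star: "x \<in> Ob A \<Longrightarrow> y \<in> Ob A \<Longrightarrow> unitary A x y u \<Longrightarrow> unitary A y x (Star A x y u)"
  by (simp add: unitary_def star_closed star_star)

lemma unitary_cancel:
  assumes "x \<in> Ob A" "y \<in> Ob A" "z \<in> Ob A" "unitary A x y u"
  shows "a \<in> Hom A z x \<Longrightarrow> Comp A z y x (Star A x y u) (Comp A z x y u a) = a"
    and "a \<in> Hom A z y \<Longrightarrow> Comp A z x y u (Comp A z y x (Star A x y u) a) = a"
  using unitaryD[OF assms(4)] assms(1-3)
  by (simp_all add: comp_assoc[symmetric] star_closed comp_unit_left)

lemma unitary_comp:
  assumes x: "x \<in> Ob A" and y: "y \<in> Ob A" and z: "z \<in> Ob A" and u: "unitary A x y u" and v: "unitary A y z v"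
  shows "unitary A x z (Comp A x y z v u)"
proof -
  note h = x y z unitaryD(1)[OF u] unitaryD(1)[OF v]
  have "Comp A x z x (Comp A z y x (Star A x y u) (Star A y z v)) (Comp A x y z v u) =
      Comp A x y x (Star A x y u) (Comp A x z y (Star A y z v) (Comp A x y z v u))"
    using h by (simp add: comp_assoc star_closed comp_closed)
  also have "\<dots> = Unit A x"
    using unitary_cancel(1)[OF y z x v h(4)] unitaryD(2)[OF u] by simp
  finally have 1: "Comp A x z x (Comp A z y x (Star A x y u) (Star A y z v)) (Comp A x y z v u) = Unit A x" .
  have "Comp A z x z (Comp A x y z v u) (Comp A z y x (Star A x y u) (Star A y z v)) =
      Comp A z y z v (Comp A z x y u (Comp A z y x (Star A x y u) (Star A y z v)))"
    using h by (simp add: comp_assoc star_closed comp_closed)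
  also have "\<dots> = Unit A z"
    using unitary_cancel(2)[OF x y z u star_closed[OF y z h(5)]] unitaryD(3)[OF v] by simp
  finally show ?thesis
    using 1 h by (simp add: unitary_def comp_closed star_comp)
qed

context
  fixes x x' y y' u v
  assumes x: "x \<in> Ob A" and x': "x' \<in> Ob A" and y: "y \<in> Ob A" and y': "y' \<in> Ob A"
    and u: "unitary A x x' u" and v: "unitary A y y' v"
begin

lemma conjugate_closed: "a \<in> Hom A x y \<Longrightarrow> conjugate A x x' y y' u v a \<in> Hom A x' y'"
  using x x' y y' unitaryD(1)[OF u] unitaryD(1)[OF v]
  by (auto simp: conjugate_def intro!: comp_closed star_closed)

lemma conjugate_add:
  "a \<in> Hom A x y \<Longrightarrow> b \<in> Hom A x y \<Longrightarrow> conjugate A x x' y y' u v (Add A x y a b) =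
     Add A x' y' (conjugate A x x' y y' u v a) (conjugate A x x' y y' u v b)"
  using x x' y y' unitaryD(1)[OF u] unitaryD(1)[OF v]
  by (simp add: conjugate_def comp_add_left comp_add_right comp_closed star_closed)

lemma conjugate_scale:
  "a \<in> Hom A x y \<Longrightarrow> t \<in> F \<Longrightarrow> conjugate A x x' y y' u v (Scale A x y t a) =
     Scale A x' y' t (conjugate A x x' y y' u v a)"
  using x x' y y' unitaryD(1)[OF u] unitaryD(1)[OF v]
  by (simp add: conjugate_def comp_scale_left comp_scale_right comp_closed star_closed)

lemma conjugate_star:
  "a \<in> Hom A x y \<Longrightarrow> conjugate A y y' x x' v u (Star A x y a) = Star A x' y' (conjugate A x x' y y' u v a)"
  using x x' y y' unitaryD(1)[OF u] unitaryD(1)[OF v]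
  by (simp add: conjugate_def star_comp comp_closed star_closed star_star comp_assoc)

lemma conjugate_comp:
  assumes z: "z \<in> Ob A" and z': "z' \<in> Ob A" and w: "unitary A z z' w" and a: "a \<in> Hom A x y" and b: "b \<in> Hom A y z"
  shows "conjugate A x x' z z' u w (Comp A x y z b a) =
    Comp A x' y' z' (conjugate A y y' z z' v w b) (conjugate A x x' y y' u v a)"
proof -
  note h = x x' y y' z z' a b unitaryD(1)[OF u] unitaryD(1)[OF v] unitaryD(1)[OF w]
  let ?k = "Comp A x' x y a (Star A x x' u)"
  have k: "?k \<in> Hom A x' y" using h by (intro comp_closed star_closed)
  have "Comp A x' y' z' (conjugate A y y' z z' v w b) (conjugate A x x' y y' u v a) =
      Comp A x' y z' (Comp A y z z' w b) (Comp A x' y' y (Star A y y' v) (Comp A x' y y' v ?k))"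
    using h by (simp add: conjugate_def comp_assoc comp_closed star_closed)
  also have "\<dots> = Comp A x' y z' (Comp A y z z' w b) ?k"
    using unitary_cancel(1)[OF y y' x' v k] by simp
  also have "\<dots> = conjugate A x x' z z' u w (Comp A x y z b a)"
    using h by (simp add: conjugate_def comp_assoc comp_closed star_closed)
  finally show ?thesis by simp
qed

lemma conjugate_inverse:
  assumes a: "a \<in> Hom A x y"
  shows "conjugate A x' x y' y (Star A x x' u) (Star A y y' v) (conjugate A x x' y y' u v a) = a"
proof -
  note h = x x' y y' a unitaryD(1)[OF u] unitaryD(1)[OF v]
  have "conjugate A x' x y' y (Star A x x' u) (Star A y y' v) (conjugate A x x' y y' u v a) =
      Comp A x y' y (Star A y y' v) (Comp A x y y' v (Comp A x x y a (Comp A x x' x (Star A x x' u) u)))"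
    using h by (simp add: conjugate_def comp_assoc comp_closed star_closed star_star)
  also have "\<dots> = a"
    using h unitary_cancel(1)[OF y y' x v a] by (simp add: unitaryD(2)[OF u] comp_unit_right)
  finally show ?thesis .
qed

text \<open>Compose with the adjoint of \<open>u\<close> on the right. Naturality of a unitary
  transformation thus says that one functor is the conjugate of the other, and the two views are
  exchanged freely below.\<close>

lemma conjugate_natural:
  assumes a: "a \<in> Hom A x y" and b: "b \<in> Hom A x' y'"
  shows "Comp A x y y' v a = Comp A x x' y' b u \<longleftrightarrow> b = conjugate A x x' y y' u v a"
proof -
  note h = x x' y y' a b unitaryD(1)[OF u] unitaryD(1)[OF v]
  have "Comp A x' x y' (Comp A x x' y' b u) (Star A x x' u) = b"
    using h unitaryD(3)[OF u] by (simp add: comp_assoc star_closed comp_unit_right)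
  moreover have "Comp A x x' y' (conjugate A x x' y y' u v a) u = Comp A x y y' v a"
    using h unitaryD(2)[OF u] by (simp add: conjugate_def comp_assoc star_closed comp_closed comp_unit_right)
  ultimately show ?thesis by (auto simp: conjugate_def)
qed

end

lemma conjugate_inverse':
  assumes "x \<in> Ob A" "x' \<in> Ob A" "y \<in> Ob A" "y' \<in> Ob A" "unitary A x x' u" "unitary A y y' v" "b \<in> Hom A x' y'"
  shows "conjugate A x x' y y' u v (conjugate A x' x y' y (Star A x x' u) (Star A y y' v) b) = b"
  using conjugate_inverse[OF assms(2,1,4,3) unitary_star[OF assms(1,2,5)] unitary_star[OF assms(3,4,6)] assms(7)]
    assms star_star unitaryD(1) by simp

lemma conjugate_unit:
  "\<lbrakk>x \<in> Ob A; x' \<in> Ob A; unitary A x x' u\<rbrakk> \<Longrightarrow> conjugate A x x' x x' u u (Unit A x) = Unit A x'"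
  using unitaryD[of x x' u] by (simp add: conjugate_def comp_unit_right)

lemma conjugate_units:
  "\<lbrakk>x \<in> Ob A; y \<in> Ob A; a \<in> Hom A x y\<rbrakk> \<Longrightarrow> conjugate A x x y y (Unit A x) (Unit A y) a = a"
  by (simp add: conjugate_def comp_unit_left comp_unit_right star_unit)

end

context star_functor
begin

lemma map_unitary:
  assumes "star_category F A" "x \<in> Ob A" "y \<in> Ob A" "unitary A x y u"
  shows "unitary B (f x) (f y) (\<phi> x y u)"
proof -
  interpret A: star_category F A by fact
  show ?thesis
    using assms(2-4)
    by (simp add: unitary_def hom_closed map_star[symmetric] map_comp[symmetric] map_unit A.star_closed)
qed

lemma map_conjugate:
  assumes "star_category F A" "x \<in> Ob A" "x' \<in> Ob A" "y \<in> Ob A" "y' \<in> Ob A"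
    "unitary A x x' u" "unitary A y y' v" "a \<in> Hom A x y"
  shows "\<phi> x' y' (conjugate A x x' y y' u v a) =
    conjugate B (f x) (f x') (f y) (f y') (\<phi> x x' u) (\<phi> y y' v) (\<phi> x y a)"
proof -
  interpret A: star_category F A by fact
  show ?thesis
    using assms(2-8) A.unitaryD(1)[OF assms(6)] A.unitaryD(1)[OF assms(7)]
    by (simp add: conjugate_def map_comp map_star A.comp_closed A.star_closed)
qed

end

text \<open>Arbitrarily chosen unitaries with sources \<open>f x\<close> turn \<open>f\<close> into
  a naturally isomorphic functor with the prescribed object map \<open>f'\<close>. Object maps are
  adjusted in this way whenever a functor has to land on chosen objects.\<close>

lemma conjugate_functor:
  assumes A: "star_category F A" and B: "star_category F B" and func: "star_functor F A B f \<phi>"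
    and f': "\<And>x. x \<in> Ob A \<Longrightarrow> f' x \<in> Ob B" and t: "\<And>x. x \<in> Ob A \<Longrightarrow> unitary B (f x) (f' x) (t x)"
  shows "star_functor F A B f' (\<lambda>x y a. conjugate B (f x) (f' x) (f y) (f' y) (t x) (t y) (\<phi> x y a))"
proof -
  interpret A: star_category F A by (rule A)
  interpret B: star_category F B by (rule B)
  interpret f: star_functor F A B f \<phi> by (rule func)
  show ?thesis
  proof
    fix x y z a b assume x: "x \<in> Ob A" and y: "y \<in> Ob A" and z: "z \<in> Ob A" and a: "a \<in> Hom A x y" and b: "b \<in> Hom A y z"
    show "conjugate B (f x) (f' x) (f z) (f' z) (t x) (t z) (\<phi> x z (Comp A x y z b a)) =
        Comp B (f' x) (f' y) (f' z) (conjugate B (f y) (f' y) (f z) (f' z) (t y) (t z) (\<phi> y z b))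
          (conjugate B (f x) (f' x) (f y) (f' y) (t x) (t y) (\<phi> x y a))"
      unfolding f.map_comp[OF x y z a b] using x y z a b
      by (intro B.conjugate_comp f.ob_closed f' t f.hom_closed)
  qed (simp_all add: f' t f.ob_closed f.hom_closed f.map_unit f.map_add f.map_scale f.map_star
        B.conjugate_closed B.conjugate_unit B.conjugate_add B.conjugate_scale B.conjugate_star)
qed

definition fully_faithful ::
    "('o, 'a) normed_star_cat \<Rightarrow> ('p, 'b) normed_star_cat \<Rightarrow> ('o \<Rightarrow> 'p) \<Rightarrow> ('o \<Rightarrow> 'o \<Rightarrow> 'a \<Rightarrow> 'b) \<Rightarrow> bool" where
  "fully_faithful A B f \<phi> \<longleftrightarrow> (\<forall>x\<in>Ob A. \<forall>y\<in>Ob A. bij_betw (\<phi> x y) (Hom A x y) (Hom B (f x) (f y)))"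

definition unitarily_surjective ::
    "('o, 'a) normed_star_cat \<Rightarrow> ('p, 'b) normed_star_cat \<Rightarrow> ('o \<Rightarrow> 'p) \<Rightarrow> bool" where
  "unitarily_surjective A B f \<longleftrightarrow> (\<forall>y\<in>Ob B. \<exists>x\<in>Ob A. \<exists>u. unitary B (f x) y u)"

lemma fully_faithfulD:
  assumes "fully_faithful A B f \<phi>" "x \<in> Ob A" "y \<in> Ob A"
  shows "\<lbrakk>\<phi> x y a = \<phi> x y b; a \<in> Hom A x y; b \<in> Hom A x y\<rbrakk> \<Longrightarrow> a = b"
    and "c \<in> Hom B (f x) (f y) \<Longrightarrow> inv_into (Hom A x y) (\<phi> x y) c \<in> Hom A x y"
    and "c \<in> Hom B (f x) (f y) \<Longrightarrow> \<phi> x y (inv_into (Hom A x y) (\<phi> x y) c) = c"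
    and "a \<in> Hom A x y \<Longrightarrow> inv_into (Hom A x y) (\<phi> x y) (\<phi> x y a) = a"
proof -
  have "bij_betw (\<phi> x y) (Hom A x y) (Hom B (f x) (f y))" using assms by (simp add: fully_faithful_def)
  then have inj: "inj_on (\<phi> x y) (Hom A x y)" and img: "\<phi> x y ` Hom A x y = Hom B (f x) (f y)"
    by (simp_all add: bij_betw_def)
  show "\<lbrakk>\<phi> x y a = \<phi> x y b; a \<in> Hom A x y; b \<in> Hom A x y\<rbrakk> \<Longrightarrow> a = b" using inj by (rule inj_onD)
  show "c \<in> Hom B (f x) (f y) \<Longrightarrow> inv_into (Hom A x y) (\<phi> x y) c \<in> Hom A x y"
    and "c \<in> Hom B (f x) (f y) \<Longrightarrow> \<phi> x y (inv_into (Hom A x y) (\<phi> x y) c) = c"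
    by (simp_all add: img[symmetric] inv_into_into f_inv_into_f)
  show "a \<in> Hom A x y \<Longrightarrow> inv_into (Hom A x y) (\<phi> x y) (\<phi> x y a) = a" using inj by (rule inv_into_f_f)
qed

lemma fully_faithfulI:
  assumes "\<And>x y a. \<lbrakk>x \<in> Ob A; y \<in> Ob A; a \<in> Hom A x y\<rbrakk> \<Longrightarrow> \<phi> x y a \<in> Hom B (f x) (f y)"
    and "\<And>x y a b. \<lbrakk>x \<in> Ob A; y \<in> Ob A; a \<in> Hom A x y; b \<in> Hom A x y; \<phi> x y a = \<phi> x y b\<rbrakk> \<Longrightarrow> a = b"
    and "\<And>x y c. \<lbrakk>x \<in> Ob A; y \<in> Ob A; c \<in> Hom B (f x) (f y)\<rbrakk> \<Longrightarrow> \<exists>a\<in>Hom A x y. \<phi> x y a = c"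
  shows "fully_faithful A B f \<phi>"
  unfolding fully_faithful_def bij_betw_def
  using assms by (auto intro!: inj_onI) (metis image_eqI)

lemma fully_faithful_reflects_unitary:
  assumes A: "star_category F A" and func: "star_functor F A B f \<phi>" and ff: "fully_faithful A B f \<phi>"
    and x: "x \<in> Ob A" and y: "y \<in> Ob A" and u: "u \<in> Hom A x y" and uni: "unitary B (f x) (f y) (\<phi> x y u)"
  shows "unitary A x y u"
proof -
  interpret A: star_category F A by (rule A)
  interpret f: star_functor F A B f \<phi> by (rule func)
  have su: "Star A x y u \<in> Hom A y x" using x y u by (rule A.star_closed)
  have "\<phi> x x (Comp A x y x (Star A x y u) u) = \<phi> x x (Unit A x)"
    using x y u su uni by (simp add: f.map_comp f.map_star f.map_unit unitary_def)
  then have 1: "Comp A x y x (Star A x y u) u = Unit A x"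
    using x y u su by (intro fully_faithfulD(1)[OF ff x x] A.comp_closed A.unit_closed)
  have "\<phi> y y (Comp A y x y u (Star A x y u)) = \<phi> y y (Unit A y)"
    using x y u su uni by (simp add: f.map_comp f.map_star f.map_unit unitary_def)
  then have "Comp A y x y u (Star A x y u) = Unit A y"
    using x y u su by (intro fully_faithfulD(1)[OF ff y y] A.comp_closed A.unit_closed)
  with 1 u show ?thesis by (simp add: unitary_def)
qed

text \<open>Only the object map \<open>g\<close> is a choice; the lift on arrows is forced.
  Functoriality is checked after applying \<open>\<phi>\<close>, where each equation becomes one for
  \<open>\<chi>\<close>; \<open>eq\<close> packages this.\<close>

lemma fully_faithful_lift:
  assumes K: "star_category F K" and A: "star_category F A"
    and func: "star_functor F A B f \<phi>" and ff: "fully_faithful A B f \<phi>" and \<chi>: "star_functor F K B h \<chi>"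
    and g: "\<And>x. x \<in> Ob K \<Longrightarrow> g x \<in> Ob A" and fg: "\<And>x. x \<in> Ob K \<Longrightarrow> f (g x) = h x"
  shows "star_functor F K A g (\<lambda>x y a. inv_into (Hom A (g x) (g y)) (\<phi> (g x) (g y)) (\<chi> x y a))"
proof -
  interpret K: star_category F K by (rule K)
  interpret A: star_category F A by (rule A)
  interpret f: star_functor F A B f \<phi> by (rule func)
  interpret \<chi>: star_functor F K B h \<chi> by (rule \<chi>)
  let ?\<psi> = "\<lambda>x y a. inv_into (Hom A (g x) (g y)) (\<phi> (g x) (g y)) (\<chi> x y a)"
  have in_B: "\<chi> x y a \<in> Hom B (f (g x)) (f (g y))" if "x \<in> Ob K" "y \<in> Ob K" "a \<in> Hom K x y" for x y a
    using that \<chi>.hom_closed by (simp add: fg)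
  have cl: "?\<psi> x y a \<in> Hom A (g x) (g y)" and map: "\<phi> (g x) (g y) (?\<psi> x y a) = \<chi> x y a"
    if "x \<in> Ob K" "y \<in> Ob K" "a \<in> Hom K x y" for x y a
    using fully_faithfulD(2,3)[OF ff g g in_B] that by auto
  have eq: "?\<psi> x y a = b" if "x \<in> Ob K" "y \<in> Ob K" "b \<in> Hom A (g x) (g y)" "\<chi> x y a = \<phi> (g x) (g y) b" for x y a b
    using fully_faithfulD(4)[OF ff g g that(3)] that by simp
  show ?thesis
  proof
    show "g x \<in> Ob A" if "x \<in> Ob K" for x using that by (rule g)
    fix x y assume x: "x \<in> Ob K" and y: "y \<in> Ob K"
    show "?\<psi> x x (Unit K x) = Unit A (g x)"
      using x by (intro eq) (simp_all add: A.unit_closed f.map_unit \<chi>.map_unit g fg)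
    fix a assume a: "a \<in> Hom K x y"
    show "?\<psi> x y a \<in> Hom A (g x) (g y)" using x y a by (rule cl)
    show "?\<psi> y x (Star K x y a) = Star A (g x) (g y) (?\<psi> x y a)"
      using x y a by (intro eq) (simp_all add: A.star_closed f.map_star \<chi>.map_star g fg cl map)
    show "?\<psi> x y (Scale K x y t a) = Scale A (g x) (g y) t (?\<psi> x y a)" if "t \<in> F" for t
      using x y a that by (intro eq) (simp_all add: A.scale_closed f.map_scale \<chi>.map_scale g fg cl map)
    show "?\<psi> x y (Add K x y a b) = Add A (g x) (g y) (?\<psi> x y a) (?\<psi> x y b)" if "b \<in> Hom K x y" for b
      using x y a that by (intro eq) (simp_all add: A.add_closed f.map_add \<chi>.map_add g fg cl map)
    show "?\<psi> x z (Comp K x y z b a) = Comp A (g x) (g y) (g z) (?\<psi> y z b) (?\<psi> x y a)"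
      if "z \<in> Ob K" "b \<in> Hom K y z" for z b
      using x y a that by (intro eq) (simp_all add: A.comp_closed f.map_comp \<chi>.map_comp g fg cl map)
  qed
qed

text \<open>Conjugation by \<open>\<eta>\<close> recovers \<open>a\<close> from
  \<open>\<psi> (\<phi> a)\<close>, which makes \<open>f\<close> faithful; \<open>\<epsilon>\<close>
  does the same for \<open>g\<close>. Fullness uses both.\<close>

lemma unitary_equivalence_imp:
  assumes A: "star_category F A" and B: "star_category F B" and equiv: "unitary_equivalence F A B f \<phi>"
  shows "fully_faithful A B f \<phi>" "unitarily_surjective A B f"
proof -
  interpret A: star_category F A by (rule A)
  interpret B: star_category F B by (rule B)
  obtain g \<psi> \<eta> \<epsilon> where func: "star_functor F A B f \<phi>" and G: "star_functor F B A g \<psi>"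
    and iso: "unitary_nat_iso A A (g \<circ> f) (\<lambda>x y. \<psi> (f x) (f y) \<circ> \<phi> x y) id (\<lambda>x y. id) \<eta>"
      "unitary_nat_iso B B (f \<circ> g) (\<lambda>x y. \<phi> (g x) (g y) \<circ> \<psi> x y) id (\<lambda>x y. id) \<epsilon>"
    using equiv unfolding unitary_equivalence_def by blast
  have \<eta>: "\<And>x. x \<in> Ob A \<Longrightarrow> unitary A (g (f x)) x (\<eta> x)"
      "\<And>x y a. \<lbrakk>x \<in> Ob A; y \<in> Ob A; a \<in> Hom A x y\<rbrakk> \<Longrightarrow>
        Comp A (g (f x)) (g (f y)) y (\<eta> y) (\<psi> (f x) (f y) (\<phi> x y a)) = Comp A (g (f x)) x y a (\<eta> x)"
    using iso(1) by (simp_all add: unitary_nat_iso_def)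
  have \<epsilon>: "\<And>y. y \<in> Ob B \<Longrightarrow> unitary B (f (g y)) y (\<epsilon> y)"
      "\<And>x y b. \<lbrakk>x \<in> Ob B; y \<in> Ob B; b \<in> Hom B x y\<rbrakk> \<Longrightarrow>
        Comp B (f (g x)) (f (g y)) y (\<epsilon> y) (\<phi> (g x) (g y) (\<psi> x y b)) = Comp B (f (g x)) x y b (\<epsilon> x)"
    using iso(2) by (simp_all add: unitary_nat_iso_def)
  interpret f: star_functor F A B f \<phi> by (rule func)
  interpret g: star_functor F B A g \<psi> by (rule G)
  have \<eta>': "a = conjugate A (g (f x)) x (g (f y)) y (\<eta> x) (\<eta> y) (\<psi> (f x) (f y) (\<phi> x y a))"
    if "x \<in> Ob A" "y \<in> Ob A" "a \<in> Hom A x y" for x y a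
    using A.conjugate_natural[OF _ _ _ _ \<eta>(1)[OF that(1)] \<eta>(1)[OF that(2)], of "\<psi> (f x) (f y) (\<phi> x y a)" a] \<eta>(2)[OF that] that
    by (simp add: f.ob_closed g.ob_closed f.hom_closed g.hom_closed)
  have \<epsilon>': "b = conjugate B (f (g x)) x (f (g y)) y (\<epsilon> x) (\<epsilon> y) (\<phi> (g x) (g y) (\<psi> x y b))"
    if "x \<in> Ob B" "y \<in> Ob B" "b \<in> Hom B x y" for x y b
    using B.conjugate_natural[OF _ _ _ _ \<epsilon>(1)[OF that(1)] \<epsilon>(1)[OF that(2)], of "\<phi> (g x) (g y) (\<psi> x y b)" b] \<epsilon>(2)[OF that] that
    by (simp add: f.ob_closed g.ob_closed f.hom_closed g.hom_closed)
  show "unitarily_surjective A B f"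
    unfolding unitarily_surjective_def using \<epsilon>(1) g.ob_closed by blast
  show "fully_faithful A B f \<phi>"
  proof (rule fully_faithfulI)
    fix x y assume x: "x \<in> Ob A" and y: "y \<in> Ob A"
    show "\<phi> x y a \<in> Hom B (f x) (f y)" if "a \<in> Hom A x y" for a using x y that by (rule f.hom_closed)
    show "a = b" if "a \<in> Hom A x y" "b \<in> Hom A x y" "\<phi> x y a = \<phi> x y b" for a b
      using \<eta>'[OF x y that(1)] \<eta>'[OF x y that(2)] that(3) by simp
    fix b assume b: "b \<in> Hom B (f x) (f y)"
    \<comment> \<open>The only candidate for a preimage of \<open>b\<close>. Conjugating back gives
      \<open>\<psi> (\<phi> a) = \<psi> b\<close>, and faithfulness of \<open>\<psi>\<close> gives
      \<open>\<phi> a = b\<close>.\<close>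
    define a where "a = conjugate A (g (f x)) x (g (f y)) y (\<eta> x) (\<eta> y) (\<psi> (f x) (f y) b)"
    note o = g.ob_closed[OF f.ob_closed[OF x]] g.ob_closed[OF f.ob_closed[OF y]]
    note fo = f.ob_closed[OF x] f.ob_closed[OF y]
    have \<psi>b: "\<psi> (f x) (f y) b \<in> Hom A (g (f x)) (g (f y))" using fo b by (rule g.hom_closed)
    have a: "a \<in> Hom A x y"
      unfolding a_def by (rule A.conjugate_closed[OF o(1) x o(2) y \<eta>(1)[OF x] \<eta>(1)[OF y] \<psi>b])
    have fa: "\<phi> x y a \<in> Hom B (f x) (f y)" using x y a by (rule f.hom_closed)
    have "\<psi> (f x) (f y) (\<phi> x y a) = \<psi> (f x) (f y) b"
      using A.conjugate_inverse[OF o(1) x o(2) y \<eta>(1)[OF x] \<eta>(1)[OF y] \<psi>b]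
        A.conjugate_inverse[OF o(1) x o(2) y \<eta>(1)[OF x] \<eta>(1)[OF y] g.hom_closed[OF fo fa]] \<eta>'[OF x y a]
      by (simp add: a_def[symmetric])
    then have "\<phi> x y a = b"
      using \<epsilon>'[OF fo fa] \<epsilon>'[OF fo b] by simp
    with a show "\<exists>a\<in>Hom A x y. \<phi> x y a = b" by blast
  qed
qed

lemma unitary_equivalenceI:
  assumes A: "star_category F A" and B: "star_category F B" and func: "star_functor F A B f \<phi>"
    and ff: "fully_faithful A B f \<phi>" and es: "unitarily_surjective A B f"
  shows "unitary_equivalence F A B f \<phi>"
proof -
  interpret A: star_category F A by (rule A)
  interpret B: star_category F B by (rule B)
  interpret f: star_functor F A B f \<phi> by (rule func)
  have "\<forall>y\<in>Ob B. \<exists>p. fst p \<in> Ob A \<and> unitary B (f (fst p)) y (snd p)"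
  proof
    fix y assume "y \<in> Ob B"
    then obtain x u where "x \<in> Ob A" "unitary B (f x) y u" using es unfolding unitarily_surjective_def by blast
    then show "\<exists>p. fst p \<in> Ob A \<and> unitary B (f (fst p)) y (snd p)" by (intro exI[of _ "(x, u)"]) simp
  qed
  from bchoice[OF this] obtain p where p: "\<forall>y\<in>Ob B. fst (p y) \<in> Ob A \<and> unitary B (f (fst (p y))) y (snd (p y))"
    by blast
  define g \<epsilon> where "g y = fst (p y)" and "\<epsilon> y = snd (p y)" for y
  have g: "g y \<in> Ob A" and \<epsilon>: "unitary B (f (g y)) y (\<epsilon> y)" if "y \<in> Ob B" for y
    using p that by (simp_all add: g_def \<epsilon>_def)
  have \<epsilon>s: "unitary B y (f (g y)) (Star B (f (g y)) y (\<epsilon> y))" if "y \<in> Ob B" for y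
    using that by (intro B.unitary_star f.ob_closed g \<epsilon>)
  \<comment> \<open>The identity of \<open>B\<close> moved to the objects \<open>f (g y)\<close>. In
    this form it lifts through the fully faithful functor \<open>f\<close>, and the lift is the
    quasi-inverse.\<close>
  define \<chi> where "\<chi> x y b = conjugate B x (f (g x)) y (f (g y)) (Star B (f (g x)) x (\<epsilon> x)) (Star B (f (g y)) y (\<epsilon> y)) b" for x y b
  have \<chi>: "star_functor F B B (\<lambda>y. f (g y)) \<chi>"
    unfolding \<chi>_def using conjugate_functor[OF B B star_functor_id, of "\<lambda>y. f (g y)"] \<epsilon>s f.ob_closed[OF g] by simp
  interpret \<chi>: star_functor F B B "\<lambda>y. f (g y)" \<chi> by (rule \<chi>)
  define \<psi> where "\<psi> x y b = inv_into (Hom A (g x) (g y)) (\<phi> (g x) (g y)) (\<chi> x y b)" for x y b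
  have \<psi>: "star_functor F B A g \<psi>"
    unfolding \<psi>_def by (rule fully_faithful_lift[OF B A func ff \<chi> g refl])
  have \<phi>\<psi>: "\<phi> (g x) (g y) (\<psi> x y b) = \<chi> x y b" if "x \<in> Ob B" "y \<in> Ob B" "b \<in> Hom B x y" for x y b
    unfolding \<psi>_def using that by (intro fully_faithfulD(3)[OF ff] g \<chi>.hom_closed)
  interpret \<psi>: star_functor F B A g \<psi> by (rule \<psi>)
  have \<epsilon>_nat: "Comp B (f (g x)) (f (g y)) y (\<epsilon> y) (\<chi> x y b) = Comp B (f (g x)) x y b (\<epsilon> x)"
    if "x \<in> Ob B" "y \<in> Ob B" "b \<in> Hom B x y" for x y b
    using B.conjugate_natural[OF f.ob_closed[OF g[OF that(1)]] that(1) f.ob_closed[OF g[OF that(2)]] that(2) \<epsilon>[OF that(1)] \<epsilon>[OF that(2)]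
        \<chi>.hom_closed[OF that] that(3)]
      B.conjugate_inverse'[OF f.ob_closed[OF g[OF that(1)]] that(1) f.ob_closed[OF g[OF that(2)]] that(2) \<epsilon>[OF that(1)] \<epsilon>[OF that(2)] that(3)]
    by (simp add: \<chi>_def)
  \<comment> \<open>A triangle identity taken as definition: \<open>f\<close> must send
    \<open>\<eta> x\<close> to \<open>\<epsilon> (f x)\<close>.\<close>
  define \<eta> where "\<eta> x = inv_into (Hom A (g (f x)) x) (\<phi> (g (f x)) x) (\<epsilon> (f x))" for x
  have \<eta>H: "\<eta> x \<in> Hom A (g (f x)) x" and \<phi>\<eta>: "\<phi> (g (f x)) x (\<eta> x) = \<epsilon> (f x)" if x: "x \<in> Ob A" for x
    unfolding \<eta>_def using fully_faithfulD(2,3)[OF ff g[OF f.ob_closed[OF x]] x] B.unitaryD(1)[OF \<epsilon>[OF f.ob_closed[OF x]]] by auto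
  have \<eta>U: "unitary A (g (f x)) x (\<eta> x)" if x: "x \<in> Ob A" for x
    using fully_faithful_reflects_unitary[OF A func ff g[OF f.ob_closed[OF x]] x \<eta>H[OF x]] \<epsilon>[OF f.ob_closed[OF x]]
    by (simp add: \<phi>\<eta>[OF x])
  have \<eta>_nat: "Comp A (g (f x)) (g (f y)) y (\<eta> y) (\<psi> (f x) (f y) (\<phi> x y a)) = Comp A (g (f x)) x y a (\<eta> x)"
    if x: "x \<in> Ob A" and y: "y \<in> Ob A" and a: "a \<in> Hom A x y" for x y a
  proof (rule fully_faithfulD(1)[OF ff g[OF f.ob_closed[OF x]] y])
    note o = x y f.ob_closed[OF x] f.ob_closed[OF y] g[OF f.ob_closed[OF x]] g[OF f.ob_closed[OF y]]
    note fa = f.hom_closed[OF x y a]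
    note h = \<psi>.hom_closed[OF o(3,4) fa] \<eta>H[OF x] \<eta>H[OF y]
    show "Comp A (g (f x)) (g (f y)) y (\<eta> y) (\<psi> (f x) (f y) (\<phi> x y a)) \<in> Hom A (g (f x)) y"
      "Comp A (g (f x)) x y a (\<eta> x) \<in> Hom A (g (f x)) y"
      using o h a by (auto intro: A.comp_closed)
    show "\<phi> (g (f x)) y (Comp A (g (f x)) (g (f y)) y (\<eta> y) (\<psi> (f x) (f y) (\<phi> x y a))) =
        \<phi> (g (f x)) y (Comp A (g (f x)) x y a (\<eta> x))"
      using o h a \<epsilon>_nat[OF o(3,4) fa] by (simp add: f.map_comp \<phi>\<psi>[OF o(3,4) fa] \<phi>\<eta>)
  qed
  show ?thesis
    unfolding unitary_equivalence_def unitary_nat_iso_def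
  proof (intro conjI func exI[of _ g] exI[of _ \<psi>] \<psi> exI[of _ \<eta>] exI[of _ \<epsilon>])
  qed (use \<eta>U \<eta>_nat \<epsilon> \<epsilon>_nat \<phi>\<psi> in auto)
qed

section \<open>Model structure\<close>

lemma fully_faithfulE:
  assumes "fully_faithful A B f \<phi>" "x \<in> Ob A" "y \<in> Ob A" "c \<in> Hom B (f x) (f y)"
  obtains a where "a \<in> Hom A x y" "\<phi> x y a = c"
  using fully_faithfulD(2,3)[OF assms] that by blast

lemma fully_faithful_cong:
  assumes "\<And>x. x \<in> Ob A \<Longrightarrow> f x = g x"
    and "\<And>x y a. \<lbrakk>x \<in> Ob A; y \<in> Ob A; a \<in> Hom A x y\<rbrakk> \<Longrightarrow> \<phi> x y a = \<psi> x y a"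
  shows "fully_faithful A B f \<phi> \<longleftrightarrow> fully_faithful A B g \<psi>"
proof -
  have "bij_betw (\<phi> x y) (Hom A x y) (Hom B (f x) (f y)) \<longleftrightarrow> bij_betw (\<psi> x y) (Hom A x y) (Hom B (g x) (g y))"
    if "x \<in> Ob A" "y \<in> Ob A" for x y
    using assms(1)[OF that(1)] assms(1)[OF that(2)] bij_betw_cong[of "Hom A x y" "\<phi> x y" "\<psi> x y"] assms(2)[OF that]
    by simp
  then show ?thesis unfolding fully_faithful_def by simp
qed

lemma unitarily_surjective_cong:
  "(\<And>x. x \<in> Ob A \<Longrightarrow> f x = g x) \<Longrightarrow> unitarily_surjective A B f \<longleftrightarrow> unitarily_surjective A B g"
  by (auto simp: unitarily_surjective_def)

section \<open>Composition and cancellation for weak equivalences\<close>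

context
  fixes F :: "complex set" and A :: "('o, 'a) normed_star_cat" and B :: "('p, 'b) normed_star_cat"
    and D :: "('q, 'c) normed_star_cat" and f \<phi> g \<psi>
  assumes A: "star_category F A" and B: "star_category F B" and D: "star_category F D"
    and f: "star_functor F A B f \<phi>" and g: "star_functor F B D g \<psi>"
begin

interpretation A: star_category F A by (rule A)
interpretation B: star_category F B by (rule B)
interpretation D: star_category F D by (rule D)
interpretation f: star_functor F A B f \<phi> by (rule f)
interpretation g: star_functor F B D g \<psi> by (rule g)

lemma fully_faithful_comp:
  assumes "fully_faithful A B f \<phi>" "fully_faithful B D g \<psi>"
  shows "fully_faithful A D (\<lambda>x. g (f x)) (\<lambda>x y a. \<psi> (f x) (f y) (\<phi> x y a))"
  unfolding fully_faithful_def
proof (intro ballI)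
  fix x y assume x: "x \<in> Ob A" and y: "y \<in> Ob A"
  have "bij_betw (\<psi> (f x) (f y) \<circ> \<phi> x y) (Hom A x y) (Hom D (g (f x)) (g (f y)))"
    using assms x y f.ob_closed unfolding fully_faithful_def by (intro bij_betw_trans[of _ _ "Hom B (f x) (f y)"]) auto
  then show "bij_betw (\<lambda>a. \<psi> (f x) (f y) (\<phi> x y a)) (Hom A x y) (Hom D (g (f x)) (g (f y)))"
    by (simp add: comp_def)
qed

lemma unitarily_surjective_comp:
  assumes "unitarily_surjective A B f" "unitarily_surjective B D g"
  shows "unitarily_surjective A D (\<lambda>x. g (f x))"
  unfolding unitarily_surjective_def
proof
  fix z assume z: "z \<in> Ob D"
  obtain y v where y: "y \<in> Ob B" and v: "unitary D (g y) z v"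
    using assms(2) z unfolding unitarily_surjective_def by blast
  obtain x u where x: "x \<in> Ob A" and u: "unitary B (f x) y u"
    using assms(1) y unfolding unitarily_surjective_def by blast
  have "unitary D (g (f x)) z (Comp D (g (f x)) (g y) z v (\<psi> (f x) y u))"
    using x y z u v by (intro D.unitary_comp g.map_unitary[OF B] g.ob_closed f.ob_closed)
  then show "\<exists>x\<in>Ob A. \<exists>u. unitary D (g (f x)) z u" using x by blast
qed

text \<open>Every object of \<open>B\<close> is unitarily isomorphic to one in the image of
  \<open>f\<close>, so every arrow of \<open>B\<close> is a conjugate of an arrow in the image
  (\<open>lift\<close>), and on these \<open>g\<close> is controlled by the composite.\<close>

lemma fully_faithful_left_cancel:
  assumes f': "fully_faithful A B f \<phi>" "unitarily_surjective A B f"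
    and gf: "fully_faithful A D (\<lambda>x. g (f x)) (\<lambda>x y a. \<psi> (f x) (f y) (\<phi> x y a))"
  shows "fully_faithful B D g \<psi>"
proof (rule fully_faithfulI)
  fix y y' assume y: "y \<in> Ob B" and y': "y' \<in> Ob B"
  show "\<psi> y y' b \<in> Hom D (g y) (g y')" if "b \<in> Hom B y y'" for b using y y' that by (rule g.hom_closed)
  obtain x u where x: "x \<in> Ob A" and u: "unitary B (f x) y u"
    using f'(2) y unfolding unitarily_surjective_def by blast
  obtain x' u' where x': "x' \<in> Ob A" and u': "unitary B (f x') y' u'"
    using f'(2) y' unfolding unitarily_surjective_def by blast
  note fx = f.ob_closed[OF x] and fx' = f.ob_closed[OF x']
  have lift: "\<exists>a\<in>Hom A x x'. b = conjugate B (f x) y (f x') y' u u' (\<phi> x x' a)" if b: "b \<in> Hom B y y'" for b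
  proof -
    let ?c = "conjugate B y (f x) y' (f x') (Star B (f x) y u) (Star B (f x') y' u') b"
    have "?c \<in> Hom B (f x) (f x')"
      using y y' fx fx' u u' b by (intro B.conjugate_closed B.unitary_star)
    then obtain a where "a \<in> Hom A x x'" "\<phi> x x' a = ?c"
      by (rule fully_faithfulE[OF f'(1) x x'])
    then show ?thesis
      using B.conjugate_inverse'[OF fx y fx' y' u u' b] by (intro bexI[of _ a]) simp_all
  qed
  have map: "\<psi> y y' (conjugate B (f x) y (f x') y' u u' (\<phi> x x' a)) =
      conjugate D (g (f x)) (g y) (g (f x')) (g y') (\<psi> (f x) y u) (\<psi> (f x') y' u') (\<psi> (f x) (f x') (\<phi> x x' a))"
    if "a \<in> Hom A x x'" for a
    using that x x' by (intro g.map_conjugate[OF B fx y fx' y' u u'] f.hom_closed)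
  note gu = g.map_unitary[OF B fx y u] and gu' = g.map_unitary[OF B fx' y' u']
  note go = g.ob_closed[OF fx] g.ob_closed[OF y] g.ob_closed[OF fx'] g.ob_closed[OF y']
  show "b = b'" if b: "b \<in> Hom B y y'" and b': "b' \<in> Hom B y y'" and eq: "\<psi> y y' b = \<psi> y y' b'" for b b'
  proof -
    obtain a where a: "a \<in> Hom A x x'" "b = conjugate B (f x) y (f x') y' u u' (\<phi> x x' a)" using lift[OF b] by (rule bexE)
    obtain a' where a': "a' \<in> Hom A x x'" "b' = conjugate B (f x) y (f x') y' u u' (\<phi> x x' a')" using lift[OF b'] by (rule bexE)
    have h: "\<psi> (f x) (f x') (\<phi> x x' a) \<in> Hom D (g (f x)) (g (f x'))" if "a \<in> Hom A x x'" for a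
      using that x x' fx fx' by (intro g.hom_closed f.hom_closed)
    note eq' = eq[unfolded a(2) a'(2) map[OF a(1)] map[OF a'(1)]]
    have "\<psi> (f x) (f x') (\<phi> x x' a) = \<psi> (f x) (f x') (\<phi> x x' a')"
      by (rule trans[OF D.conjugate_inverse[OF go gu gu' h[OF a(1)], unfolded eq', symmetric]
            D.conjugate_inverse[OF go gu gu' h[OF a'(1)]]])
    then have "a = a'" using a(1) a'(1) by (rule fully_faithfulD(1)[OF gf x x'])
    then show ?thesis unfolding a(2) a'(2) by (rule arg_cong)
  qed
  show "\<exists>b\<in>Hom B y y'. \<psi> y y' b = c" if c: "c \<in> Hom D (g y) (g y')" for c
  proof -
    let ?c = "conjugate D (g y) (g (f x)) (g y') (g (f x')) (Star D (g (f x)) (g y) (\<psi> (f x) y u))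
      (Star D (g (f x')) (g y') (\<psi> (f x') y' u')) c"
    have "?c \<in> Hom D (g (f x)) (g (f x'))"
      using go gu gu' c by (intro D.conjugate_closed D.unitary_star)
    then obtain a where a: "a \<in> Hom A x x'" "\<psi> (f x) (f x') (\<phi> x x' a) = ?c"
      by (rule fully_faithfulE[OF gf x x'])
    show ?thesis
    proof (rule bexI[of _ "conjugate B (f x) y (f x') y' u u' (\<phi> x x' a)"])
      show "\<psi> y y' (conjugate B (f x) y (f x') y' u u' (\<phi> x x' a)) = c"
        unfolding map[OF a(1)] a(2) using go gu gu' c by (rule D.conjugate_inverse')
      show "conjugate B (f x) y (f x') y' u u' (\<phi> x x' a) \<in> Hom B y y'"
        using x x' a(1) by (intro B.conjugate_closed[OF fx y fx' y' u u'] f.hom_closed)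
    qed
  qed
qed

lemma unitarily_surjective_left_cancel:
  "unitarily_surjective A D (\<lambda>x. g (f x)) \<Longrightarrow> unitarily_surjective B D g"
  unfolding unitarily_surjective_def using f.ob_closed by blast

lemma fully_faithful_right_cancel:
  assumes g': "fully_faithful B D g \<psi>"
    and gf: "fully_faithful A D (\<lambda>x. g (f x)) (\<lambda>x y a. \<psi> (f x) (f y) (\<phi> x y a))"
  shows "fully_faithful A B f \<phi>"
proof (rule fully_faithfulI)
  fix x y assume x: "x \<in> Ob A" and y: "y \<in> Ob A"
  show "\<phi> x y a \<in> Hom B (f x) (f y)" if "a \<in> Hom A x y" for a using x y that by (rule f.hom_closed)
  show "a = b" if "a \<in> Hom A x y" "b \<in> Hom A x y" "\<phi> x y a = \<phi> x y b" for a b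
    using fully_faithfulD(1)[OF gf x y] that by simp
  show "\<exists>a\<in>Hom A x y. \<phi> x y a = b" if b: "b \<in> Hom B (f x) (f y)" for b
  proof -
    have "\<psi> (f x) (f y) b \<in> Hom D (g (f x)) (g (f y))" using x y b by (intro g.hom_closed f.ob_closed)
    then obtain a where a: "a \<in> Hom A x y" "\<psi> (f x) (f y) (\<phi> x y a) = \<psi> (f x) (f y) b"
      by (rule fully_faithfulE[OF gf x y])
    have "\<phi> x y a = b"
      using a(2) f.hom_closed[OF x y a(1)] b by (rule fully_faithfulD(1)[OF g' f.ob_closed[OF x] f.ob_closed[OF y]])
    with a show ?thesis by blast
  qed
qed

text \<open>A unitary from \<open>g (f x)\<close> to \<open>g y\<close> has a preimage because
  \<open>g\<close> is full, and the preimage is unitary because \<open>g\<close> is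
  faithful.\<close>

lemma unitarily_surjective_right_cancel:
  assumes g': "fully_faithful B D g \<psi>" and gf: "unitarily_surjective A D (\<lambda>x. g (f x))"
  shows "unitarily_surjective A B f"
  unfolding unitarily_surjective_def
proof
  fix y assume y: "y \<in> Ob B"
  obtain x u where x: "x \<in> Ob A" and u: "unitary D (g (f x)) (g y) u"
    using gf g.ob_closed[OF y] unfolding unitarily_surjective_def by blast
  define w where "w = inv_into (Hom B (f x) y) (\<psi> (f x) y) u"
  have w: "w \<in> Hom B (f x) y" "\<psi> (f x) y w = u"
    unfolding w_def using fully_faithfulD(2,3)[OF g' f.ob_closed[OF x] y] D.unitaryD(1)[OF u] by auto
  then have "unitary B (f x) y w"
    using fully_faithful_reflects_unitary[OF B g g' f.ob_closed[OF x] y w(1)] u by simp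
  with x show "\<exists>x\<in>Ob A. \<exists>u. unitary B (f x) y u" by blast
qed

end

section \<open>The three classes as subcategories and two out of three\<close>

context unitary_model
begin

text \<open>From here on weak equivalences are handled by conditions on the functor alone, with no
  quasi-inverse to carry along.\<close>

lemma Weq_iff:
  assumes "in_hom C \<Phi> A B"
  shows "\<Phi> \<in> Weq F \<kappa> \<longleftrightarrow> fully_faithful A B (obmap \<Phi>) (hommap \<Phi>) \<and> unitarily_surjective A B (obmap \<Phi>)"
proof -
  note h = in_homD[OF assms]
  have "\<Phi> \<in> Weq F \<kappa> \<longleftrightarrow> unitary_equivalence F A B (obmap \<Phi>) (hommap \<Phi>)"
    using assms h(4,5) by (simp add: Weq_def in_hom_def)
  also have "\<dots> \<longleftrightarrow> fully_faithful A B (obmap \<Phi>) (hommap \<Phi>) \<and> unitarily_surjective A B (obmap \<Phi>)"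
    by (rule iffI, rule conjI)
      (erule unitary_equivalence_imp[OF small_star[OF h(1)] small_star[OF h(2)]],
        erule unitary_equivalence_imp[OF small_star[OF h(1)] small_star[OF h(2)]],
        erule conjE, rule unitary_equivalenceI[OF small_star[OF h(1)] small_star[OF h(2)] h(3)])
  finally show ?thesis .
qed

lemma Cof_iff:
  assumes "in_hom C \<Phi> A B"
  shows "\<Phi> \<in> Cof F \<kappa> \<longleftrightarrow> inj_on (obmap \<Phi>) (Ob A)"
proof -
  have "\<Phi> \<in> Arr C" using assms by (simp add: in_hom_def)
  then show ?thesis unfolding Cof_def mem_Collect_eq in_homD(4)[OF assms] by blast
qed

lemma Fib_iff:
  assumes "in_hom C \<Phi> A B"
  shows "\<Phi> \<in> Fib F \<kappa> \<longleftrightarrow> (\<forall>x\<in>Ob A. \<forall>y\<in>Ob B. \<forall>v. unitary B (obmap \<Phi> x) y v \<longrightarrow>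
    (\<exists>x'\<in>Ob A. \<exists>u. unitary A x x' u \<and> obmap \<Phi> x' = y \<and> hommap \<Phi> x x' u = v))"
proof -
  have "\<Phi> \<in> Arr C" using assms by (simp add: in_hom_def)
  then show ?thesis
    unfolding Fib_def mem_Collect_eq in_homD(4)[OF assms] in_homD(5)[OF assms] by (simp only: simp_thms)
qed

lemma Fib_lift:
  assumes "in_hom C \<Phi> A B" "\<Phi> \<in> Fib F \<kappa>" "x \<in> Ob A" "y \<in> Ob B" "unitary B (obmap \<Phi> x) y v"
  obtains x' u where "x' \<in> Ob A" "unitary A x x' u" "obmap \<Phi> x' = y" "hommap \<Phi> x x' u = v"
  using assms(2-5) unfolding Fib_iff[OF assms(1)] by blast

lemma cmp_fully_faithful:
  assumes "in_hom C \<Phi> A B"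
  shows "fully_faithful A D (obmap (Cmp C \<Psi> \<Phi>)) (hommap (Cmp C \<Psi> \<Phi>)) \<longleftrightarrow>
    fully_faithful A D (\<lambda>x. obmap \<Psi> (obmap \<Phi> x)) (\<lambda>x y a. hommap \<Psi> (obmap \<Phi> x) (obmap \<Phi> y) (hommap \<Phi> x y a))"
  using cmp_apply[OF assms] by (rule fully_faithful_cong)

lemma cmp_unitarily_surjective:
  assumes "in_hom C \<Phi> A B"
  shows "unitarily_surjective A D (obmap (Cmp C \<Psi> \<Phi>)) \<longleftrightarrow> unitarily_surjective A D (\<lambda>x. obmap \<Psi> (obmap \<Phi> x))"
  using cmp_apply(1)[OF assms] by (rule unitarily_surjective_cong)

lemma two_out_of_three_Weq: "two_out_of_three C (Weq F \<kappa>)"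
  unfolding two_out_of_three_def
proof (intro ballI impI)
  fix \<Phi> \<Psi> assume arr: "\<Phi> \<in> Arr C" "\<Psi> \<in> Arr C" "Cod C \<Phi> = Dom C \<Psi>"
  define A B D where "A = Src \<Phi>" and "B = Tgt \<Phi>" and "D = Tgt \<Psi>"
  have \<Phi>: "in_hom C \<Phi> A B" and \<Psi>: "in_hom C \<Psi> B D"
    using arr by (auto simp: A_def B_def D_def in_hom_def)
  note stars = small_star[OF in_homD(1)[OF \<Phi>]] small_star[OF in_homD(2)[OF \<Phi>]] small_star[OF in_homD(2)[OF \<Psi>]]
    in_homD(3)[OF \<Phi>] in_homD(3)[OF \<Psi>]
  note iffs = Weq_iff[OF \<Phi>] Weq_iff[OF \<Psi>] Weq_iff[OF cmp_in_hom[OF \<Phi> \<Psi>]] cmp_fully_faithful[OF \<Phi>] cmp_unitarily_surjective[OF \<Phi>]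
  have "\<Phi> \<in> Weq F \<kappa> \<Longrightarrow> \<Psi> \<in> Weq F \<kappa> \<Longrightarrow> Cmp C \<Psi> \<Phi> \<in> Weq F \<kappa>"
    unfolding iffs using fully_faithful_comp[OF stars] unitarily_surjective_comp[OF stars] by blast
  moreover have "\<Phi> \<in> Weq F \<kappa> \<Longrightarrow> Cmp C \<Psi> \<Phi> \<in> Weq F \<kappa> \<Longrightarrow> \<Psi> \<in> Weq F \<kappa>"
    unfolding iffs using fully_faithful_left_cancel[OF stars] unitarily_surjective_left_cancel[OF stars] by blast
  moreover have "\<Psi> \<in> Weq F \<kappa> \<Longrightarrow> Cmp C \<Psi> \<Phi> \<in> Weq F \<kappa> \<Longrightarrow> \<Phi> \<in> Weq F \<kappa>"
    unfolding iffs using fully_faithful_right_cancel[OF stars] unitarily_surjective_right_cancel[OF stars] by blast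
  ultimately show "(\<Phi> \<in> Weq F \<kappa> \<and> \<Psi> \<in> Weq F \<kappa> \<longrightarrow> Cmp C \<Psi> \<Phi> \<in> Weq F \<kappa>) \<and>
      (\<Phi> \<in> Weq F \<kappa> \<and> Cmp C \<Psi> \<Phi> \<in> Weq F \<kappa> \<longrightarrow> \<Psi> \<in> Weq F \<kappa>) \<and>
      (\<Psi> \<in> Weq F \<kappa> \<and> Cmp C \<Psi> \<Phi> \<in> Weq F \<kappa> \<longrightarrow> \<Phi> \<in> Weq F \<kappa>)"
    by blast
qed

lemma ide_apply:
  "x \<in> Ob A \<Longrightarrow> obmap (Ide C A) x = x"
  "x \<in> Ob A \<Longrightarrow> y \<in> Ob A \<Longrightarrow> a \<in> Hom A x y \<Longrightarrow> hommap (Ide C A) x y a = a"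
  by simp_all

lemma ide_classes:
  assumes "A \<in> small_cats"
  shows "Ide C A \<in> Weq F \<kappa>" "Ide C A \<in> Fib F \<kappa>" "Ide C A \<in> Cof F \<kappa>"
proof -
  interpret A: star_category F A using small_star[OF assms] .
  note i = ide_in_hom[OF assms]
  have "fully_faithful A A id (\<lambda>x y. id)" by (auto simp: fully_faithful_def)
  then have "fully_faithful A A (obmap (Ide C A)) (hommap (Ide C A))"
    using fully_faithful_cong[of A "obmap (Ide C A)" id "hommap (Ide C A)" "\<lambda>x y. id"] by simp
  moreover have "unitarily_surjective A A (obmap (Ide C A))"
    unfolding unitarily_surjective_def using A.unitary_unit by (auto intro!: bexI exI)
  ultimately show "Ide C A \<in> Weq F \<kappa>" unfolding Weq_iff[OF i] by blast
  show "Ide C A \<in> Fib F \<kappa>" unfolding Fib_iff[OF i] using A.unitaryD(1) by fastforce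
  show "Ide C A \<in> Cof F \<kappa>" unfolding Cof_iff[OF i] by (auto simp: inj_on_def)
qed

lemma wide_subcategoryI:
  assumes "S \<subseteq> Arr C" "\<And>A. A \<in> small_cats \<Longrightarrow> Ide C A \<in> S"
    and "\<And>\<Phi> \<Psi> A B D. \<lbrakk>in_hom C \<Phi> A B; in_hom C \<Psi> B D; \<Phi> \<in> S; \<Psi> \<in> S\<rbrakk> \<Longrightarrow> Cmp C \<Psi> \<Phi> \<in> S"
  shows "wide_subcategory C S"
  unfolding wide_subcategory_def
proof (intro conjI ballI impI)
  fix \<Phi> \<Psi> assume S: "\<Phi> \<in> S" "\<Psi> \<in> S" and "Cod C \<Phi> = Dom C \<Psi>"
  then have "in_hom C \<Phi> (Src \<Phi>) (Tgt \<Phi>)" "in_hom C \<Psi> (Tgt \<Phi>) (Tgt \<Psi>)"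
    using assms(1) by (auto simp: in_hom_def)
  then show "Cmp C \<Psi> \<Phi> \<in> S" using S by (rule assms(3))
qed (use assms in auto)

lemma wide_subcategory_Weq: "wide_subcategory C (Weq F \<kappa>)"
proof (rule wide_subcategoryI[OF _ ide_classes(1)])
  fix \<Phi> \<Psi> A B D assume "in_hom C \<Phi> A B" "in_hom C \<Psi> B D" "\<Phi> \<in> Weq F \<kappa>" "\<Psi> \<in> Weq F \<kappa>"
  then show "Cmp C \<Psi> \<Phi> \<in> Weq F \<kappa>"
    using two_out_of_three_Weq unfolding two_out_of_three_def by (metis in_hom_def)
qed (auto simp: Weq_def)

lemma wide_subcategory_Cof: "wide_subcategory C (Cof F \<kappa>)"
proof (rule wide_subcategoryI[OF _ ide_classes(3)])
  fix \<Phi> \<Psi> A B D assume \<Phi>: "in_hom C \<Phi> A B" and \<Psi>: "in_hom C \<Psi> B D" and c: "\<Phi> \<in> Cof F \<kappa>" "\<Psi> \<in> Cof F \<kappa>"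
  show "Cmp C \<Psi> \<Phi> \<in> Cof F \<kappa>"
    unfolding Cof_iff[OF cmp_in_hom[OF \<Phi> \<Psi>]]
  proof (rule inj_onI)
    fix x y assume x: "x \<in> Ob A" and y: "y \<in> Ob A" and "obmap (Cmp C \<Psi> \<Phi>) x = obmap (Cmp C \<Psi> \<Phi>) y"
    then have "obmap \<Phi> x = obmap \<Phi> y"
      using c(2) in_hom_closed(1)[OF \<Phi>] unfolding Cof_iff[OF \<Psi>] cmp_apply(1)[OF \<Phi> x] cmp_apply(1)[OF \<Phi> y]
      by (auto dest: inj_onD)
    then show "x = y" using c(1) x y unfolding Cof_iff[OF \<Phi>] by (auto dest: inj_onD)
  qed
qed (auto simp: Cof_def)

lemma wide_subcategory_Fib: "wide_subcategory C (Fib F \<kappa>)"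
proof (rule wide_subcategoryI[OF _ ide_classes(2)])
  fix \<Phi> \<Psi> A B D assume \<Phi>: "in_hom C \<Phi> A B" and \<Psi>: "in_hom C \<Psi> B D" and c: "\<Phi> \<in> Fib F \<kappa>" "\<Psi> \<in> Fib F \<kappa>"
  interpret A: star_category F A using small_star[OF in_homD(1)[OF \<Phi>]] .
  show "Cmp C \<Psi> \<Phi> \<in> Fib F \<kappa>"
    unfolding Fib_iff[OF cmp_in_hom[OF \<Phi> \<Psi>]]
  proof (intro ballI allI impI)
    fix x z v assume x: "x \<in> Ob A" and z: "z \<in> Ob D" and v: "unitary D (obmap (Cmp C \<Psi> \<Phi>) x) z v"
    obtain y w where y: "y \<in> Ob B" "unitary B (obmap \<Phi> x) y w" "obmap \<Psi> y = z" "hommap \<Psi> (obmap \<Phi> x) y w = v"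
      using Fib_lift[OF \<Psi> c(2) in_hom_closed(1)[OF \<Phi> x] z] v unfolding cmp_apply(1)[OF \<Phi> x] by blast
    obtain x' u where x': "x' \<in> Ob A" "unitary A x x' u" "obmap \<Phi> x' = y" "hommap \<Phi> x x' u = w"
      using Fib_lift[OF \<Phi> c(1) x y(1,2)] by blast
    show "\<exists>x'\<in>Ob A. \<exists>u. unitary A x x' u \<and> obmap (Cmp C \<Psi> \<Phi>) x' = z \<and> hommap (Cmp C \<Psi> \<Phi>) x x' u = v"
      using x' y cmp_apply(1)[OF \<Phi> x'(1)] cmp_apply(2)[OF \<Phi> x x'(1) A.unitaryD(1)[OF x'(2)]]
      by (intro bexI[of _ x'] exI[of _ u]) (simp_all del: C1star_cat_simps)
  qed
qed (auto simp: Fib_def)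

section \<open>Closure under retracts\<close>

lemma cmp_eqD:
  assumes "in_hom C \<Phi> A B" "in_hom C \<Phi>' A B'" and eq: "Cmp C \<Psi> \<Phi> = Cmp C \<Psi>' \<Phi>'"
  shows "x \<in> Ob A \<Longrightarrow> obmap \<Psi> (obmap \<Phi> x) = obmap \<Psi>' (obmap \<Phi>' x)"
    and "\<lbrakk>x \<in> Ob A; y \<in> Ob A; a \<in> Hom A x y\<rbrakk> \<Longrightarrow>
      hommap \<Psi> (obmap \<Phi> x) (obmap \<Phi> y) (hommap \<Phi> x y a) = hommap \<Psi>' (obmap \<Phi>' x) (obmap \<Phi>' y) (hommap \<Phi>' x y a)"
proof -
  assume x: "x \<in> Ob A"
  show "obmap \<Psi> (obmap \<Phi> x) = obmap \<Psi>' (obmap \<Phi>' x)"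
    unfolding cmp_apply(1)[OF assms(1) x, symmetric] cmp_apply(1)[OF assms(2) x, symmetric] eq ..
next
  assume h: "x \<in> Ob A" "y \<in> Ob A" "a \<in> Hom A x y"
  show "hommap \<Psi> (obmap \<Phi> x) (obmap \<Phi> y) (hommap \<Phi> x y a) = hommap \<Psi>' (obmap \<Phi>' x) (obmap \<Phi>' y) (hommap \<Phi>' x y a)"
    unfolding cmp_apply(2)[OF assms(1) h, symmetric] cmp_apply(2)[OF assms(2) h, symmetric] eq ..
qed

lemma cmp_ideD:
  assumes "in_hom C \<Phi> A B" and eq: "Cmp C \<Psi> \<Phi> = Ide C A"
  shows "x \<in> Ob A \<Longrightarrow> obmap \<Psi> (obmap \<Phi> x) = x"
    and "\<lbrakk>x \<in> Ob A; y \<in> Ob A; a \<in> Hom A x y\<rbrakk> \<Longrightarrow> hommap \<Psi> (obmap \<Phi> x) (obmap \<Phi> y) (hommap \<Phi> x y a) = a"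
proof -
  assume x: "x \<in> Ob A"
  show "obmap \<Psi> (obmap \<Phi> x) = x"
    unfolding cmp_apply(1)[OF assms(1) x, symmetric] eq using x by (rule ide_apply(1))
next
  assume h: "x \<in> Ob A" "y \<in> Ob A" "a \<in> Hom A x y"
  show "hommap \<Psi> (obmap \<Phi> x) (obmap \<Phi> y) (hommap \<Phi> x y a) = a"
    unfolding cmp_apply(2)[OF assms(1) h, symmetric] eq using h by (rule ide_apply(2))
qed

lemma retractE:
  assumes "retract_of C \<Phi> \<Psi>"
  obtains A B X Y i r i' r' where "in_hom C \<Phi> A B" "in_hom C \<Psi> X Y"
    "in_hom C i A X" "in_hom C r X A" "in_hom C i' B Y" "in_hom C r' Y B"
    "Cmp C r i = Ide C A" "Cmp C r' i' = Ide C B" "Cmp C \<Psi> i = Cmp C i' \<Phi>" "Cmp C \<Phi> r = Cmp C r' \<Psi>"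
proof -
  define A B X Y where "A = Src \<Phi>" and "B = Tgt \<Phi>" and "X = Src \<Psi>" and "Y = Tgt \<Psi>"
  have h: "in_hom C \<Phi> A B" "in_hom C \<Psi> X Y"
    using assms by (simp_all add: retract_of_def in_hom_def A_def B_def X_def Y_def)
  obtain i r i' r' where m: "in_hom C i A X" "in_hom C r X A" "in_hom C i' B Y" "in_hom C r' Y B"
    and eq: "Cmp C r i = Ide C A" "Cmp C r' i' = Ide C B" "Cmp C \<Psi> i = Cmp C i' \<Phi>" "Cmp C \<Phi> r = Cmp C r' \<Psi>"
    using assms unfolding retract_of_def A_def B_def X_def Y_def C1star_cat_simps(2,3) by blast
  show thesis by (rule that[OF h m eq])
qed

lemma closed_under_retracts_Cof: "closed_under_retracts C (Cof F \<kappa>)"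
  unfolding closed_under_retracts_def
proof (intro allI impI, elim conjE)
  fix \<Phi> \<Psi> assume ret: "retract_of C \<Phi> \<Psi>" and \<Psi>: "\<Psi> \<in> Cof F \<kappa>"
  obtain A B X Y i r i' r' where h: "in_hom C \<Phi> A B" "in_hom C \<Psi> X Y"
    and m: "in_hom C i A X" "in_hom C r X A" "in_hom C i' B Y" "in_hom C r' Y B"
    and eq: "Cmp C r i = Ide C A" "Cmp C r' i' = Ide C B" "Cmp C \<Psi> i = Cmp C i' \<Phi>" "Cmp C \<Phi> r = Cmp C r' \<Psi>"
    using ret by (rule retractE)
  note ri = cmp_ideD[OF m(1) eq(1)] and ri' = cmp_ideD[OF m(3) eq(2)]
    and \<Psi>i = cmp_eqD[OF m(1) h(1) eq(3)] and \<Phi>r = cmp_eqD[OF m(2) h(2) eq(4)]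
  show "\<Phi> \<in> Cof F \<kappa>"
    unfolding Cof_iff[OF h(1)]
  proof (rule inj_onI)
    fix x y assume x: "x \<in> Ob A" and y: "y \<in> Ob A" and e: "obmap \<Phi> x = obmap \<Phi> y"
    have "obmap \<Psi> (obmap i x) = obmap \<Psi> (obmap i y)"
      unfolding \<Psi>i(1)[OF x] \<Psi>i(1)[OF y] e ..
    then have "obmap i x = obmap i y"
      using in_hom_closed(1)[OF m(1) x] in_hom_closed(1)[OF m(1) y] by (rule inj_onD[OF \<Psi>[unfolded Cof_iff[OF h(2)]]])
    then have "obmap r (obmap i x) = obmap r (obmap i y)" by (rule arg_cong)
    then show "x = y" unfolding ri(1)[OF x] ri(1)[OF y] .
  qed
qed

text \<open>Push \<open>v\<close> forward along \<open>i'\<close>, lift it through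
  \<open>\<Psi>\<close> from \<open>i x\<close>, and pull the lift back along \<open>r\<close>. As
  \<open>r i\<close> and \<open>r' i'\<close> are identities, the result starts at \<open>x\<close>
  and lies over \<open>v\<close>.\<close>

lemma closed_under_retracts_Fib: "closed_under_retracts C (Fib F \<kappa>)"
  unfolding closed_under_retracts_def
proof (intro allI impI, elim conjE)
  fix \<Phi> \<Psi> assume ret: "retract_of C \<Phi> \<Psi>" and \<Psi>: "\<Psi> \<in> Fib F \<kappa>"
  obtain A B X Y i r i' r' where h: "in_hom C \<Phi> A B" "in_hom C \<Psi> X Y"
    and m: "in_hom C i A X" "in_hom C r X A" "in_hom C i' B Y" "in_hom C r' Y B"
    and eq: "Cmp C r i = Ide C A" "Cmp C r' i' = Ide C B" "Cmp C \<Psi> i = Cmp C i' \<Phi>" "Cmp C \<Phi> r = Cmp C r' \<Psi>"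
    using ret by (rule retractE)
  note ri = cmp_ideD[OF m(1) eq(1)] and ri' = cmp_ideD[OF m(3) eq(2)]
    and \<Psi>i = cmp_eqD[OF m(1) h(1) eq(3)] and \<Phi>r = cmp_eqD[OF m(2) h(2) eq(4)]
  interpret B: star_category F B using small_star[OF in_homD(2)[OF h(1)]] .
  interpret X: star_category F X using small_star[OF in_homD(1)[OF h(2)]] .
  show "\<Phi> \<in> Fib F \<kappa>"
    unfolding Fib_iff[OF h(1)]
  proof (intro ballI allI impI)
    fix x y v assume x: "x \<in> Ob A" and y: "y \<in> Ob B" and v: "unitary B (obmap \<Phi> x) y v"
    note \<Phi>x = in_hom_closed(1)[OF h(1) x] and ix = in_hom_closed(1)[OF m(1) x] and iy = in_hom_closed(1)[OF m(3) y]
    have "unitary Y (obmap \<Psi> (obmap i x)) (obmap i' y) (hommap i' (obmap \<Phi> x) y v)"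
      using star_functor.map_unitary[OF in_homD(3)[OF m(3)] B.star_category_axioms \<Phi>x y v] \<Psi>i(1)[OF x] by simp
    then obtain x' u where x': "x' \<in> Ob X" and u: "unitary X (obmap i x) x' u" and \<Psi>x': "obmap \<Psi> x' = obmap i' y"
      and \<Psi>u: "hommap \<Psi> (obmap i x) x' u = hommap i' (obmap \<Phi> x) y v"
      using Fib_lift[OF h(2) \<Psi> ix iy] by blast
    have "unitary A x (obmap r x') (hommap r (obmap i x) x' u)"
      using star_functor.map_unitary[OF in_homD(3)[OF m(2)] X.star_category_axioms ix x' u] ri(1)[OF x] by simp
    moreover have "obmap \<Phi> (obmap r x') = y"
      using \<Phi>r(1)[OF x'] \<Psi>x' ri'(1)[OF y] by simp
    moreover have "hommap \<Phi> x (obmap r x') (hommap r (obmap i x) x' u) = v"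
      using \<Phi>r(2)[OF ix x' X.unitaryD(1)[OF u]] ri(1)[OF x] \<Psi>x' \<Psi>u \<Psi>i(1)[OF x] ri'(2)[OF \<Phi>x y B.unitaryD(1)[OF v]] by simp
    ultimately show "\<exists>x'\<in>Ob A. \<exists>u. unitary A x x' u \<and> obmap \<Phi> x' = y \<and> hommap \<Phi> x x' u = v"
      using in_hom_closed(1)[OF m(2) x'] by blast
  qed
qed

text \<open>Each half of the criterion passes to the retract: a preimage of \<open>b\<close> is the
  image under \<open>r\<close> of a preimage of \<open>i' b\<close>, and a unitary that ends at
  \<open>y\<close> is the image under \<open>r'\<close> of one that ends at
  \<open>i' y\<close>.\<close>

lemma closed_under_retracts_Weq: "closed_under_retracts C (Weq F \<kappa>)"
  unfolding closed_under_retracts_def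
proof (intro allI impI, elim conjE)
  fix \<Phi> \<Psi> assume ret: "retract_of C \<Phi> \<Psi>" and \<Psi>: "\<Psi> \<in> Weq F \<kappa>"
  obtain A B X Y i r i' r' where h: "in_hom C \<Phi> A B" "in_hom C \<Psi> X Y"
    and m: "in_hom C i A X" "in_hom C r X A" "in_hom C i' B Y" "in_hom C r' Y B"
    and eq: "Cmp C r i = Ide C A" "Cmp C r' i' = Ide C B" "Cmp C \<Psi> i = Cmp C i' \<Phi>" "Cmp C \<Phi> r = Cmp C r' \<Psi>"
    using ret by (rule retractE)
  note ri = cmp_ideD[OF m(1) eq(1)] and ri' = cmp_ideD[OF m(3) eq(2)]
    and \<Psi>i = cmp_eqD[OF m(1) h(1) eq(3)] and \<Phi>r = cmp_eqD[OF m(2) h(2) eq(4)]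
  have ff: "fully_faithful X Y (obmap \<Psi>) (hommap \<Psi>)" and es: "unitarily_surjective X Y (obmap \<Psi>)"
    using \<Psi> unfolding Weq_iff[OF h(2)] by simp_all
  interpret Y: star_category F Y using small_star[OF in_homD(2)[OF h(2)]] .
  have "fully_faithful A B (obmap \<Phi>) (hommap \<Phi>)"
  proof (rule fully_faithfulI)
    fix x y assume x: "x \<in> Ob A" and y: "y \<in> Ob A"
    note i = in_hom_closed(1)[OF m(1) x] in_hom_closed(1)[OF m(1) y]
    note \<Phi>o = in_hom_closed(1)[OF h(1) x] in_hom_closed(1)[OF h(1) y]
    show "hommap \<Phi> x y a \<in> Hom B (obmap \<Phi> x) (obmap \<Phi> y)" if "a \<in> Hom A x y" for a
      using x y that by (rule in_hom_closed(2)[OF h(1)])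
    show "a = b" if a: "a \<in> Hom A x y" and b: "b \<in> Hom A x y" and eq: "hommap \<Phi> x y a = hommap \<Phi> x y b" for a b
    proof -
      have "hommap i x y a = hommap i x y b"
        using \<Psi>i(2)[OF x y a] \<Psi>i(2)[OF x y b] eq
        by (intro fully_faithfulD(1)[OF ff i _ in_hom_closed(2)[OF m(1) x y a] in_hom_closed(2)[OF m(1) x y b]]) simp
      then have "hommap r (obmap i x) (obmap i y) (hommap i x y a) = hommap r (obmap i x) (obmap i y) (hommap i x y b)"
        by (rule arg_cong)
      then show ?thesis unfolding ri(2)[OF x y a] ri(2)[OF x y b] .
    qed
    show "\<exists>a\<in>Hom A x y. hommap \<Phi> x y a = b" if b: "b \<in> Hom B (obmap \<Phi> x) (obmap \<Phi> y)" for b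
    proof -
      have "hommap i' (obmap \<Phi> x) (obmap \<Phi> y) b \<in> Hom Y (obmap \<Psi> (obmap i x)) (obmap \<Psi> (obmap i y))"
        using in_hom_closed(2)[OF m(3) \<Phi>o b] \<Psi>i(1)[OF x] \<Psi>i(1)[OF y] by simp
      then obtain c where c: "c \<in> Hom X (obmap i x) (obmap i y)"
        "hommap \<Psi> (obmap i x) (obmap i y) c = hommap i' (obmap \<Phi> x) (obmap \<Phi> y) b"
        by (rule fully_faithfulE[OF ff i])
      have "hommap r (obmap i x) (obmap i y) c \<in> Hom A x y"
        using in_hom_closed(2)[OF m(2) i c(1)] ri(1)[OF x] ri(1)[OF y] by simp
      moreover have "hommap \<Phi> x y (hommap r (obmap i x) (obmap i y) c) = b"
        using \<Phi>r(2)[OF i c(1)] c(2) ri(1)[OF x] ri(1)[OF y] \<Psi>i(1)[OF x] \<Psi>i(1)[OF y] ri'(2)[OF \<Phi>o b] by simp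
      ultimately show ?thesis by blast
    qed
  qed
  moreover have "unitarily_surjective A B (obmap \<Phi>)"
    unfolding unitarily_surjective_def
  proof
    fix y assume y: "y \<in> Ob B"
    note iy = in_hom_closed(1)[OF m(3) y]
    obtain x u where x: "x \<in> Ob X" and u: "unitary Y (obmap \<Psi> x) (obmap i' y) u"
      using es iy unfolding unitarily_surjective_def by blast
    have "unitary B (obmap \<Phi> (obmap r x)) y (hommap r' (obmap \<Psi> x) (obmap i' y) u)"
      using star_functor.map_unitary[OF in_homD(3)[OF m(4)] Y.star_category_axioms in_hom_closed(1)[OF h(2) x] iy u]
        \<Phi>r(1)[OF x] ri'(1)[OF y] by simp
    then show "\<exists>x\<in>Ob A. \<exists>u. unitary B (obmap \<Phi> x) y u"
      using in_hom_closed(1)[OF m(2) x] by blast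
  qed
  ultimately show "\<Phi> \<in> Weq F \<kappa>" unfolding Weq_iff[OF h(1)] by blast
qed

section \<open>The lifting axioms\<close>

lemma squareE:
  assumes "square C i p u v"
  obtains A B X Y where "in_hom C i A B" "in_hom C p X Y" "in_hom C u A X" "in_hom C v B Y" "Cmp C p u = Cmp C v i"
proof (rule that)
  show "in_hom C i (Src i) (Tgt i)" "in_hom C p (Src p) (Tgt p)" "in_hom C u (Src i) (Src p)" "in_hom C v (Tgt i) (Tgt p)"
    using assms by (simp_all add: square_def in_hom_def)
  show "Cmp C p u = Cmp C v i"
    using assms unfolding square_def by (elim conjE)
qed

lemma liftI:
  assumes h: "star_functor F B X h \<chi>" and i: "in_hom C i A B" and p: "in_hom C p X Y" and u: "in_hom C u A X" and v: "in_hom C v B Y"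
    and "\<And>x. x \<in> Ob A \<Longrightarrow> h (obmap i x) = obmap u x"
    and "\<And>x y a. \<lbrakk>x \<in> Ob A; y \<in> Ob A; a \<in> Hom A x y\<rbrakk> \<Longrightarrow> \<chi> (obmap i x) (obmap i y) (hommap i x y a) = hommap u x y a"
    and "\<And>x. x \<in> Ob B \<Longrightarrow> obmap p (h x) = obmap v x"
    and "\<And>x y a. \<lbrakk>x \<in> Ob B; y \<in> Ob B; a \<in> Hom B x y\<rbrakk> \<Longrightarrow> hommap p (h x) (h y) (\<chi> x y a) = hommap v x y a"
  shows "\<exists>h. in_hom C h (Cod C i) (Dom C p) \<and> Cmp C h i = u \<and> Cmp C p h = v"
proof (intro exI[of _ "mk_arrow B X h \<chi>"] conjI)
  have H: "in_hom C (mk_arrow B X h \<chi>) B X"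
    using in_homD(2)[OF i] in_homD(1)[OF p] h by (rule in_hom_mk)
  then show "in_hom C (mk_arrow B X h \<chi>) (Cod C i) (Dom C p)"
    using in_homD(5)[OF i] in_homD(4)[OF p] by simp
  show "Cmp C (mk_arrow B X h \<chi>) i = u"
    by (rule arrow_eqI[OF cmp_in_hom[OF i H] u])
      (simp_all add: cmp_apply[OF i] in_hom_closed[OF i] assms(6,7) del: C1star_cat_simps)
  show "Cmp C p (mk_arrow B X h \<chi>) = v"
    by (rule arrow_eqI[OF cmp_in_hom[OF H p] v])
      (simp_all add: cmp_apply[OF H] assms(8,9) del: C1star_cat_simps)
qed

text \<open>A fibration that is a weak equivalence is surjective on objects in the strict sense. On
  the image of \<open>i\<close> the object map of the lift is forced, and well defined by
  injectivity; elsewhere it is any choice over \<open>v\<close>. Full faithfulness of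
  \<open>p\<close> then determines the arrows.\<close>

lemma lifting_Cof_trivial_Fib:
  assumes ci: "i \<in> Cof F \<kappa>" and cp: "p \<in> Weq F \<kappa>" "p \<in> Fib F \<kappa>"
  shows "has_lifting C i p"
  unfolding has_lifting_def
proof (intro allI impI)
  fix u v assume "square C i p u v"
  then obtain A B X Y where i: "in_hom C i A B" and p: "in_hom C p X Y" and u: "in_hom C u A X" and v: "in_hom C v B Y"
    and eq: "Cmp C p u = Cmp C v i" by (rule squareE)
  note pu = cmp_eqD[OF u i eq]
  have inj: "inj_on (obmap i) (Ob A)" using ci unfolding Cof_iff[OF i] .
  have ff: "fully_faithful X Y (obmap p) (hommap p)" and es: "unitarily_surjective X Y (obmap p)"
    using cp(1) unfolding Weq_iff[OF p] by simp_all
  \<comment> \<open>Lifting the unitary from \<open>p x\<close> to \<open>y\<close> moves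
    \<open>x\<close> to an object that lies exactly over \<open>y\<close>.\<close>
  have surj: "\<exists>x\<in>Ob X. obmap p x = y" if y: "y \<in> Ob Y" for y
  proof -
    obtain x w where x: "x \<in> Ob X" and w: "unitary Y (obmap p x) y w"
      using es y unfolding unitarily_surjective_def by blast
    then show ?thesis using Fib_lift[OF p cp(2) x y w] by blast
  qed
  define h where "h b = (if b \<in> obmap i ` Ob A then obmap u (inv_into (Ob A) (obmap i) b)
    else SOME x. x \<in> Ob X \<and> obmap p x = obmap v b)" for b
  have hi: "h (obmap i x) = obmap u x" if "x \<in> Ob A" for x
    using that inj by (simp add: h_def)
  have h: "h b \<in> Ob X" "obmap p (h b) = obmap v b" if b: "b \<in> Ob B" for b
  proof -
    have "h b \<in> Ob X \<and> obmap p (h b) = obmap v b"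
    proof (cases "b \<in> obmap i ` Ob A")
      case True
      then obtain x where "x \<in> Ob A" "b = obmap i x" by blast
      then show ?thesis using hi pu(1) in_hom_closed(1)[OF u] by simp
    next
      case False
      have "\<exists>x. x \<in> Ob X \<and> obmap p x = obmap v b" using surj[OF in_hom_closed(1)[OF v b]] by blast
      from someI_ex[OF this] show ?thesis using False by (simp add: h_def)
    qed
    then show "h b \<in> Ob X" "obmap p (h b) = obmap v b" by simp_all
  qed
  define \<chi> where "\<chi> x y a = inv_into (Hom X (h x) (h y)) (hommap p (h x) (h y)) (hommap v x y a)" for x y a
  have func: "star_functor F B X h \<chi>"
    unfolding \<chi>_def
    by (rule fully_faithful_lift[OF small_star[OF in_homD(2)[OF i]] small_star[OF in_homD(1)[OF p]] in_homD(3)[OF p] ff in_homD(3)[OF v] h])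
  show "\<exists>h. in_hom C h (Cod C i) (Dom C p) \<and> Cmp C h i = u \<and> Cmp C p h = v"
  proof (rule liftI[OF func i p u v hi _ h(2)])
    fix x y a assume x: "x \<in> Ob A" and y: "y \<in> Ob A" and a: "a \<in> Hom A x y"
    show "\<chi> (obmap i x) (obmap i y) (hommap i x y a) = hommap u x y a"
      unfolding \<chi>_def hi[OF x] hi[OF y] pu(2)[OF x y a, symmetric]
      using in_hom_closed[OF u] x y a by (intro fully_faithfulD(4)[OF ff])
  next
    fix x y a assume x: "x \<in> Ob B" and y: "y \<in> Ob B" and a: "a \<in> Hom B x y"
    show "hommap p (h x) (h y) (\<chi> x y a) = hommap v x y a"
      unfolding \<chi>_def using in_hom_closed(2)[OF v x y a] h[OF x] h[OF y] by (intro fully_faithfulD(3)[OF ff]) simp_all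
  qed
qed

text \<open>\<open>i\<close> has a retraction \<open>g\<close> with unitaries \<open>w b\<close>
  from \<open>i (g b)\<close> to \<open>b\<close>. Their images under \<open>v\<close> start at
  \<open>p (u (g b))\<close> and lift through the fibration to unitaries \<open>t b\<close>, whose
  ends are the objects \<open>h b\<close>. Conjugating the composite of the retraction with
  \<open>u\<close> by the \<open>t b\<close> gives the diagonal.\<close>

lemma lifting_trivial_Cof_Fib:
  assumes ci: "i \<in> Weq F \<kappa>" "i \<in> Cof F \<kappa>" and cp: "p \<in> Fib F \<kappa>"
  shows "has_lifting C i p"
  unfolding has_lifting_def
proof (intro allI impI)
  fix u v assume "square C i p u v"
  then obtain A B X Y where i: "in_hom C i A B" and p: "in_hom C p X Y" and u: "in_hom C u A X" and v: "in_hom C v B Y"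
    and eq: "Cmp C p u = Cmp C v i" by (rule squareE)
  note pu = cmp_eqD[OF u i eq]
  interpret A: star_category F A using small_star[OF in_homD(1)[OF i]] .
  interpret B: star_category F B using small_star[OF in_homD(2)[OF i]] .
  interpret X: star_category F X using small_star[OF in_homD(1)[OF p]] .
  interpret Y: star_category F Y using small_star[OF in_homD(2)[OF p]] .
  interpret i: star_functor F A B "obmap i" "hommap i" by (rule in_homD(3)[OF i])
  interpret u: star_functor F A X "obmap u" "hommap u" by (rule in_homD(3)[OF u])
  interpret v: star_functor F B Y "obmap v" "hommap v" by (rule in_homD(3)[OF v])
  interpret p: star_functor F X Y "obmap p" "hommap p" by (rule in_homD(3)[OF p])
  have inj: "inj_on (obmap i) (Ob A)" using ci(2) unfolding Cof_iff[OF i] .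
  have ff: "fully_faithful A B (obmap i) (hommap i)" and es: "unitarily_surjective A B (obmap i)"
    using ci(1) unfolding Weq_iff[OF i] by simp_all
  \<comment> \<open>On the image of \<open>i\<close> the retraction is strict and its unitaries are
    identities; otherwise the upper triangle would commute only up to isomorphism.\<close>
  have "\<forall>b\<in>Ob B. \<exists>q. fst q \<in> Ob A \<and> unitary B (obmap i (fst q)) b (snd q) \<and>
    (\<forall>x\<in>Ob A. b = obmap i x \<longrightarrow> fst q = x \<and> snd q = Unit B b)"
  proof
    fix b assume b: "b \<in> Ob B"
    show "\<exists>q. fst q \<in> Ob A \<and> unitary B (obmap i (fst q)) b (snd q) \<and>
      (\<forall>x\<in>Ob A. b = obmap i x \<longrightarrow> fst q = x \<and> snd q = Unit B b)"
    proof (cases "b \<in> obmap i ` Ob A")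
      case True
      then obtain x where x: "x \<in> Ob A" "b = obmap i x" by blast
      then show ?thesis
        using B.unitary_unit[OF b] inj by (intro exI[of _ "(x, Unit B b)"]) (auto dest: inj_onD)
    next
      case False
      obtain x w where "x \<in> Ob A" "unitary B (obmap i x) b w"
        using es b unfolding unitarily_surjective_def by blast
      with False show ?thesis by (intro exI[of _ "(x, w)"]) auto
    qed
  qed
  from bchoice[OF this] obtain q where q: "\<forall>b\<in>Ob B. fst (q b) \<in> Ob A \<and> unitary B (obmap i (fst (q b))) b (snd (q b)) \<and>
    (\<forall>x\<in>Ob A. b = obmap i x \<longrightarrow> fst (q b) = x \<and> snd (q b) = Unit B b)" by blast
  define g w where "g b = fst (q b)" and "w b = snd (q b)" for b
  have g: "g b \<in> Ob A" and w: "unitary B (obmap i (g b)) b (w b)" if "b \<in> Ob B" for b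
    using q that by (simp_all add: g_def w_def)
  have gi: "g (obmap i x) = x" and wi: "w (obmap i x) = Unit B (obmap i x)" if "x \<in> Ob A" for x
    using q[rule_format, OF i.ob_closed[OF that]] that by (simp_all add: g_def w_def)
  define \<beta> where "\<beta> x y b = conjugate B x (obmap i (g x)) y (obmap i (g y))
    (Star B (obmap i (g x)) x (w x)) (Star B (obmap i (g y)) y (w y)) b" for x y b
  have \<beta>: "star_functor F B B (\<lambda>y. obmap i (g y)) \<beta>"
    unfolding \<beta>_def
    using conjugate_functor[OF B.star_category_axioms B.star_category_axioms star_functor_id, of "\<lambda>y. obmap i (g y)"]
      B.unitary_star[OF i.ob_closed[OF g] _ w] i.ob_closed[OF g] by simp
  interpret \<beta>: star_functor F B B "\<lambda>y. obmap i (g y)" \<beta> by (rule \<beta>)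
  define \<rho> where "\<rho> x y b = inv_into (Hom A (g x) (g y)) (hommap i (g x) (g y)) (\<beta> x y b)" for x y b
  have \<rho>: "star_functor F B A g \<rho>"
    unfolding \<rho>_def
    by (rule fully_faithful_lift[OF B.star_category_axioms A.star_category_axioms in_homD(3)[OF i] ff \<beta> g refl])
  interpret \<rho>: star_functor F B A g \<rho> by (rule \<rho>)
  have i\<rho>: "hommap i (g x) (g y) (\<rho> x y b) = \<beta> x y b" if "x \<in> Ob B" "y \<in> Ob B" "b \<in> Hom B x y" for x y b
    unfolding \<rho>_def using that by (intro fully_faithfulD(3)[OF ff] g \<beta>.hom_closed)
  have \<rho>i: "\<rho> (obmap i x) (obmap i y) (hommap i x y a) = a" if x: "x \<in> Ob A" and y: "y \<in> Ob A" and a: "a \<in> Hom A x y" for x y a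
  proof -
    have "\<beta> (obmap i x) (obmap i y) (hommap i x y a) = hommap i x y a"
      unfolding \<beta>_def gi[OF x] gi[OF y] wi[OF x] wi[OF y]
      using i.ob_closed[OF x] i.ob_closed[OF y] i.hom_closed[OF x y a] by (simp add: B.star_unit B.conjugate_units)
    then show ?thesis
      unfolding \<rho>_def gi[OF x] gi[OF y] using fully_faithfulD(4)[OF ff x y a] by simp
  qed
  have pug: "obmap p (obmap u (g b)) = obmap v (obmap i (g b))" if "b \<in> Ob B" for b
    using pu(1)[OF g[OF that]] .
  \<comment> \<open>Over the image of \<open>i\<close> the identity of \<open>u x\<close> is a lift
    of the identity chosen there, and it is the one taken. Elsewhere the fibration property supplies
    a lift.\<close>
  have "\<forall>b\<in>Ob B. \<exists>q. fst q \<in> Ob X \<and> unitary X (obmap u (g b)) (fst q) (snd q) \<and> obmap p (fst q) = obmap v b \<and>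
    hommap p (obmap u (g b)) (fst q) (snd q) = hommap v (obmap i (g b)) b (w b) \<and>
    (\<forall>x\<in>Ob A. b = obmap i x \<longrightarrow> fst q = obmap u x \<and> snd q = Unit X (obmap u x))"
  proof
    fix b assume b: "b \<in> Ob B"
    show "\<exists>q. fst q \<in> Ob X \<and> unitary X (obmap u (g b)) (fst q) (snd q) \<and> obmap p (fst q) = obmap v b \<and>
      hommap p (obmap u (g b)) (fst q) (snd q) = hommap v (obmap i (g b)) b (w b) \<and>
      (\<forall>x\<in>Ob A. b = obmap i x \<longrightarrow> fst q = obmap u x \<and> snd q = Unit X (obmap u x))"
    proof (cases "b \<in> obmap i ` Ob A")
      case True
      then obtain x where x: "x \<in> Ob A" and b_eq: "b = obmap i x" by blast
      show ?thesis
      proof (intro exI[of _ "(obmap u x, Unit X (obmap u x))"] conjI ballI impI; unfold fst_conv snd_conv b_eq gi[OF x] wi[OF x])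
        show "obmap u x \<in> Ob X" "unitary X (obmap u x) (obmap u x) (Unit X (obmap u x))"
          using u.ob_closed[OF x] X.unitary_unit by simp_all
        show "obmap p (obmap u x) = obmap v (obmap i x)" by (rule pu(1)[OF x])
        show "hommap p (obmap u x) (obmap u x) (Unit X (obmap u x)) = hommap v (obmap i x) (obmap i x) (Unit B (obmap i x))"
          using u.ob_closed[OF x] i.ob_closed[OF x] pu(1)[OF x] by (simp add: p.map_unit v.map_unit)
        fix x' assume "x' \<in> Ob A" "obmap i x = obmap i x'"
        then have "x = x'" using inj x by (auto dest: inj_onD)
        then show "obmap u x = obmap u x'" "Unit X (obmap u x) = Unit X (obmap u x')" by simp_all
      qed
    next
      case False
      have "unitary Y (obmap p (obmap u (g b))) (obmap v b) (hommap v (obmap i (g b)) b (w b))"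
        unfolding pug[OF b] using b by (intro v.map_unitary[OF B.star_category_axioms] i.ob_closed g w)
      then obtain x t where "x \<in> Ob X" "unitary X (obmap u (g b)) x t" "obmap p x = obmap v b"
        "hommap p (obmap u (g b)) x t = hommap v (obmap i (g b)) b (w b)"
        using Fib_lift[OF p cp u.ob_closed[OF g[OF b]] v.ob_closed[OF b]] by blast
      with False show ?thesis by (intro exI[of _ "(x, t)"]) auto
    qed
  qed
  from bchoice[OF this] obtain q' where q': "\<forall>b\<in>Ob B. fst (q' b) \<in> Ob X \<and> unitary X (obmap u (g b)) (fst (q' b)) (snd (q' b)) \<and>
    obmap p (fst (q' b)) = obmap v b \<and> hommap p (obmap u (g b)) (fst (q' b)) (snd (q' b)) = hommap v (obmap i (g b)) b (w b) \<and>
    (\<forall>x\<in>Ob A. b = obmap i x \<longrightarrow> fst (q' b) = obmap u x \<and> snd (q' b) = Unit X (obmap u x))" by blast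
  define h t where "h b = fst (q' b)" and "t b = snd (q' b)" for b
  have h: "h b \<in> Ob X" and t: "unitary X (obmap u (g b)) (h b) (t b)" and ph: "obmap p (h b) = obmap v b"
    and pt: "hommap p (obmap u (g b)) (h b) (t b) = hommap v (obmap i (g b)) b (w b)" if "b \<in> Ob B" for b
    using q' that by (simp_all add: h_def t_def)
  have hi: "h (obmap i x) = obmap u x" and ti: "t (obmap i x) = Unit X (obmap u x)" if "x \<in> Ob A" for x
    using q'[rule_format, OF i.ob_closed[OF that]] that by (simp_all add: h_def t_def)
  define \<chi> where "\<chi> x y b = conjugate X (obmap u (g x)) (h x) (obmap u (g y)) (h y) (t x) (t y) (hommap u (g x) (g y) (\<rho> x y b))" for x y b
  have func: "star_functor F B X h \<chi>"
    unfolding \<chi>_def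
    using conjugate_functor[OF B.star_category_axioms X.star_category_axioms star_functor_comp[OF \<rho> in_homD(3)[OF u]], of h t] h t
    by (simp add: comp_def)
  show "\<exists>h. in_hom C h (Cod C i) (Dom C p) \<and> Cmp C h i = u \<and> Cmp C p h = v"
  proof (rule liftI[OF func i p u v hi _ ph])
    fix x y a assume x: "x \<in> Ob A" and y: "y \<in> Ob A" and a: "a \<in> Hom A x y"
    show "\<chi> (obmap i x) (obmap i y) (hommap i x y a) = hommap u x y a"
      unfolding \<chi>_def gi[OF x] gi[OF y] hi[OF x] hi[OF y] ti[OF x] ti[OF y] \<rho>i[OF x y a]
      using x y a by (intro X.conjugate_units u.ob_closed u.hom_closed)
  next
    fix x y b assume x: "x \<in> Ob B" and y: "y \<in> Ob B" and b: "b \<in> Hom B x y"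
    note gx = g[OF x] and gy = g[OF y] and \<rho>b = \<rho>.hom_closed[OF x y b]
    \<comment> \<open>\<open>p\<close> and \<open>v\<close> both commute with conjugation, so what
      remains is to undo in \<open>B\<close> the conjugation that defines
      \<open>\<beta>\<close>.\<close>
    have "hommap p (h x) (h y) (\<chi> x y b) = conjugate Y (obmap p (obmap u (g x))) (obmap p (h x)) (obmap p (obmap u (g y))) (obmap p (h y))
        (hommap p (obmap u (g x)) (h x) (t x)) (hommap p (obmap u (g y)) (h y) (t y))
        (hommap p (obmap u (g x)) (obmap u (g y)) (hommap u (g x) (g y) (\<rho> x y b)))"
      unfolding \<chi>_def using x y gx gy \<rho>b
      by (intro p.map_conjugate[OF X.star_category_axioms] u.ob_closed h t u.hom_closed)
    also have "\<dots> = conjugate Y (obmap v (obmap i (g x))) (obmap v x) (obmap v (obmap i (g y))) (obmap v y)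
        (hommap v (obmap i (g x)) x (w x)) (hommap v (obmap i (g y)) y (w y))
        (hommap v (obmap i (g x)) (obmap i (g y)) (\<beta> x y b))"
      unfolding pu(2)[OF gx gy \<rho>b] pt[OF x] pt[OF y] pug[OF x] pug[OF y] ph[OF x] ph[OF y] i\<rho>[OF x y b] ..
    also have "\<dots> = hommap v x y (conjugate B (obmap i (g x)) x (obmap i (g y)) y (w x) (w y) (\<beta> x y b))"
      using x y gx gy b
      by (intro v.map_conjugate[OF B.star_category_axioms, symmetric] i.ob_closed w \<beta>.hom_closed)
    also have "conjugate B (obmap i (g x)) x (obmap i (g y)) y (w x) (w y) (\<beta> x y b) = b"
      unfolding \<beta>_def using x y gx gy b by (intro B.conjugate_inverse' i.ob_closed w)
    finally show "hommap p (h x) (h y) (\<chi> x y b) = hommap v x y b" .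
  qed
qed

end

section \<open>Functorial factorizations\<close>

lemma pull_cat_corestrict:
  assumes "star_functor F K A f \<phi>" "\<And>x. x \<in> Ob K \<Longrightarrow> h x \<in> P" "\<And>x. x \<in> Ob K \<Longrightarrow> g (h x) = f x"
  shows "star_functor F K (pull_cat A P g) h \<phi>"
proof -
  interpret f: star_functor F K A f \<phi> by fact
  show ?thesis
    by unfold_locales
      (simp_all add: assms(2,3) f.hom_closed f.map_unit f.map_comp f.map_add f.map_scale f.map_star)
qed

lemma unitary_pull_cat [simp]: "unitary (pull_cat A P g) x y u \<longleftrightarrow> unitary A (g x) (g y) u"
  by (simp add: unitary_def)

context unitary_model
begin

lemma pull_cat_small:
  assumes A: "A \<in> small_cats" and P: "|P :: 'u set| <o \<kappa>" and g: "g ` P \<subseteq> Ob A"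
  shows "pull_cat A P g \<in> small_cats"
proof -
  have "g x \<in> Ob A" if "x \<in> P" for x using g that by blast
  then show ?thesis
    using A P pull_cat_Cstar[OF F small_CstarD[OF A] g] by (simp add: small_Cstar_categories_def)
qed

lemma square_arrows:
  assumes "square C f g u v"
  shows "in_hom C f (Src f) (Tgt f)" "in_hom C g (Src g) (Tgt g)" "in_hom C u (Src f) (Src g)" "in_hom C v (Tgt f) (Tgt g)"
    and "Cmp C g u = Cmp C v f"
proof -
  show "in_hom C f (Src f) (Tgt f)" "in_hom C g (Src g) (Tgt g)" "in_hom C u (Src f) (Src g)" "in_hom C v (Tgt f) (Tgt g)"
    using assms by (simp_all add: square_def in_hom_def)
  show "Cmp C g u = Cmp C v f"
    using assms unfolding square_def by (elim conjE)
qed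

lemma square_paste:
  assumes sq: "square C f g u v" and sq': "square C g h u' v'"
  shows "square C f h (Cmp C u' u) (Cmp C v' v)"
proof -
  note arr = square_arrows[OF sq] and arr' = square_arrows[OF sq']
  have eq: "Cmp C h (Cmp C u' u) = Cmp C (Cmp C v' v) f"
    unfolding category.cmp_assoc[OF C_category arr(3) arr'(3) arr'(2)] arr'(5)
      category.cmp_assoc[OF C_category arr(3) arr(2) arr'(4), symmetric] arr(5)
    by (rule category.cmp_assoc[OF C_category arr(1) arr(4) arr'(4)])
  show ?thesis
    using sq sq' cmp_in_hom[OF arr(3) arr'(3)] cmp_in_hom[OF arr(4) arr'(4)] eq
    unfolding square_def C1star_cat_simps(2,3) by (elim conjE) (intro conjI; assumption)
qed

text \<open>The middle object is supplied as an explicit \<open>E f\<close>, where the definition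
  reads it off as the codomain of \<open>L f\<close>.\<close>

lemma functorially_factorsI:
  assumes L: "\<And>f A B. in_hom C f A B \<Longrightarrow> in_hom C (L f) A (E f)"
    and R: "\<And>f A B. in_hom C f A B \<Longrightarrow> in_hom C (R f) (E f) B"
    and RL: "\<And>f A B. in_hom C f A B \<Longrightarrow> Cmp C (R f) (L f) = f"
    and M: "\<And>f g u v. square C f g u v \<Longrightarrow> in_hom C (M f g u v) (E f) (E g)"
    and M_L: "\<And>f g u v. square C f g u v \<Longrightarrow> Cmp C (M f g u v) (L f) = Cmp C (L g) u"
    and R_M: "\<And>f g u v. square C f g u v \<Longrightarrow> Cmp C (R g) (M f g u v) = Cmp C v (R f)"
    and M_ide: "\<And>f A B. in_hom C f A B \<Longrightarrow> M f f (Ide C A) (Ide C B) = Ide C (E f)"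
    and M_cmp: "\<And>f g h u v u' v'. square C f g u v \<Longrightarrow> square C g h u' v' \<Longrightarrow>
      M f h (Cmp C u' u) (Cmp C v' v) = Cmp C (M g h u' v') (M f g u v)"
    and mem: "\<And>f A B. in_hom C f A B \<Longrightarrow> L f \<in> S" "\<And>f A B. in_hom C f A B \<Longrightarrow> R f \<in> T"
  shows "functorially_factors C S T"
proof -
  have arr: "in_hom C f (Src f) (Tgt f)" if "f \<in> Arr C" for f using that by (simp add: in_hom_def)
  have E: "Cod C (L f) = E f" if "f \<in> Arr C" for f
    using in_homD(5)[OF L[OF arr[OF that]]] by simp
  have sq: "f \<in> Arr C" "g \<in> Arr C" if "square C f g u v" for f g u v
    using that by (simp_all add: square_def)
  have "functorial_factorization C L R M"
    unfolding functorial_factorization_def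
  proof (intro conjI ballI allI impI)
    fix f assume f: "f \<in> Arr C"
    show "in_hom C (L f) (Dom C f) (Cod C (L f))" "in_hom C (R f) (Cod C (L f)) (Cod C f)"
      using L[OF arr[OF f]] R[OF arr[OF f]] unfolding E[OF f] by simp_all
    show "Cmp C (R f) (L f) = f" by (rule RL[OF arr[OF f]])
    show "M f f (Ide C (Dom C f)) (Ide C (Cod C f)) = Ide C (Cod C (L f))"
      unfolding E[OF f] unfolding C1star_cat_simps(2,3) by (rule M_ide[OF arr[OF f]])
  next
    fix f g u v assume s: "square C f g u v"
    show "in_hom C (M f g u v) (Cod C (L f)) (Cod C (L g))"
      unfolding E[OF sq(1)[OF s]] E[OF sq(2)[OF s]] by (rule M[OF s])
    show "Cmp C (M f g u v) (L f) = Cmp C (L g) u" by (rule M_L[OF s])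
    show "Cmp C (R g) (M f g u v) = Cmp C v (R f)" by (rule R_M[OF s])
  next
    fix f g h u v u' v' assume "square C f g u v \<and> square C g h u' v'"
    then show "M f h (Cmp C u' u) (Cmp C v' v) = Cmp C (M g h u' v') (M f g u v)"
      by (elim conjE) (rule M_cmp)
  qed
  then show ?thesis
    unfolding functorially_factors_def using mem arr by blast
qed

text \<open>The mapping cylinder, with the arrows of the target.\<close>

lemma factorization_Cof_trivial_Fib: "functorially_factors C (Cof F \<kappa>) (Weq F \<kappa> \<inter> Fib F \<kappa>)"
proof -
  obtain s :: "'u + 'u \<Rightarrow> 'u" where s: "inj s" using encode_sums by (rule exE)
  define P where "P f = (\<lambda>x. s (Inl x)) ` Ob (Src f) \<union> (\<lambda>y. s (Inr y)) ` Ob (Tgt f)" for f :: "('u, 'u) fun_arrow"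
  \<comment> \<open>The projection of the cylinder: a coded object of the source goes to its image,
    a coded object of the target to itself. Hom sets are pulled back along it, so \<open>R f\<close>
    is the identity on arrows.\<close>
  define q where "q f z = (case inv_into UNIV s z of Inl x \<Rightarrow> obmap f x | Inr y \<Rightarrow> y)" for f :: "('u, 'u) fun_arrow" and z
  define E where "E f = pull_cat (Tgt f) (P f) (q f)" for f
  define L where "L f = mk_arrow (Src f) (E f) (\<lambda>x. s (Inl x)) (hommap f)" for f
  define R where "R f = mk_arrow (E f) (Tgt f) (q f) (\<lambda>x y. id)" for f
  define m where "m u v z = (case inv_into UNIV s z of Inl x \<Rightarrow> s (Inl (obmap u x)) | Inr y \<Rightarrow> s (Inr (obmap v y)))"
    for u v :: "('u, 'u) fun_arrow" and z
  define M where "M f g u v = mk_arrow (E f) (E g) (m u v) (\<lambda>x y. hommap v (q f x) (q f y))" for f g u v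
  have q [simp]: "q f (s (Inl x)) = obmap f x" "q f (s (Inr y)) = y" for f x y
    using s by (simp_all add: q_def)
  have m [simp]: "m u v (s (Inl x)) = s (Inl (obmap u x))" "m u v (s (Inr y)) = s (Inr (obmap v y))" for u v x y
    using s by (simp_all add: m_def)
  have cases: thesis if "z \<in> P f" "\<And>x. x \<in> Ob (Src f) \<Longrightarrow> z = s (Inl x) \<Longrightarrow> thesis"
    "\<And>y. y \<in> Ob (Tgt f) \<Longrightarrow> z = s (Inr y) \<Longrightarrow> thesis" for z f thesis
    using that unfolding P_def by blast
  have PI: "x \<in> Ob (Src f) \<Longrightarrow> s (Inl x) \<in> P f" "y \<in> Ob (Tgt f) \<Longrightarrow> s (Inr y) \<in> P f" for x y f
    by (simp_all add: P_def)
  have ObE [simp]: "Ob (E f) = P f" and HomE [simp]: "Hom (E f) x y = Hom (Tgt f) (q f x) (q f y)" for f x y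
    by (simp_all add: E_def)
  have q_in: "q f z \<in> Ob B" if f: "in_hom C f A B" and z: "z \<in> P f" for f A B z
    using z by (rule cases) (simp_all add: in_homD(4,5)[OF f] in_hom_closed(1)[OF f])
  have E: "E f \<in> small_cats" and pull: "star_functor F (E f) B (q f) (\<lambda>x y. id)" if f: "in_hom C f A B" for f A B
  proof -
    have "|P f| <o \<kappa>"
      unfolding P_def using in_homD(1,2,4,5)[OF f] by (intro small_Un small_image) (simp_all add: small_Cstar_categories_def)
    then show "E f \<in> small_cats"
      unfolding E_def using in_homD(2,5)[OF f] q_in[OF f] by (intro pull_cat_small) auto
    show "star_functor F (E f) B (q f) (\<lambda>x y. id)"
      unfolding E_def using in_homD(5)[OF f] q_in[OF f] by (auto intro!: pull_cat_functor)
  qed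
  have L: "in_hom C (L f) A (E f)" if f: "in_hom C f A B" for f A B
    unfolding L_def in_homD(4)[OF f]
  proof (rule in_hom_mk[OF in_homD(1)[OF f] E[OF f]])
    show "star_functor F A (E f) (\<lambda>x. s (Inl x)) (hommap f)"
      unfolding E_def in_homD(5)[OF f]
      by (rule pull_cat_corestrict[OF in_homD(3)[OF f]]) (simp_all add: PI in_homD(4)[OF f])
  qed
  have R: "in_hom C (R f) (E f) B" if f: "in_hom C f A B" for f A B
    unfolding R_def in_homD(5)[OF f] by (rule in_hom_mk[OF E[OF f] in_homD(2)[OF f] pull[OF f]])
  \<comment> \<open>On coded source objects this is commutativity of the given square; on coded
    target objects both sides are \<open>obmap v\<close> by definition.\<close>
  have qm: "q g (m u v z) = obmap v (q f z)" if sq: "square C f g u v" and z: "z \<in> P f" for f g u v z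
    using z by (rule cases) (simp_all add: cmp_eqD(1)[OF square_arrows(3,1,5)[OF sq]])
  have mP: "m u v z \<in> P g" if sq: "square C f g u v" and z: "z \<in> P f" for f g u v z
    using z by (rule cases)
      (simp_all add: PI in_hom_closed(1)[OF square_arrows(3)[OF sq]] in_hom_closed(1)[OF square_arrows(4)[OF sq]])
  have M: "in_hom C (M f g u v) (E f) (E g)" if sq: "square C f g u v" for f g u v
    unfolding M_def
  proof (rule in_hom_mk[OF E[OF square_arrows(1)[OF sq]] E[OF square_arrows(2)[OF sq]]])
    have "star_functor F (E f) (Tgt g) (\<lambda>z. obmap v (q f z)) (\<lambda>x y. hommap v (q f x) (q f y))"
      using star_functor_comp[OF pull[OF square_arrows(1)[OF sq]] in_homD(3)[OF square_arrows(4)[OF sq]]]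
      by (simp add: comp_def)
    then show "star_functor F (E f) (E g) (m u v) (\<lambda>x y. hommap v (q f x) (q f y))"
      unfolding E_def[of g] by (rule pull_cat_corestrict) (simp_all add: mP[OF sq] qm[OF sq])
  qed
  show ?thesis
  proof (rule functorially_factorsI[OF L R _ M])
    fix f A B assume f: "in_hom C f A B"
    note Sf = in_homD(4)[OF f] and Tf = in_homD(5)[OF f]
    show "Cmp C (R f) (L f) = f"
      by (rule arrow_eqI[OF cmp_in_hom[OF L[OF f] R[OF f]] f]; simp only: cmp_apply[OF L[OF f]])
        (simp_all add: L_def R_def Sf Tf PI in_hom_closed[OF f])
    show "M f f (Ide C A) (Ide C B) = Ide C (E f)"
    proof (rule arrow_eqI[OF _ ide_in_hom[OF E[OF f]]])
      have "square C f f (Ide C A) (Ide C B)"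
        using f ide_in_hom[OF in_homD(1)[OF f]] ide_in_hom[OF in_homD(2)[OF f]] Sf Tf
          category.cmp_ide_left[OF C_category f] category.cmp_ide_right[OF C_category f]
        by (simp add: square_def in_hom_def)
      then show "in_hom C (M f f (Ide C A) (Ide C B)) (E f) (E f)" by (rule M)
      fix z assume "z \<in> Ob (E f)"
      then have z: "z \<in> P f" by simp
      then have "m (Ide C A) (Ide C B) z = z"
        by (rule cases) (simp_all add: Sf Tf)
      then show "obmap (M f f (Ide C A) (Ide C B)) z = obmap (Ide C (E f)) z"
        using z by (simp add: M_def)
      fix w a assume "w \<in> Ob (E f)" "a \<in> Hom (E f) z w"
      then show "hommap (M f f (Ide C A) (Ide C B)) z w a = hommap (Ide C (E f)) z w a"
        using z q_in[OF f] by (simp add: M_def Tf)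
    qed
    show "L f \<in> Cof F \<kappa>"
      unfolding Cof_iff[OF L[OF f]] by (rule inj_onI) (simp add: L_def Sf inj_eq[OF s])
    interpret B: star_category F B using small_star[OF in_homD(2)[OF f]] .
    have "fully_faithful (E f) B (q f) (\<lambda>x y. id)"
      by (simp add: fully_faithful_def Tf)
    moreover have "unitarily_surjective (E f) B (q f)"
      unfolding unitarily_surjective_def
    proof
      fix y assume "y \<in> Ob B"
      then show "\<exists>z\<in>Ob (E f). \<exists>u. unitary B (q f z) y u"
        using B.unitary_unit[of y] by (intro bexI[of _ "s (Inr y)"] exI[of _ "Unit B y"]) (simp_all add: PI Tf)
    qed
    ultimately have "fully_faithful (E f) B (obmap (R f)) (hommap (R f))" "unitarily_surjective (E f) B (obmap (R f))"
      using fully_faithful_cong[of "E f" "obmap (R f)" "q f" "hommap (R f)" "\<lambda>x y. id" B]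
        unitarily_surjective_cong[of "E f" "obmap (R f)" "q f" B] by (simp_all add: R_def)
    then have "R f \<in> Weq F \<kappa>" unfolding Weq_iff[OF R[OF f]] by (rule conjI)
    moreover have "R f \<in> Fib F \<kappa>"
      unfolding Fib_iff[OF R[OF f]]
    proof (intro ballI allI impI)
      fix z y v assume z: "z \<in> Ob (E f)" and y: "y \<in> Ob B" and "unitary B (obmap (R f) z) y v"
      then have v: "unitary B (q f z) y v" by (simp add: R_def)
      \<comment> \<open>The lift of \<open>v\<close> is \<open>v\<close> itself, seen as an arrow
        from \<open>z\<close> to the copy of \<open>y\<close> in the second summand.\<close>
      show "\<exists>z'\<in>Ob (E f). \<exists>u. unitary (E f) z z' u \<and> obmap (R f) z' = y \<and> hommap (R f) z z' u = v"
        using z y v B.unitaryD(1)[OF v]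
        by (intro bexI[of _ "s (Inr y)"] exI[of _ v]) (simp_all add: PI Tf R_def, simp add: E_def Tf)
    qed
    ultimately show "R f \<in> Weq F \<kappa> \<inter> Fib F \<kappa>" by (rule IntI)
  next
    fix f g u v assume sq: "square C f g u v"
    note arr = square_arrows[OF sq] and eq = cmp_eqD[OF square_arrows(3,1,5)[OF sq]]
    show "Cmp C (M f g u v) (L f) = Cmp C (L g) u"
    proof (rule arrow_eqI[OF cmp_in_hom[OF L[OF arr(1)] M[OF sq]] cmp_in_hom[OF arr(3) L[OF arr(2)]]];
        simp only: cmp_apply[OF L[OF arr(1)]] cmp_apply[OF arr(3)])
      fix x assume x: "x \<in> Ob (Src f)"
      show "obmap (M f g u v) (obmap (L f) x) = obmap (L g) (obmap u x)"
        using x in_hom_closed(1)[OF arr(3) x] by (simp add: L_def M_def PI)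
      fix y a assume y: "y \<in> Ob (Src f)" and a: "a \<in> Hom (Src f) x y"
      show "hommap (M f g u v) (obmap (L f) x) (obmap (L f) y) (hommap (L f) x y a) =
          hommap (L g) (obmap u x) (obmap u y) (hommap u x y a)"
        using x y a in_hom_closed(1)[OF arr(3) x] in_hom_closed(1)[OF arr(3) y] in_hom_closed(2)[OF arr(3) x y a]
          in_hom_closed(2)[OF arr(1) x y a] eq(2)[OF x y a]
        by (simp add: L_def M_def PI)
    qed
    show "Cmp C (R g) (M f g u v) = Cmp C v (R f)"
    proof (rule arrow_eqI[OF cmp_in_hom[OF M[OF sq] R[OF arr(2)]] cmp_in_hom[OF R[OF arr(1)] arr(4)]];
        simp only: cmp_apply[OF M[OF sq]] cmp_apply[OF R[OF arr(1)]])
      fix x assume x: "x \<in> Ob (E f)"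
      show "obmap (R g) (obmap (M f g u v) x) = obmap v (obmap (R f) x)"
        using x mP[OF sq] qm[OF sq] by (simp add: M_def R_def)
      fix y a assume y: "y \<in> Ob (E f)" and a: "a \<in> Hom (E f) x y"
      show "hommap (R g) (obmap (M f g u v) x) (obmap (M f g u v) y) (hommap (M f g u v) x y a) =
          hommap v (obmap (R f) x) (obmap (R f) y) (hommap (R f) x y a)"
        using x y a mP[OF sq] qm[OF sq] q_in[OF arr(1)] in_hom_closed(2)[OF arr(4)] by (simp add: M_def R_def)
    qed
  next
    fix f g h u v u' v' assume sq: "square C f g u v" and sq': "square C g h u' v'"
    note arr = square_arrows[OF sq] and arr' = square_arrows[OF sq']
    have cmp: "square C f h (Cmp C u' u) (Cmp C v' v)" by (rule square_paste[OF sq sq'])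
    show "M f h (Cmp C u' u) (Cmp C v' v) = Cmp C (M g h u' v') (M f g u v)"
    proof (rule arrow_eqI[OF M[OF cmp] cmp_in_hom[OF M[OF sq] M[OF sq']]]; simp only: cmp_apply[OF M[OF sq]])
      fix x assume x: "x \<in> Ob (E f)"
      then have "x \<in> P f" by simp
      then have "m (Cmp C u' u) (Cmp C v' v) x = m u' v' (m u v x)"
        by (rule cases) (simp_all add: cmp_apply(1)[OF arr(3)] cmp_apply(1)[OF arr(4)] del: C1star_cat_simps(5))
      then show "obmap (M f h (Cmp C u' u) (Cmp C v' v)) x = obmap (M g h u' v') (obmap (M f g u v) x)"
        using x mP[OF sq] by (simp add: M_def del: C1star_cat_simps(5))
      fix y a assume y: "y \<in> Ob (E f)" and a: "a \<in> Hom (E f) x y"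
      have c: "hommap (Cmp C v' v) (q f x) (q f y) a = hommap v' (obmap v (q f x)) (obmap v (q f y)) (hommap v (q f x) (q f y) a)"
        using x y a q_in[OF arr(1)] by (intro cmp_apply(2)[OF arr(4)]) simp_all
      show "hommap (M f h (Cmp C u' u) (Cmp C v' v)) x y a =
          hommap (M g h u' v') (obmap (M f g u v) x) (obmap (M f g u v) y) (hommap (M f g u v) x y a)"
        using x y a c mP[OF sq] qm[OF sq] q_in[OF arr(1)] in_hom_closed(2)[OF arr(4)]
        by (simp add: M_def del: C1star_cat_simps(5))
    qed
  qed
qed

text \<open>The path object, with the arrows of the source.\<close>

lemma factorization_trivial_Cof_Fib: "functorially_factors C (Weq F \<kappa> \<inter> Cof F \<kappa>) (Fib F \<kappa>)"
proof -
  obtain e :: "'u \<times> 'u \<Rightarrow> 'u" where e: "inj e" using encode_pairs by (rule exE)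
  \<comment> \<open>Codes an object \<open>x\<close> of the source, an object \<open>y\<close> of
    the target and a unitary \<open>v\<close> from \<open>f x\<close> to \<open>y\<close> as a
    single element.\<close>
  define t where "t x y v = e (x, e (y, v))" for x y v
  define p1 p2 p3 where "p1 z = fst (inv_into UNIV e z)" and "p2 z = fst (inv_into UNIV e (snd (inv_into UNIV e z)))" and "p3 z = snd (inv_into UNIV e (snd (inv_into UNIV e z)))" for z
  have p [simp]: "p1 (t x y v) = x" "p2 (t x y v) = y" "p3 (t x y v) = v" for x y v
    using e by (simp_all add: t_def p1_def p2_def p3_def)
  define P where "P f = (\<lambda>(x, y, v). t x y v) ` (SIGMA x:Ob (Src f). SIGMA y:Ob (Tgt f). {v \<in> Hom (Tgt f) (obmap f x) y. unitary (Tgt f) (obmap f x) y v})"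
    for f :: "('u, 'u) fun_arrow"
  define E where "E f = pull_cat (Src f) (P f) p1" for f
  define L where "L f = mk_arrow (Src f) (E f) (\<lambda>x. t x (obmap f x) (Unit (Tgt f) (obmap f x))) (\<lambda>x y. id)" for f
  \<comment> \<open>An arrow \<open>a\<close> is sent to its image under \<open>f\<close> conjugated
    by the two unitaries, so that the third components become a natural transformation from
    \<open>f\<close> to \<open>R f\<close>.\<close>
  define R where "R f = mk_arrow (E f) (Tgt f) p2 (\<lambda>z w a. conjugate (Tgt f) (obmap f (p1 z)) (p2 z) (obmap f (p1 w)) (p2 w)
    (p3 z) (p3 w) (hommap f (p1 z) (p1 w) a))" for f
  \<comment> \<open>The functor \<open>v\<close> of the square also transports the unitary. Its new
    source is the required one because the square commutes.\<close>
  define m where "m f u v z = t (obmap u (p1 z)) (obmap v (p2 z)) (hommap v (obmap f (p1 z)) (p2 z) (p3 z))"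
    for f u v :: "('u, 'u) fun_arrow" and z
  define M where "M f g u v = mk_arrow (E f) (E g) (m f u v) (\<lambda>x y. hommap u (p1 x) (p1 y))" for f g u v
  have PI: "t x y v \<in> P f" if "x \<in> Ob (Src f)" "y \<in> Ob (Tgt f)" "unitary (Tgt f) (obmap f x) y v" for x y v f
    using that unfolding P_def by (intro image_eqI[of _ _ "(x, y, v)"]) (simp_all add: unitary_def)
  have PD: "p1 z \<in> Ob (Src f)" "p2 z \<in> Ob (Tgt f)" "unitary (Tgt f) (obmap f (p1 z)) (p2 z) (p3 z)" "t (p1 z) (p2 z) (p3 z) = z"
    if "z \<in> P f" for z f
  proof -
    note zP = that[unfolded P_def]
    from zP obtain w where z: "z = (\<lambda>(x, y, v). t x y v) w"
      and w: "w \<in> (SIGMA x:Ob (Src f). SIGMA y:Ob (Tgt f). {v \<in> Hom (Tgt f) (obmap f x) y. unitary (Tgt f) (obmap f x) y v})"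
      by (rule imageE)
    obtain x y v where "w = (x, y, v)" by (cases w)
    with w z have "x \<in> Ob (Src f)" "y \<in> Ob (Tgt f)" "unitary (Tgt f) (obmap f x) y v" "z = t x y v" by simp_all
    then show "p1 z \<in> Ob (Src f)" "p2 z \<in> Ob (Tgt f)" "unitary (Tgt f) (obmap f (p1 z)) (p2 z) (p3 z)" "t (p1 z) (p2 z) (p3 z) = z"
      by simp_all
  qed
  have PH: "p3 z \<in> Hom (Tgt f) (obmap f (p1 z)) (p2 z)" if "z \<in> P f" for z f
    using PD(3)[OF that] by (simp add: unitary_def)
  have ObE [simp]: "Ob (E f) = P f" and HomE [simp]: "Hom (E f) x y = Hom (Src f) (p1 x) (p1 y)" for f x y
    by (simp_all add: E_def)
  have E: "E f \<in> small_cats" and pull: "star_functor F (E f) A p1 (\<lambda>x y. id)" if f: "in_hom C f A B" for f A B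
  proof -
    have H: "|{v \<in> Hom B (obmap f x) y. unitary B (obmap f x) y v}| <o \<kappa>" if "x \<in> Ob A" "y \<in> Ob B" for x y
    proof -
      have "|Hom B (obmap f x) y| <o \<kappa>"
        using in_homD(2)[OF f] in_hom_closed(1)[OF f that(1)] that(2) by (simp add: small_Cstar_categories_def)
      then show ?thesis by (rule small_subset) (rule Collect_restrict)
    qed
    have sP: "|P f| <o \<kappa>"
      unfolding P_def in_homD(4)[OF f] in_homD(5)[OF f] using in_homD(1,2)[OF f] H
      by (intro small_image small_Sigma) (simp_all add: small_Cstar_categories_def)
    have p1_in: "p1 ` P f \<subseteq> Ob A"
      by (rule image_subsetI) (simp only: PD(1) in_homD(4)[OF f, symmetric])
    show "E f \<in> small_cats"
      unfolding E_def in_homD(4)[OF f] by (rule pull_cat_small[OF in_homD(1)[OF f] sP p1_in])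
    show "star_functor F (E f) A p1 (\<lambda>x y. id)"
      unfolding E_def in_homD(4)[OF f] by (rule pull_cat_functor[OF p1_in])
  qed
  have L: "in_hom C (L f) A (E f)" if f: "in_hom C f A B" for f A B
    unfolding L_def in_homD(4)[OF f]
  proof (rule in_hom_mk[OF in_homD(1)[OF f] E[OF f]])
    interpret B: star_category F B using small_star[OF in_homD(2)[OF f]] .
    have "star_functor F A (Src f) id (\<lambda>x y. id)"
      unfolding in_homD(4)[OF f] by (rule star_functor_id)
    then show "star_functor F A (E f) (\<lambda>x. t x (obmap f x) (Unit (Tgt f) (obmap f x))) (\<lambda>x y. id)"
      unfolding E_def
      by (rule pull_cat_corestrict)
        (simp_all add: PI in_homD(4)[OF f] in_homD(5)[OF f] in_hom_closed(1)[OF f] B.unitary_unit)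
  qed
  have R: "in_hom C (R f) (E f) B" if f: "in_hom C f A B" for f A B
    unfolding R_def in_homD(5)[OF f]
  proof (rule in_hom_mk[OF E[OF f] in_homD(2)[OF f]])
    show "star_functor F (E f) B p2 (\<lambda>z w a. conjugate B (obmap f (p1 z)) (p2 z) (obmap f (p1 w)) (p2 w)
        (p3 z) (p3 w) (hommap f (p1 z) (p1 w) a))"
      using conjugate_functor[OF small_star[OF E[OF f]] small_star[OF in_homD(2)[OF f]]
          star_functor_comp[OF pull[OF f] in_homD(3)[OF f]], of p2 p3] PD[of _ f] in_homD(5)[OF f]
      by (simp add: comp_def)
  qed
  have mP: "m f u v z \<in> P g" if sq: "square C f g u v" and z: "z \<in> P f" for f g u v z
  proof -
    note arr = square_arrows[OF sq]
    have "unitary (Tgt g) (obmap v (obmap f (p1 z))) (obmap v (p2 z)) (hommap v (obmap f (p1 z)) (p2 z) (p3 z))"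
      by (rule star_functor.map_unitary[OF in_homD(3)[OF arr(4)] small_star[OF in_homD(2)[OF arr(1)]]
            in_hom_closed(1)[OF arr(1) PD(1)[OF z]] PD(2,3)[OF z]])
    then show ?thesis
      unfolding m_def cmp_eqD(1)[OF arr(3,1,5) PD(1)[OF z], symmetric]
      by (rule PI[OF in_hom_closed(1)[OF arr(3) PD(1)[OF z]] in_hom_closed(1)[OF arr(4) PD(2)[OF z]]])
  qed
  have pm: "p1 (m f u v z) = obmap u (p1 z)" "p2 (m f u v z) = obmap v (p2 z)"
    "p3 (m f u v z) = hommap v (obmap f (p1 z)) (p2 z) (p3 z)" for f u v z
    by (simp_all add: m_def)
  have M: "in_hom C (M f g u v) (E f) (E g)" if sq: "square C f g u v" for f g u v
    unfolding M_def
  proof (rule in_hom_mk[OF E[OF square_arrows(1)[OF sq]] E[OF square_arrows(2)[OF sq]]])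
    have "star_functor F (E f) (Src g) (\<lambda>z. obmap u (p1 z)) (\<lambda>x y. hommap u (p1 x) (p1 y))"
      using star_functor_comp[OF pull[OF square_arrows(1)[OF sq]] in_homD(3)[OF square_arrows(3)[OF sq]]]
      by (simp add: comp_def)
    then show "star_functor F (E f) (E g) (m f u v) (\<lambda>x y. hommap u (p1 x) (p1 y))"
      unfolding E_def[of g] by (rule pull_cat_corestrict) (simp_all add: mP[OF sq] pm)
  qed
  show ?thesis
  proof (rule functorially_factorsI[OF L R _ M])
    fix f A B assume f: "in_hom C f A B"
    note Sf = in_homD(4)[OF f] and Tf = in_homD(5)[OF f]
    interpret A: star_category F A using small_star[OF in_homD(1)[OF f]] .
    interpret B: star_category F B using small_star[OF in_homD(2)[OF f]] .
    have LP: "t x (obmap f x) (Unit B (obmap f x)) \<in> P f" if "x \<in> Ob A" for x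
      using that in_hom_closed(1)[OF f that] by (intro PI) (simp_all add: Sf Tf B.unitary_unit)
    show "Cmp C (R f) (L f) = f"
      by (rule arrow_eqI[OF cmp_in_hom[OF L[OF f] R[OF f]] f]; simp only: cmp_apply[OF L[OF f]])
        (simp_all add: L_def R_def Sf Tf LP in_hom_closed[OF f] B.conjugate_units)
    show "M f f (Ide C A) (Ide C B) = Ide C (E f)"
    proof (rule arrow_eqI[OF _ ide_in_hom[OF E[OF f]]])
      have "square C f f (Ide C A) (Ide C B)"
        using f ide_in_hom[OF in_homD(1)[OF f]] ide_in_hom[OF in_homD(2)[OF f]] Sf Tf
          category.cmp_ide_left[OF C_category f] category.cmp_ide_right[OF C_category f]
        by (simp add: square_def in_hom_def)
      then show "in_hom C (M f f (Ide C A) (Ide C B)) (E f) (E f)" by (rule M)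
      fix z assume "z \<in> Ob (E f)"
      then have z: "z \<in> P f" by simp
      note zD = PD[OF z] PH[OF z]
      have "m f (Ide C A) (Ide C B) z = t (p1 z) (p2 z) (p3 z)"
        unfolding m_def using zD(1,2,5) in_hom_closed(1)[OF f, of "p1 z"] by (simp add: Sf Tf)
      then show "obmap (M f f (Ide C A) (Ide C B)) z = obmap (Ide C (E f)) z"
        using z zD(4) by (simp add: M_def)
      fix w a assume "w \<in> Ob (E f)" "a \<in> Hom (E f) z w"
      then show "hommap (M f f (Ide C A) (Ide C B)) z w a = hommap (Ide C (E f)) z w a"
        using z zD(1) PD(1)[of w f] by (simp add: M_def Sf)
    qed
    have "L f \<in> Cof F \<kappa>"
      unfolding Cof_iff[OF L[OF f]]
    proof (rule inj_onI)
      fix x y assume "x \<in> Ob A" "y \<in> Ob A" "obmap (L f) x = obmap (L f) y"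
      then have "p1 (t x (obmap f x) (Unit B (obmap f x))) = p1 (t y (obmap f y) (Unit B (obmap f y)))"
        by (simp only: L_def mk_arrow_simps Sf Tf)
      then show "x = y" by (simp only: p)
    qed
    moreover have "L f \<in> Weq F \<kappa>"
    proof -
      have "fully_faithful A (E f) (\<lambda>x. t x (obmap f x) (Unit B (obmap f x))) (\<lambda>x y. id)"
        by (simp add: fully_faithful_def Sf)
      moreover have "unitarily_surjective A (E f) (\<lambda>x. t x (obmap f x) (Unit B (obmap f x)))"
        unfolding unitarily_surjective_def
      proof
        fix z assume "z \<in> Ob (E f)"
        then have "p1 z \<in> Ob A" using PD(1)[of z f] Sf by simp
        \<comment> \<open>Hom sets of the path object depend on first components alone, so the unit
          of \<open>p1 z\<close> is a unitary from the image of \<open>p1 z\<close> to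
          \<open>z\<close>.\<close>
        then show "\<exists>x\<in>Ob A. \<exists>u. unitary (E f) (t x (obmap f x) (Unit B (obmap f x))) z u"
          using A.unitary_unit by (intro bexI[of _ "p1 z"] exI[of _ "Unit A (p1 z)"]) (simp_all add: E_def Sf)
      qed
      ultimately have "fully_faithful A (E f) (obmap (L f)) (hommap (L f))" "unitarily_surjective A (E f) (obmap (L f))"
        using fully_faithful_cong[of A "obmap (L f)" "\<lambda>x. t x (obmap f x) (Unit B (obmap f x))" "hommap (L f)" "\<lambda>x y. id" "E f"]
          unitarily_surjective_cong[of A "obmap (L f)" "\<lambda>x. t x (obmap f x) (Unit B (obmap f x))" "E f"]
        by (simp_all add: L_def Sf Tf)
      then show ?thesis unfolding Weq_iff[OF L[OF f]] by (rule conjI)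
    qed
    ultimately show "L f \<in> Weq F \<kappa> \<inter> Cof F \<kappa>" by blast
    show "R f \<in> Fib F \<kappa>"
      unfolding Fib_iff[OF R[OF f]]
    proof (intro ballI allI impI)
      fix z y w assume "z \<in> Ob (E f)" and y: "y \<in> Ob B" and "unitary B (obmap (R f) z) y w"
      then have z: "z \<in> P f" and w: "unitary B (p2 z) y w" by (simp_all add: R_def)
      have x: "p1 z \<in> Ob A" and y2: "p2 z \<in> Ob B" and v: "unitary B (obmap f (p1 z)) (p2 z) (p3 z)"
        using PD[OF z] by (simp_all add: Sf Tf)
      note fx = in_hom_closed(1)[OF f x]
      \<comment> \<open>The lift of \<open>w\<close> keeps the object of the source and composes
        \<open>w\<close> with the stored unitary. The unit of \<open>p1 z\<close>, seen as an arrow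
        from \<open>z\<close> to \<open>z'\<close>, is sent to \<open>(w v) v^* = w\<close>, where
        \<open>v\<close> is \<open>p3 z\<close>.\<close>
      define z' where "z' = t (p1 z) y (Comp B (obmap f (p1 z)) (p2 z) y w (p3 z))"
      have wv: "unitary B (obmap f (p1 z)) y (Comp B (obmap f (p1 z)) (p2 z) y w (p3 z))"
        by (rule B.unitary_comp[OF fx y2 y v w])
      have z': "z' \<in> P f"
        unfolding z'_def using x y wv by (intro PI) (simp_all add: Sf Tf)
      have pz': "p1 z' = p1 z" "p2 z' = y" "p3 z' = Comp B (obmap f (p1 z)) (p2 z) y w (p3 z)"
        by (simp_all add: z'_def)
      have "hommap (R f) z z' (Unit A (p1 z)) = conjugate B (obmap f (p1 z)) (p2 z) (obmap f (p1 z)) y (p3 z)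
          (Comp B (obmap f (p1 z)) (p2 z) y w (p3 z)) (Unit B (obmap f (p1 z)))"
        using z z' x A.unit_closed[OF x] star_functor.map_unit[OF in_homD(3)[OF f] x] by (simp add: R_def Sf Tf pz')
      also have "\<dots> = w"
        using fx y2 y B.unitaryD[OF v] B.unitaryD(1)[OF w]
        by (simp add: conjugate_def B.comp_unit_right B.comp_closed B.comp_assoc B.star_closed)
      finally show "\<exists>z'\<in>Ob (E f). \<exists>u. unitary (E f) z z' u \<and> obmap (R f) z' = y \<and> hommap (R f) z z' u = w"
        using z' A.unitary_unit[OF x] by (intro bexI[of _ z'] exI[of _ "Unit A (p1 z)"]) (simp_all add: R_def pz', simp add: E_def Sf pz')
    qed
  next
    fix f g u v assume sq: "square C f g u v"
    note arr = square_arrows[OF sq] and eq = cmp_eqD[OF square_arrows(3,1,5)[OF sq]]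
    interpret B: star_category F "Tgt f" using small_star[OF in_homD(2)[OF arr(1)]] .
    interpret Y: star_category F "Tgt g" using small_star[OF in_homD(2)[OF arr(2)]] .
    interpret v: star_functor F "Tgt f" "Tgt g" "obmap v" "hommap v" by (rule in_homD(3)[OF arr(4)])
    have LP: "t x (obmap f x) (Unit (Tgt f) (obmap f x)) \<in> P f" if "x \<in> Ob (Src f)" for x
      using that in_hom_closed(1)[OF arr(1) that] by (intro PI B.unitary_unit) simp_all
    show "Cmp C (M f g u v) (L f) = Cmp C (L g) u"
    proof (rule arrow_eqI[OF cmp_in_hom[OF L[OF arr(1)] M[OF sq]] cmp_in_hom[OF arr(3) L[OF arr(2)]]];
        simp only: cmp_apply[OF L[OF arr(1)]] cmp_apply[OF arr(3)])
      fix x assume x: "x \<in> Ob (Src f)"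
      show "obmap (M f g u v) (obmap (L f) x) = obmap (L g) (obmap u x)"
        using x in_hom_closed(1)[OF arr(3) x] LP[OF x] eq(1)[OF x] v.map_unit[OF in_hom_closed(1)[OF arr(1) x]]
        by (simp add: L_def M_def m_def)
      fix y a assume y: "y \<in> Ob (Src f)" and a: "a \<in> Hom (Src f) x y"
      show "hommap (M f g u v) (obmap (L f) x) (obmap (L f) y) (hommap (L f) x y a) =
          hommap (L g) (obmap u x) (obmap u y) (hommap u x y a)"
        using x y a in_hom_closed(1)[OF arr(3) x] in_hom_closed(1)[OF arr(3) y] in_hom_closed(2)[OF arr(3) x y a] LP[OF x] LP[OF y]
        by (simp add: L_def M_def)
    qed
    show "Cmp C (R g) (M f g u v) = Cmp C v (R f)"
    proof (rule arrow_eqI[OF cmp_in_hom[OF M[OF sq] R[OF arr(2)]] cmp_in_hom[OF R[OF arr(1)] arr(4)]];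
        simp only: cmp_apply[OF M[OF sq]] cmp_apply[OF R[OF arr(1)]])
      fix x assume "x \<in> Ob (E f)"
      then have x: "x \<in> P f" by simp
      show "obmap (R g) (obmap (M f g u v) x) = obmap v (obmap (R f) x)"
        using x mP[OF sq x] by (simp add: M_def R_def pm)
      fix y a assume "y \<in> Ob (E f)" and "a \<in> Hom (E f) x y"
      then have y: "y \<in> P f" and a: "a \<in> Hom (Src f) (p1 x) (p1 y)" by simp_all
      note xD = PD[OF x] and yD = PD[OF y]
      note fo = in_hom_closed(1)[OF arr(1) xD(1)] in_hom_closed(1)[OF arr(1) yD(1)]
      have "hommap (R g) (m f u v x) (m f u v y) (hommap u (p1 x) (p1 y) a) =
          conjugate (Tgt g) (obmap v (obmap f (p1 x))) (obmap v (p2 x)) (obmap v (obmap f (p1 y))) (obmap v (p2 y))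
            (hommap v (obmap f (p1 x)) (p2 x) (p3 x)) (hommap v (obmap f (p1 y)) (p2 y) (p3 y))
            (hommap v (obmap f (p1 x)) (obmap f (p1 y)) (hommap f (p1 x) (p1 y) a))"
        using mP[OF sq x] mP[OF sq y] in_hom_closed(2)[OF arr(3) xD(1) yD(1) a] eq(1)[OF xD(1)] eq(1)[OF yD(1)] eq(2)[OF xD(1) yD(1) a]
        by (simp add: R_def pm)
      \<comment> \<open>\<open>v\<close> commutes with conjugation, which is why \<open>M\<close>
        may act on arrows by \<open>u\<close> alone.\<close>
      also have "\<dots> = hommap v (p2 x) (p2 y) (conjugate (Tgt f) (obmap f (p1 x)) (p2 x) (obmap f (p1 y)) (p2 y) (p3 x) (p3 y)
            (hommap f (p1 x) (p1 y) a))"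
        by (rule v.map_conjugate[OF B.star_category_axioms fo(1) xD(2) fo(2) yD(2) xD(3) yD(3)
              in_hom_closed(2)[OF arr(1) xD(1) yD(1) a], symmetric])
      finally show "hommap (R g) (obmap (M f g u v) x) (obmap (M f g u v) y) (hommap (M f g u v) x y a) =
          hommap v (obmap (R f) x) (obmap (R f) y) (hommap (R f) x y a)"
        using x y a by (simp add: M_def R_def[of f])
    qed
  next
    fix f g h u v u' v' assume sq: "square C f g u v" and sq': "square C g h u' v'"
    note arr = square_arrows[OF sq] and arr' = square_arrows[OF sq']
    have cmp: "square C f h (Cmp C u' u) (Cmp C v' v)" by (rule square_paste[OF sq sq'])
    show "M f h (Cmp C u' u) (Cmp C v' v) = Cmp C (M g h u' v') (M f g u v)"
    proof (rule arrow_eqI[OF M[OF cmp] cmp_in_hom[OF M[OF sq] M[OF sq']]]; simp only: cmp_apply[OF M[OF sq]])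
      fix x assume "x \<in> Ob (E f)"
      then have x: "x \<in> P f" by simp
      note xD = PD[OF x] PH[OF x]
      have "m f (Cmp C u' u) (Cmp C v' v) x = m g u' v' (m f u v x)"
        unfolding m_def p cmp_apply(1)[OF arr(3) xD(1)] cmp_apply(1)[OF arr(4) xD(2)]
          cmp_apply(2)[OF arr(4) in_hom_closed(1)[OF arr(1) xD(1)] xD(2) xD(5)] cmp_eqD(1)[OF arr(3,1,5) xD(1)] ..
      then show "obmap (M f h (Cmp C u' u) (Cmp C v' v)) x = obmap (M g h u' v') (obmap (M f g u v) x)"
        using x mP[OF sq x] by (simp add: M_def del: C1star_cat_simps(5))
      fix y a assume "y \<in> Ob (E f)" and "a \<in> Hom (E f) x y"
      then have y: "y \<in> P f" and a: "a \<in> Hom (Src f) (p1 x) (p1 y)" by simp_all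
      show "hommap (M f h (Cmp C u' u) (Cmp C v' v)) x y a =
          hommap (M g h u' v') (obmap (M f g u v) x) (obmap (M f g u v) y) (hommap (M f g u v) x y a)"
        using x y a mP[OF sq x] mP[OF sq y] in_hom_closed(2)[OF arr(3) xD(1) PD(1)[OF y] a] cmp_apply(2)[OF arr(3) xD(1) PD(1)[OF y] a, of u']
        by (simp add: M_def pm del: C1star_cat_simps(5))
    qed
  qed
qed

end

theorem theorem4p2:
  fixes F :: "complex set" and \<mu> :: "'j rel" and \<kappa> :: "'u rel"
  assumes "F = \<real> \<or> F = UNIV"
    and "size_bounds \<mu> \<kappa>"
  shows "model_category \<mu> (C1star_cat F \<kappa>) (Weq F \<kappa>) (Fib F \<kappa>) (Cof F \<kappa>)"
proof -
  interpret unitary_model \<mu> \<kappa> F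
    using assms by unfold_locales
  show ?thesis
    unfolding model_category_def
    by (intro conjI C_category limits colimits wide_subcategory_Weq wide_subcategory_Fib wide_subcategory_Cof
        two_out_of_three_Weq closed_under_retracts_Weq closed_under_retracts_Fib closed_under_retracts_Cof
        factorization_Cof_trivial_Fib factorization_trivial_Cof_Fib ballI)
      (auto intro: lifting_Cof_trivial_Fib lifting_trivial_Cof_Fib)
qed

end
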